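(* The Cauchy problem for the modified Kawahara equation \[\partial_t v - \partial_x^5 v + \beta \partial_x^3 v + \gamma \partial_x v - \tfrac{\mu}{3}\partial_x (v^3) = 0,\qquad v(0,x)=v_0(x)\in L^2(\mathbb T),\] is globally (in time) well-posed in $L^2(\mathbb T)$.
   Context: $\mathbb T=\mathbb R/2\pi\mathbb Z$, $\beta\ge0$, $\gamma\in\mathbb R$, $\mu=\pm1$, and $v$ is real-valued. A solution means a function satisfying the Duhamel formula $v(t)=S(t)v_0+\frac{\mu}{3}\int_0^t S(t-s)\partial_x(v(s)^3)\,ds$, where $S(t)f=\frac1{2\pi}\sum_{n\in\mathbb Z}e^{inx}e^{it(n^5+\beta n^3-\gamma n)}\hat f(n)$. Local well-posedness in $H^s$ means: for $v_0\in H^s$ there exist $T=T(\|v_0\|_{H^s})>0$ and a solution $v$ in a subset $X^s_T\subset C([0,T];H^s)$, unique in $X^s_T$, with $v_0\mapsto v$ continuous from a ball of $H^s$ into $X^s_T$. Global well-posedness means that $T$ can be taken arbitrarily large. *)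

theory Defs
  imports "HOL-Analysis.Analysis"
begin

text \<open>Functions on the torus T = R/2piZ are represented by their values on [0,2pi]
  (a real-valued function on the reals; values outside [0,2pi] are irrelevant).\<close>

definition L2T :: "(real \<Rightarrow> real) set" where
  "L2T = {f. set_borel_measurable lebesgue {0..2*pi} f \<and>
              set_integrable lebesgue {0..2*pi} (\<lambda>x. (f x)^2)}"

definition l2norm :: "(real \<Rightarrow> real) \<Rightarrow> real" where
  "l2norm f = sqrt (set_lebesgue_integral lebesgue {0..2*pi} (\<lambda>x. (f x)^2))"

definition l2dist :: "(real \<Rightarrow> real) \<Rightarrow> (real \<Rightarrow> real) \<Rightarrow> real" where
  "l2dist f g = l2norm (\<lambda>x. f x - g x)"

definition fcoeff :: "(real \<Rightarrow> real) \<Rightarrow> int \<Rightarrow> complex" where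
  "fcoeff f n = set_lebesgue_integral lebesgue {0..2*pi}
                  (\<lambda>x. complex_of_real (f x) * cis (- (real_of_int n) * x))"

definition phase :: "real \<Rightarrow> real \<Rightarrow> int \<Rightarrow> real" where
  "phase \<beta> \<gamma> n = (real_of_int n)^5 + \<beta> * (real_of_int n)^3 - \<gamma> * real_of_int n"

definition CL2 :: "real \<Rightarrow> (real \<Rightarrow> real \<Rightarrow> real) set" where
  "CL2 T = {v. (\<forall>t\<in>{0..T}. v t \<in> L2T) \<and>
               (\<forall>t\<in>{0..T}. \<forall>\<epsilon>>0. \<exists>\<delta>>0. \<forall>t'\<in>{0..T}.
                   \<bar>t' - t\<bar> < \<delta> \<longrightarrow> l2dist (v t') (v t) < \<epsilon>)}"

text \<open>v (as a function of t and x) is a solution on [0,T] of the Duhamel formula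
  v(t) = S(t) v0 + mu/3 int_0^t S(t-s) d_x (v(s)^3) ds, written coefficientwise in Fourier
  variables (S(t) acts on the n-th coefficient as multiplication by e^{i t phase(n)}, and
  d_x as multiplication by i n).  The nonlinear term is required to be meaningful:
  v(s)^3 is integrable on T for a.e. s in [0,T], and its Fourier coefficients are
  integrable in s on [0,T].\<close>
definition kawahara_sol ::
  "real \<Rightarrow> real \<Rightarrow> real \<Rightarrow> real \<Rightarrow> (real \<Rightarrow> real) \<Rightarrow> (real \<Rightarrow> real \<Rightarrow> real) \<Rightarrow> bool" where
  "kawahara_sol \<beta> \<gamma> \<mu> T v0 v \<longleftrightarrow>
     v \<in> CL2 T \<and>
     (AE s in lebesgue. s \<in> {0..T} \<longrightarrow>
        set_integrable lebesgue {0..2*pi} (\<lambda>x. (v s x)^3)) \<and>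
     (\<forall>n::int. set_integrable lebesgue {0..T} (\<lambda>s. fcoeff (\<lambda>x. (v s x)^3) n)) \<and>
     (\<forall>t\<in>{0..T}. \<forall>n::int.
        fcoeff (v t) n =
          cis (t * phase \<beta> \<gamma> n) * fcoeff v0 n
          + complex_of_real (\<mu> / 3) *
            set_lebesgue_integral lebesgue {0..t}
              (\<lambda>s. cis ((t - s) * phase \<beta> \<gamma> n) * (\<i> * of_int n)
                    * fcoeff (\<lambda>x. (v s x)^3) n))"

end

theory Submission
  imports Defs "HOL-Probability.Discrete_Topology"
begin

text \<open>Truncate the equation to the frequencies \<open>\<bar>n\<bar> \<le> N\<close> and write \<open>\<zeta>\<close> for the Fourier coefficients
  with the linear flow removed, so that the time derivative of \<open>\<zeta>\<close> is a cubic sum with phases \<open>cis (s \<Phi>)\<close>.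
  On \<open>a + b + c + d = 0\<close> the phase factors as \<open>- (a+b)(a+c)(b+c)(5/2 (a\<^sup>2+b\<^sup>2+c\<^sup>2+d\<^sup>2) + 3 \<beta>)\<close>,
  which off the resonant set gains two derivatives, one more than the nonlinearity loses. Hence quartic forms
  in \<open>\<zeta>\<close> can be integrated by parts in time. Applied to the fourth power of the \<open>L\<^sup>4\<close> norm this gives a
  bound on its time integral in terms of the conserved \<open>L\<^sup>2\<close> norm; applied to the energy of high
  frequencies it gives equicontinuity of the tails, and applied to the low-frequency energy of the
  difference of two truncated solutions it closes a Gronwall argument. In the latter the resonant terms
  only rotate the phase of each \<open>\<zeta>\<^sub>n\<close>, with a speed that differs between the two solutions by
  \<open>n (\<bar>\<zeta>\<^sub>n\<bar>\<^sup>2 - \<bar>\<xi>\<^sub>n\<bar>\<^sup>2)\<close> up to conserved quantities, and this is again controlled by a normal form.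
  So the truncated solutions are Cauchy in \<open>C([0,T]; L\<^sup>2)\<close>, jointly in the truncation and the data, for
  every \<open>T\<close>. The space \<open>X\<close> of the theorem consists of the uniform \<open>L\<^sup>2\<close> limits of truncated solutions, and
  the \<open>L\<^sup>4\<close> bound lets the cubic term pass to the limit.\<close>

section \<open>Lattice sums and the resonance function\<close>

text \<open>The obstacle is the resonant rotation. At time zero nothing but the data controls the
  difference of two rotation speeds, so comparing frequencies up to \<open>M\<close> costs a factor
  \<open>M * e 0\<close>. The stability estimate is therefore not Lipschitz: \<open>M\<close> is
  fixed from the tail of one datum, after that the second datum is taken close and the cut-offs
  large, and continuity is what results. Exponents: after the derivative loss is paid, the phase
  still leaves a weight \<open>1 / pp\<close>. The lattice sums converge with
  \<open>pp powr - (7/8)\<close>. The spare power \<open>1/8\<close> is spent either on a small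
  factor \<open>K powr - (1/8)\<close>, which absorbs boundary terms of the normal form, or on the
  error made by unequal cut-offs at frequencies beyond \<open>L\<close>. The derivative of a mode is
  bounded through the squared L4 norm, which is controlled in time average but not pointwise; hence
  Gronwall runs with a coefficient of which only the integral is bounded. Uniqueness is relative to
  the space: its members are determined by a coefficient sequence, and the Duhamel formula at time
  zero identifies that sequence with the datum.\<close>

definition l2b :: "(int \<Rightarrow> complex) \<Rightarrow> real \<Rightarrow> bool" where
  "l2b x X \<longleftrightarrow> 0 \<le> X \<and> (\<forall>A. finite A \<longrightarrow> (\<Sum>n\<in>A. (cmod (x n))\<^sup>2) \<le> X\<^sup>2)"

definition jb :: "int \<Rightarrow> real" where "jb n = max 1 \<bar>real_of_int n\<bar>"

text \<open>Three of the six pair sums suffice: when the four frequencies sum to zero the other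
  three are their negatives, so the product is symmetric in all four slots
  (\<open>nonres_pp\<close>).\<close>

definition pp :: "int \<Rightarrow> int \<Rightarrow> int \<Rightarrow> real" where
  "pp a b c = \<bar>real_of_int (a + b)\<bar> * \<bar>real_of_int (a + c)\<bar> * \<bar>real_of_int (b + c)\<bar>"

definition sq4 :: "int \<Rightarrow> int \<Rightarrow> int \<Rightarrow> int \<Rightarrow> real" where
  "sq4 a b c d = real_of_int (a\<^sup>2 + b\<^sup>2 + c\<^sup>2 + d\<^sup>2)"

definition nonres :: "int \<times> int \<times> int \<times> int \<Rightarrow> bool" where
  "nonres = (\<lambda>(a, b, c, d). a + b + c + d = 0 \<and> a + b \<noteq> 0 \<and> a + c \<noteq> 0 \<and> b + c \<noteq> 0)"

definition Ph :: "real \<Rightarrow> real \<Rightarrow> int \<Rightarrow> int \<Rightarrow> int \<Rightarrow> int \<Rightarrow> real" where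
  "Ph \<beta> \<gamma> a b c d = phase \<beta> \<gamma> a + phase \<beta> \<gamma> b + phase \<beta> \<gamma> c + phase \<beta> \<gamma> d"

text \<open>The phase is odd, so it cancels as soon as two of the frequencies are opposite, since
  then the other two are opposite as well; this explains the three linear factors. The contribution
  of \<open>\<gamma>\<close> is proportional to the sum of the frequencies and vanishes.\<close>

lemma Ph_factor:
  assumes "a + b + c + d = 0"
  shows "Ph \<beta> \<gamma> a b c d =
    - real_of_int (a + b) * real_of_int (a + c) * real_of_int (b + c) * (5 / 2 * sq4 a b c d + 3 * \<beta>)"
proof -
  have d: "d = - a - b - c" using assms by simp
  show ?thesis unfolding Ph_def phase_def sq4_def d
    by (simp add: algebra_simps power_numeral_reduce)
qed

lemma sq4_nonneg [simp]: "0 \<le> sq4 a b c d"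
  unfolding sq4_def by simp

text \<open>The sign condition on \<open>\<beta>\<close> keeps the last factor of the phase from
  cancelling, so the quintic part alone bounds it from below.\<close>

lemma Ph_lower:
  assumes "a + b + c + d = 0" "\<beta> \<ge> 0"
  shows "pp a b c * sq4 a b c d \<le> \<bar>Ph \<beta> \<gamma> a b c d\<bar>"
proof -
  have "\<bar>Ph \<beta> \<gamma> a b c d\<bar> = pp a b c * (5 / 2 * sq4 a b c d + 3 * \<beta>)"
    using assms(2) sq4_nonneg[of a b c d]
    unfolding Ph_factor[OF assms(1)] pp_def by (simp only: abs_mult abs_minus_cancel)
  moreover have "pp a b c * sq4 a b c d \<le> pp a b c * (5 / 2 * sq4 a b c d + 3 * \<beta>)"
  proof (rule mult_left_mono)
    show "sq4 a b c d \<le> 5 / 2 * sq4 a b c d + 3 * \<beta>" using assms(2) sq4_nonneg[of a b c d] by linarith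
  qed (simp add: pp_def)
  ultimately show ?thesis by simp
qed

text \<open>The term \<open>n = 0\<close> of the series is \<open>0 powr - p = 0\<close>.\<close>

definition zc :: "real \<Rightarrow> real" where "zc p = 2 * (\<Sum>n. real n powr - p)"

section \<open>Power sums over the nonzero integers and Cauchy-Schwarz on finite lattice
  sets\<close>

lemma zc_nonneg: "p > 1 \<Longrightarrow> 0 \<le> zc p"
  unfolding zc_def by (intro mult_nonneg_nonneg suminf_nonneg) (auto simp: summable_real_powr_iff)

lemma sum_int_powr_le:
  assumes "p > 1" "finite A" "0 \<notin> A"
  shows "(\<Sum>m\<in>A. \<bar>real_of_int m\<bar> powr - p) \<le> zc p"
proof -
  have s: "summable (\<lambda>n. real n powr - p)" using assms by (simp add: summable_real_powr_iff)
  have half: "(\<Sum>m\<in>B. \<bar>real_of_int m\<bar> powr - p) \<le> (\<Sum>n. real n powr - p)"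
    if "finite B" "inj_on (\<lambda>m. nat \<bar>m\<bar>) B" for B :: "int set"
  proof -
    have "(\<Sum>m\<in>B. \<bar>real_of_int m\<bar> powr - p) = (\<Sum>n\<in>(\<lambda>m. nat \<bar>m\<bar>) ` B. real n powr - p)"
      using that by (subst sum.reindex) (auto intro!: sum.cong)
    also have "\<dots> \<le> (\<Sum>n. real n powr - p)" using s that by (intro sum_le_suminf) auto
    finally show ?thesis .
  qed
  have A: "(A \<inter> {0<..}) \<union> (A \<inter> {..<0}) = A"
  proof -
    have "0 < m \<or> m < 0" if "m \<in> A" for m :: int using that assms(3) by (cases m "0::int" rule: linorder_cases) auto
    then show ?thesis by blast
  qed
  have "(\<Sum>m\<in>A. \<bar>real_of_int m\<bar> powr - p) =
      (\<Sum>m\<in>(A \<inter> {0<..}) \<union> (A \<inter> {..<0}). \<bar>real_of_int m\<bar> powr - p)" unfolding A ..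
  also have "\<dots> = (\<Sum>m\<in>A \<inter> {0<..}. \<bar>real_of_int m\<bar> powr - p) + (\<Sum>m\<in>A \<inter> {..<0}. \<bar>real_of_int m\<bar> powr - p)"
    by (rule sum.union_disjoint) (use assms(2) in auto)
  also have "\<dots> \<le> (\<Sum>n. real n powr - p) + (\<Sum>n. real n powr - p)"
    by (intro add_mono half) (auto simp: inj_on_def assms(2))
  finally show ?thesis unfolding zc_def by simp
qed

text \<open>Injectivity embeds \<open>F\<close> into a product set; since all terms are nonnegative
  the sum may be enlarged to the full product, where it factors. This is how the linear constraint
  on the frequencies is used throughout: any coordinates that determine the quadruple may serve as
  free variables.\<close>

lemma sum2_le:
  fixes u v :: "int \<Rightarrow> real"
  assumes "finite F" "inj_on (\<lambda>q. (f q, g q)) F" "\<And>n. 0 \<le> u n" "\<And>n. 0 \<le> v n"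
  shows "(\<Sum>q\<in>F. u (f q) * v (g q)) \<le> (\<Sum>n\<in>f ` F. u n) * (\<Sum>n\<in>g ` F. v n)"
proof -
  have "(\<Sum>q\<in>F. u (f q) * v (g q)) = (\<Sum>(m, n)\<in>(\<lambda>q. (f q, g q)) ` F. u m * v n)"
    using assms by (subst sum.reindex) auto
  also have "\<dots> \<le> (\<Sum>(m, n)\<in>(f ` F) \<times> (g ` F). u m * v n)"
    using assms by (intro sum_mono2) auto
  also have "\<dots> = (\<Sum>n\<in>f ` F. u n) * (\<Sum>n\<in>g ` F. v n)"
    by (simp add: sum.cartesian_product sum_product)
  finally show ?thesis .
qed

lemma sum3_le:
  fixes u v w :: "int \<Rightarrow> real"
  assumes "finite F" "inj_on (\<lambda>q. (f q, g q, h q)) F"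
    "\<And>n. 0 \<le> u n" "\<And>n. 0 \<le> v n" "\<And>n. 0 \<le> w n"
  shows "(\<Sum>q\<in>F. u (f q) * v (g q) * w (h q)) \<le>
    (\<Sum>n\<in>f ` F. u n) * (\<Sum>n\<in>g ` F. v n) * (\<Sum>n\<in>h ` F. w n)"
proof -
  have "(\<Sum>q\<in>F. u (f q) * v (g q) * w (h q)) =
      (\<Sum>(m, n, k)\<in>(\<lambda>q. (f q, g q, h q)) ` F. u m * v n * w k)"
    using assms by (subst sum.reindex) auto
  also have "\<dots> \<le> (\<Sum>(m, n, k)\<in>(f ` F) \<times> (g ` F) \<times> (h ` F). u m * v n * w k)"
    using assms by (intro sum_mono2) auto
  also have "\<dots> = (\<Sum>m\<in>f ` F. \<Sum>n\<in>g ` F. \<Sum>k\<in>h ` F. u m * v n * w k)"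
    by (simp only: sum.cartesian_product case_prod_conv split_def)
  also have "\<dots> = (\<Sum>n\<in>f ` F. u n) * (\<Sum>n\<in>g ` F. v n) * (\<Sum>n\<in>h ` F. w n)"
    by (simp only: sum_distrib_left[symmetric] sum_distrib_right[symmetric])
  finally show ?thesis .
qed

lemma CS_sum_le:
  fixes f g :: "'a \<Rightarrow> real"
  assumes "(\<Sum>q\<in>F. (f q)\<^sup>2) \<le> U\<^sup>2" "(\<Sum>q\<in>F. (g q)\<^sup>2) \<le> V\<^sup>2" "0 \<le> U" "0 \<le> V"
  shows "(\<Sum>q\<in>F. f q * g q) \<le> U * V"
proof -
  have "(\<Sum>q\<in>F. f q * g q)\<^sup>2 \<le> (\<Sum>q\<in>F. (f q)\<^sup>2) * (\<Sum>q\<in>F. (g q)\<^sup>2)"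
    by (rule Cauchy_Schwarz_ineq_sum)
  also have "\<dots> \<le> U\<^sup>2 * V\<^sup>2" using assms by (intro mult_mono) (auto simp: sum_nonneg)
  finally have "(\<Sum>q\<in>F. f q * g q)\<^sup>2 \<le> (U * V)\<^sup>2" by (simp add: power_mult_distrib)
  then show ?thesis using assms by (simp add: power2_le_iff_abs_le)
qed

lemma l2bD: "l2b x X \<Longrightarrow> finite A \<Longrightarrow> (\<Sum>n\<in>A. (cmod (x n))\<^sup>2) \<le> X\<^sup>2"
  by (simp add: l2b_def)

lemma l2b_nonneg: "l2b x X \<Longrightarrow> 0 \<le> X"
  by (simp add: l2b_def)

lemma l2b_le: assumes "l2b x X" shows "cmod (x n) \<le> X"
  using l2bD[OF assms, of "{n}"] l2b_nonneg[OF assms] by (simp add: power2_le_iff_abs_le)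

lemma abs_int_ge_1: "m \<noteq> (0::int) \<Longrightarrow> 1 \<le> \<bar>real_of_int m\<bar>" by linarith

lemma sum_powr_image_le:
  assumes "p > 1" "finite F" "\<And>q. q \<in> F \<Longrightarrow> f q \<noteq> 0"
  shows "(\<Sum>m\<in>f ` F. \<bar>real_of_int m\<bar> powr - p) \<le> zc p"
  by (rule sum_int_powr_le) (use assms in \<open>auto simp: image_iff\<close>)

lemma l2b_image: "l2b x X \<Longrightarrow> finite F \<Longrightarrow> (\<Sum>n\<in>f ` F. (cmod (x n))\<^sup>2) \<le> X\<^sup>2"
  by (simp add: l2bD)

lemma mult3_mono:
  fixes a b c A B C :: real
  assumes "a \<le> A" "b \<le> B" "c \<le> C" "0 \<le> a" "0 \<le> b" "0 \<le> c"
  shows "a * b * c \<le> A * B * C"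
  using assms by (intro mult_mono) auto

text \<open>Cauchy-Schwarz separates the weight from the amplitudes. Squaring turns the exponent
  \<open>7/8\<close> into \<open>7/4\<close>, which exceeds one. Weight and amplitudes may use
  different coordinates, as long as each pair of coordinates determines the point of
  \<open>F\<close>.\<close>

lemma pair_sum_le:
  assumes "finite F" "inj_on (\<lambda>q. (f q, g q)) F" "inj_on (\<lambda>q. (f' q, g' q)) F"
    "\<And>q. q \<in> F \<Longrightarrow> f q \<noteq> 0" "\<And>q. q \<in> F \<Longrightarrow> g q \<noteq> 0" "l2b x X" "l2b y Y"
  shows "(\<Sum>q\<in>F. (\<bar>real_of_int (f q)\<bar> * \<bar>real_of_int (g q)\<bar>) powr - (7/8)
            * (cmod (x (f' q)) * cmod (y (g' q)))) \<le> zc (7/4) * (X * Y)"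
proof (rule CS_sum_le)
  have e: "((\<bar>real_of_int (f q)\<bar> * \<bar>real_of_int (g q)\<bar>) powr - (7/8))\<^sup>2 =
      \<bar>real_of_int (f q)\<bar> powr - (7/4) * \<bar>real_of_int (g q)\<bar> powr - (7/4)" for q
    by (simp add: powr_mult power2_eq_square powr_add[symmetric] mult_ac)
  have "(\<Sum>q\<in>F. ((\<bar>real_of_int (f q)\<bar> * \<bar>real_of_int (g q)\<bar>) powr - (7/8))\<^sup>2)
     \<le> (\<Sum>n\<in>f ` F. \<bar>real_of_int n\<bar> powr - (7/4)) * (\<Sum>n\<in>g ` F. \<bar>real_of_int n\<bar> powr - (7/4))"
    unfolding e by (rule sum2_le[OF assms(1,2)]) auto
  also have "\<dots> \<le> zc (7/4) * zc (7/4)"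
    by (intro mult_mono sum_powr_image_le sum_nonneg zc_nonneg assms(1,4,5)) simp_all
  finally show "(\<Sum>q\<in>F. ((\<bar>real_of_int (f q)\<bar> * \<bar>real_of_int (g q)\<bar>) powr - (7/8))\<^sup>2) \<le> (zc (7/4))\<^sup>2"
    by (simp add: power2_eq_square)
  have "(\<Sum>q\<in>F. (cmod (x (f' q)) * cmod (y (g' q)))\<^sup>2) = (\<Sum>q\<in>F. (cmod (x (f' q)))\<^sup>2 * (cmod (y (g' q)))\<^sup>2)"
    by (simp add: power_mult_distrib)
  also have "\<dots> \<le> (\<Sum>n\<in>f' ` F. (cmod (x n))\<^sup>2) * (\<Sum>n\<in>g' ` F. (cmod (y n))\<^sup>2)"
    by (rule sum2_le[OF assms(1,3)]) auto
  also have "\<dots> \<le> X\<^sup>2 * Y\<^sup>2"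
    by (intro mult_mono l2b_image[OF assms(6)] l2b_image[OF assms(7)] sum_nonneg assms(1)) simp_all
  finally show "(\<Sum>q\<in>F. (cmod (x (f' q)) * cmod (y (g' q)))\<^sup>2) \<le> (X * Y)\<^sup>2"
    by (simp add: power_mult_distrib)
qed (use assms l2b_nonneg zc_nonneg in auto)

definition ctri :: real where "ctri = sqrt (zc (9/8) * zc (9/8)) * sqrt (zc (5/4))"

lemma ctri_nonneg: "0 \<le> ctri" unfolding ctri_def by (simp add: zc_nonneg)

text \<open>One pair sum is dropped, being at least one in size, and the exponent is split as
  \<open>7/8 = 9/16 + 5/16\<close> before Cauchy-Schwarz. The first factor carries \<open>w\<close>
  and, squared, two weights of exponent \<open>9/8\<close>, summable in the coordinates
  \<open>h\<close>, \<open>f + h\<close>, \<open>g + h\<close>. The second carries \<open>x\<close>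
  and \<open>y\<close> and has room for only one more free variable.\<close>

lemma trilinear_le:
  assumes F: "finite F" and inj: "inj_on (\<lambda>q. (f q, g q, h q)) F"
    and nz: "\<And>q. q \<in> F \<Longrightarrow> f q + g q \<noteq> 0" "\<And>q. q \<in> F \<Longrightarrow> f q + h q \<noteq> 0" "\<And>q. q \<in> F \<Longrightarrow> g q + h q \<noteq> 0"
    and l2: "l2b x X" "l2b y Y" "l2b w W"
  shows "(\<Sum>q\<in>F. pp (f q) (g q) (h q) powr - (7/8) * (cmod (x (f q)) * cmod (y (g q)) * cmod (w (h q))))
         \<le> ctri * (X * Y * W)"
proof -
  note nn = l2b_nonneg[OF l2(1)] l2b_nonneg[OF l2(2)] l2b_nonneg[OF l2(3)]
  let ?s = "\<lambda>q. \<bar>real_of_int (f q + h q)\<bar>" and ?t = "\<lambda>q. \<bar>real_of_int (g q + h q)\<bar>"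
  let ?x = "\<lambda>q. cmod (x (f q))" and ?y = "\<lambda>q. cmod (y (g q))" and ?w = "\<lambda>q. cmod (w (h q))"
  have pos: "1 \<le> ?s q" "1 \<le> ?t q" if "q \<in> F" for q
    using nz that abs_int_ge_1 by blast+
  have k: "pp (f q) (g q) (h q) powr - (7/8) \<le> (?s q * ?t q) powr - (9/16) * (?s q * ?t q) powr - (5/16)"
    if "q \<in> F" for q
  proof -
    have "?s q * ?t q \<le> pp (f q) (g q) (h q)"
    proof -
      have "1 * (?s q * ?t q) \<le> \<bar>real_of_int (f q + g q)\<bar> * (?s q * ?t q)"
        using nz(1)[OF that] by (intro mult_right_mono abs_int_ge_1) auto
      then show ?thesis by (simp only: pp_def mult.assoc)
    qed
    moreover have "0 < ?s q * ?t q" using pos[OF that] by simp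
    ultimately have "pp (f q) (g q) (h q) powr - (7/8) \<le> (?s q * ?t q) powr - (7/8)"
      by (intro powr_mono2') auto
    then show ?thesis by (simp add: powr_add[symmetric])
  qed
  have "(\<Sum>q\<in>F. pp (f q) (g q) (h q) powr - (7/8) * (?x q * ?y q * ?w q)) \<le>
     (\<Sum>q\<in>F. (?w q * (?s q * ?t q) powr - (9/16)) * ((?x q * ?y q) * (?s q * ?t q) powr - (5/16)))"
  proof (rule sum_mono)
    fix q assume "q \<in> F"
    from mult_right_mono[OF k[OF this], of "?x q * ?y q * ?w q"]
    show "pp (f q) (g q) (h q) powr - (7/8) * (?x q * ?y q * ?w q) \<le>
      (?w q * (?s q * ?t q) powr - (9/16)) * ((?x q * ?y q) * (?s q * ?t q) powr - (5/16))"
      by (simp add: mult_ac)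
  qed
  also have "\<dots> \<le> (W * sqrt (zc (9/8) * zc (9/8))) * ((X * Y) * sqrt (zc (5/4)))"
  proof (rule CS_sum_le)
    have e: "(?w q * (?s q * ?t q) powr - (9/16))\<^sup>2 = (cmod (w (h q)))\<^sup>2 * ?s q powr - (9/8) * ?t q powr - (9/8)" for q
      by (simp add: powr_mult power_mult_distrib power2_eq_square powr_add[symmetric] mult_ac)
    have "(\<Sum>q\<in>F. (?w q * (?s q * ?t q) powr - (9/16))\<^sup>2) \<le>
       (\<Sum>n\<in>h ` F. (cmod (w n))\<^sup>2) * (\<Sum>n\<in>(\<lambda>q. f q + h q) ` F. \<bar>real_of_int n\<bar> powr - (9/8)) *
        (\<Sum>n\<in>(\<lambda>q. g q + h q) ` F. \<bar>real_of_int n\<bar> powr - (9/8))"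
      unfolding e using inj by (intro sum3_le[OF F]) (auto simp: inj_on_def)
    also have "\<dots> \<le> W\<^sup>2 * zc (9/8) * zc (9/8)"
      by (intro mult3_mono sum_powr_image_le sum_nonneg l2b_image[OF l2(3)] F nz(2,3)) simp_all
    also have "\<dots> = (W * sqrt (zc (9/8) * zc (9/8)))\<^sup>2"
      using zc_nonneg[of "9/8"] by (simp add: power_mult_distrib power2_eq_square)
    finally show "(\<Sum>q\<in>F. (?w q * (?s q * ?t q) powr - (9/16))\<^sup>2) \<le> (W * sqrt (zc (9/8) * zc (9/8)))\<^sup>2" .
    \<comment> \<open>With \<open>f\<close> and \<open>g\<close> as free variables only one of the
      two weights can be summed, so their product is split by the arithmetic-geometric mean; the
      exponent \<open>5/8\<close> doubles to the summable \<open>5/4\<close>.\<close>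
    have "((?x q * ?y q) * (?s q * ?t q) powr - (5/16))\<^sup>2 \<le>
       1/2 * ((cmod (x (f q)))\<^sup>2 * (cmod (y (g q)))\<^sup>2 * ?s q powr - (5/4)) +
       1/2 * ((cmod (x (f q)))\<^sup>2 * (cmod (y (g q)))\<^sup>2 * ?t q powr - (5/4))" for q
    proof -
      have am: "u * v \<le> 1/2 * u\<^sup>2 + 1/2 * v\<^sup>2" for u v :: real
        using zero_le_power2[of "u - v"] by (simp add: power2_diff)
      have "((?s q * ?t q) powr - (5/16))\<^sup>2 = ?s q powr - (5/8) * ?t q powr - (5/8)"
        by (simp add: powr_mult power2_eq_square powr_add[symmetric] mult_ac)
      also have "\<dots> \<le> 1/2 * ?s q powr - (5/4) + 1/2 * ?t q powr - (5/4)"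
        using am[of "?s q powr - (5/8)" "?t q powr - (5/8)"]
        by (simp add: power2_eq_square powr_add[symmetric])
      finally have "(?x q * ?y q)\<^sup>2 * ((?s q * ?t q) powr - (5/16))\<^sup>2 \<le>
        (?x q * ?y q)\<^sup>2 * (1/2 * ?s q powr - (5/4) + 1/2 * ?t q powr - (5/4))"
        by (rule mult_left_mono) simp
      then show ?thesis by (simp only: power_mult_distrib ring_distribs mult_ac)
    qed
    then have "(\<Sum>q\<in>F. ((?x q * ?y q) * (?s q * ?t q) powr - (5/16))\<^sup>2) \<le>
      (\<Sum>q\<in>F. 1/2 * ((cmod (x (f q)))\<^sup>2 * (cmod (y (g q)))\<^sup>2 * ?s q powr - (5/4)) +
       1/2 * ((cmod (x (f q)))\<^sup>2 * (cmod (y (g q)))\<^sup>2 * ?t q powr - (5/4)))" by (intro sum_mono)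
    also have "\<dots> = 1/2 * (\<Sum>q\<in>F. (cmod (x (f q)))\<^sup>2 * (cmod (y (g q)))\<^sup>2 * ?s q powr - (5/4)) +
       1/2 * (\<Sum>q\<in>F. (cmod (x (f q)))\<^sup>2 * (cmod (y (g q)))\<^sup>2 * ?t q powr - (5/4))"
      by (simp add: sum.distrib sum_distrib_left)
    also have "\<dots> \<le> 1/2 * (X\<^sup>2 * Y\<^sup>2 * zc (5/4)) + 1/2 * (X\<^sup>2 * Y\<^sup>2 * zc (5/4))"
    proof (intro add_mono mult_left_mono)
      have "(\<Sum>q\<in>F. (cmod (x (f q)))\<^sup>2 * (cmod (y (g q)))\<^sup>2 * ?s q powr - (5/4)) \<le>
        (\<Sum>n\<in>f ` F. (cmod (x n))\<^sup>2) * (\<Sum>n\<in>g ` F. (cmod (y n))\<^sup>2) * (\<Sum>n\<in>(\<lambda>q. f q + h q) ` F. \<bar>real_of_int n\<bar> powr - (5/4))"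
        using inj by (intro sum3_le[OF F]) (auto simp: inj_on_def)
      also have "\<dots> \<le> X\<^sup>2 * Y\<^sup>2 * zc (5/4)"
        by (intro mult3_mono sum_powr_image_le sum_nonneg l2b_image[OF l2(1)] l2b_image[OF l2(2)] F nz(2,3)) simp_all
      finally show "(\<Sum>q\<in>F. (cmod (x (f q)))\<^sup>2 * (cmod (y (g q)))\<^sup>2 * ?s q powr - (5/4)) \<le> X\<^sup>2 * Y\<^sup>2 * zc (5/4)" .
      have "(\<Sum>q\<in>F. (cmod (x (f q)))\<^sup>2 * (cmod (y (g q)))\<^sup>2 * ?t q powr - (5/4)) \<le>
        (\<Sum>n\<in>f ` F. (cmod (x n))\<^sup>2) * (\<Sum>n\<in>g ` F. (cmod (y n))\<^sup>2) * (\<Sum>n\<in>(\<lambda>q. g q + h q) ` F. \<bar>real_of_int n\<bar> powr - (5/4))"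
        using inj by (intro sum3_le[OF F]) (auto simp: inj_on_def)
      also have "\<dots> \<le> X\<^sup>2 * Y\<^sup>2 * zc (5/4)"
        by (intro mult3_mono sum_powr_image_le sum_nonneg l2b_image[OF l2(1)] l2b_image[OF l2(2)] F nz(2,3)) simp_all
      finally show "(\<Sum>q\<in>F. (cmod (x (f q)))\<^sup>2 * (cmod (y (g q)))\<^sup>2 * ?t q powr - (5/4)) \<le> X\<^sup>2 * Y\<^sup>2 * zc (5/4)" .
    qed auto
    also have "\<dots> = ((X * Y) * sqrt (zc (5/4)))\<^sup>2"
      using zc_nonneg[of "5/4"] by (simp add: power_mult_distrib)
    finally show "(\<Sum>q\<in>F. ((?x q * ?y q) * (?s q * ?t q) powr - (5/16))\<^sup>2) \<le> ((X * Y) * sqrt (zc (5/4)))\<^sup>2" .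
  qed (use nn zc_nonneg in auto)
  finally show ?thesis by (simp add: ctri_def mult_ac)
qed

text \<open>The size of a time derivative of \<open>\<zeta>\<^sub>n\<close>: one frequency factor is lost, and the part of strength \<open>m\<close>, caused by
  different cut-offs of size at least \<open>L\<close>, is only present at frequencies beyond \<open>L\<close>. Since a product-rule
  term differentiates exactly one factor, \<open>adm\<close> admits such a size in any one of the four slots.\<close>

definition sb :: "(int \<Rightarrow> complex) \<Rightarrow> real \<Rightarrow> real \<Rightarrow> real \<Rightarrow> bool" where
  "sb x h m L \<longleftrightarrow> 0 \<le> h \<and> 0 \<le> m \<and> (\<forall>n. cmod (x n) \<le> jb n * (h + m * (jb n / L) powr (1/8)))"

definition wsum :: "(int \<times> int \<times> int \<times> int) set \<Rightarrow> (int \<times> int \<times> int \<times> int \<Rightarrow> real) \<Rightarrow>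
    (int \<Rightarrow> complex) \<Rightarrow> (int \<Rightarrow> complex) \<Rightarrow> (int \<Rightarrow> complex) \<Rightarrow> (int \<Rightarrow> complex) \<Rightarrow> real" where
  "wsum F \<omega> x y z w = (\<Sum>(a, b, c, d)\<in>F. \<omega> (a, b, c, d) * (cmod (x a) * cmod (y b) * cmod (z c) * cmod (w d)))"

definition adm :: "(int \<times> int \<times> int \<times> int) set \<Rightarrow> (int \<times> int \<times> int \<times> int \<Rightarrow> real) \<Rightarrow>
    real \<Rightarrow> real \<Rightarrow> real \<Rightarrow> bool" where
  "adm F \<omega> A B L \<longleftrightarrow> (\<forall>x y z w X Y Z W h m.
     (sb x h m L \<and> l2b y Y \<and> l2b z Z \<and> l2b w W \<longrightarrow> wsum F \<omega> x y z w \<le> (A * h + B * m) * (Y * Z * W)) \<and>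
     (l2b x X \<and> sb y h m L \<and> l2b z Z \<and> l2b w W \<longrightarrow> wsum F \<omega> x y z w \<le> (A * h + B * m) * (X * Z * W)) \<and>
     (l2b x X \<and> l2b y Y \<and> sb z h m L \<and> l2b w W \<longrightarrow> wsum F \<omega> x y z w \<le> (A * h + B * m) * (X * Y * W)) \<and>
     (l2b x X \<and> l2b y Y \<and> l2b z Z \<and> sb w h m L \<longrightarrow> wsum F \<omega> x y z w \<le> (A * h + B * m) * (X * Y * Z)))"

section \<open>Size of the normal form weights on nonresonant quadruples\<close>

lemma nonres_pp:
  assumes "nonres (a, b, c, d)"
  shows "pp a b c = pp b c d" "pp a b c = pp a c d" "pp a b c = pp a b d"
proof -
  have "d = - a - b - c" using assms by (simp add: nonres_def)
  then have e: "c + d = - (a + b)" "b + d = - (a + c)" "a + d = - (b + c)" by auto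
  show "pp a b c = pp b c d" "pp a b c = pp a c d" "pp a b c = pp a b d"
    unfolding pp_def e by (simp_all only: of_int_minus abs_minus_cancel mult_ac)
qed

lemma nonres_ge_1:
  assumes "nonres (a, b, c, d)"
  shows "1 \<le> pp a b c" "1 \<le> sq4 a b c d"
proof -
  have nz: "a + b \<noteq> 0" "a + c \<noteq> 0" "b + c \<noteq> 0" using assms by (auto simp: nonres_def)
  show "1 \<le> pp a b c" unfolding pp_def
    using mult_mono[OF mult_mono[OF abs_int_ge_1[OF nz(1)] abs_int_ge_1[OF nz(2)]] abs_int_ge_1[OF nz(3)]]
    by simp
  have "0 < a\<^sup>2 + b\<^sup>2"
    using nz(1) by (metis add.right_neutral sum_power2_gt_zero_iff)
  then have "1 \<le> a\<^sup>2 + b\<^sup>2 + c\<^sup>2 + d\<^sup>2"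
    by (smt (verit) zero_le_power2)
  then show "1 \<le> sq4 a b c d" unfolding sq4_def by linarith
qed

lemma jb_le_sqrt:
  assumes "nonres (a, b, c, d)" "j \<in> {a, b, c, d}"
  shows "jb j \<le> sqrt (sq4 a b c d)"
proof -
  have "\<bar>real_of_int j\<bar>\<^sup>2 \<le> sq4 a b c d" using assms(2) unfolding sq4_def by auto
  then have "\<bar>real_of_int j\<bar> \<le> sqrt (sq4 a b c d)" by (rule real_le_rsqrt)
  moreover have "1 \<le> sqrt (sq4 a b c d)" using nonres_ge_1(2)[OF assms(1)] by simp
  ultimately show ?thesis unfolding jb_def by simp
qed

text \<open>The frequencies are recovered from the pair sums, for instance
  \<open>2 * a = (a + b) + (a + c) - (b + c)\<close>, so a bound for the three pair sums bounds all
  four of them.\<close>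

lemma sqrt_sq4_le_max:
  assumes "nonres (a, b, c, d)" "\<bar>real_of_int (a + b)\<bar> \<le> s" "\<bar>real_of_int (a + c)\<bar> \<le> s" "\<bar>real_of_int (b + c)\<bar> \<le> s"
  shows "sqrt (sq4 a b c d) \<le> 4 * s"
proof -
  have d: "d = - a - b - c" using assms by (simp add: nonres_def)
  have s: "0 \<le> s" using assms(2) by linarith
  have "\<bar>real_of_int a\<bar> \<le> 2 * s" "\<bar>real_of_int b\<bar> \<le> 2 * s" "\<bar>real_of_int c\<bar> \<le> 2 * s" "\<bar>real_of_int d\<bar> \<le> 2 * s"
    using assms(2-4) unfolding d by (simp_all; linarith)+
  then have "(real_of_int a)\<^sup>2 \<le> (2 * s)\<^sup>2" "(real_of_int b)\<^sup>2 \<le> (2 * s)\<^sup>2"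
    "(real_of_int c)\<^sup>2 \<le> (2 * s)\<^sup>2" "(real_of_int d)\<^sup>2 \<le> (2 * s)\<^sup>2"
    using s by (simp_all only: abs_le_square_iff[symmetric] abs_of_nonneg mult_nonneg_nonneg zero_le_numeral)
  then have "sq4 a b c d \<le> (4 * s)\<^sup>2" unfolding sq4_def by (simp add: power2_eq_square)
  then show ?thesis using s real_le_lsqrt sq4_nonneg by (simp add: real_le_lsqrt)
qed

text \<open>Every factor of \<open>pp\<close> is at least one, so each is bounded by the whole
  product. This lets a negative power of \<open>pp\<close> be exchanged for a negative power of the
  largest frequency.\<close>

lemma sqrt_sq4_le_pp:
  assumes "nonres (a, b, c, d)"
  shows "sqrt (sq4 a b c d) \<le> 4 * pp a b c"
proof (rule sqrt_sq4_le_max[OF assms])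
  have nz: "1 \<le> \<bar>real_of_int (a + b)\<bar>" "1 \<le> \<bar>real_of_int (a + c)\<bar>" "1 \<le> \<bar>real_of_int (b + c)\<bar>"
    using assms abs_int_ge_1 unfolding nonres_def by blast+
  have m: "x \<le> x * y * z" "x \<le> y * x * z" "x \<le> y * z * x" if "1 \<le> x" "1 \<le> y" "1 \<le> z" for x y z :: real
    using that mult_mono[of 1 y 1 z] mult_left_mono[of 1 "y * z" x] by (simp_all add: mult_ac)
  show "\<bar>real_of_int (a + b)\<bar> \<le> pp a b c" unfolding pp_def by (rule m(1)[OF nz])
  show "\<bar>real_of_int (a + c)\<bar> \<le> pp a b c" unfolding pp_def by (rule m(2)[OF nz(2,1,3)])
  show "\<bar>real_of_int (b + c)\<bar> \<le> pp a b c" unfolding pp_def by (rule m(3)[OF nz(3,1,2)])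
qed

text \<open>The exponent \<open>1/8\<close> is that of \<open>sb\<close>; an eighth root reduces any
  constant up to \<open>2 powr 8\<close> to a factor two.\<close>

lemma root8_le_2: "0 \<le> x \<Longrightarrow> x \<le> 5 * y \<Longrightarrow> 0 \<le> y \<Longrightarrow> x powr (1/8) \<le> 2 * y powr (1/8)" for x y :: real
proof -
  assume a: "0 \<le> x" "x \<le> 5 * y" "0 \<le> y"
  have "x powr (1/8) \<le> (2 powr 8 * y) powr (1/8)"
  proof (rule powr_mono2)
    have "(2::real) powr 8 = 256" by (simp add: powr_numeral)
    then show "x \<le> 2 powr 8 * y" using a by simp
  qed (use a in auto)
  also have "\<dots> = 2 * y powr (1/8)" using a by (simp add: powr_mult powr_powr)
  finally show ?thesis .
qed

text \<open>The weight and the derivative bound each supply one factor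
  \<open>sqrt (sq4 a b c d)\<close>, which together cancel \<open>sq4\<close> and leave
  \<open>1 / pp\<close>. The power \<open>7/8\<close> is kept for the lattice sum. The remaining
  \<open>1/8\<close> turns into \<open>K powr - (1/8)\<close> in the \<open>h\<close> term by
  \<open>sqrt_sq4_le_pp\<close>; in the \<open>m\<close> term it cancels the growth of
  \<open>(jb n / L) powr (1/8)\<close> and leaves \<open>L powr - (1/8)\<close>.\<close>

lemma weight_high_pointwise:
  assumes q: "nonres (a, b, c, d)" and K: "1 \<le> K" "K\<^sup>2 \<le> sq4 a b c d" and L: "1 \<le> L"
    and w: "0 \<le> \<omega>" "\<omega> \<le> sqrt (sq4 a b c d) / (pp a b c * sq4 a b c d)"
    and x: "sb x h m L" and j: "j \<in> {a, b, c, d}"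
  shows "\<omega> * cmod (x j) \<le> 2 * (K powr - (1/8) * h + L powr - (1/8) * m) * pp a b c powr - (7/8)"
proof -
  let ?S = "sqrt (sq4 a b c d)" and ?P = "pp a b c"
  have P: "1 \<le> ?P" and S: "1 \<le> ?S" using nonres_ge_1[OF q] by auto
  have jS: "jb j \<le> ?S" and SP: "?S \<le> 4 * ?P" using jb_le_sqrt[OF q j] sqrt_sq4_le_pp[OF q] by auto
  have hm: "0 \<le> h" "0 \<le> m" and j1: "1 \<le> jb j" using x by (auto simp: sb_def jb_def)
  have "\<omega> * cmod (x j) \<le> (?S / (?P * sq4 a b c d)) * (?S * (h + m * (?S / L) powr (1/8)))"
  proof (intro mult_mono w)
    have "cmod (x j) \<le> jb j * (h + m * (jb j / L) powr (1/8))" using x by (auto simp: sb_def)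
    also have "\<dots> \<le> ?S * (h + m * (?S / L) powr (1/8))"
      using jS hm L j1 S by (intro mult_mono add_mono powr_mono2 divide_right_mono) auto
    finally show "cmod (x j) \<le> ?S * (h + m * (?S / L) powr (1/8))" .
  qed (use P in auto)
  also have "\<dots> = (h + m * (?S / L) powr (1/8)) / ?P"
  proof -
    have "?S * ?S = sq4 a b c d" by simp
    moreover have "sq4 a b c d \<noteq> 0" using nonres_ge_1[OF q] by auto
    ultimately show ?thesis using P by (simp add: field_simps)
  qed
  also have "\<dots> = h * (?P powr - (1/8) * ?P powr - (7/8)) + m * L powr - (1/8) * ?S powr (1/8) * (?P powr - (1/8) * ?P powr - (7/8))"
    using P L S by (simp add: powr_add[symmetric] powr_minus_divide powr_divide field_simps)
  also have "\<dots> \<le> h * (2 * K powr - (1/8) * ?P powr - (7/8)) + m * L powr - (1/8) * (2 * ?P powr (1/8)) * (?P powr - (1/8) * ?P powr - (7/8))"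
  proof (intro add_mono mult_left_mono mult_right_mono)
    have "K \<le> ?S" using K by (simp add: real_le_rsqrt)
    then have "K powr (1/8) \<le> 2 * ?P powr (1/8)" using SP K P by (intro root8_le_2) auto
    then show "?P powr - (1/8) \<le> 2 * K powr - (1/8)" using K P by (simp add: powr_minus_divide field_simps)
    show "?S powr (1/8) \<le> 2 * ?P powr (1/8)" using S SP P by (intro root8_le_2) auto
  qed (use hm in auto)
  also have "\<dots> = 2 * (K powr - (1/8) * h + L powr - (1/8) * m) * pp a b c powr - (7/8)"
  proof -
    have "?P powr (1/8) * ?P powr - (1/8) = 1" using P by (simp add: powr_add[symmetric])
    then show ?thesis by algebra
  qed
  finally show ?thesis .
qed

text \<open>Any three of the frequencies determine the fourth, and \<open>pp\<close> can be
  rewritten through any three of them, so \<open>trilinear_le\<close> applies whichever slot is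
  omitted.\<close>

lemma quad_sum_le:
  assumes F: "finite F" and nr: "\<And>q. q \<in> F \<Longrightarrow> nonres q"
    and l2: "l2b x X" "l2b y Y" "l2b w W"
  shows "(\<Sum>(a, b, c, d)\<in>F. pp a b c powr - (7/8) * (cmod (x b) * cmod (y c) * cmod (w d))) \<le> ctri * (X * Y * W)"
    "(\<Sum>(a, b, c, d)\<in>F. pp a b c powr - (7/8) * (cmod (x a) * cmod (y c) * cmod (w d))) \<le> ctri * (X * Y * W)"
    "(\<Sum>(a, b, c, d)\<in>F. pp a b c powr - (7/8) * (cmod (x a) * cmod (y b) * cmod (w d))) \<le> ctri * (X * Y * W)"
    "(\<Sum>(a, b, c, d)\<in>F. pp a b c powr - (7/8) * (cmod (x a) * cmod (y b) * cmod (w c))) \<le> ctri * (X * Y * W)"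
proof -
  define f1 f2 f3 f4 :: "int \<times> int \<times> int \<times> int \<Rightarrow> int"
    where f: "f1 = (\<lambda>(a, b, c, d). a)" "f2 = (\<lambda>(a, b, c, d). b)" "f3 = (\<lambda>(a, b, c, d). c)" "f4 = (\<lambda>(a, b, c, d). d)"
  have s: "f1 q + f2 q + f3 q + f4 q = 0" if "q \<in> F" for q using nr[OF that] by (auto simp: f nonres_def split: prod.splits)
  have nz: "f1 q + f2 q \<noteq> 0" "f1 q + f3 q \<noteq> 0" "f2 q + f3 q \<noteq> 0" if "q \<in> F" for q
    using nr[OF that] by (auto simp: f nonres_def split: prod.splits)
  have nz': "f1 q + f4 q \<noteq> 0" "f2 q + f4 q \<noteq> 0" "f3 q + f4 q \<noteq> 0" if "q \<in> F" for q
    using nz[OF that] s[OF that] by linarith+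
  have eq: "q = q'" if "f1 q = f1 q'" "f2 q = f2 q'" "f3 q = f3 q'" "f4 q = f4 q'" for q q'
    using that by (auto simp: f split: prod.splits)
  have inj: "inj_on (\<lambda>q. (f2 q, f3 q, f4 q)) F" "inj_on (\<lambda>q. (f1 q, f3 q, f4 q)) F"
     "inj_on (\<lambda>q. (f1 q, f2 q, f4 q)) F" "inj_on (\<lambda>q. (f1 q, f2 q, f3 q)) F"
    unfolding inj_on_def using s eq by (auto simp: add_eq_0_iff)
  have P: "pp (f1 q) (f2 q) (f3 q) = pp (f2 q) (f3 q) (f4 q)" "pp (f1 q) (f2 q) (f3 q) = pp (f1 q) (f3 q) (f4 q)"
    "pp (f1 q) (f2 q) (f3 q) = pp (f1 q) (f2 q) (f4 q)" if "q \<in> F" for q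
    using nonres_pp[of "f1 q" "f2 q" "f3 q" "f4 q"] nr[OF that] by (auto simp: f split: prod.splits)
  have "(\<Sum>q\<in>F. pp (f1 q) (f2 q) (f3 q) powr - (7/8) * (cmod (x (f2 q)) * cmod (y (f3 q)) * cmod (w (f4 q)))) \<le> ctri * (X * Y * W)"
    using trilinear_le[OF F inj(1) nz(3) nz'(2,3) l2] P(1) by simp
  then show "(\<Sum>(a, b, c, d)\<in>F. pp a b c powr - (7/8) * (cmod (x b) * cmod (y c) * cmod (w d))) \<le> ctri * (X * Y * W)"
    by (simp add: f split_def)
  have "(\<Sum>q\<in>F. pp (f1 q) (f2 q) (f3 q) powr - (7/8) * (cmod (x (f1 q)) * cmod (y (f3 q)) * cmod (w (f4 q)))) \<le> ctri * (X * Y * W)"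
    using trilinear_le[OF F inj(2) nz(2) nz'(1,3) l2] P(2) by simp
  then show "(\<Sum>(a, b, c, d)\<in>F. pp a b c powr - (7/8) * (cmod (x a) * cmod (y c) * cmod (w d))) \<le> ctri * (X * Y * W)"
    by (simp add: f split_def)
  have "(\<Sum>q\<in>F. pp (f1 q) (f2 q) (f3 q) powr - (7/8) * (cmod (x (f1 q)) * cmod (y (f2 q)) * cmod (w (f4 q)))) \<le> ctri * (X * Y * W)"
    using trilinear_le[OF F inj(3) nz(1) nz'(1,2) l2] P(3) by simp
  then show "(\<Sum>(a, b, c, d)\<in>F. pp a b c powr - (7/8) * (cmod (x a) * cmod (y b) * cmod (w d))) \<le> ctri * (X * Y * W)"
    by (simp add: f split_def)
  have "(\<Sum>q\<in>F. pp (f1 q) (f2 q) (f3 q) powr - (7/8) * (cmod (x (f1 q)) * cmod (y (f2 q)) * cmod (w (f3 q)))) \<le> ctri * (X * Y * W)"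
    using trilinear_le[OF F inj(4) nz(1,2,3) l2] by simp
  then show "(\<Sum>(a, b, c, d)\<in>F. pp a b c powr - (7/8) * (cmod (x a) * cmod (y b) * cmod (w c))) \<le> ctri * (X * Y * W)"
    by (simp add: f split_def)
qed

lemma sum_quad_mono:
  assumes "\<And>a b c d. (a, b, c, d) \<in> F \<Longrightarrow> f a b c d \<le> D * (g a b c d :: real)" "(\<Sum>(a, b, c, d)\<in>F. g a b c d) \<le> G" "0 \<le> D"
  shows "(\<Sum>(a, b, c, d)\<in>F. f a b c d) \<le> D * G"
proof -
  have "(\<Sum>(a, b, c, d)\<in>F. f a b c d) \<le> (\<Sum>(a, b, c, d)\<in>F. D * g a b c d)"
    by (rule sum_mono) (use assms(1) in auto)
  also have "\<dots> = D * (\<Sum>(a, b, c, d)\<in>F. g a b c d)" by (simp add: sum_distrib_left split_def)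
  also have "\<dots> \<le> D * G" using assms by (intro mult_left_mono)
  finally show ?thesis .
qed

text \<open>The slot holding the derivative is consumed by the weight through
  \<open>weight_high_pointwise\<close>, and the other three slots are summed by
  \<open>quad_sum_le\<close>. The smallness in \<open>K\<close> is what later allows boundary terms
  to be absorbed and tails to be controlled.\<close>

lemma adm_high:
  assumes F: "finite F" and nr: "\<And>q. q \<in> F \<Longrightarrow> nonres q"
    and K: "1 \<le> K" "\<And>a b c d. (a, b, c, d) \<in> F \<Longrightarrow> K\<^sup>2 \<le> sq4 a b c d" and L: "1 \<le> L"
    and w: "\<And>a b c d. (a, b, c, d) \<in> F \<Longrightarrow> 0 \<le> \<omega> (a, b, c, d)"
      "\<And>a b c d. (a, b, c, d) \<in> F \<Longrightarrow> \<omega> (a, b, c, d) \<le> sqrt (sq4 a b c d) / (pp a b c * sq4 a b c d)"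
  shows "adm F \<omega> (2 * ctri * K powr - (1/8)) (2 * ctri * L powr - (1/8)) L"
  unfolding adm_def
proof (intro allI conjI impI; elim conjE)
  fix x y z w :: "int \<Rightarrow> complex" and X Y Z W h m :: real
  let ?D = "2 * (K powr - (1/8) * h + L powr - (1/8) * m)"
  note pw = weight_high_pointwise[OF nr K(1) K(2) L w(1) w(2)]
  have D: "0 \<le> ?D" if "sb v h m L" for v using that by (auto simp: sb_def)
  have e: "(2 * ctri * K powr - (1/8) * h + 2 * ctri * L powr - (1/8) * m) * R = ?D * (ctri * R)" for R
    by (simp add: algebra_simps)
  { assume s: "sb x h m L" and l: "l2b y Y" "l2b z Z" "l2b w W"
    show "wsum F \<omega> x y z w \<le> (2 * ctri * K powr - (1/8) * h + 2 * ctri * L powr - (1/8) * m) * (Y * Z * W)"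
      unfolding wsum_def e
    proof (rule sum_quad_mono[OF _ quad_sum_le(1)[OF F nr l] D[OF s]])
      fix a b c d assume q: "(a, b, c, d) \<in> F"
      from mult_right_mono[OF pw[OF q q q q s, of a], of "cmod (y b) * cmod (z c) * cmod (w d)"]
      show "\<omega> (a, b, c, d) * (cmod (x a) * cmod (y b) * cmod (z c) * cmod (w d)) \<le>
         ?D * (pp a b c powr - (7/8) * (cmod (y b) * cmod (z c) * cmod (w d)))" by (simp add: mult_ac)
    qed }
  { assume s: "sb y h m L" and l: "l2b x X" "l2b z Z" "l2b w W"
    show "wsum F \<omega> x y z w \<le> (2 * ctri * K powr - (1/8) * h + 2 * ctri * L powr - (1/8) * m) * (X * Z * W)"
      unfolding wsum_def e
    proof (rule sum_quad_mono[OF _ quad_sum_le(2)[OF F nr l] D[OF s]])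
      fix a b c d assume q: "(a, b, c, d) \<in> F"
      from mult_right_mono[OF pw[OF q q q q s, of b], of "cmod (x a) * cmod (z c) * cmod (w d)"]
      show "\<omega> (a, b, c, d) * (cmod (x a) * cmod (y b) * cmod (z c) * cmod (w d)) \<le>
         ?D * (pp a b c powr - (7/8) * (cmod (x a) * cmod (z c) * cmod (w d)))" by (simp add: mult_ac)
    qed }
  { assume s: "sb z h m L" and l: "l2b x X" "l2b y Y" "l2b w W"
    show "wsum F \<omega> x y z w \<le> (2 * ctri * K powr - (1/8) * h + 2 * ctri * L powr - (1/8) * m) * (X * Y * W)"
      unfolding wsum_def e
    proof (rule sum_quad_mono[OF _ quad_sum_le(3)[OF F nr l] D[OF s]])
      fix a b c d assume q: "(a, b, c, d) \<in> F"
      from mult_right_mono[OF pw[OF q q q q s, of c], of "cmod (x a) * cmod (y b) * cmod (w d)"]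
      show "\<omega> (a, b, c, d) * (cmod (x a) * cmod (y b) * cmod (z c) * cmod (w d)) \<le>
         ?D * (pp a b c powr - (7/8) * (cmod (x a) * cmod (y b) * cmod (w d)))" by (simp add: mult_ac)
    qed }
  { assume s: "sb w h m L" and l: "l2b x X" "l2b y Y" "l2b z Z"
    show "wsum F \<omega> x y z w \<le> (2 * ctri * K powr - (1/8) * h + 2 * ctri * L powr - (1/8) * m) * (X * Y * Z)"
      unfolding wsum_def e
    proof (rule sum_quad_mono[OF _ quad_sum_le(4)[OF F nr l] D[OF s]])
      fix a b c d assume q: "(a, b, c, d) \<in> F"
      from mult_right_mono[OF pw[OF q q q q s, of d], of "cmod (x a) * cmod (y b) * cmod (z c)"]
      show "\<omega> (a, b, c, d) * (cmod (x a) * cmod (y b) * cmod (z c) * cmod (w d)) \<le>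
         ?D * (pp a b c powr - (7/8) * (cmod (x a) * cmod (y b) * cmod (z c)))" by (simp add: mult_ac)
    qed }
qed

text \<open>Here the weight carries \<open>d\<close> squared, one factor more than in
  \<open>weight_high_pointwise\<close>. Together with the derivative this leaves
  \<open>sqrt (sq4 a b c d) / pp a b c\<close>, in which the largest pair sum cancels the square
  root and the two smaller ones survive. The three summands on the right cover the three possible
  positions of the largest pair sum.\<close>

lemma weight_fixed_pointwise:
  assumes q: "nonres (a, b, c, d)" and L: "1 \<le> L"
    and w: "0 \<le> \<omega>" "\<omega> \<le> (real_of_int d)\<^sup>2 / (pp a b c * sq4 a b c d)"
    and x: "sb x h m L" and j: "j \<in> {a, b, c, d}"
  shows "\<omega> * cmod (x j) \<le> 8 * (h + (jb d / L) powr (1/8) * m) *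
    ((\<bar>real_of_int (a + b)\<bar> * \<bar>real_of_int (a + c)\<bar>) powr - (7/8) +
     (\<bar>real_of_int (a + b)\<bar> * \<bar>real_of_int (b + c)\<bar>) powr - (7/8) +
     (\<bar>real_of_int (a + c)\<bar> * \<bar>real_of_int (b + c)\<bar>) powr - (7/8))"
proof -
  let ?S = "sqrt (sq4 a b c d)" and ?P = "pp a b c"
  let ?u = "\<bar>real_of_int (a + b)\<bar>" and ?v = "\<bar>real_of_int (a + c)\<bar>" and ?w = "\<bar>real_of_int (b + c)\<bar>"
  have P: "1 \<le> ?P" and S: "1 \<le> ?S" using nonres_ge_1[OF q] by auto
  have d: "d = - a - b - c" using q by (simp add: nonres_def)
  have uvw: "1 \<le> ?u" "1 \<le> ?v" "1 \<le> ?w" using q abs_int_ge_1 unfolding nonres_def by blast+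
  have jS: "jb j \<le> ?S" using jb_le_sqrt[OF q j] by auto
  have hm: "0 \<le> h" "0 \<le> m" and j1: "1 \<le> jb j" and d1: "1 \<le> jb d" using x by (auto simp: sb_def jb_def)
  \<comment> \<open>Here \<open>r\<close> is the largest pair sum and \<open>s\<close>,
    \<open>t\<close> are the other two. All frequencies are at most
    \<open>5 * (jb d * (s * t))\<close>, so the growth in the \<open>m\<close> term costs
    \<open>(s * t) powr (1/8)\<close> and leaves the exponent \<open>7/8\<close>.\<close>
  have main: "?S / ?P * (h + m * (jb j / L) powr (1/8)) \<le> 8 * (h + (jb d / L) powr (1/8) * m) * (s * t) powr - (7/8)"
    if P_eq: "?P = s * t * r" and le: "?u \<le> r" "?v \<le> r" "?w \<le> r" and rle: "r \<le> 2 * jb d + s + t"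
      and st: "1 \<le> s" "1 \<le> t" for s t r :: real
  proof -
    have SP: "?S / ?P \<le> 4 / (s * t)"
    proof -
      have "0 < r" using le uvw by linarith
      then show ?thesis using sqrt_sq4_le_max[OF q le] st unfolding P_eq by (simp add: field_simps)
    qed
    have "jb j \<le> 3 * jb d + s + t"
    proof -
      have "\<bar>real_of_int j\<bar> \<le> \<bar>real_of_int d\<bar> + r" using j le unfolding d by auto
      then show ?thesis using rle st unfolding jb_def by auto
    qed
    also have "\<dots> \<le> 5 * (jb d * (s * t))"
    proof -
      have "s \<le> jb d * (s * t)" "t \<le> jb d * (s * t)" "jb d \<le> jb d * (s * t)"
        using st d1 mult_mono[of 1 "jb d" s "s * t"] mult_mono[of 1 "jb d" t "s * t"] mult_left_mono[of 1 "s * t" "jb d"]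
          mult_mono[of 1 s 1 t] mult_left_mono[of 1 t s] mult_right_mono[of 1 s t] by auto
      then show ?thesis by linarith
    qed
    finally have "jb j / L \<le> 5 * (jb d / L * (s * t))" using L by (simp add: field_simps)
    then have J: "(jb j / L) powr (1/8) \<le> 2 * (jb d / L * (s * t)) powr (1/8)"
      using j1 d1 L st by (intro root8_le_2) auto
    have "?S / ?P * (h + m * (jb j / L) powr (1/8)) \<le> 4 / (s * t) * (h + m * (2 * (jb d / L * (s * t)) powr (1/8)))"
      using SP J hm st S P by (intro mult_mono add_mono mult_left_mono) auto
    also have "\<dots> = 4 * (h * ((s * t) powr - (1/8) * (s * t) powr - (7/8)) + 2 * m * (jb d / L) powr (1/8) * (s * t) powr - (7/8))"
    proof -
      have "1 / (s * t) = (s * t) powr - (1/8) * (s * t) powr - (7/8)"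
        using st by (simp add: powr_add[symmetric] powr_minus_divide)
      moreover have "(jb d / L * (s * t)) powr (1/8) = (jb d / L) powr (1/8) * (s * t) powr (1/8)"
        using st by (simp only: powr_mult)
      moreover have "(s * t) powr (1/8) * (s * t) powr - (1/8) = 1" using st by (simp add: powr_add[symmetric])
      ultimately show ?thesis by algebra
    qed
    also have "\<dots> \<le> 4 * (2 * h * (1 * (s * t) powr - (7/8)) + 2 * m * (jb d / L) powr (1/8) * (s * t) powr - (7/8))"
    proof -
      have "(s * t) powr - (1/8) \<le> 1" using st mult_mono[of 1 s 1 t] powr_mono2'[of "-(1/8)" 1 "s * t"] by simp
      then have "h * ((s * t) powr - (1/8) * (s * t) powr - (7/8)) \<le> 2 * h * (1 * (s * t) powr - (7/8))"
        using hm by (intro mult_mono mult_right_mono) auto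
      then show ?thesis by simp
    qed
    also have "\<dots> = 8 * (h + (jb d / L) powr (1/8) * m) * (s * t) powr - (7/8)" by (simp add: algebra_simps)
    finally show ?thesis .
  qed
  have mono: "8 * (h + (jb d / L) powr (1/8) * m) * e \<le> 8 * (h + (jb d / L) powr (1/8) * m) * (e1 + e2 + e3)"
    if "e \<le> e1 + e2 + e3" for e e1 e2 e3
    using hm that by (intro mult_left_mono) auto
  have "\<omega> * cmod (x j) \<le> (real_of_int d)\<^sup>2 / (?P * sq4 a b c d) * (jb j * (h + m * (jb j / L) powr (1/8)))"
    using x w P by (intro mult_mono) (auto simp: sb_def)
  also have "\<dots> \<le> sq4 a b c d / (?P * sq4 a b c d) * (?S * (h + m * (jb j / L) powr (1/8)))"
    using jS hm j1 P by (intro mult_mono divide_right_mono) (auto simp: sq4_def)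
  also have "\<dots> = ?S / ?P * (h + m * (jb j / L) powr (1/8))"
    using nonres_ge_1(2)[OF q] P by (simp add: field_simps)
  finally have le1: "\<omega> * cmod (x j) \<le> ?S / ?P * (h + m * (jb j / L) powr (1/8))" .
  have P1: "?P = ?u * ?v * ?w" "?P = ?u * ?w * ?v" "?P = ?v * ?w * ?u" by (simp_all add: pp_def mult_ac)
  \<comment> \<open>From \<open>b + c = - 2 * d - (a + b) - (a + c)\<close> and its two
    permutations: the largest pair sum is controlled by the output frequency and the other
    two.\<close>
  have R: "?w \<le> 2 * jb d + ?u + ?v" "?v \<le> 2 * jb d + ?u + ?w" "?u \<le> 2 * jb d + ?v + ?w"
    unfolding d jb_def of_int_add of_int_minus of_int_diff by (simp_all add: max_def abs_if)
  consider "?u \<le> ?w" "?v \<le> ?w" | "?u \<le> ?v" "?w \<le> ?v" | "?v \<le> ?u" "?w \<le> ?u" by linarith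
  then show ?thesis
  proof cases
    case 1
    show ?thesis by (rule order_trans[OF le1 order_trans[OF main[OF P1(1) 1 order_refl R(1) uvw(1,2)] mono]]) simp
  next
    case 2
    show ?thesis by (rule order_trans[OF le1 order_trans[OF main[OF P1(2) 2(1) order_refl 2(2) R(2) uvw(1,3)] mono]]) simp
  next
    case 3
    show ?thesis by (rule order_trans[OF le1 order_trans[OF main[OF P1(3) order_refl 3 R(3) uvw(2,3)] mono]]) simp
  qed
qed

text \<open>With the last frequency frozen two free variables remain, and both any two of the
  frequencies \<open>a\<close>, \<open>b\<close>, \<open>c\<close> and any two of the pair sums
  parametrise them, which is what \<open>pair_sum_le\<close> asks for.\<close>

lemma quad_fixed_sum_le:
  assumes F: "finite F" and nr: "\<And>q. q \<in> F \<Longrightarrow> nonres q" and fx: "\<And>a b c d. (a, b, c, d) \<in> F \<Longrightarrow> d = d0"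
    and l2: "l2b x X" "l2b y Y"
  defines "R \<equiv> \<lambda>a b c. (\<bar>real_of_int (a + b)\<bar> * \<bar>real_of_int (a + c)\<bar>) powr - (7/8) +
     (\<bar>real_of_int (a + b)\<bar> * \<bar>real_of_int (b + c)\<bar>) powr - (7/8) +
     (\<bar>real_of_int (a + c)\<bar> * \<bar>real_of_int (b + c)\<bar>) powr - (7/8)"
  shows "(\<Sum>(a, b, c, d)\<in>F. R a b c * (cmod (x b) * cmod (y c))) \<le> 3 * (zc (7/4) * (X * Y))"
    "(\<Sum>(a, b, c, d)\<in>F. R a b c * (cmod (x a) * cmod (y c))) \<le> 3 * (zc (7/4) * (X * Y))"
    "(\<Sum>(a, b, c, d)\<in>F. R a b c * (cmod (x a) * cmod (y b))) \<le> 3 * (zc (7/4) * (X * Y))"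
proof -
  define f1 f2 f3 :: "int \<times> int \<times> int \<times> int \<Rightarrow> int"
    where f: "f1 = (\<lambda>(a, b, c, d). a)" "f2 = (\<lambda>(a, b, c, d). b)" "f3 = (\<lambda>(a, b, c, d). c)"
  define g1 g2 g3 where g: "g1 = (\<lambda>q. f1 q + f2 q)" "g2 = (\<lambda>q. f1 q + f3 q)" "g3 = (\<lambda>q. f2 q + f3 q)"
  have s: "f1 q + f2 q + f3 q = - d0" if "q \<in> F" for q
    using nr[OF that] fx that by (cases q) (auto simp: f nonres_def)
  have nz: "g1 q \<noteq> 0" "g2 q \<noteq> 0" "g3 q \<noteq> 0" if "q \<in> F" for q
    using nr[OF that] by (auto simp: f g nonres_def split: prod.splits)
  have eq: "q = q'" if "q \<in> F" "q' \<in> F" "f1 q = f1 q'" "f2 q = f2 q'" "f3 q = f3 q'" for q q'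
    using that by (cases q; cases q') (auto simp: f dest!: fx)
  have i: "inj_on (\<lambda>q. (f2 q, f3 q)) F" "inj_on (\<lambda>q. (f1 q, f3 q)) F" "inj_on (\<lambda>q. (f1 q, f2 q)) F"
    "inj_on (\<lambda>q. (g1 q, g2 q)) F" "inj_on (\<lambda>q. (g1 q, g3 q)) F" "inj_on (\<lambda>q. (g2 q, g3 q)) F"
  proof -
    { fix q q' assume h: "q \<in> F" "q' \<in> F"
      have "f2 q = f2 q' \<Longrightarrow> f3 q = f3 q' \<Longrightarrow> q = q'" "f1 q = f1 q' \<Longrightarrow> f3 q = f3 q' \<Longrightarrow> q = q'"
        "f1 q = f1 q' \<Longrightarrow> f2 q = f2 q' \<Longrightarrow> q = q'" "g1 q = g1 q' \<Longrightarrow> g2 q = g2 q' \<Longrightarrow> q = q'"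
        "g1 q = g1 q' \<Longrightarrow> g3 q = g3 q' \<Longrightarrow> q = q'" "g2 q = g2 q' \<Longrightarrow> g3 q = g3 q' \<Longrightarrow> q = q'"
        using eq[OF h] s[OF h(1)] s[OF h(2)] by (auto simp: g) }
    note h = this
    show "inj_on (\<lambda>q. (f2 q, f3 q)) F" "inj_on (\<lambda>q. (f1 q, f3 q)) F" "inj_on (\<lambda>q. (f1 q, f2 q)) F"
    "inj_on (\<lambda>q. (g1 q, g2 q)) F" "inj_on (\<lambda>q. (g1 q, g3 q)) F" "inj_on (\<lambda>q. (g2 q, g3 q)) F"
      unfolding inj_on_def using h by blast+
  qed
  let ?k = "\<lambda>g g' f f' q. (\<bar>real_of_int (g q)\<bar> * \<bar>real_of_int (g' q)\<bar>) powr - (7/8) * (cmod (x (f q)) * cmod (y (f' q)))"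
  have *: "(\<Sum>q\<in>F. ?k g1 g2 f f' q + ?k g1 g3 f f' q + ?k g2 g3 f f' q) \<le> 3 * (zc (7/4) * (X * Y))"
    if "inj_on (\<lambda>q. (f q, f' q)) F" for f f'
    using pair_sum_le[OF F i(4) that nz(1,2) l2] pair_sum_le[OF F i(5) that nz(1,3) l2] pair_sum_le[OF F i(6) that nz(2,3) l2]
    by (simp add: sum.distrib)
  show "(\<Sum>(a, b, c, d)\<in>F. R a b c * (cmod (x b) * cmod (y c))) \<le> 3 * (zc (7/4) * (X * Y))"
    using *[OF i(1)] by (simp add: f g R_def split_def distrib_right)
  show "(\<Sum>(a, b, c, d)\<in>F. R a b c * (cmod (x a) * cmod (y c))) \<le> 3 * (zc (7/4) * (X * Y))"
    using *[OF i(2)] by (simp add: f g R_def split_def distrib_right)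
  show "(\<Sum>(a, b, c, d)\<in>F. R a b c * (cmod (x a) * cmod (y b))) \<le> 3 * (zc (7/4) * (X * Y))"
    using *[OF i(3)] by (simp add: f g R_def split_def distrib_right)
qed

text \<open>Of the three undifferentiated slots two are summed and the third is bounded uniformly by
  its \<open>l2b\<close> constant. There is no small factor here: the estimate accommodates an extra
  power of the output frequency instead.\<close>

lemma adm_fixed:
  assumes F: "finite F" and nr: "\<And>q. q \<in> F \<Longrightarrow> nonres q" and fx: "\<And>a b c d. (a, b, c, d) \<in> F \<Longrightarrow> d = d0"
    and L: "1 \<le> L"
    and w: "\<And>a b c d. (a, b, c, d) \<in> F \<Longrightarrow> 0 \<le> \<omega> (a, b, c, d)"
      "\<And>a b c d. (a, b, c, d) \<in> F \<Longrightarrow> \<omega> (a, b, c, d) \<le> (real_of_int d)\<^sup>2 / (pp a b c * sq4 a b c d)"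
  shows "adm F \<omega> (24 * zc (7/4)) (24 * zc (7/4) * (jb d0 / L) powr (1/8)) L"
  unfolding adm_def
proof (intro allI conjI impI; elim conjE)
  fix x y z w :: "int \<Rightarrow> complex" and X Y Z W h m :: real
  let ?D = "8 * (h + (jb d0 / L) powr (1/8) * m)"
  let ?R = "\<lambda>a b c. (\<bar>real_of_int (a + b)\<bar> * \<bar>real_of_int (a + c)\<bar>) powr - (7/8) +
     (\<bar>real_of_int (a + b)\<bar> * \<bar>real_of_int (b + c)\<bar>) powr - (7/8) +
     (\<bar>real_of_int (a + c)\<bar> * \<bar>real_of_int (b + c)\<bar>) powr - (7/8)"
  have pw: "\<omega> (a, b, c, d) * (cmod (v j) * (p * q * r)) \<le> (?D * T) * (?R a b c * (p * q))"
    if "(a, b, c, d) \<in> F" "sb v h m L" "j \<in> {a, b, c, d}" "0 \<le> p" "0 \<le> q" "0 \<le> r" "r \<le> T" for a b c d v j p q r T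
  proof -
    have "d = d0" by (rule fx[OF that(1)])
    have "0 \<le> ?D * ?R a b c" using that(2) by (intro mult_nonneg_nonneg add_nonneg_nonneg) (auto simp: sb_def)
    moreover have "p * q * r \<le> p * q * T" "0 \<le> p * q * r" using that by (auto intro!: mult_left_mono)
    ultimately have "\<omega> (a, b, c, d) * cmod (v j) * (p * q * r) \<le> ?D * ?R a b c * (p * q * T)"
      using mult_mono[OF weight_fixed_pointwise[OF nr[OF that(1)] L w(1)[OF that(1)] w(2)[OF that(1)] that(2,3)], of "p * q * r" "p * q * T"]
      unfolding \<open>d = d0\<close> by blast
    then show ?thesis by (simp add: mult_ac)
  qed
  have e: "(24 * zc (7/4) * h + 24 * zc (7/4) * (jb d0 / L) powr (1/8) * m) * (p * q * r) =
    (?D * r) * (3 * (zc (7/4) * (p * q)))" for p q r by (simp add: algebra_simps)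
  have D: "0 \<le> ?D * r" if "sb v h m L" "l2b u r" for v u r using that by (auto simp: sb_def l2b_def)
  { assume s: "sb x h m L" and l: "l2b y Y" "l2b z Z" "l2b w W"
    show "wsum F \<omega> x y z w \<le> (24 * zc (7/4) * h + 24 * zc (7/4) * (jb d0 / L) powr (1/8) * m) * (Y * Z * W)"
      unfolding wsum_def e
    proof (rule sum_quad_mono[OF _ quad_fixed_sum_le(1)[OF F nr fx l(1,2)] D[OF s l(3)]])
      fix a b c d assume q: "(a, b, c, d) \<in> F"
      show "\<omega> (a, b, c, d) * (cmod (x a) * cmod (y b) * cmod (z c) * cmod (w d)) \<le>
         ?D * W * (?R a b c * (cmod (y b) * cmod (z c)))"
        using pw[OF q s, of a "cmod (y b)" "cmod (z c)" "cmod (w d)" W] l2b_le[OF l(3)] by (simp add: mult_ac)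
    qed }
  { assume s: "sb y h m L" and l: "l2b x X" "l2b z Z" "l2b w W"
    show "wsum F \<omega> x y z w \<le> (24 * zc (7/4) * h + 24 * zc (7/4) * (jb d0 / L) powr (1/8) * m) * (X * Z * W)"
      unfolding wsum_def e
    proof (rule sum_quad_mono[OF _ quad_fixed_sum_le(2)[OF F nr fx l(1,2)] D[OF s l(3)]])
      fix a b c d assume q: "(a, b, c, d) \<in> F"
      show "\<omega> (a, b, c, d) * (cmod (x a) * cmod (y b) * cmod (z c) * cmod (w d)) \<le>
         ?D * W * (?R a b c * (cmod (x a) * cmod (z c)))"
        using pw[OF q s, of b "cmod (x a)" "cmod (z c)" "cmod (w d)" W] l2b_le[OF l(3)] by (simp add: mult_ac)
    qed }
  { assume s: "sb z h m L" and l: "l2b x X" "l2b y Y" "l2b w W"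
    show "wsum F \<omega> x y z w \<le> (24 * zc (7/4) * h + 24 * zc (7/4) * (jb d0 / L) powr (1/8) * m) * (X * Y * W)"
      unfolding wsum_def e
    proof (rule sum_quad_mono[OF _ quad_fixed_sum_le(3)[OF F nr fx l(1,2)] D[OF s l(3)]])
      fix a b c d assume q: "(a, b, c, d) \<in> F"
      show "\<omega> (a, b, c, d) * (cmod (x a) * cmod (y b) * cmod (z c) * cmod (w d)) \<le>
         ?D * W * (?R a b c * (cmod (x a) * cmod (y b)))"
        using pw[OF q s, of c "cmod (x a)" "cmod (y b)" "cmod (w d)" W] l2b_le[OF l(3)] by (simp add: mult_ac)
    qed }
  { assume s: "sb w h m L" and l: "l2b x X" "l2b y Y" "l2b z Z"
    show "wsum F \<omega> x y z w \<le> (24 * zc (7/4) * h + 24 * zc (7/4) * (jb d0 / L) powr (1/8) * m) * (X * Y * Z)"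
      unfolding wsum_def e
    proof (rule sum_quad_mono[OF _ quad_fixed_sum_le(3)[OF F nr fx l(1,2)] D[OF s l(3)]])
      fix a b c d assume q: "(a, b, c, d) \<in> F"
      show "\<omega> (a, b, c, d) * (cmod (x a) * cmod (y b) * cmod (z c) * cmod (w d)) \<le>
         ?D * Z * (?R a b c * (cmod (x a) * cmod (y b)))"
        using pw[OF q s, of d "cmod (x a)" "cmod (y b)" "cmod (z c)" Z] l2b_le[OF l(3)] by (simp add: mult_ac)
    qed }
qed

section \<open>Normal form for quartic expressions\<close>

text \<open>Integration by parts in time: integrating the oscillating factor gains
  \<open>1 / \<bar>f\<bar>\<close> at the price of two endpoint terms and a derivative of the
  amplitude.\<close>

lemma integral_cis_le:
  fixes p p' :: "real \<Rightarrow> complex"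
  assumes t: "0 \<le> t" and f: "f \<noteq> 0"
    and p: "\<And>s. s \<in> {0..t} \<Longrightarrow> (p has_vector_derivative p' s) (at s within {0..t})"
    and c: "continuous_on {0..t} p'"
  shows "cmod (integral {0..t} (\<lambda>s. cis (s * f) * p s)) \<le>
    (cmod (p t) + cmod (p 0)) / \<bar>f\<bar> + integral {0..t} (\<lambda>s. cmod (p' s) / \<bar>f\<bar>)"
proof -
  have cp: "continuous_on {0..t} p"
    unfolding continuous_on_eq_continuous_within using p has_vector_derivative_continuous by blast
  have cc: "continuous_on {0..t} (\<lambda>s. cis (s * f))"
    unfolding cis_conv_exp by (intro continuous_intros)
  let ?H = "\<lambda>s. cis (s * f) * p s / (\<i> * f)" and ?g = "\<lambda>s. cis (s * f) * p' s / (\<i> * f)"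
  have "((\<lambda>s. cis (s * f) * p s + ?g s) has_integral (?H t - ?H 0)) {0..t}"
  proof (rule fundamental_theorem_of_calculus[OF t])
    fix s assume s: "s \<in> {0..t}"
    have "((\<lambda>s. cis (s * f)) has_vector_derivative (f *\<^sub>R (\<i> * cis (s * f)))) (at s within {0..t})"
      unfolding has_vector_derivative_def
      by (rule has_derivative_eq_rhs, (rule derivative_eq_intros refl)+) (auto simp: mult_ac scaleR_conv_of_real)
    from has_vector_derivative_mult[OF this p[OF s]]
    have "((\<lambda>s. cis (s * f) * p s * (1 / (\<i> * f))) has_vector_derivative
      ((cis (s * f) * p' s + f *\<^sub>R (\<i> * cis (s * f)) * p s) * (1 / (\<i> * f)))) (at s within {0..t})"
      by (rule has_vector_derivative_mult_left)
    then show "(?H has_vector_derivative (cis (s * f) * p s + ?g s)) (at s within {0..t})"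
      using f by (simp add: field_simps scaleR_conv_of_real)
  qed
  moreover have g: "?g integrable_on {0..t}" "(\<lambda>s. cmod (?g s)) integrable_on {0..t}"
    using f by (intro integrable_continuous_real continuous_intros cc c; simp)+
  moreover have "(\<lambda>s. cis (s * f) * p s) integrable_on {0..t}"
    by (intro integrable_continuous_real continuous_intros cc cp)
  ultimately have "integral {0..t} (\<lambda>s. cis (s * f) * p s) + integral {0..t} ?g = ?H t - ?H 0"
    using has_integral_unique has_integral_add[OF integrable_integral integrable_integral] by blast
  then have "integral {0..t} (\<lambda>s. cis (s * f) * p s) = ?H t - ?H 0 - integral {0..t} ?g"
    by (simp add: algebra_simps)
  also have "cmod \<dots> \<le> cmod (?H t) + cmod (?H 0) + cmod (integral {0..t} ?g)"
    by (meson add_mono norm_triangle_ineq4 order_refl order_trans)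
  also have "cmod (integral {0..t} ?g) \<le> integral {0..t} (\<lambda>s. cmod (?g s))"
    using g by (intro integral_norm_bound_integral) auto
  also have "(\<lambda>s. cmod (?g s)) = (\<lambda>s. cmod (p' s) / \<bar>f\<bar>)"
    by (simp add: norm_mult norm_divide)
  also have "cmod (?H t) + cmod (?H 0) = (cmod (p t) + cmod (p 0)) / \<bar>f\<bar>"
    by (simp add: norm_mult norm_divide add_divide_distrib)
  finally show ?thesis by simp
qed

definition qform :: "(int \<times> int \<times> int \<times> int) set \<Rightarrow> (int \<times> int \<times> int \<times> int \<Rightarrow> complex) \<Rightarrow>
    (int \<times> int \<times> int \<times> int \<Rightarrow> real) \<Rightarrow> (real \<Rightarrow> int \<Rightarrow> complex) \<Rightarrow> (real \<Rightarrow> int \<Rightarrow> complex) \<Rightarrow>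
    (real \<Rightarrow> int \<Rightarrow> complex) \<Rightarrow> (real \<Rightarrow> int \<Rightarrow> complex) \<Rightarrow> real \<Rightarrow> complex" where
  "qform F \<kappa> \<Phi> x y z w s = (\<Sum>(a, b, c, d)\<in>F. \<kappa> (a, b, c, d) *
     (cis (s * \<Phi> (a, b, c, d)) * (x s a * y s b * z s c * w s d)))"

text \<open>The four slots are independent curves \<open>x1\<close> to \<open>x4\<close> with
  derivatives \<open>y1\<close> to \<open>y4\<close>, because differences of quartic forms expand
  into forms that mix two solutions with their difference.\<close>

locale quartic_form =
  fixes F :: "(int \<times> int \<times> int \<times> int) set" and \<kappa> :: "int \<times> int \<times> int \<times> int \<Rightarrow> complex"
    and \<Phi> :: "int \<times> int \<times> int \<times> int \<Rightarrow> real"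
    and T :: real and x1 x2 x3 x4 y1 y2 y3 y4 :: "real \<Rightarrow> int \<Rightarrow> complex"
  assumes F: "finite F" and nz: "\<And>q. q \<in> F \<Longrightarrow> \<Phi> q \<noteq> 0"
    and d1: "\<And>n s. s \<in> {0..T} \<Longrightarrow> ((\<lambda>s. x1 s n) has_vector_derivative y1 s n) (at s within {0..T})"
    and d2: "\<And>n s. s \<in> {0..T} \<Longrightarrow> ((\<lambda>s. x2 s n) has_vector_derivative y2 s n) (at s within {0..T})"
    and d3: "\<And>n s. s \<in> {0..T} \<Longrightarrow> ((\<lambda>s. x3 s n) has_vector_derivative y3 s n) (at s within {0..T})"
    and d4: "\<And>n s. s \<in> {0..T} \<Longrightarrow> ((\<lambda>s. x4 s n) has_vector_derivative y4 s n) (at s within {0..T})"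
    and c1: "\<And>n. continuous_on {0..T} (\<lambda>s. y1 s n)" and c2: "\<And>n. continuous_on {0..T} (\<lambda>s. y2 s n)"
    and c3: "\<And>n. continuous_on {0..T} (\<lambda>s. y3 s n)" and c4: "\<And>n. continuous_on {0..T} (\<lambda>s. y4 s n)"
begin

abbreviation form :: "real \<Rightarrow> complex" where "form \<equiv> qform F \<kappa> \<Phi> x1 x2 x3 x4"

definition \<omega> :: "int \<times> int \<times> int \<times> int \<Rightarrow> real" where
  "\<omega> q = cmod (\<kappa> q) / \<bar>\<Phi> q\<bar>"

lemma cx: "continuous_on {0..T} (\<lambda>s. x1 s n)" "continuous_on {0..T} (\<lambda>s. x2 s n)"
    "continuous_on {0..T} (\<lambda>s. x3 s n)" "continuous_on {0..T} (\<lambda>s. x4 s n)"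
  unfolding continuous_on_eq_continuous_within
  using d1 d2 d3 d4 has_vector_derivative_continuous by blast+

lemma continuous_wsum:
  assumes "\<And>n. continuous_on S (\<lambda>s. u1 s n)" "\<And>n. continuous_on S (\<lambda>s. u2 s n)"
    "\<And>n. continuous_on S (\<lambda>s. u3 s n)" "\<And>n. continuous_on S (\<lambda>s. u4 s n)"
  shows "continuous_on S (\<lambda>s. wsum F \<omega> (u1 s) (u2 s) (u3 s) (u4 s))"
  unfolding wsum_def split_def by (intro continuous_intros assms)

text \<open>Every quadruple is integrated by parts separately. After that all terms are taken in
  absolute value: the gain is already contained in the weight \<open>\<omega>\<close>.\<close>

lemma form_integral_le:
  assumes t: "t \<in> {0..T}"
  shows "cmod (integral {0..t} form) \<le>
    wsum F \<omega> (x1 t) (x2 t) (x3 t) (x4 t) + wsum F \<omega> (x1 0) (x2 0) (x3 0) (x4 0) +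
    integral {0..t} (\<lambda>s. wsum F \<omega> (y1 s) (x2 s) (x3 s) (x4 s) + wsum F \<omega> (x1 s) (y2 s) (x3 s) (x4 s) +
      wsum F \<omega> (x1 s) (x2 s) (y3 s) (x4 s) + wsum F \<omega> (x1 s) (x2 s) (x3 s) (y4 s))"
proof -
  have sub: "{0..t} \<subseteq> {0..T}" and t0: "0 \<le> t" using t by auto
  note cxt = cx[THEN continuous_on_subset, OF sub] and cyt = c1[THEN continuous_on_subset, OF sub]
    c2[THEN continuous_on_subset, OF sub] c3[THEN continuous_on_subset, OF sub] c4[THEN continuous_on_subset, OF sub]
  have cc: "continuous_on {0..t} (\<lambda>s. cis (s * f))" for f
    unfolding cis_conv_exp by (intro continuous_intros)
  let ?p = "\<lambda>(a, b, c, d) s. x1 s a * x2 s b * x3 s c * x4 s d"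
  let ?p' = "\<lambda>(a, b, c, d) s. y1 s a * x2 s b * x3 s c * x4 s d + x1 s a * y2 s b * x3 s c * x4 s d
     + x1 s a * x2 s b * y3 s c * x4 s d + x1 s a * x2 s b * x3 s c * y4 s d"
  let ?w = "\<lambda>(a, b, c, d) s. cmod (y1 s a) * cmod (x2 s b) * cmod (x3 s c) * cmod (x4 s d) + cmod (x1 s a) * cmod (y2 s b) * cmod (x3 s c) * cmod (x4 s d)
     + cmod (x1 s a) * cmod (x2 s b) * cmod (y3 s c) * cmod (x4 s d) + cmod (x1 s a) * cmod (x2 s b) * cmod (x3 s c) * cmod (y4 s d)"
  have cp: "continuous_on {0..t} (?p q)" "continuous_on {0..t} (?p' q)" "continuous_on {0..t} (?w q)" for q
    by (cases q; simp; intro continuous_intros cxt cyt)+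
  have dp: "(?p q has_vector_derivative ?p' q s) (at s within {0..t})" if "s \<in> {0..t}" for q s
  proof (cases q)
    case (fields a b c d)
    have s: "s \<in> {0..T}" using that sub by auto
    note dd = d1[OF s, THEN has_vector_derivative_within_subset, OF sub]
      d2[OF s, THEN has_vector_derivative_within_subset, OF sub]
      d3[OF s, THEN has_vector_derivative_within_subset, OF sub]
      d4[OF s, THEN has_vector_derivative_within_subset, OF sub]
    show ?thesis
      using has_vector_derivative_mult[OF has_vector_derivative_mult[OF has_vector_derivative_mult[OF dd(1)[of a] dd(2)[of b]] dd(3)[of c]] dd(4)[of d]]
      unfolding fields by (simp add: algebra_simps)
  qed
  have one: "cmod (integral {0..t} (\<lambda>s. \<kappa> q * (cis (s * \<Phi> q) * ?p q s))) \<le>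
     \<omega> q * cmod (?p q t) + \<omega> q * cmod (?p q 0) + integral {0..t} (\<lambda>s. \<omega> q * ?w q s)" if q: "q \<in> F" for q
  proof -
    have "cmod (integral {0..t} (\<lambda>s. \<kappa> q * (cis (s * \<Phi> q) * ?p q s))) =
      cmod (\<kappa> q) * cmod (integral {0..t} (\<lambda>s. cis (s * \<Phi> q) * ?p q s))" by (simp add: norm_mult)
    also have "\<dots> \<le> cmod (\<kappa> q) * ((cmod (?p q t) + cmod (?p q 0)) / \<bar>\<Phi> q\<bar> + integral {0..t} (\<lambda>s. cmod (?p' q s) / \<bar>\<Phi> q\<bar>))"
      by (intro mult_left_mono integral_cis_le[OF t0 nz[OF q] dp cp(2)]) auto
    also have "\<dots> = \<omega> q * cmod (?p q t) + \<omega> q * cmod (?p q 0) + integral {0..t} (\<lambda>s. \<omega> q * cmod (?p' q s))"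
      unfolding \<omega>_def by (simp add: distrib_left add_divide_distrib)
    also have "integral {0..t} (\<lambda>s. \<omega> q * cmod (?p' q s)) \<le> integral {0..t} (\<lambda>s. \<omega> q * ?w q s)"
    proof (rule integral_le)
      show "(\<lambda>s. \<omega> q * cmod (?p' q s)) integrable_on {0..t}" "(\<lambda>s. \<omega> q * ?w q s) integrable_on {0..t}"
        by (intro integrable_continuous_real continuous_intros cp)+
      fix s
      have "cmod (?p' q s) \<le> ?w q s"
        by (cases q) (auto simp: norm_mult[symmetric] intro!: norm_triangle_le add_mono)
      then show "\<omega> q * cmod (?p' q s) \<le> \<omega> q * ?w q s" unfolding \<omega>_def by (intro mult_left_mono) auto
    qed
    finally show ?thesis by simp
  qed
  have A: "integral {0..t} form = (\<Sum>q\<in>F. integral {0..t} (\<lambda>s. \<kappa> q * (cis (s * \<Phi> q) * ?p q s)))"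
    unfolding qform_def split_def prod.collapse
    by (rule integral_sum[OF F]) (intro integrable_continuous_real continuous_intros cc cxt)
  have B: "cmod (integral {0..t} form) \<le> (\<Sum>q\<in>F. \<omega> q * cmod (?p q t) + \<omega> q * cmod (?p q 0) + integral {0..t} (\<lambda>s. \<omega> q * ?w q s))"
    unfolding A by (rule order_trans[OF norm_sum sum_mono[OF one]])
  have C: "(\<Sum>q\<in>F. \<omega> q * cmod (?p q t) + \<omega> q * cmod (?p q 0) + integral {0..t} (\<lambda>s. \<omega> q * ?w q s)) = (\<Sum>q\<in>F. \<omega> q * cmod (?p q t)) + (\<Sum>q\<in>F. \<omega> q * cmod (?p q 0)) + integral {0..t} (\<lambda>s. \<Sum>q\<in>F. \<omega> q * ?w q s)"
    unfolding sum.distrib by (subst integral_sum[OF F]) (intro integrable_continuous_real continuous_intros cp, simp)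
  have D: "(\<Sum>q\<in>F. \<omega> q * cmod (?p q s)) = wsum F \<omega> (x1 s) (x2 s) (x3 s) (x4 s)" for s
    unfolding wsum_def by (rule sum.cong) (auto simp: norm_mult)
  have E: "(\<Sum>q\<in>F. \<omega> q * ?w q s) = wsum F \<omega> (y1 s) (x2 s) (x3 s) (x4 s) + wsum F \<omega> (x1 s) (y2 s) (x3 s) (x4 s) +
      wsum F \<omega> (x1 s) (x2 s) (y3 s) (x4 s) + wsum F \<omega> (x1 s) (x2 s) (x3 s) (y4 s)" for s
    unfolding wsum_def sum.distrib[symmetric] by (rule sum.cong) (auto simp: distrib_left)
  show ?thesis using B unfolding C D E .
qed

text \<open>Each of the four integrands differentiates exactly one slot and is estimated by the
  corresponding clause of \<open>adm\<close>.\<close>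

lemma form_integral_adm:
  assumes t: "t \<in> {0..T}" and a: "adm F \<omega> A B L" and AB: "0 \<le> A" "0 \<le> B" and L: "1 \<le> L"
    and X: "\<And>s. s \<in> {0..T} \<Longrightarrow> l2b (x1 s) (X1 s)" "\<And>s. s \<in> {0..T} \<Longrightarrow> l2b (x2 s) (X2 s)"
      "\<And>s. s \<in> {0..T} \<Longrightarrow> l2b (x3 s) (X3 s)" "\<And>s. s \<in> {0..T} \<Longrightarrow> l2b (x4 s) (X4 s)"
    and Y: "\<And>s. s \<in> {0..T} \<Longrightarrow> sb (y1 s) (h1 s) (m1 s) L" "\<And>s. s \<in> {0..T} \<Longrightarrow> sb (y2 s) (h2 s) (m2 s) L"
      "\<And>s. s \<in> {0..T} \<Longrightarrow> sb (y3 s) (h3 s) (m3 s) L" "\<And>s. s \<in> {0..T} \<Longrightarrow> sb (y4 s) (h4 s) (m4 s) L"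
    and cX: "continuous_on {0..T} X1" "continuous_on {0..T} X2" "continuous_on {0..T} X3" "continuous_on {0..T} X4"
    and ch: "continuous_on {0..T} h1" "continuous_on {0..T} h2" "continuous_on {0..T} h3" "continuous_on {0..T} h4"
    and cm: "continuous_on {0..T} m1" "continuous_on {0..T} m2" "continuous_on {0..T} m3" "continuous_on {0..T} m4"
  shows "cmod (integral {0..t} form) \<le>
    A * (X1 t * X2 t * X3 t * X4 t) + A * (X1 0 * X2 0 * X3 0 * X4 0) +
    integral {0..t} (\<lambda>s. (A * h1 s + B * m1 s) * (X2 s * X3 s * X4 s) + (A * h2 s + B * m2 s) * (X1 s * X3 s * X4 s) +
      (A * h3 s + B * m3 s) * (X1 s * X2 s * X4 s) + (A * h4 s + B * m4 s) * (X1 s * X2 s * X3 s))"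
proof -
  have sub: "{0..t} \<subseteq> {0..T}" and T: "0 \<in> {0..T}" using t by auto
  have bd: "wsum F \<omega> (x1 s) (x2 s) (x3 s) (x4 s) \<le> A * (X1 s * X2 s * X3 s * X4 s)" if s: "s \<in> {0..T}" for s
  proof -
    \<comment> \<open>The endpoint terms contain no derivative. Since \<open>jb n\<close> is at
      least one, an l2 bound is in particular a derivative size with \<open>m = 0\<close>, so
      \<open>adm\<close> covers them as well.\<close>
    have "sb (x1 s) (X1 s) 0 L" unfolding sb_def
    proof (intro conjI allI)
      show "0 \<le> X1 s" using X(1)[OF s] l2b_nonneg by blast
      fix n
      have "cmod (x1 s n) \<le> X1 s" using X(1)[OF s] l2b_le by blast
      also have "\<dots> \<le> jb n * X1 s" using \<open>0 \<le> X1 s\<close> by (simp add: jb_def mult_le_cancel_right1)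
      finally show "cmod (x1 s n) \<le> jb n * (X1 s + 0 * (jb n / L) powr (1/8))" by simp
    qed auto
    then have "wsum F \<omega> (x1 s) (x2 s) (x3 s) (x4 s) \<le> (A * X1 s + B * 0) * (X2 s * X3 s * X4 s)"
      using a X(2,3,4)[OF s] unfolding adm_def by blast
    then show ?thesis by (simp add: mult_ac)
  qed
  have "integral {0..t} (\<lambda>s. wsum F \<omega> (y1 s) (x2 s) (x3 s) (x4 s) + wsum F \<omega> (x1 s) (y2 s) (x3 s) (x4 s) +
      wsum F \<omega> (x1 s) (x2 s) (y3 s) (x4 s) + wsum F \<omega> (x1 s) (x2 s) (x3 s) (y4 s)) \<le>
    integral {0..t} (\<lambda>s. (A * h1 s + B * m1 s) * (X2 s * X3 s * X4 s) + (A * h2 s + B * m2 s) * (X1 s * X3 s * X4 s) +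
      (A * h3 s + B * m3 s) * (X1 s * X2 s * X4 s) + (A * h4 s + B * m4 s) * (X1 s * X2 s * X3 s))"
  proof (rule integral_le)
    show "(\<lambda>s. wsum F \<omega> (y1 s) (x2 s) (x3 s) (x4 s) + wsum F \<omega> (x1 s) (y2 s) (x3 s) (x4 s) +
      wsum F \<omega> (x1 s) (x2 s) (y3 s) (x4 s) + wsum F \<omega> (x1 s) (x2 s) (x3 s) (y4 s)) integrable_on {0..t}"
      by (intro integrable_continuous_real continuous_on_subset[OF _ sub] continuous_intros continuous_wsum cx c1 c2 c3 c4)
    show "(\<lambda>s. (A * h1 s + B * m1 s) * (X2 s * X3 s * X4 s) + (A * h2 s + B * m2 s) * (X1 s * X3 s * X4 s) +
      (A * h3 s + B * m3 s) * (X1 s * X2 s * X4 s) + (A * h4 s + B * m4 s) * (X1 s * X2 s * X3 s)) integrable_on {0..t}"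
      by (intro integrable_continuous_real continuous_on_subset[OF _ sub] continuous_intros cX ch cm)
    fix s assume "s \<in> {0..t}"
    then have s: "s \<in> {0..T}" using sub by auto
    show "wsum F \<omega> (y1 s) (x2 s) (x3 s) (x4 s) + wsum F \<omega> (x1 s) (y2 s) (x3 s) (x4 s) +
      wsum F \<omega> (x1 s) (x2 s) (y3 s) (x4 s) + wsum F \<omega> (x1 s) (x2 s) (x3 s) (y4 s) \<le>
      (A * h1 s + B * m1 s) * (X2 s * X3 s * X4 s) + (A * h2 s + B * m2 s) * (X1 s * X3 s * X4 s) +
      (A * h3 s + B * m3 s) * (X1 s * X2 s * X4 s) + (A * h4 s + B * m4 s) * (X1 s * X2 s * X3 s)"
      using a X[OF s] Y[OF s] unfolding adm_def by (intro add_mono) blast+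
  qed
  then show ?thesis using form_integral_le[OF t] bd[OF t] bd[OF T] by linarith
qed

end

text \<open>Only the integral of \<open>k\<close> enters the bound. The coefficient used later has a
  time integral that is bounded uniformly in the truncation, whereas its size is not.\<close>

lemma gronwall:
  fixes e k :: "real \<Rightarrow> real"
  assumes e: "continuous_on {0..T} e" and k: "continuous_on {0..T} k" "\<And>s. s \<in> {0..T} \<Longrightarrow> 0 \<le> k s"
    and le: "\<And>t. t \<in> {0..T} \<Longrightarrow> e t \<le> a + integral {0..t} (\<lambda>s. k s * e s)"
    and t: "t \<in> {0..T}"
  shows "e t \<le> a * exp (integral {0..t} k)"
proof -
  define U where "U = (\<lambda>t. a + integral {0..t} (\<lambda>s. k s * e s))"
  define V where "V = (\<lambda>t. U t * exp (- integral {0..t} k))"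
  have d: "(U has_real_derivative k s * e s) (at s within {0..T})"
    "((\<lambda>t. integral {0..t} k) has_real_derivative k s) (at s within {0..T})" if "s \<in> {0..T}" for s
  proof -
    have "((\<lambda>t. integral {0..t} (\<lambda>s. k s * e s)) has_real_derivative k s * e s) (at s within {0..T})"
      by (rule integral_has_real_derivative[OF _ that]) (intro continuous_intros e k)
    from DERIV_add[OF DERIV_const this]
    show "(U has_real_derivative k s * e s) (at s within {0..T})" unfolding U_def by simp
    show "((\<lambda>t. integral {0..t} k) has_real_derivative k s) (at s within {0..T})"
      by (rule integral_has_real_derivative[OF k(1) that])
  qed
  have dV: "(V has_real_derivative (k s * e s - k s * U s) * exp (- integral {0..s} k)) (at s within {0..T})"
    if "s \<in> {0..T}" for s
    unfolding V_def by (rule derivative_eq_intros d[OF that] refl | simp add: algebra_simps)+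
  have "V t \<le> V 0"
  proof (rule DERIV_nonpos_imp_decreasing_open[where f = V and a = 0 and b = t])
    show "0 \<le> t" using t by simp
    have "continuous_on {0..T} V"
      unfolding continuous_on_eq_continuous_within using dV DERIV_continuous by blast
    then show "continuous_on {0..t} V" by (rule continuous_on_subset) (use t in auto)
    fix s assume s: "0 < s" "s < t"
    then have "(V has_real_derivative (k s * e s - k s * U s) * exp (- integral {0..s} k)) (at s)"
      using dV[of s] t by (simp add: at_within_Icc_at)
    moreover have "(k s * e s - k s * U s) * exp (- integral {0..s} k) \<le> 0"
      using le[of s] k(2)[of s] s t unfolding U_def
      by (intro mult_nonpos_nonneg) (auto intro!: mult_left_mono)
    ultimately show "\<exists>y. (V has_real_derivative y) (at s) \<and> y \<le> 0" by blast
  qed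
  then have "U t * exp (- integral {0..t} k) \<le> a" by (simp add: V_def U_def)
  then have "U t \<le> a * exp (integral {0..t} k)" by (simp add: exp_minus field_simps)
  then show ?thesis using le[OF t] by (simp add: U_def)
qed

section \<open>Cubic convolutions on a box of frequencies\<close>

definition modes :: "nat \<Rightarrow> int set" where "modes N = {- int N..int N}"

definition supp :: "(int \<Rightarrow> complex) \<Rightarrow> nat \<Rightarrow> bool" where
  "supp u N \<longleftrightarrow> (\<forall>n. n \<notin> modes N \<longrightarrow> u n = 0)"

definition herm :: "(int \<Rightarrow> complex) \<Rightarrow> bool" where
  "herm u \<longleftrightarrow> (\<forall>n. u (- n) = cnj (u n))"

definition n2 :: "nat \<Rightarrow> (int \<Rightarrow> complex) \<Rightarrow> real" where
  "n2 N u = (\<Sum>n\<in>modes N. (cmod (u n))\<^sup>2)"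

text \<open>The sum runs over the box only, so this is the convolution when \<open>v\<close> is supported in the box.\<close>

definition conv :: "nat \<Rightarrow> (int \<Rightarrow> complex) \<Rightarrow> (int \<Rightarrow> complex) \<Rightarrow> int \<Rightarrow> complex" where
  "conv N v w m = (\<Sum>b\<in>modes N. v b * w (m - b))"

definition tri :: "nat \<Rightarrow> (int \<Rightarrow> complex) \<Rightarrow> (int \<Rightarrow> complex) \<Rightarrow> (int \<Rightarrow> complex) \<Rightarrow> int \<Rightarrow> complex" where
  "tri N u v w n = (\<Sum>a\<in>modes N. \<Sum>b\<in>modes N. u a * v b * w (n - a - b))"

text \<open>For Hermitian \<open>u\<close> supported in the box this is the fourth power of the L4
  norm of the trigonometric polynomial, up to a factor \<open>2 * pi\<close>, by Parseval applied to
  its square (\<open>integral_tp_pow4\<close>).\<close>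

definition Q :: "nat \<Rightarrow> (int \<Rightarrow> complex) \<Rightarrow> real" where
  "Q N u = (\<Sum>m\<in>modes (2 * N). (cmod (conv N u u m))\<^sup>2)"

definition QD :: "nat \<Rightarrow> (int \<times> int \<times> int \<times> int) set" where
  "QD N = {(a, b, c, d). a \<in> modes N \<and> b \<in> modes N \<and> c \<in> modes N \<and> d \<in> modes N \<and> a + b + c + d = 0}"

definition NR :: "nat \<Rightarrow> (int \<times> int \<times> int \<times> int) set" where
  "NR N = {q \<in> QD N. nonres q}"

lemma finite_modes [simp]: "finite (modes N)" by (simp add: modes_def)
lemma QD_iff:
  "(a, b, c, d) \<in> QD N \<longleftrightarrow> a \<in> modes N \<and> b \<in> modes N \<and> d \<in> modes N \<and> - d - a - b \<in> modes N \<and> c = - d - a - b"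
proof -
  have "a + b + c + d = 0 \<longleftrightarrow> c = - d - a - b" by linarith
  then show ?thesis unfolding QD_def by auto
qed

lemma finite_QD [simp]: "finite (QD N)"
  by (rule finite_subset[of _ "modes N \<times> modes N \<times> modes N \<times> modes N"]) (auto simp: QD_def)
lemma finite_NR [simp]: "finite (NR N)" by (simp add: NR_def)
lemma modes_minus [simp]: "- n \<in> modes N \<longleftrightarrow> n \<in> modes N" by (auto simp: modes_def)
lemma modes_0 [simp]: "0 \<in> modes N" by (simp add: modes_def)
lemma modes_mono: "M \<le> N \<Longrightarrow> modes M \<subseteq> modes N" by (auto simp: modes_def)
lemma modes_add: "a \<in> modes M \<Longrightarrow> b \<in> modes N \<Longrightarrow> a + b \<in> modes (M + N)" by (auto simp: modes_def)
lemma suppD: "supp u N \<Longrightarrow> n \<notin> modes N \<Longrightarrow> u n = 0" by (simp add: supp_def)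
lemma supp_mono: "supp u M \<Longrightarrow> M \<le> N \<Longrightarrow> supp u N" using modes_mono by (auto simp: supp_def)
lemma hermD: "herm u \<Longrightarrow> u (- n) = cnj (u n)" by (simp add: herm_def)
lemma supp_diff: "supp u N \<Longrightarrow> supp v N \<Longrightarrow> supp (\<lambda>n. u n - v n) N" by (simp add: supp_def)
lemma herm_diff: "herm u \<Longrightarrow> herm v \<Longrightarrow> herm (\<lambda>n. u n - v n)" by (simp add: herm_def)
lemma n2_nonneg [simp]: "0 \<le> n2 N u" by (simp add: n2_def sum_nonneg)
lemma Q_nonneg [simp]: "0 \<le> Q N u" by (simp add: Q_def sum_nonneg)

lemma l2b_supp:
  assumes "supp u N"
  shows "l2b u (sqrt (n2 N u))"
  unfolding l2b_def
proof (intro conjI allI impI)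
  fix A :: "int set" assume "finite A"
  have "(\<Sum>n\<in>A. (cmod (u n))\<^sup>2) = (\<Sum>n\<in>A \<inter> modes N. (cmod (u n))\<^sup>2)"
    using assms \<open>finite A\<close> by (intro sum.mono_neutral_right) (auto simp: supp_def)
  also have "\<dots> \<le> n2 N u" unfolding n2_def by (intro sum_mono2) auto
  finally show "(\<Sum>n\<in>A. (cmod (u n))\<^sup>2) \<le> (sqrt (n2 N u))\<^sup>2" by simp
qed simp

lemma l2b_mono: "l2b u X \<Longrightarrow> X \<le> Y \<Longrightarrow> l2b u Y"
  unfolding l2b_def by (meson order_trans power_mono)

lemma n2_mono_modes: "supp u M \<Longrightarrow> M \<le> N \<Longrightarrow> n2 N u = n2 M u"
  unfolding n2_def by (intro sum.mono_neutral_right) (auto simp: supp_def dest: subsetD[OF modes_mono])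

lemma conv_mono_modes: "supp v M \<Longrightarrow> M \<le> N \<Longrightarrow> conv N v w = conv M v w"
  unfolding conv_def by (intro ext sum.mono_neutral_right) (auto simp: supp_def dest: subsetD[OF modes_mono])

lemma tri_conv: "tri N u v w n = (\<Sum>a\<in>modes N. u a * conv N v w (n - a))"
  by (simp add: tri_def conv_def sum_distrib_left mult.assoc)

lemma tri_mono_modes:
  assumes "supp u M" "supp v M" "M \<le> N"
  shows "tri N u v w = tri M u v w"
  unfolding tri_conv conv_mono_modes[OF assms(2,3)] using assms
  by (intro ext sum.mono_neutral_right) (auto simp: supp_def dest: subsetD[OF modes_mono])

lemma supp_conv:
  assumes "supp v M" "supp w N"
  shows "supp (conv M v w) (M + N)"
  unfolding supp_def
proof (intro allI impI)
  fix m assume m: "m \<notin> modes (M + N)"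
  have "m - b \<notin> modes N" if "b \<in> modes M" for b using modes_add[OF that, of "m - b"] m by auto
  then show "conv M v w m = 0" unfolding conv_def using assms(2) by (simp add: supp_def)
qed

lemma supp_conv2: "supp v N \<Longrightarrow> supp w N \<Longrightarrow> supp (conv N v w) (2 * N)"
  using supp_conv[of v N w N] by (simp add: mult_2)

lemma Q_mono_modes:
  assumes "supp u M" "M \<le> N"
  shows "Q N u = Q M u"
proof -
  have "n2 (2 * N) (conv M u u) = n2 (2 * M) (conv M u u)"
    using assms by (intro n2_mono_modes supp_conv2) auto
  then show ?thesis unfolding Q_def conv_mono_modes[OF assms] by (simp add: n2_def)
qed

lemma sum_shift:
  assumes "supp q N" "a \<in> modes M"
  shows "(\<Sum>m\<in>modes (M + N). q (m - a) * X m) = (\<Sum>b\<in>modes N. q b * X (a + b))"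
proof -
  have "(\<Sum>b\<in>modes N. q b * X (a + b)) = (\<Sum>m\<in>(+) a ` modes N. q (m - a) * X m)"
    by (subst sum.reindex) auto
  also have "\<dots> = (\<Sum>m\<in>modes (M + N). q (m - a) * X m)"
  proof (rule sum.mono_neutral_left)
    show "(+) a ` modes N \<subseteq> modes (M + N)" using assms(2) modes_add by auto
    show "\<forall>m\<in>modes (M + N) - (+) a ` modes N. q (m - a) * X m = 0"
    proof
      fix m assume "m \<in> modes (M + N) - (+) a ` modes N"
      then have "m - a \<notin> modes N" by (auto simp: image_iff)
      then show "q (m - a) * X m = 0" using assms(1) by (simp add: supp_def)
    qed
  qed simp
  finally show ?thesis ..
qed

lemma conv_commute:
  assumes "supp v N" "supp w N"
  shows "conv N v w = conv N w v"
proof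
  fix m
  have "conv N v w m = (\<Sum>b\<in>modes N \<inter> (\<lambda>c. m - c) ` modes N. v b * w (m - b))"
    unfolding conv_def
  proof (intro sum.mono_neutral_right ballI)
    fix b assume "b \<in> modes N - modes N \<inter> (\<lambda>c. m - c) ` modes N"
    then have "m - b \<notin> modes N" by (auto simp: image_iff)
    then show "v b * w (m - b) = 0" using assms(2) by (simp add: supp_def)
  qed auto
  also have "\<dots> = (\<Sum>c\<in>modes N \<inter> (\<lambda>c. m - c) ` modes N. w c * v (m - c))"
    by (rule sum.reindex_bij_witness[of _ "\<lambda>c. m - c" "\<lambda>c. m - c"]) (auto simp: image_iff)
  also have "\<dots> = conv N w v m"
    unfolding conv_def
  proof (intro sum.mono_neutral_left ballI)
    fix b assume "b \<in> modes N - modes N \<inter> (\<lambda>c. m - c) ` modes N"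
    then have "m - b \<notin> modes N" by (auto simp: image_iff)
    then show "w b * v (m - b) = 0" using assms(1) by (simp add: supp_def)
  qed auto
  finally show "conv N v w m = conv N w v m" .
qed

lemma conv_pair_sum:
  assumes "supp q N"
  shows "(\<Sum>m\<in>modes (2 * N). conv N p q m * conv N r s (- m)) =
    (\<Sum>a\<in>modes N. \<Sum>b\<in>modes N. \<Sum>c\<in>modes N. p a * q b * r c * s (- a - b - c))"
proof -
  have "(\<Sum>m\<in>modes (2 * N). conv N p q m * conv N r s (- m)) =
    (\<Sum>m\<in>modes (2 * N). \<Sum>a\<in>modes N. p a * (q (m - a) * conv N r s (- m)))"
    unfolding conv_def[of N p] by (simp add: sum_distrib_right mult.assoc)
  also have "\<dots> = (\<Sum>a\<in>modes N. p a * (\<Sum>m\<in>modes (2 * N). q (m - a) * conv N r s (- m)))"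
    by (subst sum.swap) (simp add: sum_distrib_left)
  also have "\<dots> = (\<Sum>a\<in>modes N. p a * (\<Sum>b\<in>modes N. q b * conv N r s (- (a + b))))"
    using sum_shift[OF assms, where M = N, folded mult_2] by simp
  also have "\<dots> = (\<Sum>a\<in>modes N. \<Sum>b\<in>modes N. \<Sum>c\<in>modes N. p a * q b * r c * s (- a - b - c))"
    unfolding conv_def by (simp add: sum_distrib_left mult.assoc)
  finally show ?thesis .
qed

lemma herm_conv:
  assumes "herm v" "herm w"
  shows "conv N v w (- m) = cnj (conv N v w m)"
proof -
  have "conv N v w (- m) = (\<Sum>b\<in>modes N. v (- b) * w (- (m - b)))"
    unfolding conv_def by (rule sum.reindex_bij_witness[of _ uminus uminus]) auto
  also have "\<dots> = cnj (conv N v w m)"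
    by (simp add: conv_def hermD[OF assms(1)] hermD[OF assms(2)] del: minus_diff_eq)
  finally show ?thesis .
qed

lemma cmod_sq_conv:
  assumes "herm v" "herm w"
  shows "complex_of_real ((cmod (conv N v w m))\<^sup>2) = conv N v w m * conv N v w (- m)"
  unfolding herm_conv[OF assms] complex_norm_square ..

text \<open>The lattice form of estimating the integral of \<open>(u w)^2 = u^2 w^2\<close> by
  Cauchy-Schwarz: exchanging the two middle summation variables turns the pairing of
  \<open>u w\<close> with itself into the pairing of \<open>u u\<close> with
  \<open>w w\<close>.\<close>

lemma conv_cross_le:
  assumes "supp u N" "supp w N" "herm u" "herm w"
  shows "n2 (2 * N) (conv N u w) \<le> sqrt (Q N u) * sqrt (Q N w)"
proof -
  have "complex_of_real (n2 (2 * N) (conv N u w)) = (\<Sum>m\<in>modes (2 * N). conv N u w m * conv N u w (- m))"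
    unfolding n2_def of_real_sum cmod_sq_conv[OF assms(3,4)] ..
  also have "\<dots> = (\<Sum>a\<in>modes N. \<Sum>b\<in>modes N. \<Sum>c\<in>modes N. u a * w b * u c * w (- a - b - c))"
    by (rule conv_pair_sum[OF assms(2)])
  also have "\<dots> = (\<Sum>a\<in>modes N. \<Sum>b\<in>modes N. \<Sum>c\<in>modes N. u a * u b * w c * w (- a - b - c))"
  proof (rule sum.cong[OF refl])
    fix a
    have "- a - c - b = - a - b - c" for b c :: int by simp
    then show "(\<Sum>b\<in>modes N. \<Sum>c\<in>modes N. u a * w b * u c * w (- a - b - c)) =
      (\<Sum>b\<in>modes N. \<Sum>c\<in>modes N. u a * u b * w c * w (- a - b - c))"
      by (subst sum.swap) (simp only: mult_ac)
  qed
  also have "\<dots> = (\<Sum>m\<in>modes (2 * N). conv N u u m * conv N w w (- m))"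
    by (rule conv_pair_sum[OF assms(1), symmetric])
  finally have "n2 (2 * N) (conv N u w) = cmod (\<Sum>m\<in>modes (2 * N). conv N u u m * conv N w w (- m))"
    by (metis abs_of_nonneg n2_nonneg norm_of_real)
  also have "\<dots> \<le> (\<Sum>m\<in>modes (2 * N). cmod (conv N u u m) * cmod (conv N w w m))"
    by (rule order_trans[OF norm_sum]) (simp add: norm_mult herm_conv assms)
  also have "\<dots> \<le> sqrt (Q N u) * sqrt (Q N w)"
    by (rule CS_sum_le) (simp_all add: Q_def sum_nonneg)
  finally show ?thesis .
qed

lemma conv_cross_l2b:
  assumes "supp u N" "supp w N" "herm u" "herm w"
  shows "l2b (conv N u w) (sqrt (Q N u) + sqrt (Q N w))"
proof (rule l2b_mono[OF l2b_supp[OF supp_conv2[OF assms(1,2)]]])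
  have "n2 (2 * N) (conv N u w) \<le> (sqrt (Q N u) + sqrt (Q N w))\<^sup>2"
  proof -
    have "0 \<le> sqrt (Q N u) * sqrt (Q N w)" "0 \<le> Q N u" "0 \<le> Q N w" by simp_all
    moreover have "(sqrt (Q N u) + sqrt (Q N w))\<^sup>2 = Q N u + Q N w + 2 * (sqrt (Q N u) * sqrt (Q N w))"
      by (simp add: power2_sum)
    ultimately show ?thesis using conv_cross_le[OF assms] by linarith
  qed
  then show "sqrt (n2 (2 * N) (conv N u w)) \<le> sqrt (Q N u) + sqrt (Q N w)"
    by (simp add: real_le_lsqrt)
qed

lemma conv_self_l2b: "supp u N \<Longrightarrow> l2b (conv N u u) (sqrt (Q N u))"
  using l2b_supp[OF supp_conv2[of u N u]] by (simp add: Q_def n2_def)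

lemma tri_le:
  assumes "l2b (conv N v w) C"
  shows "cmod (tri N u v w n) \<le> sqrt (n2 N u) * C"
proof -
  have "cmod (tri N u v w n) \<le> (\<Sum>a\<in>modes N. cmod (u a) * cmod (conv N v w (n - a)))"
    unfolding tri_conv by (rule order_trans[OF norm_sum]) (simp add: norm_mult)
  also have "\<dots> \<le> sqrt (n2 N u) * C"
  proof (rule CS_sum_le)
    have "(\<Sum>a\<in>modes N. (cmod (conv N v w (n - a)))\<^sup>2) = (\<Sum>m\<in>(\<lambda>a. n - a) ` modes N. (cmod (conv N v w m))\<^sup>2)"
      by (subst sum.reindex) (auto simp: inj_on_def)
    also have "\<dots> \<le> C\<^sup>2" using assms by (intro l2bD) auto
    finally show "(\<Sum>a\<in>modes N. (cmod (conv N v w (n - a)))\<^sup>2) \<le> C\<^sup>2" .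
  qed (use assms in \<open>auto simp: n2_def sum_nonneg l2b_nonneg\<close>)
  finally show ?thesis .
qed

abbreviation cub :: "nat \<Rightarrow> (int \<Rightarrow> complex) \<Rightarrow> int \<Rightarrow> complex" where "cub N u \<equiv> tri N u u u"

lemma cub_le: "supp u N \<Longrightarrow> cmod (cub N u n) \<le> sqrt (n2 N u) * sqrt (Q N u)"
  by (rule tri_le[OF conv_self_l2b])

lemma tri_swap: "tri N u v w = tri N v u w"
proof
  fix n
  have "n - a - b = n - b - a" for a b :: int by simp
  then show "tri N u v w n = tri N v u w n" unfolding tri_def by (subst sum.swap) (simp only: mult_ac)
qed

text \<open>By the symmetry of the trilinear sum every difference is moved into the first slot,
  where only its l2 norm enters; the two remaining factors are measured through
  \<open>Q\<close>.\<close>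

lemma cub_diff_le:
  assumes "supp u N" "supp w N" "herm u" "herm w"
  shows "cmod (cub N u n - cub N w n) \<le> 2 * sqrt (n2 N (\<lambda>n. u n - w n)) * (sqrt (Q N u) + sqrt (Q N w))"
proof -
  let ?y = "\<lambda>n. u n - w n"
  have "cub N u n - cub N w n = tri N ?y u u n + tri N w ?y u n + tri N w w ?y n"
    unfolding tri_def by (simp add: sum.distrib[symmetric] sum_subtractf[symmetric] algebra_simps)
  also have "tri N w ?y u n = tri N ?y w u n"
    by (simp only: tri_swap)
  also have "tri N w w ?y n = tri N w ?y w n"
    unfolding tri_conv conv_commute[OF assms(2) supp_diff[OF assms(1,2)]] ..
  also have "tri N w ?y w n = tri N ?y w w n"
    by (simp only: tri_swap)
  finally have "cmod (cub N u n - cub N w n) \<le> cmod (tri N ?y u u n) + cmod (tri N ?y w u n) + cmod (tri N ?y w w n)"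
    by (simp only:) (intro norm_triangle_le add_right_mono norm_triangle_ineq)
  also have "\<dots> \<le> sqrt (n2 N ?y) * sqrt (Q N u) + sqrt (n2 N ?y) * (sqrt (Q N w) + sqrt (Q N u)) + sqrt (n2 N ?y) * sqrt (Q N w)"
    using assms by (intro add_mono tri_le conv_self_l2b conv_cross_l2b)
  also have "\<dots> = 2 * sqrt (n2 N ?y) * (sqrt (Q N u) + sqrt (Q N w))" by (simp add: algebra_simps)
  finally show ?thesis .
qed

text \<open>Evaluating at \<open>- d\<close> replaces the constraint that the output equals the sum
  of the inputs by the symmetric constraint \<open>a + b + c + d = 0\<close>.\<close>

lemma sum_tri_quads:
  assumes "supp w N"
  shows "(\<Sum>d\<in>modes N. f d * tri N u v w (- d)) = (\<Sum>(a, b, c, d)\<in>QD N. f d * (u a * v b * w c))"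
proof -
  have "(\<Sum>d\<in>modes N. f d * tri N u v w (- d)) =
    (\<Sum>(d, a, b)\<in>modes N \<times> modes N \<times> modes N. f d * (u a * v b * w (- d - a - b)))"
    by (simp add: tri_def sum_distrib_left sum.cartesian_product split_def)
  also have "\<dots> = (\<Sum>(d, a, b)\<in>{(d, a, b). d \<in> modes N \<and> a \<in> modes N \<and> b \<in> modes N \<and> - d - a - b \<in> modes N}. f d * (u a * v b * w (- d - a - b)))"
    using assms by (intro sum.mono_neutral_right) (auto simp: supp_def)
  also have "\<dots> = (\<Sum>(a, b, c, d)\<in>QD N. f d * (u a * v b * w c))"
    by (rule sum.reindex_bij_witness[of _ "\<lambda>(a, b, c, d). (d, a, b)" "\<lambda>(d, a, b). (a, b, - d - a - b, d)"])
      (auto simp: QD_iff)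
  finally show ?thesis .
qed

text \<open>Symmetry allows the weight to be moved to any of the four slots; adding the four
  versions produces the weight \<open>a + b + c + d = 0\<close>. This cancellation is the
  conservation of the l2 norm.\<close>

lemma sum_quads_weight_zero:
  "(\<Sum>(a, b, c, d)\<in>QD N. of_int d * (u a * u b * u c * (u d :: complex))) = 0"
proof -
  let ?f = "\<lambda>(a, b, c, d). u a * u b * u c * u d"
  have 1: "(\<Sum>(a, b, c, d)\<in>QD N. of_int d * ?f (a, b, c, d)) = (\<Sum>(a, b, c, d)\<in>QD N. of_int a * ?f (a, b, c, d))"
    by (rule sum.reindex_bij_witness[of _ "\<lambda>(a, b, c, d). (d, b, c, a)" "\<lambda>(a, b, c, d). (d, b, c, a)"])
      (auto simp: QD_def mult_ac)
  have 2: "(\<Sum>(a, b, c, d)\<in>QD N. of_int d * ?f (a, b, c, d)) = (\<Sum>(a, b, c, d)\<in>QD N. of_int b * ?f (a, b, c, d))"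
    by (rule sum.reindex_bij_witness[of _ "\<lambda>(a, b, c, d). (a, d, c, b)" "\<lambda>(a, b, c, d). (a, d, c, b)"])
      (auto simp: QD_def mult_ac)
  have 3: "(\<Sum>(a, b, c, d)\<in>QD N. of_int d * ?f (a, b, c, d)) = (\<Sum>(a, b, c, d)\<in>QD N. of_int c * ?f (a, b, c, d))"
    by (rule sum.reindex_bij_witness[of _ "\<lambda>(a, b, c, d). (a, b, d, c)" "\<lambda>(a, b, c, d). (a, b, d, c)"])
      (auto simp: QD_def mult_ac)
  have "(\<Sum>(a, b, c, d)\<in>QD N. of_int a * ?f (a, b, c, d)) + (\<Sum>(a, b, c, d)\<in>QD N. of_int b * ?f (a, b, c, d)) +
    (\<Sum>(a, b, c, d)\<in>QD N. of_int c * ?f (a, b, c, d)) + (\<Sum>(a, b, c, d)\<in>QD N. of_int d * ?f (a, b, c, d)) =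
    (\<Sum>(a, b, c, d)\<in>QD N. of_int (a + b + c + d) * ?f (a, b, c, d))"
    by (simp add: sum.distrib[symmetric] split_def distrib_right)
  also have "\<dots> = 0" by (intro sum.neutral) (auto simp: QD_def simp del: of_int_add)
  finally have "4 * (\<Sum>(a, b, c, d)\<in>QD N. of_int d * ?f (a, b, c, d)) = 0"
    unfolding 1[symmetric] 2[symmetric] 3[symmetric] by simp
  then show ?thesis by simp
qed

text \<open>A resonant quadruple consists of two opposite pairs, so for Hermitian \<open>u\<close>
  the product is \<open>(cmod (u x))\<^sup>2 * (cmod (u y))\<^sup>2\<close>.\<close>

lemma resonant_real:
  assumes "herm u" "q \<in> QD N - NR N" "q = (a, b, c, d)"
  shows "Im (u a * u b * u c * u d) = 0"
proof -
  have *: "Im (u x * u (- x) * (u y * u (- y))) = 0" for x y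
    unfolding hermD[OF assms(1)] complex_norm_square[symmetric] by simp
  have "d = - a - b - c" "a + b = 0 \<or> a + c = 0 \<or> b + c = 0"
    using assms(2,3) by (auto simp: QD_def NR_def nonres_def)
  then consider "b = - a" "d = - c" | "c = - a" "d = - b" | "c = - b" "d = - a" by force
  then show ?thesis
  proof cases
    case 1 then show ?thesis using *[of a c] by (simp only: mult_ac)
  next
    case 2 then show ?thesis using *[of a b] by (simp only: mult_ac)
  next
    case 3 then show ?thesis using *[of a b] by (simp only: mult_ac)
  qed
qed

text \<open>The resonant terms lie on the three lines \<open>a = n\<close>, \<open>b = n\<close> and
  \<open>a + b = 0\<close>. Each line contributes \<open>n2 N u * u n\<close>. For
  \<open>n \<noteq> 0\<close> there are three distinct intersection points, each on exactly two
  lines and each with value \<open>(cmod (u n))\<^sup>2 * u n\<close>, so the overcount is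
  subtracted three times.\<close>

lemma cub_resonance:
  assumes "supp u N" "herm u" "n \<in> modes N" "n \<noteq> 0"
  shows "cub N u n = (\<Sum>(a, b, c, d)\<in>{q \<in> NR N. snd (snd (snd q)) = - n}. u a * u b * u c) +
    3 * complex_of_real (n2 N u - (cmod (u n))\<^sup>2) * u n"
proof -
  let ?f = "\<lambda>a b. u a * u b * u (n - a - b)"
  let ?E = "complex_of_real (n2 N u)" and ?e = "complex_of_real ((cmod (u n))\<^sup>2)"
  have uu: "u a * u (- a) = complex_of_real ((cmod (u a))\<^sup>2)" for a
    unfolding hermD[OF assms(2)] complex_norm_square[symmetric] ..
  have E: "(\<Sum>a\<in>modes N. u a * u (- a)) = ?E" unfolding uu n2_def by simp
  have n0: "(\<Sum>b\<in>modes N. ?f n b) = u n * ?E"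
    unfolding E[symmetric] by (simp add: sum_distrib_left mult.assoc)
  \<comment> \<open>The resonant part of row \<open>a\<close>. Row \<open>n\<close> is resonant
    throughout; any other row contains the points \<open>b = n\<close> and \<open>b = - a\<close>,
    which coincide when \<open>a = - n\<close>, hence the \<open>0\<close>.\<close>
  define g where "g a = (if a = n then u n * ?E else u a * u (- a) * u n + (if a = - n then 0 else u a * u (- a) * u n))" for a
  have inner: "(\<Sum>b\<in>modes N. ?f a b) = (\<Sum>b\<in>{b \<in> modes N. a \<noteq> n \<and> b \<noteq> n \<and> a + b \<noteq> 0}. ?f a b) + g a" if a: "a \<in> modes N" for a
  proof (cases "a = n")
    case True then show ?thesis using n0 by (simp add: g_def)
  next
    case False
    have "(\<Sum>b\<in>modes N. ?f a b) = (\<Sum>b\<in>modes N - {n, - a}. ?f a b) + (\<Sum>b\<in>{n, - a}. ?f a b)"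
      using a assms(3) by (intro sum.subset_diff) auto
    also have "modes N - {n, - a} = {b \<in> modes N. a \<noteq> n \<and> b \<noteq> n \<and> a + b \<noteq> 0}" using False by auto
    also have "(\<Sum>b\<in>{n, - a}. ?f a b) = g a"
    proof (cases "a = - n")
      case True then show ?thesis using False by (simp add: g_def mult_ac)
    next
      case f: False
      then have "n \<noteq> - a" by auto
      then show ?thesis using False f by (simp add: g_def mult_ac)
    qed
    finally show ?thesis .
  qed
  have nn: "n \<noteq> - n" using assms(4) by simp
  have sg: "(\<Sum>a\<in>modes N. g a) = 3 * (?E - ?e) * u n"
  proof -
    have "(\<Sum>a\<in>modes N. g a) = (\<Sum>a\<in>modes N. 2 * u n * (u a * u (- a)) +
       (if a = n then u n * ?E - 2 * u n * ?e else 0) + (if a = - n then - u n * ?e else 0))"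
      using nn uu[of n] by (intro sum.cong refl) (auto simp: g_def mult_ac)
    also have "\<dots> = 2 * u n * ?E + (u n * ?E - 2 * u n * ?e) + (- u n * ?e)"
      using assms(3) by (simp add: sum.distrib sum_distrib_left[symmetric] E del: sum.delta' sum.delta) (simp add: sum.delta)
    finally show ?thesis by (simp add: algebra_simps)
  qed
  have "cub N u n = (\<Sum>a\<in>modes N. (\<Sum>b\<in>{b \<in> modes N. a \<noteq> n \<and> b \<noteq> n \<and> a + b \<noteq> 0}. ?f a b) + g a)"
    unfolding tri_def by (rule sum.cong[OF refl inner])
  also have "\<dots> = (\<Sum>a\<in>modes N. \<Sum>b\<in>{b \<in> modes N. a \<noteq> n \<and> b \<noteq> n \<and> a + b \<noteq> 0}. ?f a b) + 3 * (?E - ?e) * u n"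
    by (simp add: sum.distrib sg)
  also have "(\<Sum>a\<in>modes N. \<Sum>b\<in>{b \<in> modes N. a \<noteq> n \<and> b \<noteq> n \<and> a + b \<noteq> 0}. ?f a b) =
     (\<Sum>(a, b)\<in>Sigma (modes N) (\<lambda>a. {b \<in> modes N. a \<noteq> n \<and> b \<noteq> n \<and> a + b \<noteq> 0}). ?f a b)"
    by (rule sum.Sigma) auto
  also have "\<dots> = (\<Sum>(a, b)\<in>{(a, b). a \<in> modes N \<and> b \<in> modes N \<and> n - a - b \<in> modes N \<and> a \<noteq> n \<and> b \<noteq> n \<and> a + b \<noteq> 0}. ?f a b)"
    using assms(1) by (intro sum.mono_neutral_right) (auto simp: supp_def)
  also have "\<dots> = (\<Sum>(a, b, c, d)\<in>{q \<in> NR N. snd (snd (snd q)) = - n}. u a * u b * u c)"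
    by (rule sum.reindex_bij_witness[of _ "\<lambda>(a, b, c, d). (a, b)" "\<lambda>(a, b). (a, b, n - a - b, - n)"])
      (use assms(3) in \<open>auto simp: NR_def QD_def nonres_def algebra_simps\<close>)
  finally show ?thesis by simp
qed

lemma continuous_on_cis_mult [continuous_intros]:
  "continuous_on S f \<Longrightarrow> continuous_on S (\<lambda>s. cis (f s))" for f :: "real \<Rightarrow> real"
  unfolding cis_conv_exp by (intro continuous_intros)

lemma deriv_cmod_sq:
  assumes "(f has_vector_derivative f') (at s within S)"
  shows "((\<lambda>s. (cmod (f s))\<^sup>2) has_real_derivative 2 * Re (cnj (f s) * f')) (at s within S)"
proof -
  have r: "((\<lambda>s. Re (f s)) has_real_derivative Re f') (at s within S)"
    "((\<lambda>s. Im (f s)) has_real_derivative Im f') (at s within S)"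
    using bounded_linear.has_vector_derivative[OF bounded_linear_Re assms]
      bounded_linear.has_vector_derivative[OF bounded_linear_Im assms]
    by (simp_all add: has_real_derivative_iff_has_vector_derivative)
  show ?thesis unfolding cmod_power2
    by (rule derivative_eq_intros r refl)+ (simp add: algebra_simps)
qed

lemma sum_union_le:
  fixes f :: "'a \<Rightarrow> real"
  assumes "finite A" "finite B" "\<And>x. 0 \<le> f x"
  shows "sum f (A \<union> B) \<le> sum f A + sum f B"
  using sum.union_inter[OF assms(1,2), of f] sum_nonneg[of "A \<inter> B" f, OF assms(3)] by linarith

section \<open>Truncated solutions\<close>

locale kaw =
  fixes \<beta> \<gamma> \<mu> :: real
  assumes beta: "0 \<le> \<beta>" and mu: "\<bar>\<mu>\<bar> = 1"
begin

definition U :: "real \<Rightarrow> (int \<Rightarrow> complex) \<Rightarrow> int \<Rightarrow> complex" where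
  "U s z n = cis (s * phase \<beta> \<gamma> n) * z n"

definition rhs :: "nat \<Rightarrow> nat \<Rightarrow> real \<Rightarrow> (int \<Rightarrow> complex) \<Rightarrow> int \<Rightarrow> complex" where
  "rhs N B s z n = (if n \<in> modes N then \<i> * of_real (\<mu> * of_int n / 3) * cis (- (s * phase \<beta> \<gamma> n)) * cub B (U s z) n else 0)"

lemma phase_minus: "phase \<beta> \<gamma> (- n) = - phase \<beta> \<gamma> n"
  by (simp add: phase_def)

lemma supp_U: "supp z N \<Longrightarrow> supp (U s z) N" by (simp add: supp_def U_def)
lemma herm_U: "herm z \<Longrightarrow> herm (U s z)" by (simp add: herm_def U_def phase_minus cis_cnj)
lemma n2_U [simp]: "n2 N (U s z) = n2 N z" by (simp add: n2_def U_def norm_mult)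
lemma U_diff: "(\<lambda>n. U s z n - U s w n) = U s (\<lambda>n. z n - w n)" by (auto simp: U_def right_diff_distrib)

lemma U_prod:
  assumes "a + b + c + d = 0"
  shows "U s x a * U s y b * U s z c * U s w d = cis (s * Ph \<beta> \<gamma> a b c d) * (x a * y b * z c * w d)"
  by (simp add: U_def Ph_def cis_mult[symmetric] distrib_left)

lemma Ph_bound:
  assumes "nonres (a, b, c, d)"
  shows "pp a b c * sq4 a b c d \<le> \<bar>Ph \<beta> \<gamma> a b c d\<bar>" "0 < pp a b c * sq4 a b c d"
proof -
  show "pp a b c * sq4 a b c d \<le> \<bar>Ph \<beta> \<gamma> a b c d\<bar>"
    using assms beta by (intro Ph_lower) (auto simp: nonres_def)
  show "0 < pp a b c * sq4 a b c d" using nonres_ge_1[OF assms] by (intro mult_pos_pos) auto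
qed

definition PhQ :: "int \<times> int \<times> int \<times> int \<Rightarrow> real" where
  "PhQ = (\<lambda>(a, b, c, d). Ph \<beta> \<gamma> a b c d)"

lemma PhQ_nz: "nonres q \<Longrightarrow> PhQ q \<noteq> 0"
  using Ph_bound by (cases q) (force simp: PhQ_def)

lemma weight_le:
  assumes "nonres (a, b, c, d)" "k \<le> w" "0 \<le> w"
  shows "k / \<bar>PhQ (a, b, c, d)\<bar> \<le> w / (pp a b c * sq4 a b c d)"
  using Ph_bound[OF assms(1)] assms(2,3) by (auto simp: PhQ_def intro!: frac_le)

text \<open>Multiplying by \<open>cnj (u n) = u (- n)\<close> adds a fourth slot of frequency
  \<open>d = - n\<close>, which explains the condition \<open>- d \<in> S\<close>. The unimodular
  factors of \<open>rhs\<close> and of the linear flow combine into \<open>U\<close>.\<close>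

lemma rhs_energy:
  assumes "herm z" "supp z N" "N \<le> B" and S: "S \<subseteq> modes B"
  shows "(\<Sum>n\<in>S. 2 * Re (cnj (z n) * rhs N B s z n)) =
     Re (\<Sum>(a, b, c, d)\<in>QD B. (if - d \<in> S then - (2 * \<i> * of_real \<mu> * of_int d / 3) else 0) *
       (U s z a * U s z b * U s z c * U s z d))"
proof -
  let ?u = "U s z"
  have h: "herm ?u" and su: "supp ?u B" using herm_U assms supp_U supp_mono by blast+
  define f where "f d = (if - d \<in> S then - (2 * \<i> * of_real \<mu> * of_int d / 3) * ?u d else 0)" for d
  have "(\<Sum>n\<in>S. 2 * Re (cnj (z n) * rhs N B s z n)) = (\<Sum>n\<in>S. Re (f (- n) * cub B ?u n))"
  proof (rule sum.cong[OF refl])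
    fix n assume n: "n \<in> S"
    have "f (- n) = 2 * \<i> * of_real \<mu> * of_int n / 3 * cnj (?u n)" using n hermD[OF h] by (simp add: f_def)
    moreover have "cnj (?u n) = cis (- (s * phase \<beta> \<gamma> n)) * cnj (z n)" by (simp add: U_def cis_cnj)
    moreover have "cnj (z n) = 0" if "n \<notin> modes N" using suppD[OF assms(2) that] by simp
    ultimately have "2 * (cnj (z n) * rhs N B s z n) = f (- n) * cub B ?u n"
      by (cases "n \<in> modes N") (simp_all add: rhs_def)
    moreover have "2 * Re w = Re (2 * w)" for w by simp
    ultimately show "2 * Re (cnj (z n) * rhs N B s z n) = Re (f (- n) * cub B ?u n)" by (simp only:)
  qed
  also have "\<dots> = Re (\<Sum>n\<in>S. f (- n) * cub B ?u n)" by simp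
  also have "(\<Sum>n\<in>S. f (- n) * cub B ?u n) = (\<Sum>n\<in>modes B. f (- n) * cub B ?u n)"
    using S by (intro sum.mono_neutral_left) (auto simp: f_def)
  also have "\<dots> = (\<Sum>d\<in>modes B. f d * cub B ?u (- d))"
    by (rule sum.reindex_bij_witness[of _ uminus uminus]) auto
  also have "\<dots> = (\<Sum>(a, b, c, d)\<in>QD B. f d * (?u a * ?u b * ?u c))" by (rule sum_tri_quads[OF su])
  also have "\<dots> = (\<Sum>(a, b, c, d)\<in>QD B. (if - d \<in> S then - (2 * \<i> * of_real \<mu> * of_int d / 3) else 0) *
       (?u a * ?u b * ?u c * ?u d))"
    by (intro sum.cong) (auto simp: f_def)
  finally show ?thesis .
qed

lemma rhs_energy_zero:
  assumes "herm z" "supp z N" "N \<le> B"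
  shows "(\<Sum>n\<in>modes B. 2 * Re (cnj (z n) * rhs N B s z n)) = 0"
proof -
  let ?u = "U s z"
  have "(\<Sum>(a, b, c, d)\<in>QD B. (if - d \<in> modes B then - (2 * \<i> * of_real \<mu> * of_int d / 3) else 0) *
     (?u a * ?u b * ?u c * ?u d)) = - (2 * \<i> * of_real \<mu> / 3) * (\<Sum>(a, b, c, d)\<in>QD B. of_int d * (?u a * ?u b * ?u c * ?u d))"
    unfolding sum_distrib_left by (intro sum.cong) (auto simp: QD_def)
  then show ?thesis unfolding rhs_energy[OF assms subset_refl] sum_quads_weight_zero by simp
qed

end

text \<open>The equation is projected to \<open>modes N\<close>, whereas sums range over the larger box \<open>modes B\<close>, so that solutions with
  different \<open>N\<close> can be compared in a common box.\<close>

locale galerkin = kaw +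
  fixes N B :: nat and T :: real and \<zeta> :: "real \<Rightarrow> int \<Rightarrow> complex"
  assumes NB: "N \<le> B" and T: "0 \<le> T" and supp_N: "\<And>s. supp (\<zeta> s) N" and herm: "\<And>s. herm (\<zeta> s)"
    and deriv: "\<And>s n. s \<in> {0..T} \<Longrightarrow> ((\<lambda>s. \<zeta> s n) has_vector_derivative rhs N B s (\<zeta> s) n) (at s within {0..T})"
begin

abbreviation r :: "real \<Rightarrow> int \<Rightarrow> complex" where "r s \<equiv> rhs N B s (\<zeta> s)"
definition q :: "real \<Rightarrow> real" where "q s = sqrt (Q B (U s (\<zeta> s)))"

lemma supp_B: "supp (\<zeta> s) B" using supp_N NB supp_mono by blast

lemma cont: "continuous_on {0..T} (\<lambda>s. \<zeta> s n)"
  unfolding continuous_on_eq_continuous_within using deriv has_vector_derivative_continuous by blast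

lemma cont_U: "continuous_on {0..T} (\<lambda>s. U s (\<zeta> s) n)"
  unfolding U_def by (intro continuous_intros cont)

lemma cont_r: "continuous_on {0..T} (\<lambda>s. r s n)"
  unfolding rhs_def tri_def by (cases "n \<in> modes N") (auto intro!: continuous_intros cont_U)

lemma cont_Q: "continuous_on {0..T} (\<lambda>s. Q B (U s (\<zeta> s)))"
  unfolding Q_def conv_def by (intro continuous_intros cont_U)

lemma cont_q: "continuous_on {0..T} q"
  unfolding q_def by (intro continuous_intros cont_Q)

lemma q_nonneg [simp]: "0 \<le> q s" by (simp add: q_def)
lemma q_sq: "(q s)\<^sup>2 = Q B (U s (\<zeta> s))" by (simp add: q_def)

lemma cmod_r_le: "cmod (r s n) \<le> jb n * (sqrt (n2 B (\<zeta> s)) * q s)"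
proof (cases "n \<in> modes N")
  case True
  have "cmod (r s n) = \<bar>real_of_int n\<bar> / 3 * cmod (cub B (U s (\<zeta> s)) n)"
    using True mu by (simp add: rhs_def norm_mult abs_mult)
  also have "\<dots> \<le> jb n * (sqrt (n2 B (\<zeta> s)) * q s)"
    using cub_le[OF supp_U[OF supp_B], of s s n]
    by (intro mult_mono) (auto simp: jb_def q_def)
  finally show ?thesis .
qed (auto simp: rhs_def jb_def intro!: mult_nonneg_nonneg)

lemma energy_deriv:
  assumes S: "S \<subseteq> modes B" and s: "s \<in> {0..T}"
  shows "((\<lambda>s. \<Sum>n\<in>S. (cmod (\<zeta> s n))\<^sup>2) has_real_derivative
     Re (\<Sum>(a, b, c, d)\<in>QD B. (if - d \<in> S then - (2 * \<i> * of_real \<mu> * of_int d / 3) else 0) *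
       (U s (\<zeta> s) a * U s (\<zeta> s) b * U s (\<zeta> s) c * U s (\<zeta> s) d))) (at s within {0..T})"
  unfolding rhs_energy[OF herm supp_N NB S, symmetric] by (intro DERIV_sum deriv_cmod_sq deriv s)

lemma energy: "s \<in> {0..T} \<Longrightarrow> n2 B (\<zeta> s) = n2 B (\<zeta> 0)"
proof -
  assume s: "s \<in> {0..T}"
  have "((\<lambda>s. n2 B (\<zeta> s)) has_real_derivative 0) (at x within {0..T})" if "x \<in> {0..T}" for x
  proof -
    have "((\<lambda>s. n2 B (\<zeta> s)) has_real_derivative (\<Sum>n\<in>modes B. 2 * Re (cnj (\<zeta> x n) * r x n))) (at x within {0..T})"
      unfolding n2_def by (intro DERIV_sum deriv_cmod_sq deriv that)
    then show ?thesis unfolding rhs_energy_zero[OF herm supp_N NB] .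
  qed
  then obtain c where "\<forall>x\<in>{0..T}. n2 B (\<zeta> x) = c"
    using has_field_derivative_zero_constant[of "{0..T}" "\<lambda>s. n2 B (\<zeta> s)"] by auto
  then show ?thesis using s T by auto
qed

text \<open>Resonant quadruples drop out of the energy of any set of modes: their products are real
  while the coefficient is purely imaginary. What is left has nonvanishing phases and is open to the
  normal form.\<close>

lemma modes_change:
  assumes S: "S \<subseteq> modes B" and t: "t \<in> {0..T}"
  defines "\<kappa> \<equiv> \<lambda>(a, b, c, d). - (2 * \<i> * of_real \<mu> * of_int d / 3) :: complex"
  shows "(\<Sum>n\<in>S. (cmod (\<zeta> t n))\<^sup>2) - (\<Sum>n\<in>S. (cmod (\<zeta> 0 n))\<^sup>2) =
    Re (integral {0..t} (qform {q \<in> NR B. - snd (snd (snd q)) \<in> S} \<kappa> PhQ \<zeta> \<zeta> \<zeta> \<zeta>))"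
proof -
  let ?F = "{q \<in> NR B. - snd (snd (snd q)) \<in> S}"
  interpret qf: quartic_form ?F \<kappa> PhQ T \<zeta> \<zeta> \<zeta> \<zeta> r r r r
    by unfold_locales (simp_all add: NR_def PhQ_nz deriv cont_r)
  have sub: "{0..t} \<subseteq> {0..T}" using t by auto
  have cf: "continuous_on {0..t} qf.form"
    unfolding qform_def split_def
    by (intro continuous_intros continuous_on_subset[OF cont sub])
  have eq: "Re (\<Sum>(a, b, c, d)\<in>QD B. (if - d \<in> S then - (2 * \<i> * of_real \<mu> * of_int d / 3) else 0) *
       (U s (\<zeta> s) a * U s (\<zeta> s) b * U s (\<zeta> s) c * U s (\<zeta> s) d)) = Re (qf.form s)" for s
  proof -
    let ?u = "U s (\<zeta> s)"
    let ?g = "\<lambda>(a, b, c, d). (if - d \<in> S then - (2 * \<i> * of_real \<mu> * of_int d / 3) else 0) * (?u a * ?u b * ?u c * ?u d)"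
    have "Re (sum ?g (QD B)) = (\<Sum>q\<in>QD B. Re (?g q))" by simp
    also have "\<dots> = (\<Sum>q\<in>NR B. Re (?g q))"
    proof (rule sum.mono_neutral_right)
      show "\<forall>q\<in>QD B - NR B. Re (?g q) = 0"
      proof
        fix p assume p: "p \<in> QD B - NR B"
        obtain a b c d where pe: "p = (a, b, c, d)" by (cases p)
        have "Im (?u a * ?u b * ?u c * ?u d) = 0" by (rule resonant_real[OF herm_U[OF herm] p pe])
        moreover have "Re (- (2 * \<i> * of_real \<mu> * of_int d / 3) * z) = 2 * \<mu> * real_of_int d / 3 * Im z" for z by simp
        ultimately have "Re (- (2 * \<i> * of_real \<mu> * of_int d / 3) * (?u a * ?u b * ?u c * ?u d)) = 0"
          by (simp only: mult_zero_right)
        then show "Re (?g p) = 0" unfolding pe prod.case by (cases "- d \<in> S") (simp_all only: if_True if_False mult_zero_left zero_complex.simps)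
      qed
    qed (auto simp: NR_def)
    also have "\<dots> = Re (sum ?g (NR B))" by simp
    also have "sum ?g (NR B) = sum ?g ?F" by (rule sum.mono_neutral_right) (auto split: prod.splits)
    also have "\<dots> = qf.form s"
      unfolding qform_def
    proof (rule sum.cong[OF refl])
      fix p assume p: "p \<in> ?F"
      obtain a b c d where pe: "p = (a, b, c, d)" by (cases p)
      then have "a + b + c + d = 0" "- d \<in> S" using p by (auto simp: NR_def QD_def)
      then show "?g p = (case p of (a, b, c, d) \<Rightarrow> \<kappa> (a, b, c, d) * (cis (s * PhQ (a, b, c, d)) * (\<zeta> s a * \<zeta> s b * \<zeta> s c * \<zeta> s d)))"
        unfolding pe prod.case U_prod[OF \<open>a + b + c + d = 0\<close>] \<kappa>_def PhQ_def by simp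
    qed
    finally show ?thesis by (simp only: split_def)
  qed
  have "((\<lambda>s. Re (qf.form s)) has_integral ((\<Sum>n\<in>S. (cmod (\<zeta> t n))\<^sup>2) - (\<Sum>n\<in>S. (cmod (\<zeta> 0 n))\<^sup>2))) {0..t}"
  proof (rule fundamental_theorem_of_calculus)
    show "0 \<le> t" using t by simp
    fix s assume s: "s \<in> {0..t}"
    then have "s \<in> {0..T}" using t by auto
    from DERIV_subset[OF energy_deriv[OF S this] sub]
    show "((\<lambda>s. \<Sum>n\<in>S. (cmod (\<zeta> s n))\<^sup>2) has_vector_derivative Re (qf.form s)) (at s within {0..t})"
      unfolding eq by (simp add: has_real_derivative_iff_has_vector_derivative)
  qed
  moreover have "(qf.form has_integral (integral {0..t} qf.form)) {0..t}"
    using cf by (intro integrable_integral integrable_continuous_real)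
  then have "((\<lambda>s. Re (qf.form s)) has_integral Re (integral {0..t} qf.form)) {0..t}"
    by (rule has_integral_Re)
  ultimately show ?thesis using has_integral_unique by blast
qed

lemma sb_r:
  assumes "sqrt (n2 B (\<zeta> 0)) \<le> R" "s \<in> {0..T}"
  shows "sb (r s) (R * q s) 0 L"
  unfolding sb_def
proof (intro conjI allI)
  have R: "0 \<le> R" using assms(1) real_sqrt_ge_zero[OF n2_nonneg] order_trans by blast
  then show "0 \<le> R * q s" by simp
  fix n
  have "sqrt (n2 B (\<zeta> s)) * q s \<le> R * q s"
    using assms energy[OF assms(2)] by (intro mult_right_mono) auto
  then show "cmod (r s n) \<le> jb n * (R * q s + 0 * (jb n / L) powr (1/8))"
    using order_trans[OF cmod_r_le mult_left_mono[of _ _ "jb n"]] by (simp add: jb_def)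
qed simp

lemma l2b_zeta:
  assumes "sqrt (n2 B (\<zeta> 0)) \<le> R" "s \<in> {0..T}"
  shows "l2b (\<zeta> s) R"
  using l2b_mono[OF l2b_supp[OF supp_B]] assms energy[OF assms(2)] by simp

text \<open>The frequencies can pair off in three ways, each leaving two free variables and hence a
  sum of at most \<open>(n2 B u)\<^sup>2\<close>. The three sets may overlap, which only helps the
  inequality.\<close>

lemma resonant_sum_le:
  assumes "herm u"
  shows "(\<Sum>(a, b, c, d)\<in>QD B - NR B. cmod (u a * u b * u c * u d)) \<le> 3 * (n2 B u)\<^sup>2"
proof -
  let ?g = "\<lambda>(a, b, c, d). cmod (u a * u b * u c * u d)"
  have cm: "cmod (u (- x)) = cmod (u x)" for x using hermD[OF assms] by simp
  have one: "sum ?g {p \<in> QD B. f p + g p = 0 \<and> f' p + g' p = 0} \<le> (n2 B u)\<^sup>2"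
    if fg: "\<And>p. ?g p = cmod (u (f p)) * cmod (u (g p)) * (cmod (u (f' p)) * cmod (u (g' p)))"
      and inj: "\<And>p p'. f p = f p' \<Longrightarrow> g p = g p' \<Longrightarrow> f' p = f' p' \<Longrightarrow> g' p = g' p' \<Longrightarrow> p = p'"
      and m: "\<And>p. p \<in> QD B \<Longrightarrow> f p \<in> modes B \<and> f' p \<in> modes B" for f g f' g'
  proof -
    let ?A = "{p \<in> QD B. f p + g p = 0 \<and> f' p + g' p = 0}"
    have "sum ?g ?A = (\<Sum>p\<in>?A. (cmod (u (f p)))\<^sup>2 * (cmod (u (f' p)))\<^sup>2)"
    proof (rule sum.cong[OF refl])
      fix p assume "p \<in> ?A"
      then have "g p = - f p" "g' p = - f' p" by auto
      then show "?g p = (cmod (u (f p)))\<^sup>2 * (cmod (u (f' p)))\<^sup>2"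
        unfolding fg by (simp add: cm power2_eq_square)
    qed
    also have "\<dots> \<le> (\<Sum>n\<in>f ` ?A. (cmod (u n))\<^sup>2) * (\<Sum>n\<in>f' ` ?A. (cmod (u n))\<^sup>2)"
    proof (rule sum2_le)
      show "inj_on (\<lambda>p. (f p, f' p)) ?A"
      proof (rule inj_onI)
        fix x y assume xy: "x \<in> ?A" "y \<in> ?A" "(f x, f' x) = (f y, f' y)"
        then show "x = y" by (intro inj) (auto simp: add_eq_0_iff)
      qed
    qed (auto intro: finite_subset[OF _ finite_QD[of B]])
    also have "\<dots> \<le> n2 B u * n2 B u"
      unfolding n2_def using m by (intro mult_mono sum_mono2 sum_nonneg) auto
    finally show ?thesis by (simp add: power2_eq_square)
  qed
  define f1 f2 f3 f4 :: "int \<times> int \<times> int \<times> int \<Rightarrow> int"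
    where f: "f1 = (\<lambda>(a, b, c, d). a)" "f2 = (\<lambda>(a, b, c, d). b)" "f3 = (\<lambda>(a, b, c, d). c)" "f4 = (\<lambda>(a, b, c, d). d)"
  let ?A1 = "{p \<in> QD B. f1 p + f2 p = 0 \<and> f3 p + f4 p = 0}" and ?A2 = "{p \<in> QD B. f1 p + f3 p = 0 \<and> f2 p + f4 p = 0}"
    and ?A3 = "{p \<in> QD B. f2 p + f3 p = 0 \<and> f1 p + f4 p = 0}"
  have fin: "finite ?A1" "finite ?A2" "finite ?A3" by (auto intro: finite_subset[OF _ finite_QD[of B]])
  have pos: "0 \<le> ?g p" for p by (cases p) auto
  have "sum ?g (QD B - NR B) \<le> sum ?g (?A1 \<union> ?A2 \<union> ?A3)"
  proof (rule sum_mono2)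
    show "QD B - NR B \<subseteq> ?A1 \<union> ?A2 \<union> ?A3" by (auto simp: NR_def nonres_def f QD_def)
  qed (use fin pos in auto)
  also have "\<dots> \<le> sum ?g (?A1 \<union> ?A2) + sum ?g ?A3"
    by (intro sum_union_le finite_UnI fin pos)
  also have "\<dots> \<le> sum ?g ?A1 + sum ?g ?A2 + sum ?g ?A3"
    by (intro add_right_mono sum_union_le fin pos)
  also have "\<dots> \<le> (n2 B u)\<^sup>2 + (n2 B u)\<^sup>2 + (n2 B u)\<^sup>2"
    by (intro add_mono one) (auto simp: f QD_def norm_mult split: prod.splits)
  finally show ?thesis by simp
qed

text \<open>\<open>Q\<close> is itself a quartic sum over the hyperplane. Its resonant part is
  bounded by the conserved energy, and its nonresonant part is a form with coefficient one.\<close>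

lemma Q_le_form:
  assumes s: "s \<in> {0..T}"
  shows "Q B (U s (\<zeta> s)) \<le> 3 * (n2 B (\<zeta> 0))\<^sup>2 + Re (qform (NR B) (\<lambda>_. 1) PhQ \<zeta> \<zeta> \<zeta> \<zeta> s)"
proof -
  interpret qf: quartic_form "NR B" "\<lambda>_. 1" PhQ T \<zeta> \<zeta> \<zeta> \<zeta> r r r r
    by unfold_locales (simp_all add: NR_def PhQ_nz deriv cont_r)
  let ?u = "U s (\<zeta> s)"
  let ?g = "\<lambda>(a, b, c, d). ?u a * ?u b * ?u c * ?u d"
  have h: "herm ?u" and su: "supp ?u B" using herm_U[OF herm] supp_U[OF supp_B] by auto
  have "complex_of_real (Q B ?u) = (\<Sum>m\<in>modes (2 * B). conv B ?u ?u m * conv B ?u ?u (- m))"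
    unfolding Q_def of_real_sum cmod_sq_conv[OF h h] ..
  also have "\<dots> = (\<Sum>a\<in>modes B. \<Sum>b\<in>modes B. \<Sum>c\<in>modes B. ?u a * ?u b * ?u c * ?u (- a - b - c))"
    by (rule conv_pair_sum[OF su])
  also have "\<dots> = (\<Sum>d\<in>modes B. ?u d * cub B ?u (- d))"
    by (simp add: tri_def sum_distrib_left mult.assoc)
  also have "\<dots> = sum ?g (QD B)"
    unfolding sum_tri_quads[OF su] by (intro sum.cong) auto
  also have "\<dots> = sum ?g (QD B - NR B) + sum ?g (NR B)"
    by (rule sum.subset_diff) (auto simp: NR_def)
  also have "sum ?g (NR B) = qf.form s"
    unfolding qform_def
  proof (rule sum.cong[OF refl])
    fix p assume p: "p \<in> NR B"
    obtain a b c d where pe: "p = (a, b, c, d)" by (cases p)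
    then have "a + b + c + d = 0" using p by (auto simp: NR_def QD_def)
    then show "?g p = (case p of (a, b, c, d) \<Rightarrow> 1 * (cis (s * PhQ (a, b, c, d)) * (\<zeta> s a * \<zeta> s b * \<zeta> s c * \<zeta> s d)))"
      unfolding pe prod.case U_prod[OF \<open>a + b + c + d = 0\<close>] PhQ_def by simp
  qed
  finally have eq: "Q B ?u = Re (sum ?g (QD B - NR B)) + Re (qf.form s)"
    by (metis Re_complex_of_real plus_complex.simps(1))
  have "Re (sum ?g (QD B - NR B)) \<le> cmod (sum ?g (QD B - NR B))" by (rule complex_Re_le_cmod)
  also have "\<dots> \<le> (\<Sum>(a, b, c, d)\<in>QD B - NR B. cmod (?u a * ?u b * ?u c * ?u d))"
    by (rule order_trans[OF norm_sum]) (simp add: split_def)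
  also have "\<dots> \<le> 3 * (n2 B ?u)\<^sup>2" by (rule resonant_sum_le[OF h])
  finally show ?thesis using eq energy[OF s] by simp
qed

end

text \<open>The sum collects the resonant term, the two endpoint terms and the remainder of Young's
  inequality in \<open>apriori\<close>; the factor two comes from absorbing half of the left-hand
  side.\<close>

definition CQ :: "real \<Rightarrow> real \<Rightarrow> real" where
  "CQ R T = 2 * (3 * R^4 * T + 4 * ctri * R^4 + 32 * ctri\<^sup>2 * R^8 * T)"

section \<open>A priori L4 bound and control of the tails of one truncated solution\<close>

context galerkin
begin

text \<open>For a single solution there is no difference of cut-offs: all \<open>m\<close> are zero
  and \<open>1\<close> serves as the value of \<open>L\<close>.\<close>

lemma form_bound_self:
  assumes R: "sqrt (n2 B (\<zeta> 0)) \<le> R" and t: "t \<in> {0..T}" and F: "F \<subseteq> NR B"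
    and K: "1 \<le> K" "\<And>a b c d. (a, b, c, d) \<in> F \<Longrightarrow> K\<^sup>2 \<le> sq4 a b c d"
    and \<kappa>: "\<And>a b c d. (a, b, c, d) \<in> F \<Longrightarrow> cmod (\<kappa> (a, b, c, d)) \<le> sqrt (sq4 a b c d)"
  shows "cmod (integral {0..t} (qform F \<kappa> PhQ \<zeta> \<zeta> \<zeta> \<zeta>)) \<le>
    2 * ctri * K powr - (1/8) * (2 * R^4 + 4 * R^4 * integral {0..t} q)"
proof -
  have fin: "finite F" by (rule finite_subset[OF F]) simp
  have nr: "nonres p" if "p \<in> F" for p using F that by (auto simp: NR_def)
  interpret qf: quartic_form F \<kappa> PhQ T \<zeta> \<zeta> \<zeta> \<zeta> r r r r
    by unfold_locales (simp_all add: fin PhQ_nz nr deriv cont_r)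
  let ?A = "2 * ctri * K powr - (1/8)"
  have adm: "adm F qf.\<omega> ?A (2 * ctri * 1 powr - (1/8)) 1"
  proof (rule adm_high[OF fin nr K])
    fix a b c d assume p: "(a, b, c, d) \<in> F"
    show "0 \<le> qf.\<omega> (a, b, c, d)" by (simp add: qf.\<omega>_def)
    show "qf.\<omega> (a, b, c, d) \<le> sqrt (sq4 a b c d) / (pp a b c * sq4 a b c d)"
      unfolding qf.\<omega>_def by (rule weight_le[OF nr[OF p] \<kappa>[OF p]]) simp
  qed simp_all
  have R0: "0 \<le> R" using R real_sqrt_ge_zero[OF n2_nonneg] order_trans by blast
  have "cmod (integral {0..t} qf.form) \<le> ?A * (R * R * R * R) + ?A * (R * R * R * R) +
    integral {0..t} (\<lambda>s. (?A * (R * q s) + (2 * ctri * 1 powr - (1/8)) * 0) * (R * R * R) + (?A * (R * q s) + (2 * ctri * 1 powr - (1/8)) * 0) * (R * R * R) +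
      (?A * (R * q s) + (2 * ctri * 1 powr - (1/8)) * 0) * (R * R * R) + (?A * (R * q s) + (2 * ctri * 1 powr - (1/8)) * 0) * (R * R * R))"
    by (rule qf.form_integral_adm[OF t adm, where ?h1.0 = "\<lambda>s. R * q s" and ?h2.0 = "\<lambda>s. R * q s" and ?h3.0 = "\<lambda>s. R * q s" and ?h4.0 = "\<lambda>s. R * q s"
          and ?m1.0 = "\<lambda>s. 0" and ?m2.0 = "\<lambda>s. 0" and ?m3.0 = "\<lambda>s. 0" and ?m4.0 = "\<lambda>s. 0"
          and ?X1.0 = "\<lambda>s. R" and ?X2.0 = "\<lambda>s. R" and ?X3.0 = "\<lambda>s. R" and ?X4.0 = "\<lambda>s. R"])
      (auto simp: ctri_nonneg intro!: continuous_intros cont_q l2b_zeta[OF R] sb_r[OF R])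
  also have "(\<lambda>s. (?A * (R * q s) + (2 * ctri * 1 powr - (1/8)) * 0) * (R * R * R) + (?A * (R * q s) + (2 * ctri * 1 powr - (1/8)) * 0) * (R * R * R) +
      (?A * (R * q s) + (2 * ctri * 1 powr - (1/8)) * 0) * (R * R * R) + (?A * (R * q s) + (2 * ctri * 1 powr - (1/8)) * 0) * (R * R * R)) = (\<lambda>s. (?A * 4 * R^4) * q s)"
    by (auto simp: power_numeral_reduce)
  also have "integral {0..t} \<dots> = (?A * 4 * R^4) * integral {0..t} q" by simp
  finally show ?thesis by (simp add: power_numeral_reduce algebra_simps)
qed

text \<open>The normal form bounds the integral of \<open>Q\<close> by the integral of
  \<open>q\<close>, and \<open>q\<close> is only the square root of \<open>Q\<close>. The estimate
  is therefore sublinear and closes for every \<open>T\<close> and every size of data.\<close>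

lemma apriori:
  assumes R: "sqrt (n2 B (\<zeta> 0)) \<le> R" and t: "t \<in> {0..T}"
  shows "integral {0..t} (\<lambda>s. Q B (U s (\<zeta> s))) \<le> CQ R T"
proof -
  have R0: "0 \<le> R" using R real_sqrt_ge_zero[OF n2_nonneg] order_trans by blast
  have sub: "{0..t} \<subseteq> {0..T}" using t by auto
  let ?A = "2 * ctri"
  let ?Q = "\<lambda>s. Q B (U s (\<zeta> s))"
  interpret qf: quartic_form "NR B" "\<lambda>_. 1" PhQ T \<zeta> \<zeta> \<zeta> \<zeta> r r r r
    by unfold_locales (simp_all add: NR_def PhQ_nz deriv cont_r)
  have iQ: "?Q integrable_on {0..t}" and iq: "q integrable_on {0..t}"
    using cont_Q cont_q by (auto intro!: integrable_continuous_real intro: continuous_on_subset[OF _ sub])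
  have "continuous_on {0..t} qf.form"
    unfolding qform_def split_def by (intro continuous_intros continuous_on_subset[OF cont sub])
  then have "qf.form integrable_on {0..t}" by (rule integrable_continuous_real)
  then have iF: "(qf.form has_integral (integral {0..t} qf.form)) {0..t}" by (rule integrable_integral)
  note iFR = has_integral_Re[OF iF]
  have n2R: "n2 B (\<zeta> 0) \<le> R\<^sup>2" using R by (simp add: sqrt_le_D)
  have "integral {0..t} ?Q \<le> integral {0..t} (\<lambda>s. 3 * (n2 B (\<zeta> 0))\<^sup>2 + Re (qf.form s))"
    using iFR by (intro integral_le iQ Q_le_form integrable_add) (use sub in \<open>auto simp: has_integral_integrable\<close>)
  also have "\<dots> = 3 * (n2 B (\<zeta> 0))\<^sup>2 * t + Re (integral {0..t} qf.form)"
    using t iFR by (subst integral_add) (auto simp: has_integral_integrable integral_unique)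
  also have "\<dots> \<le> 3 * R^4 * T + ?A * (2 * R^4 + 4 * R^4 * integral {0..t} q)"
  proof (intro add_mono)
    have "(n2 B (\<zeta> 0))\<^sup>2 \<le> (R\<^sup>2)\<^sup>2" using n2R by (intro power_mono) auto
    then show "3 * (n2 B (\<zeta> 0))\<^sup>2 * t \<le> 3 * R^4 * T" using t by (intro mult_mono) auto
    have "cmod (integral {0..t} qf.form) \<le> ?A * 1 powr - (1/8) * (2 * R^4 + 4 * R^4 * integral {0..t} q)"
    proof (rule form_bound_self[OF R t subset_refl])
      fix a b c d assume "(a, b, c, d) \<in> NR B"
      then have "1 \<le> sq4 a b c d" using nonres_ge_1(2) by (auto simp: NR_def)
      then show "1\<^sup>2 \<le> sq4 a b c d" "cmod 1 \<le> sqrt (sq4 a b c d)" by simp_all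
    qed simp
    then show "Re (integral {0..t} qf.form) \<le> ?A * (2 * R^4 + 4 * R^4 * integral {0..t} q)"
      using complex_Re_le_cmod order_trans by fastforce
  qed
  also have "?A * (2 * R^4 + 4 * R^4 * integral {0..t} q) \<le> 4 * ctri * R^4 + (32 * ctri\<^sup>2 * R^8 * T + 1/2 * integral {0..t} ?Q)"
  proof -
    \<comment> \<open>Half of \<open>0 \<le> (8 * ctri * R^4 - q s)\<^sup>2\<close>, arranged so
      that the coefficient of \<open>Q\<close> is \<open>1/2\<close>.\<close>
    have "8 * ctri * R^4 * q s \<le> 32 * ctri\<^sup>2 * R^8 + 1/2 * ?Q s" for s
      using zero_le_power2[of "8 * ctri * R^4 - q s"] unfolding power2_diff q_sq
      by (simp add: power_mult_distrib flip: power_mult)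
    then have "integral {0..t} (\<lambda>s. 8 * ctri * R^4 * q s) \<le> integral {0..t} (\<lambda>s. 32 * ctri\<^sup>2 * R^8 + 1/2 * ?Q s)"
      using iQ iq by (intro integral_le integrable_add integrable_on_mult_right) auto
    also have "\<dots> = 32 * ctri\<^sup>2 * R^8 * t + 1/2 * integral {0..t} ?Q"
      using t iQ by (subst integral_add) (auto intro: integrable_on_mult_right)
    also have "32 * ctri\<^sup>2 * R^8 * t \<le> 32 * ctri\<^sup>2 * R^8 * T" using t by (intro mult_left_mono) auto
    finally show ?thesis by (simp add: algebra_simps)
  qed
  finally show ?thesis unfolding CQ_def by simp
qed

lemma integral_q_le:
  assumes R: "sqrt (n2 B (\<zeta> 0)) \<le> R" and t: "t \<in> {0..T}"
  shows "integral {0..t} q \<le> T + CQ R T"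
proof -
  have sub: "{0..t} \<subseteq> {0..T}" using t by auto
  have iQ: "(\<lambda>s. Q B (U s (\<zeta> s))) integrable_on {0..t}" and iq: "q integrable_on {0..t}"
    using cont_Q cont_q by (auto intro!: integrable_continuous_real intro: continuous_on_subset[OF _ sub])
  have "q s \<le> 1 + Q B (U s (\<zeta> s))" for s
    using zero_le_power2[of "q s - 1"] q_nonneg[of s] q_sq[of s] Q_nonneg[of B "U s (\<zeta> s)"] unfolding power2_diff by (simp del: Q_nonneg)
  then have "integral {0..t} q \<le> integral {0..t} (\<lambda>s. 1 + Q B (U s (\<zeta> s)))"
    using iQ iq by (intro integral_le integrable_add) auto
  also have "\<dots> = t + integral {0..t} (\<lambda>s. Q B (U s (\<zeta> s)))"
    using t iQ by (subst integral_add) auto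
  finally show ?thesis using apriori[OF R t] t by auto
qed

text \<open>Energy beyond \<open>M\<close> changes only through quadruples whose output frequency
  exceeds \<open>M\<close>, so \<open>form_bound_self\<close> applies with \<open>K = M\<close> and
  gains \<open>real M powr - (1/8)\<close>. The bound depends neither on the cut-off nor on the
  box.\<close>

lemma tail_le:
  assumes R: "sqrt (n2 B (\<zeta> 0)) \<le> R" and t: "t \<in> {0..T}" and M: "1 \<le> M"
  shows "(\<Sum>n\<in>modes B - modes M. (cmod (\<zeta> t n))\<^sup>2) \<le> (\<Sum>n\<in>modes B - modes M. (cmod (\<zeta> 0 n))\<^sup>2) +
    2 * ctri * (2 * R^4 + 4 * R^4 * (T + CQ R T)) * real M powr - (1/8)"
proof -
  let ?S = "modes B - modes M"
  let ?F = "{q \<in> NR B. - snd (snd (snd q)) \<in> ?S}"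
  define \<kappa> where "\<kappa> = (\<lambda>(a :: int, b :: int, c :: int, d). - (2 * \<i> * of_real \<mu> * of_int d / 3) :: complex)"
  have "(\<Sum>n\<in>?S. (cmod (\<zeta> t n))\<^sup>2) - (\<Sum>n\<in>?S. (cmod (\<zeta> 0 n))\<^sup>2) =
    Re (integral {0..t} (qform ?F \<kappa> PhQ \<zeta> \<zeta> \<zeta> \<zeta>))"
    unfolding \<kappa>_def by (rule modes_change[OF _ t]) auto
  also have "\<dots> \<le> cmod (integral {0..t} (qform ?F \<kappa> PhQ \<zeta> \<zeta> \<zeta> \<zeta>))"
    by (rule complex_Re_le_cmod)
  also have "\<dots> \<le> 2 * ctri * real M powr - (1/8) * (2 * R^4 + 4 * R^4 * integral {0..t} q)"
  proof (rule form_bound_self[OF R t])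
    fix a b c d assume p: "(a, b, c, d) \<in> ?F"
    then have "int M < \<bar>d\<bar>" by (auto simp: modes_def)
    then have d: "real M \<le> \<bar>real_of_int d\<bar>" by linarith
    then have "(real M)\<^sup>2 \<le> \<bar>real_of_int d\<bar>\<^sup>2" by (intro power_mono) auto
    also have "\<dots> \<le> sq4 a b c d" unfolding sq4_def by simp
    finally show "(real M)\<^sup>2 \<le> sq4 a b c d" .
    have "\<bar>real_of_int d\<bar> \<le> sqrt (sq4 a b c d)" by (rule real_le_rsqrt) (simp add: sq4_def)
    then show "cmod (\<kappa> (a, b, c, d)) \<le> sqrt (sq4 a b c d)"
      using mu by (simp add: \<kappa>_def norm_mult norm_divide)
  qed (use M in auto)
  also have "\<dots> \<le> 2 * ctri * real M powr - (1/8) * (2 * R^4 + 4 * R^4 * (T + CQ R T))"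
    using integral_q_le[OF R t] ctri_nonneg by (intro mult_left_mono add_left_mono) auto
  also have "\<dots> = 2 * ctri * (2 * R^4 + 4 * R^4 * (T + CQ R T)) * real M powr - (1/8)" by (simp only: mult_ac)
  finally show ?thesis by linarith
qed

end

section \<open>Differences of quartic forms and of norms\<close>

lemma qform_diff4:
  "qform F \<kappa> \<Phi> x x x x s - qform F \<kappa> \<Phi> w w w w s =
    qform F \<kappa> \<Phi> (\<lambda>s n. x s n - w s n) x x x s + qform F \<kappa> \<Phi> w (\<lambda>s n. x s n - w s n) x x s +
    qform F \<kappa> \<Phi> w w (\<lambda>s n. x s n - w s n) x s + qform F \<kappa> \<Phi> w w w (\<lambda>s n. x s n - w s n) s"
  unfolding qform_def sum_subtractf[symmetric] sum.distrib[symmetric]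
  by (rule sum.cong) (auto simp: algebra_simps)

lemma qform_diff3:
  "qform F \<kappa> \<Phi> x x x v s - qform F \<kappa> \<Phi> w w w v s =
    qform F \<kappa> \<Phi> (\<lambda>s n. x s n - w s n) x x v s + qform F \<kappa> \<Phi> w (\<lambda>s n. x s n - w s n) x v s +
    qform F \<kappa> \<Phi> w w (\<lambda>s n. x s n - w s n) v s"
  unfolding qform_def sum_subtractf[symmetric] sum.distrib[symmetric]
  by (rule sum.cong) (auto simp: algebra_simps)

lemma qform_scale: "qform F (\<lambda>p. c * \<kappa> p) \<Phi> x y z w s = c * qform F \<kappa> \<Phi> x y z w s"
  unfolding qform_def sum_distrib_left by (rule sum.cong) (auto simp: mult_ac)

lemma qform_union:
  "finite F \<Longrightarrow> finite G \<Longrightarrow> F \<inter> G = {} \<Longrightarrow>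
    qform (F \<union> G) \<kappa> \<Phi> x y z w s = qform F \<kappa> \<Phi> x y z w s + qform G \<kappa> \<Phi> x y z w s"
  unfolding qform_def by (rule sum.union_disjoint)

lemma continuous_qform:
  assumes "\<And>n. continuous_on S (\<lambda>s. x s n)" "\<And>n. continuous_on S (\<lambda>s. y s n)"
    "\<And>n. continuous_on S (\<lambda>s. z s n)" "\<And>n. continuous_on S (\<lambda>s. w s n)"
  shows "continuous_on S (qform F \<kappa> \<Phi> x y z w)"
  unfolding qform_def split_def by (intro continuous_intros assms)

lemma sq_diff_le: "\<bar>(cmod a)\<^sup>2 - (cmod b)\<^sup>2\<bar> \<le> cmod (a - b) * (cmod a + cmod b)"
proof -
  have "(cmod a)\<^sup>2 - (cmod b)\<^sup>2 = (cmod a - cmod b) * (cmod a + cmod b)"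
    by (simp add: power2_eq_square algebra_simps)
  moreover have "\<bar>cmod a - cmod b\<bar> \<le> cmod (a - b)" by (rule norm_triangle_ineq3)
  ultimately show ?thesis by (simp add: abs_mult mult_right_mono)
qed

lemma sum_mult_le_n2: "(\<Sum>n\<in>modes B. cmod (x n) * cmod (w n)) \<le> sqrt (n2 B x) * sqrt (n2 B w)"
  by (rule CS_sum_le) (simp_all add: n2_def sum_nonneg)

lemma n2_diff_le:
  "\<bar>n2 B x - n2 B w\<bar> \<le> sqrt (n2 B (\<lambda>n. x n - w n)) * (sqrt (n2 B x) + sqrt (n2 B w))"
proof -
  have "\<bar>n2 B x - n2 B w\<bar> \<le> (\<Sum>n\<in>modes B. \<bar>(cmod (x n))\<^sup>2 - (cmod (w n))\<^sup>2\<bar>)"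
    unfolding n2_def sum_subtractf[symmetric] by (rule sum_abs)
  also have "\<dots> \<le> (\<Sum>n\<in>modes B. cmod (x n - w n) * cmod (x n)) + (\<Sum>n\<in>modes B. cmod (x n - w n) * cmod (w n))"
    unfolding sum.distrib[symmetric] distrib_left[symmetric] by (intro sum_mono sq_diff_le)
  also have "\<dots> \<le> sqrt (n2 B (\<lambda>n. x n - w n)) * (sqrt (n2 B x) + sqrt (n2 B w))"
    unfolding distrib_left by (intro add_mono sum_mult_le_n2)
  finally show ?thesis .
qed

lemma n2_triangle: "sqrt (n2 B (\<lambda>n. x n - w n)) \<le> sqrt (n2 B x) + sqrt (n2 B w)"
proof -
  have "n2 B (\<lambda>n. x n - w n) \<le> (\<Sum>n\<in>modes B. (cmod (x n))\<^sup>2 + (cmod (w n))\<^sup>2 + 2 * (cmod (x n) * cmod (w n)))"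
    unfolding n2_def
  proof (rule sum_mono)
    fix n
    have "(cmod (x n - w n))\<^sup>2 \<le> (cmod (x n) + cmod (w n))\<^sup>2"
      by (intro power_mono norm_triangle_ineq4) simp
    then show "(cmod (x n - w n))\<^sup>2 \<le> (cmod (x n))\<^sup>2 + (cmod (w n))\<^sup>2 + 2 * (cmod (x n) * cmod (w n))"
      by (simp add: power2_sum)
  qed
  also have "\<dots> = n2 B x + n2 B w + 2 * (\<Sum>n\<in>modes B. cmod (x n) * cmod (w n))"
    by (simp add: n2_def sum.distrib sum_distrib_left)
  also have "\<dots> \<le> (sqrt (n2 B x) + sqrt (n2 B w))\<^sup>2"
    using sum_mult_le_n2[of x w B] by (simp add: power2_sum)
  finally show ?thesis by (simp add: real_le_lsqrt)
qed

lemma cmod_le_n2: "n \<in> modes B \<Longrightarrow> cmod (x n) \<le> sqrt (n2 B x)"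
  unfolding n2_def by (rule real_le_rsqrt) (auto intro: member_le_sum[of n "modes B" "\<lambda>n. (cmod (x n))\<^sup>2"])

lemma adm_mono:
  assumes a: "adm F \<omega> A A1 L'" and le: "A1 \<le> A2"
  shows "adm F \<omega> A A2 L'"
proof -
  have m: "(A * h + A1 * m) * (X * Y * Z) \<le> (A * h + A2 * m) * (X * Y * Z)"
    if "sb u h m L'" "l2b x X" "l2b y Y" "l2b z Z" for u x y z h m X Y Z
    using that le by (intro mult_right_mono add_left_mono mult_nonneg_nonneg) (auto simp: sb_def l2b_def)
  have 1: "wsum F \<omega> x y z w \<le> (A * h + A2 * m) * (Y * Z * W)" if "sb x h m L'" "l2b y Y" "l2b z Z" "l2b w W" for x y z w X Y Z W h m
  proof -
    have "wsum F \<omega> x y z w \<le> (A * h + A1 * m) * (Y * Z * W)" using a that unfolding adm_def by blast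
    then show ?thesis using m[OF that(1) that(2) that(3) that(4)] by (rule order_trans)
  qed
  have 2: "wsum F \<omega> x y z w \<le> (A * h + A2 * m) * (X * Z * W)" if "l2b x X" "sb y h m L'" "l2b z Z" "l2b w W" for x y z w X Y Z W h m
  proof -
    have "wsum F \<omega> x y z w \<le> (A * h + A1 * m) * (X * Z * W)" using a that unfolding adm_def by blast
    then show ?thesis using m[OF that(2) that(1) that(3) that(4)] by (rule order_trans)
  qed
  have 3: "wsum F \<omega> x y z w \<le> (A * h + A2 * m) * (X * Y * W)" if "l2b x X" "l2b y Y" "sb z h m L'" "l2b w W" for x y z w X Y Z W h m
  proof -
    have "wsum F \<omega> x y z w \<le> (A * h + A1 * m) * (X * Y * W)" using a that unfolding adm_def by blast
    then show ?thesis using m[OF that(3) that(1) that(2) that(4)] by (rule order_trans)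
  qed
  have 4: "wsum F \<omega> x y z w \<le> (A * h + A2 * m) * (X * Y * Z)" if "l2b x X" "l2b y Y" "l2b z Z" "sb w h m L'" for x y z w X Y Z W h m
  proof -
    have "wsum F \<omega> x y z w \<le> (A * h + A1 * m) * (X * Y * Z)" using a that unfolding adm_def by blast
    then show ?thesis using m[OF that(4) that(1) that(2) that(3)] by (rule order_trans)
  qed
  show ?thesis unfolding adm_def
    by (intro allI conjI impI; elim conjE; (erule (3) 1 | erule (3) 2 | erule (3) 3 | erule (3) 4))
qed

section \<open>Difference of two truncated solutions\<close>

text \<open>\<open>M\<close> separates the frequencies whose difference is followed in time from
  those where both solutions are small by \<open>tail_le\<close>. It lies below both cut-offs, so
  neither projection affects the low modes directly.\<close>

locale galerkin_pair = kaw \<beta> \<gamma> \<mu> + g1: galerkin \<beta> \<gamma> \<mu> N1 B T \<zeta> + g2: galerkin \<beta> \<gamma> \<mu> N2 B T \<xi>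
  for \<beta> \<gamma> \<mu> :: real and N1 N2 B :: nat and T :: real and \<zeta> \<xi> +
  fixes R :: real and M :: nat
  assumes R1: "sqrt (n2 B (\<zeta> 0)) \<le> R" and R2: "sqrt (n2 B (\<xi> 0)) \<le> R"
    and M: "1 \<le> M" "M \<le> N1" "M \<le> N2"
begin

definition y :: "real \<Rightarrow> int \<Rightarrow> complex" where "y s n = \<zeta> s n - \<xi> s n"
definition dy :: "real \<Rightarrow> int \<Rightarrow> complex" where "dy s n = rhs N1 B s (\<zeta> s) n - rhs N2 B s (\<xi> s) n"
definition e :: "real \<Rightarrow> real" where "e s = sqrt (n2 B (y s))"
text \<open>The summand \<open>1\<close> gives \<open>1 \<le> k s\<close>, so that terms without
  such a factor can also be written as integrals against \<open>k\<close>.\<close>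

definition k :: "real \<Rightarrow> real" where "k s = 1 + g1.q s + g2.q s"
definition L :: real where "L = real (min N1 N2)"
definition bd :: "bool \<Rightarrow> real \<Rightarrow> real" where "bd f s = (if f then e s else R)"

lemma y_eq: "y = (\<lambda>s n. \<zeta> s n - \<xi> s n)" by (intro ext) (simp add: y_def)

lemma L: "1 \<le> L" "real M \<le> L" using M by (auto simp: L_def)

lemma R_nonneg: "0 \<le> R" using R1 real_sqrt_ge_zero[OF n2_nonneg] order_trans by blast

lemma k_ge_1: "1 \<le> k s" by (simp add: k_def)

lemma e_nonneg [simp]: "0 \<le> e s" by (simp add: e_def)

lemma cont_y: "continuous_on {0..T} (\<lambda>s. y s n)"
  unfolding y_def by (intro continuous_intros g1.cont g2.cont)

lemma cont_e: "continuous_on {0..T} e"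
  unfolding e_def n2_def by (intro continuous_intros cont_y)

lemma cont_k: "continuous_on {0..T} k"
  unfolding k_def by (intro continuous_intros g1.cont_q g2.cont_q)

lemma supp_y: "supp (y s) B" unfolding y_eq by (intro supp_diff g1.supp_B g2.supp_B)
lemma herm_y: "herm (y s)" unfolding y_eq by (intro herm_diff g1.herm g2.herm)

lemma R_zeta: "s \<in> {0..T} \<Longrightarrow> sqrt (n2 B (\<zeta> s)) \<le> R" using R1 by (simp only: g1.energy)
lemma R_xi: "s \<in> {0..T} \<Longrightarrow> sqrt (n2 B (\<xi> s)) \<le> R" using R2 by (simp only: g2.energy)

lemma e_le: "s \<in> {0..T} \<Longrightarrow> e s \<le> 2 * R"
  using n2_triangle[of B "\<zeta> s" "\<xi> s"] R_zeta R_xi unfolding e_def y_eq by fastforce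

text \<open>Below both cut-offs the two vector fields agree in form and \<open>cub_diff_le\<close>
  produces the factor \<open>e s\<close>. Beyond the smaller cut-off they are estimated separately
  without any gain; there \<open>L \<le> jb n\<close>, so the power in \<open>sb\<close> is at least
  one and the loss is charged to \<open>m\<close>.\<close>

lemma sb_dy: assumes s: "s \<in> {0..T}" shows "sb (dy s) (e s * k s) (R * k s) L"
  unfolding sb_def
proof (intro conjI allI)
  show "0 \<le> e s * k s" "0 \<le> R * k s" using k_ge_1[of s] R_nonneg by auto
  fix n
  show "cmod (dy s n) \<le> jb n * (e s * k s + R * k s * (jb n / L) powr (1/8))"
  proof (cases "n \<in> modes (min N1 N2)")
    case True
    then have n: "n \<in> modes N1" "n \<in> modes N2" by (auto simp: modes_def)
    have dyn: "dy s n = \<i> * of_real (\<mu> * of_int n / 3) * cis (- (s * phase \<beta> \<gamma> n)) * (cub B (U s (\<zeta> s)) n - cub B (U s (\<xi> s)) n)"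
      using n unfolding dy_def rhs_def by (simp add: algebra_simps)
    have "cmod (dy s n) = \<bar>real_of_int n\<bar> / 3 * cmod (cub B (U s (\<zeta> s)) n - cub B (U s (\<xi> s)) n)"
      unfolding dyn norm_mult norm_ii norm_cis norm_of_real by (simp add: abs_mult mu)
    also have "\<dots> \<le> \<bar>real_of_int n\<bar> / 3 * (2 * sqrt (n2 B (\<lambda>n. U s (\<zeta> s) n - U s (\<xi> s) n)) * (g1.q s + g2.q s))"
      unfolding g1.q_def g2.q_def
      by (intro mult_left_mono cub_diff_le supp_U herm_U g1.supp_B g2.supp_B g1.herm g2.herm) auto
    also have "\<dots> \<le> jb n / 3 * (3 * (e s * k s))"
      unfolding U_diff n2_U y_eq[symmetric]
    proof (rule mult_mono)
      have "2 * (e s * (g1.q s + g2.q s)) \<le> 3 * (e s * k s)"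
        by (intro mult_mono) (auto simp: k_def intro!: mult_left_mono mult_nonneg_nonneg add_nonneg_nonneg)
      then show "2 * sqrt (n2 B (\<lambda>n. \<zeta> s n - \<xi> s n)) * (g1.q s + g2.q s) \<le> 3 * (e s * k s)"
        by (simp add: e_def y_eq mult.assoc)
    qed (auto simp: jb_def)
    also have "\<dots> = jb n * (e s * k s + 0)" by simp
    also have "\<dots> \<le> jb n * (e s * k s + R * k s * (jb n / L) powr (1/8))"
      using k_ge_1[of s] R_nonneg by (intro mult_left_mono add_left_mono mult_nonneg_nonneg) (auto simp: jb_def)
    finally show ?thesis .
  next
    case False
    then have "int (min N1 N2) < \<bar>n\<bar>" by (auto simp: modes_def)
    then have "L \<le> jb n" unfolding jb_def L_def by linarith
    then have p: "1 \<le> (jb n / L) powr (1/8)" using L by (intro ge_one_powr_ge_zero) auto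
    have "cmod (dy s n) \<le> cmod (g1.r s n) + cmod (g2.r s n)" unfolding dy_def by (rule norm_triangle_ineq4)
    also have "\<dots> \<le> jb n * (R * g1.q s) + jb n * (R * g2.q s)"
    proof (rule add_mono)
      show "cmod (g1.r s n) \<le> jb n * (R * g1.q s)" using g1.sb_r[OF R1 s, of 1] by (simp add: sb_def)
      show "cmod (g2.r s n) \<le> jb n * (R * g2.q s)" using g2.sb_r[OF R2 s, of 1] by (simp add: sb_def)
    qed
    also have "\<dots> \<le> jb n * (R * k s)" unfolding k_def using R_nonneg by (simp add: algebra_simps jb_def)
    also have "\<dots> \<le> jb n * (e s * k s + R * k s * (jb n / L) powr (1/8))"
    proof (rule mult_left_mono)
      have "R * k s * 1 \<le> R * k s * (jb n / L) powr (1/8)"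
        using p R_nonneg k_ge_1[of s] by (intro mult_left_mono) auto
      moreover have "0 \<le> e s * k s" using k_ge_1[of s] by auto
      ultimately show "R * k s \<le> e s * k s + R * k s * (jb n / L) powr (1/8)" by linarith
    qed (simp add: jb_def)
    finally show ?thesis .
  qed
qed

text \<open>The flag is set when the slot is filled with the difference of the two solutions.\<close>

definition slot :: "bool \<Rightarrow> (real \<Rightarrow> int \<Rightarrow> complex) \<Rightarrow> (real \<Rightarrow> int \<Rightarrow> complex) \<Rightarrow> bool" where
  "slot f x x' \<longleftrightarrow>
    (\<forall>s\<in>{0..T}. \<forall>n. ((\<lambda>s. x s n) has_vector_derivative x' s n) (at s within {0..T})) \<and>
    (\<forall>n. continuous_on {0..T} (\<lambda>s. x' s n)) \<and> (\<forall>s\<in>{0..T}. l2b (x s) (bd f s)) \<and>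
    (\<forall>s\<in>{0..T}. sb (x' s) (bd f s * k s) (if f then R * k s else 0) L)"

lemma sb_mono: "sb x h m L' \<Longrightarrow> h \<le> h' \<Longrightarrow> sb x h' m L'"
  unfolding sb_def
proof (intro conjI allI; elim conjE)
  fix n assume a: "h \<le> h'" "\<forall>n. cmod (x n) \<le> jb n * (h + m * (jb n / L') powr (1/8))"
  have "jb n * (h + m * (jb n / L') powr (1/8)) \<le> jb n * (h' + m * (jb n / L') powr (1/8))"
    using a by (intro mult_left_mono) (auto simp: jb_def)
  then show "cmod (x n) \<le> jb n * (h' + m * (jb n / L') powr (1/8))" using a(2) order_trans by blast
qed auto

lemma slot_zeta: "slot False \<zeta> g1.r"
  unfolding slot_def
proof (intro conjI ballI allI)
  fix s assume s: "s \<in> {0..T}"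
  show "sb (g1.r s) (bd False s * k s) (if False then R * k s else 0) L"
    using sb_mono[OF g1.sb_r[OF R1 s], of "R * k s"] R_nonneg by (simp add: bd_def k_def mult_left_mono)
  show "l2b (\<zeta> s) (bd False s)" using g1.l2b_zeta[OF R1 s] by (simp add: bd_def)
qed (use g1.deriv g1.cont_r in auto)

lemma slot_xi: "slot False \<xi> g2.r"
  unfolding slot_def
proof (intro conjI ballI allI)
  fix s assume s: "s \<in> {0..T}"
  show "sb (g2.r s) (bd False s * k s) (if False then R * k s else 0) L"
    using sb_mono[OF g2.sb_r[OF R2 s], of "R * k s"] R_nonneg by (simp add: bd_def k_def mult_left_mono)
  show "l2b (\<xi> s) (bd False s)" using g2.l2b_zeta[OF R2 s] by (simp add: bd_def)
qed (use g2.deriv g2.cont_r in auto)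

lemma slot_y: "slot True y dy"
  unfolding slot_def
proof (intro conjI ballI allI)
  fix s n assume s: "s \<in> {0..T}"
  show "((\<lambda>s. y s n) has_vector_derivative dy s n) (at s within {0..T})"
    unfolding y_def dy_def by (intro has_vector_derivative_diff g1.deriv g2.deriv s)
next
  fix s assume s: "s \<in> {0..T}"
  show "sb (dy s) (bd True s * k s) (if True then R * k s else 0) L" using sb_dy[OF s] by (simp add: bd_def)
  show "l2b (y s) (bd True s)" using l2b_supp[OF supp_y] by (simp add: bd_def e_def)
next
  fix n show "continuous_on {0..T} (\<lambda>s. dy s n)"
    unfolding dy_def by (intro continuous_intros g1.cont_r g2.cont_r)
qed

text \<open>The integrand of \<open>form_integral_adm\<close> for slots of the sizes prescribed by
  the flags; a contribution of \<open>A'\<close> arises only when the derivative falls on a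
  difference.\<close>

definition J :: "real \<Rightarrow> real \<Rightarrow> bool \<Rightarrow> bool \<Rightarrow> bool \<Rightarrow> bool \<Rightarrow> real \<Rightarrow> real" where
  "J A A' f1 f2 f3 f4 s =
    (A * (bd f1 s * k s) + A' * (if f1 then R * k s else 0)) * (bd f2 s * bd f3 s * bd f4 s) +
    (A * (bd f2 s * k s) + A' * (if f2 then R * k s else 0)) * (bd f1 s * bd f3 s * bd f4 s) +
    (A * (bd f3 s * k s) + A' * (if f3 then R * k s else 0)) * (bd f1 s * bd f2 s * bd f4 s) +
    (A * (bd f4 s * k s) + A' * (if f4 then R * k s else 0)) * (bd f1 s * bd f2 s * bd f3 s)"

lemma cont_bd: "continuous_on {0..T} (bd f)" unfolding bd_def by (cases f) (auto intro: cont_e)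

lemma form_bound_slots:
  assumes s1: "slot f1 x1 y1" and s2: "slot f2 x2 y2" and s3: "slot f3 x3 y3" and s4: "slot f4 x4 y4"
    and F: "F \<subseteq> NR B" and adm: "adm F (\<lambda>p. cmod (\<kappa> p) / \<bar>PhQ p\<bar>) A A' L" "0 \<le> A" "0 \<le> A'" and t: "t \<in> {0..T}"
  shows "cmod (integral {0..t} (qform F \<kappa> PhQ x1 x2 x3 x4)) \<le>
     A * (bd f1 t * bd f2 t * bd f3 t * bd f4 t) + A * (bd f1 0 * bd f2 0 * bd f3 0 * bd f4 0) +
     integral {0..t} (J A A' f1 f2 f3 f4)"
proof -
  have fin: "finite F" by (rule finite_subset[OF F]) simp
  have nr: "nonres p" if "p \<in> F" for p using F that by (auto simp: NR_def)
  interpret qf: quartic_form F \<kappa> PhQ T x1 x2 x3 x4 y1 y2 y3 y4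
    by unfold_locales (use s1 s2 s3 s4 in \<open>simp_all add: fin slot_def nr PhQ_nz\<close>)
  have w: "qf.\<omega> = (\<lambda>p. cmod (\<kappa> p) / \<bar>PhQ p\<bar>)" by (auto simp: qf.\<omega>_def)
  have cm: "continuous_on {0..T} (\<lambda>s. if f then R * k s else 0)" for f
    by (cases f) (auto intro!: continuous_intros cont_k)
  show ?thesis unfolding J_def
    by (rule qf.form_integral_adm[OF t adm(1)[folded w] adm(2,3) L(1)])
      (use s1 s2 s3 s4 in \<open>simp_all add: slot_def cont_bd cm continuous_on_mult cont_k\<close>)
qed

section \<open>Forms with one and with two difference slots\<close>

definition Ik :: "real \<Rightarrow> real" where "Ik t = integral {0..t} k"
definition Iek :: "real \<Rightarrow> real" where "Iek t = integral {0..t} (\<lambda>s. k s * e s)"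
definition W :: "real \<Rightarrow> real" where "W t = integral {0..t} (\<lambda>s. k s * (e s)\<^sup>2)"

lemma cont_sub: "t \<in> {0..T} \<Longrightarrow> continuous_on {0..t} e" "t \<in> {0..T} \<Longrightarrow> continuous_on {0..t} k"
  using cont_e cont_k by (auto intro: continuous_on_subset)

lemma integrable_sub:
  assumes "t \<in> {0..T}"
  shows "k integrable_on {0..t}" "(\<lambda>s. k s * e s) integrable_on {0..t}" "(\<lambda>s. k s * (e s)\<^sup>2) integrable_on {0..t}"
    "(\<lambda>s. (e s)\<^sup>2) integrable_on {0..t}"
  by (intro integrable_continuous_real continuous_intros cont_sub assms)+

text \<open>With a single difference slot the form is linear in \<open>e\<close>. The cut-off error
  appears when the derivative falls on that slot, and then no factor \<open>e\<close>
  survives.\<close>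

lemma form_bound_1:
  assumes F: "F \<subseteq> NR B" and adm: "adm F (\<lambda>p. cmod (\<kappa> p) / \<bar>PhQ p\<bar>) A A' L" "0 \<le> A" "0 \<le> A'" and t: "t \<in> {0..T}"
    and s: "slot f1 x1 y1" "slot f2 x2 y2" "slot f3 x3 y3" "slot f4 x4 y4"
    and f: "(f1, f2, f3, f4) \<in> {(True, False, False, False), (False, True, False, False), (False, False, True, False), (False, False, False, True)}"
  shows "cmod (integral {0..t} (qform F \<kappa> PhQ x1 x2 x3 x4)) \<le>
    A * R^3 * (e t + e 0) + 4 * A * R^3 * Iek t + A' * R^4 * Ik t"
proof -
  have J: "J A A' f1 f2 f3 f4 = (\<lambda>s. 4 * A * R^3 * (k s * e s) + A' * R^4 * k s)"
    using f by (auto simp: J_def bd_def power_numeral_reduce algebra_simps)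
  have b: "bd f1 s * bd f2 s * bd f3 s * bd f4 s = R^3 * e s" for s
    using f by (auto simp: bd_def power_numeral_reduce)
  have "integral {0..t} (J A A' f1 f2 f3 f4) = 4 * A * R^3 * Iek t + A' * R^4 * Ik t"
    unfolding J Iek_def Ik_def using integrable_sub[OF t]
    by (subst integral_add) (auto intro: integrable_on_mult_right)
  then show ?thesis using form_bound_slots[OF s F adm t] unfolding b by (simp add: algebra_simps)
qed

text \<open>The last slot and one other hold the difference, so the form is quadratic in
  \<open>e\<close>, and the cut-off error still keeps one factor \<open>e\<close>.\<close>

lemma form_bound_2:
  assumes F: "F \<subseteq> NR B" and adm: "adm F (\<lambda>p. cmod (\<kappa> p) / \<bar>PhQ p\<bar>) A A' L" "0 \<le> A" "0 \<le> A'" and t: "t \<in> {0..T}"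
    and s: "slot f1 x1 y1" "slot f2 x2 y2" "slot f3 x3 y3" "slot True x4 y4"
    and f: "(f1, f2, f3) \<in> {(True, False, False), (False, True, False), (False, False, True)}"
  shows "cmod (integral {0..t} (qform F \<kappa> PhQ x1 x2 x3 x4)) \<le>
    A * R\<^sup>2 * ((e t)\<^sup>2 + (e 0)\<^sup>2) + 4 * A * R\<^sup>2 * W t + 2 * A' * R^3 * Iek t"
proof -
  have J: "J A A' f1 f2 f3 True = (\<lambda>s. 4 * A * R\<^sup>2 * (k s * (e s)\<^sup>2) + 2 * A' * R^3 * (k s * e s))"
    using f by (auto simp: J_def bd_def power_numeral_reduce power2_eq_square algebra_simps)
  have b: "bd f1 s * bd f2 s * bd f3 s * bd True s = R\<^sup>2 * (e s)\<^sup>2" for s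
    using f by (auto simp: bd_def power2_eq_square)
  have "integral {0..t} (J A A' f1 f2 f3 True) = 4 * A * R\<^sup>2 * W t + 2 * A' * R^3 * Iek t"
    unfolding J Iek_def W_def using integrable_sub[OF t]
    by (subst integral_add) (auto intro: integrable_on_mult_right)
  then show ?thesis using form_bound_slots[OF s F adm t] unfolding b by (simp add: algebra_simps)
qed

definition A4 :: real where "A4 = 24 * zc (7/4)"

lemma A4_nonneg: "0 \<le> A4" by (simp add: A4_def zc_nonneg)

text \<open>The cut-off error as seen by frequencies up to \<open>M\<close>; for fixed
  \<open>M\<close> it tends to zero when both cut-offs grow.\<close>

definition \<delta> :: real where "\<delta> = (real M / L) powr (1/8)"

text \<open>The amplitude of mode \<open>n\<close> changes only through nonresonant quadruples with
  \<open>d = - n\<close>. Their coefficient already contains one factor \<open>n\<close>, so with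
  the prefactor the weight carries \<open>n\<close> squared, exactly what the two derivatives gained
  by the phase can pay for (\<open>adm_fixed\<close>). Telescoping the difference of the two forms
  puts \<open>y\<close> into one slot at a time, so the bound is linear in the difference up to the
  cut-off error.\<close>

lemma amplitude_diff:
  assumes n: "n \<in> modes M" and t: "t \<in> {0..T}"
  shows "\<bar>real_of_int n\<bar> * \<bar>((cmod (\<zeta> t n))\<^sup>2 - (cmod (\<zeta> 0 n))\<^sup>2) - ((cmod (\<xi> t n))\<^sup>2 - (cmod (\<xi> 0 n))\<^sup>2)\<bar>
    \<le> 4 * (A4 * R^3 * (e t + e 0) + 4 * A4 * R^3 * Iek t + A4 * \<delta> * R^4 * Ik t)"
proof -
  have nB: "{n} \<subseteq> modes B" using n M g1.NB by (auto simp: modes_def)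
  let ?F = "{q \<in> NR B. - snd (snd (snd q)) \<in> {n}}"
  define \<kappa> where "\<kappa> = (\<lambda>(a :: int, b :: int, c :: int, d). - (2 * \<i> * of_real \<mu> * of_int d / 3) :: complex)"
  define \<kappa>' where "\<kappa>' = (\<lambda>p. of_int n * \<kappa> p)"
  let ?D = "((cmod (\<zeta> t n))\<^sup>2 - (cmod (\<zeta> 0 n))\<^sup>2) - ((cmod (\<xi> t n))\<^sup>2 - (cmod (\<xi> 0 n))\<^sup>2)"
  have sub: "{0..t} \<subseteq> {0..T}" using t by auto
  have int: "qform ?F \<kappa>' PhQ x1 x2 x3 x4 integrable_on {0..t}"
    if "x1 \<in> {\<zeta>, \<xi>, y}" "x2 \<in> {\<zeta>, \<xi>, y}" "x3 \<in> {\<zeta>, \<xi>, y}" "x4 \<in> {\<zeta>, \<xi>, y}" for x1 x2 x3 x4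
    using that by (intro integrable_continuous_real continuous_qform continuous_on_subset[OF _ sub])
      (auto simp: g1.cont g2.cont cont_y)
  have adm: "adm ?F (\<lambda>p. cmod (\<kappa>' p) / \<bar>PhQ p\<bar>) A4 (A4 * \<delta>) L"
  proof -
    have "adm ?F (\<lambda>p. cmod (\<kappa>' p) / \<bar>PhQ p\<bar>) (24 * zc (7/4)) (24 * zc (7/4) * (jb (- n) / L) powr (1/8)) L"
    proof (rule adm_fixed)
      fix a b c d assume p: "(a, b, c, d) \<in> ?F"
      then have nr: "nonres (a, b, c, d)" and d: "d = - n" by (auto simp: NR_def)
      then show "d = - n" by simp
      have "cmod (\<kappa>' (a, b, c, d)) = 2 / 3 * (real_of_int d)\<^sup>2"
        using mu unfolding \<kappa>'_def \<kappa>_def d by (simp add: norm_mult norm_divide power2_eq_square abs_mult[symmetric])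
      then have "cmod (\<kappa>' (a, b, c, d)) \<le> (real_of_int d)\<^sup>2"
        using zero_le_power2[of "real_of_int d"] by linarith
      then show "cmod (\<kappa>' (a, b, c, d)) / \<bar>PhQ (a, b, c, d)\<bar> \<le> (real_of_int d)\<^sup>2 / (pp a b c * sq4 a b c d)"
        by (intro weight_le nr) auto
    qed (auto simp: NR_def L)
    moreover have "24 * zc (7/4) * (jb (- n) / L) powr (1/8) \<le> A4 * \<delta>"
    proof -
      have "\<bar>n\<bar> \<le> int M" using n by (auto simp: modes_def)
      then have "\<bar>real_of_int n\<bar> \<le> real M" by linarith
      then have "jb (- n) \<le> real M" using M by (simp add: jb_def)
      then show ?thesis unfolding A4_def \<delta>_def using L
        by (intro mult_left_mono powr_mono2 divide_right_mono) (auto simp: jb_def zc_nonneg)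
    qed
    ultimately show ?thesis unfolding A4_def by (rule adm_mono)
  qed
  have c: "qform ?F \<kappa>' PhQ \<zeta> \<zeta> \<zeta> \<zeta> integrable_on {0..t}" "qform ?F \<kappa>' PhQ \<xi> \<xi> \<xi> \<xi> integrable_on {0..t}"
    by (rule int; simp)+
  have i1: "integral {0..t} (qform ?F \<kappa>' PhQ x x x x) = of_int n * integral {0..t} (qform ?F \<kappa> PhQ x x x x)" for x
    unfolding \<kappa>'_def qform_scale by simp
  have "real_of_int n * ?D = Re (of_int n * integral {0..t} (qform ?F \<kappa> PhQ \<zeta> \<zeta> \<zeta> \<zeta>) - of_int n * integral {0..t} (qform ?F \<kappa> PhQ \<xi> \<xi> \<xi> \<xi>))"
    using g1.modes_change[OF nB t] g2.modes_change[OF nB t] unfolding \<kappa>_def by (simp add: algebra_simps)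
  also have "of_int n * integral {0..t} (qform ?F \<kappa> PhQ \<zeta> \<zeta> \<zeta> \<zeta>) - of_int n * integral {0..t} (qform ?F \<kappa> PhQ \<xi> \<xi> \<xi> \<xi>) =
     integral {0..t} (\<lambda>s. qform ?F \<kappa>' PhQ \<zeta> \<zeta> \<zeta> \<zeta> s - qform ?F \<kappa>' PhQ \<xi> \<xi> \<xi> \<xi> s)"
    unfolding i1[symmetric] by (rule integral_diff[OF c, symmetric])
  also have "\<dots> = integral {0..t} (qform ?F \<kappa>' PhQ y \<zeta> \<zeta> \<zeta>) + integral {0..t} (qform ?F \<kappa>' PhQ \<xi> y \<zeta> \<zeta>) +
     integral {0..t} (qform ?F \<kappa>' PhQ \<xi> \<xi> y \<zeta>) + integral {0..t} (qform ?F \<kappa>' PhQ \<xi> \<xi> \<xi> y)"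
    unfolding qform_diff4 y_eq[symmetric]
    by (rule integral_unique, intro has_integral_add integrable_integral int) auto
  finally have eq: "real_of_int n * ?D = Re \<dots>" .
  have FN: "?F \<subseteq> NR B" by auto
  have d0: "0 \<le> A4 * \<delta>" using A4_nonneg by (simp add: \<delta>_def)
  note fb = form_bound_1[OF FN adm A4_nonneg d0 t]
  let ?b = "A4 * R^3 * (e t + e 0) + 4 * A4 * R^3 * Iek t + A4 * \<delta> * R^4 * Ik t"
  have "\<bar>real_of_int n\<bar> * \<bar>?D\<bar> = \<bar>real_of_int n * ?D\<bar>" by (simp only: abs_mult)
  also have "\<dots> \<le> cmod (integral {0..t} (qform ?F \<kappa>' PhQ y \<zeta> \<zeta> \<zeta>) + integral {0..t} (qform ?F \<kappa>' PhQ \<xi> y \<zeta> \<zeta>) +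
     integral {0..t} (qform ?F \<kappa>' PhQ \<xi> \<xi> y \<zeta>) + integral {0..t} (qform ?F \<kappa>' PhQ \<xi> \<xi> \<xi> y))"
    unfolding eq by (rule abs_Re_le_cmod)
  also have "\<dots> \<le> ?b + ?b + ?b + ?b"
  proof (intro norm_triangle_le add_mono)
    show "cmod (integral {0..t} (qform ?F \<kappa>' PhQ y \<zeta> \<zeta> \<zeta>)) \<le> ?b"
      by (rule fb[OF slot_y slot_zeta slot_zeta slot_zeta]) simp
    show "cmod (integral {0..t} (qform ?F \<kappa>' PhQ \<xi> y \<zeta> \<zeta>)) \<le> ?b"
      by (rule fb[OF slot_xi slot_y slot_zeta slot_zeta]) simp
    show "cmod (integral {0..t} (qform ?F \<kappa>' PhQ \<xi> \<xi> y \<zeta>)) \<le> ?b"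
      by (rule fb[OF slot_xi slot_xi slot_y slot_zeta]) simp
    show "cmod (integral {0..t} (qform ?F \<kappa>' PhQ \<xi> \<xi> \<xi> y)) \<le> ?b"
      by (rule fb[OF slot_xi slot_xi slot_xi slot_y]) simp
  qed
  finally show ?thesis by simp
qed

end

lemma integral_lower_le:
  fixes f :: "real \<Rightarrow> real"
  assumes "f integrable_on {0..t}" "f integrable_on {0..s}" "0 \<le> s" "s \<le> t" "\<And>x. 0 \<le> f x"
  shows "integral {0..s} f \<le> integral {0..t} f"
  using assms by (intro integral_subset_le) auto

section \<open>Evolution of the low-frequency energy of the difference\<close>

context galerkin_pair
begin

definition Lo :: "real \<Rightarrow> real" where "Lo s = (\<Sum>n\<in>modes M. (cmod (y s n))\<^sup>2)"
text \<open>The resonant part of the derivative of \<open>Lo\<close>. Apart from the conserved norms it involves only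
  \<open>n (\<bar>\<zeta>\<^sub>n\<bar>\<^sup>2 - \<bar>\<xi>\<^sub>n\<bar>\<^sup>2)\<close>, which is what \<open>amplitude_diff\<close> bounds.\<close>

definition rot :: "real \<Rightarrow> real" where
  "rot s = (\<Sum>n\<in>modes M. 2 * \<mu> * real_of_int n *
     ((n2 B (\<zeta> s) - (cmod (\<zeta> s n))\<^sup>2) - (n2 B (\<xi> s) - (cmod (\<xi> s n))\<^sup>2)) * Im (\<zeta> s n * cnj (\<xi> s n)))"
definition FM :: "(int \<times> int \<times> int \<times> int) set" where "FM = {p \<in> NR B. snd (snd (snd p)) \<in> modes M}"
definition \<kappa>E :: "int \<times> int \<times> int \<times> int \<Rightarrow> complex" where
  "\<kappa>E = (\<lambda>(a, b, c, d). - (2 * \<i> * of_real \<mu> * of_int d / 3))"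

lemma modes_M: "n \<in> modes M \<Longrightarrow> n \<in> modes N1 \<and> n \<in> modes N2 \<and> n \<in> modes B"
  using M g1.NB by (auto simp: modes_def)

text \<open>The diagonal terms are real multiples of \<open>\<i>\<close> and drop out, leaving the
  difference of the speeds times a cross term. Two rotations with equal speed would preserve the
  distance.\<close>

lemma resonant_energy_identity:
  fixes p x :: complex and v w m n :: real
  shows "2 * Re (cnj (p - x) * (\<i> * of_real (m * n / 3) * (3 * of_real v * p - 3 * of_real w * x))) =
    2 * m * n * (v - w) * Im (p * cnj x)"
  by (simp add: algebra_simps)

text \<open>\<open>cub_resonance\<close> splits the derivative of each low mode into rotation and
  nonresonant part. The factor \<open>cnj (y s n) = y s (- n)\<close> becomes the fourth slot, so
  the nonresonant parts are quartic forms ending in \<open>y\<close>.\<close>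

lemma Lo_deriv:
  assumes s: "s \<in> {0..T}"
  shows "(Lo has_real_derivative (rot s + Re (qform FM \<kappa>E PhQ \<zeta> \<zeta> \<zeta> y s - qform FM \<kappa>E PhQ \<xi> \<xi> \<xi> y s))) (at s within {0..T})"
proof -
  let ?u = "U s (\<zeta> s)" and ?w = "U s (\<xi> s)" and ?Y = "U s (y s)"
  have h: "herm ?u" "herm ?w" and su: "supp ?u B" "supp ?w B"
    using herm_U g1.herm g2.herm supp_U g1.supp_B g2.supp_B by auto
  let ?N = "\<lambda>u n. \<Sum>(a, b, c, d)\<in>{p \<in> NR B. snd (snd (snd p)) = - n}. u a * u b * u c :: complex"
  have one: "2 * Re (cnj (y s n) * dy s n) = 2 * \<mu> * real_of_int n *
     ((n2 B (\<zeta> s) - (cmod (\<zeta> s n))\<^sup>2) - (n2 B (\<xi> s) - (cmod (\<xi> s n))\<^sup>2)) * Im (\<zeta> s n * cnj (\<xi> s n)) +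
     Re (- (2 * \<i> * of_real \<mu> * of_int (- n) / 3) * ?Y (- n) * (?N ?u n - ?N ?w n))" if n: "n \<in> modes M" for n
  \<comment> \<open>The mode zero does not move, as the vector field has a factor \<open>n\<close>;
    this case is separate because \<open>cub_resonance\<close> requires a nonzero frequency.\<close>
  proof (cases "n = 0")
    case True then show ?thesis by (simp add: dy_def rhs_def)
  next
    case False
    let ?c = "cis (- (s * phase \<beta> \<gamma> n))"
    have nB: "n \<in> modes B" using modes_M n by blast
    have cu: "?c * ?u n = \<zeta> s n" "?c * ?w n = \<xi> s n" by (simp_all add: U_def cis_mult mult.assoc[symmetric])
    have cm: "cmod (?u n) = cmod (\<zeta> s n)" "cmod (?w n) = cmod (\<xi> s n)" by (simp_all add: U_def norm_mult)
    let ?v = "n2 B (\<zeta> s) - (cmod (\<zeta> s n))\<^sup>2" and ?v' = "n2 B (\<xi> s) - (cmod (\<xi> s n))\<^sup>2"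
    have "dy s n = \<i> * of_real (\<mu> * of_int n / 3) * (?c * (cub B ?u n - cub B ?w n))"
      using modes_M[OF n] unfolding dy_def rhs_def by (simp add: algebra_simps)
    also have "?c * (cub B ?u n - cub B ?w n) = ?c * (?N ?u n - ?N ?w n) + (3 * of_real ?v * (?c * ?u n) - 3 * of_real ?v' * (?c * ?w n))"
      unfolding cub_resonance[OF su(1) h(1) nB False] cub_resonance[OF su(2) h(2) nB False] cm n2_U
      by (simp only: ring_distribs mult_ac) (simp only: add_ac diff_diff_eq2 diff_conv_add_uminus minus_add_distrib)
    also have "\<dots> = ?c * (?N ?u n - ?N ?w n) + (3 * of_real ?v * \<zeta> s n - 3 * of_real ?v' * \<xi> s n)"
      unfolding cu ..
    finally have dy: "dy s n = \<i> * of_real (\<mu> * of_int n / 3) * (?c * (?N ?u n - ?N ?w n)) +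
       \<i> * of_real (\<mu> * of_int n / 3) * (3 * of_real ?v * \<zeta> s n - 3 * of_real ?v' * \<xi> s n)"
      by (simp only: distrib_left)
    have Y: "?Y (- n) = ?c * cnj (y s n)"
      by (simp add: U_def phase_minus hermD[OF herm_y])
    have a: "2 * Re (cnj (y s n) * (\<i> * of_real (\<mu> * of_int n / 3) * (3 * of_real ?v * \<zeta> s n - 3 * of_real ?v' * \<xi> s n))) =
      2 * \<mu> * real_of_int n * (?v - ?v') * Im (\<zeta> s n * cnj (\<xi> s n))"
      unfolding y_def by (rule resonant_energy_identity)
    have b: "2 * Re (cnj (y s n) * (\<i> * of_real (\<mu> * of_int n / 3) * (?c * (?N ?u n - ?N ?w n)))) =
      Re (- (2 * \<i> * of_real \<mu> * of_int (- n) / 3) * ?Y (- n) * (?N ?u n - ?N ?w n))"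
    proof -
      have "2 * (cnj (y s n) * (\<i> * of_real (\<mu> * of_int n / 3) * (?c * (?N ?u n - ?N ?w n)))) =
        - (2 * \<i> * of_real \<mu> * of_int (- n) / 3) * ?Y (- n) * (?N ?u n - ?N ?w n)"
        unfolding Y by simp
      moreover have "2 * Re z = Re (2 * z)" for z by simp
      ultimately show ?thesis by (simp only:)
    qed
    have split: "2 * Re (w * (p + q)) = 2 * Re (w * p) + 2 * Re (w * q)" for w p q :: complex
      by (simp only: distrib_left plus_complex.simps)
    show ?thesis unfolding dy split a b by (rule add.commute)
  qed
  have two: "(\<Sum>n\<in>modes M. - (2 * \<i> * of_real \<mu> * of_int (- n) / 3) * ?Y (- n) * ?N u n) =
    (\<Sum>(a, b, c, d)\<in>FM. \<kappa>E (a, b, c, d) * (u a * u b * u c * ?Y d))" for u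
  proof -
    have "(\<Sum>n\<in>modes M. - (2 * \<i> * of_real \<mu> * of_int (- n) / 3) * ?Y (- n) * ?N u n) =
      (\<Sum>d\<in>modes M. - (2 * \<i> * of_real \<mu> * of_int d / 3) * ?Y d * ?N u (- d))"
      by (rule sum.reindex_bij_witness[of _ uminus uminus]) auto
    also have "\<dots> = (\<Sum>d\<in>modes M. \<Sum>(a, b, c, d')\<in>{p \<in> FM. snd (snd (snd p)) = d}. \<kappa>E (a, b, c, d') * (u a * u b * u c * ?Y d'))"
    proof (rule sum.cong[OF refl])
      fix d assume d: "d \<in> modes M"
      have "{p \<in> NR B. snd (snd (snd p)) = - (- d)} = {p \<in> FM. snd (snd (snd p)) = d}" using d by (auto simp: FM_def)
      then show "- (2 * \<i> * of_real \<mu> * of_int d / 3) * ?Y d * ?N u (- d) =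
         (\<Sum>(a, b, c, d')\<in>{p \<in> FM. snd (snd (snd p)) = d}. \<kappa>E (a, b, c, d') * (u a * u b * u c * ?Y d'))"
        unfolding sum_distrib_left by (intro sum.cong) (auto simp: \<kappa>E_def)
    qed
    also have "\<dots> = (\<Sum>(a, b, c, d)\<in>FM. \<kappa>E (a, b, c, d) * (u a * u b * u c * ?Y d))"
      by (rule sum.group) (auto simp: FM_def)
    finally show ?thesis .
  qed
  have three: "(\<Sum>(a, b, c, d)\<in>FM. \<kappa>E (a, b, c, d) * (U s (x s) a * U s (x s) b * U s (x s) c * ?Y d)) = qform FM \<kappa>E PhQ x x x y s" for x
    unfolding qform_def
  proof (rule sum.cong[OF refl])
    fix p assume "p \<in> FM"
    moreover obtain a b c d where pe: "p = (a, b, c, d)" by (cases p)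
    ultimately have z: "a + b + c + d = 0" by (auto simp: FM_def NR_def QD_def)
    show "(case p of (a, b, c, d) \<Rightarrow> \<kappa>E (a, b, c, d) * (U s (x s) a * U s (x s) b * U s (x s) c * ?Y d)) =
      (case p of (a, b, c, d) \<Rightarrow> \<kappa>E (a, b, c, d) * (cis (s * PhQ (a, b, c, d)) * (x s a * x s b * x s c * y s d)))"
      unfolding pe prod.case U_prod[OF z] PhQ_def ..
  qed
  have "(Lo has_real_derivative (\<Sum>n\<in>modes M. 2 * Re (cnj (y s n) * dy s n))) (at s within {0..T})"
    unfolding Lo_def using slot_y s by (intro DERIV_sum deriv_cmod_sq) (auto simp: slot_def)
  also have "(\<Sum>n\<in>modes M. 2 * Re (cnj (y s n) * dy s n)) = rot s +
     Re (\<Sum>n\<in>modes M. - (2 * \<i> * of_real \<mu> * of_int (- n) / 3) * ?Y (- n) * (?N ?u n - ?N ?w n))"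
    unfolding rot_def Re_sum sum.distrib[symmetric] by (rule sum.cong[OF refl one])
  also have "(\<Sum>n\<in>modes M. - (2 * \<i> * of_real \<mu> * of_int (- n) / 3) * ?Y (- n) * (?N ?u n - ?N ?w n)) =
    qform FM \<kappa>E PhQ \<zeta> \<zeta> \<zeta> y s - qform FM \<kappa>E PhQ \<xi> \<xi> \<xi> y s"
    unfolding right_diff_distrib sum_subtractf two three ..
  finally show ?thesis .
qed

lemma cont_rot: "continuous_on {0..T} rot"
  unfolding rot_def n2_def by (intro continuous_intros g1.cont g2.cont)

lemma Lo_change:
  assumes t: "t \<in> {0..T}"
  shows "Lo t - Lo 0 = integral {0..t} rot + Re (integral {0..t} (qform FM \<kappa>E PhQ y \<zeta> \<zeta> y) +
    integral {0..t} (qform FM \<kappa>E PhQ \<xi> y \<zeta> y) + integral {0..t} (qform FM \<kappa>E PhQ \<xi> \<xi> y y))"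
proof -
  have sub: "{0..t} \<subseteq> {0..T}" using t by auto
  have int: "qform FM \<kappa>E PhQ x1 x2 x3 x4 integrable_on {0..t}"
    if "x1 \<in> {\<zeta>, \<xi>, y}" "x2 \<in> {\<zeta>, \<xi>, y}" "x3 \<in> {\<zeta>, \<xi>, y}" "x4 \<in> {\<zeta>, \<xi>, y}" for x1 x2 x3 x4
    using that by (intro integrable_continuous_real continuous_qform continuous_on_subset[OF _ sub])
      (auto simp: g1.cont g2.cont cont_y)
  let ?q = "\<lambda>s. qform FM \<kappa>E PhQ \<zeta> \<zeta> \<zeta> y s - qform FM \<kappa>E PhQ \<xi> \<xi> \<xi> y s"
  have q: "?q = (\<lambda>s. qform FM \<kappa>E PhQ y \<zeta> \<zeta> y s + qform FM \<kappa>E PhQ \<xi> y \<zeta> y s + qform FM \<kappa>E PhQ \<xi> \<xi> y y s)"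
    unfolding qform_diff3 y_eq[symmetric] ..
  have hi: "(?q has_integral (integral {0..t} (qform FM \<kappa>E PhQ y \<zeta> \<zeta> y) +
    integral {0..t} (qform FM \<kappa>E PhQ \<xi> y \<zeta> y) + integral {0..t} (qform FM \<kappa>E PhQ \<xi> \<xi> y y))) {0..t}"
    unfolding q by (intro has_integral_add integrable_integral int) auto
  have "((\<lambda>s. rot s + Re (?q s)) has_integral (Lo t - Lo 0)) {0..t}"
  proof (rule fundamental_theorem_of_calculus)
    show "0 \<le> t" using t by simp
    fix s assume s: "s \<in> {0..t}"
    then have "s \<in> {0..T}" using t by auto
    from DERIV_subset[OF Lo_deriv[OF this] sub]
    show "(Lo has_vector_derivative rot s + Re (?q s)) (at s within {0..t})"
      by (simp add: has_real_derivative_iff_has_vector_derivative)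
  qed
  moreover have "(rot has_integral (integral {0..t} rot)) {0..t}"
    by (intro integrable_integral integrable_continuous_real continuous_on_subset[OF cont_rot sub])
  from has_integral_add[OF this has_integral_Re[OF hi]]
  have "((\<lambda>s. rot s + Re (?q s)) has_integral (integral {0..t} rot + Re (integral {0..t} (qform FM \<kappa>E PhQ y \<zeta> \<zeta> y) +
    integral {0..t} (qform FM \<kappa>E PhQ \<xi> y \<zeta> y) + integral {0..t} (qform FM \<kappa>E PhQ \<xi> \<xi> y y)))) {0..t}" .
  ultimately show ?thesis using has_integral_unique by blast
qed

end

section \<open>Closing the Gronwall argument for the difference\<close>

context galerkin_pair
begin

definition C1 :: real where "C1 = 3 * T + 2 * CQ R T"

lemma k_nonneg: "0 \<le> k s" using k_ge_1[of s] by simp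

lemma Ik_le: "t \<in> {0..T} \<Longrightarrow> Ik t \<le> C1"
proof -
  assume t: "t \<in> {0..T}"
  have sub: "{0..t} \<subseteq> {0..T}" using t by auto
  have "(k has_integral (t + integral {0..t} g1.q + integral {0..t} g2.q)) {0..t}"
    unfolding k_def
    using t by (intro has_integral_add integrable_integral integrable_continuous_real continuous_on_subset[OF _ sub] g1.cont_q g2.cont_q)
      (use has_integral_const_real[of "1::real" 0 t] in auto)
  then have "Ik t = t + integral {0..t} g1.q + integral {0..t} g2.q" unfolding Ik_def by (rule integral_unique)
  then show ?thesis using g1.integral_q_le[OF R1 t] g2.integral_q_le[OF R2 t] t unfolding C1_def by auto
qed

lemma Ik_nonneg: "t \<in> {0..T} \<Longrightarrow> 0 \<le> Ik t"
  unfolding Ik_def using integrable_sub k_nonneg by (intro integral_nonneg) auto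

lemma C1_nonneg: "0 \<le> C1" using Ik_nonneg[of 0] Ik_le[of 0] g1.T by simp

lemma Iek_le: "t \<in> {0..T} \<Longrightarrow> Iek t \<le> 2 * R * C1"
proof -
  assume t: "t \<in> {0..T}"
  have "Iek t \<le> integral {0..t} (\<lambda>s. 2 * R * k s)"
    unfolding Iek_def
  proof (rule integral_le)
    fix s assume "s \<in> {0..t}"
    then have "e s \<le> 2 * R" using t by (intro e_le) auto
    then show "k s * e s \<le> 2 * R * k s" using k_ge_1[of s] mult_right_mono[of "e s" "2 * R" "k s"] by (simp add: mult_ac)
  qed (use integrable_sub[OF t] in \<open>auto intro: integrable_on_mult_right\<close>)
  also have "\<dots> = 2 * R * Ik t" by (simp add: Ik_def)
  also have "\<dots> \<le> 2 * R * C1" using Ik_le[OF t] R_nonneg by (intro mult_left_mono) auto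
  finally show ?thesis .
qed

lemma W_nonneg: "t \<in> {0..T} \<Longrightarrow> 0 \<le> W t"
  unfolding W_def using integrable_sub(3) k_nonneg by (intro integral_nonneg) auto

lemma W_mono: "s \<in> {0..T} \<Longrightarrow> t \<in> {0..T} \<Longrightarrow> s \<le> t \<Longrightarrow> W s \<le> W t"
  unfolding W_def using integrable_sub(3) k_nonneg by (intro integral_lower_le) auto

text \<open>Young's inequality inside the integral turns the product of the present distance with
  its history into terms quadratic in \<open>e\<close>, as Gronwall for \<open>e\<close> squared
  requires.\<close>

lemma e_Iek_le:
  assumes t: "t \<in> {0..T}"
  shows "e t * Iek t \<le> (C1 * (e t)\<^sup>2 + W t) / 2"
proof -
  have "e t * Iek t = integral {0..t} (\<lambda>s. e t * (k s * e s))" by (simp add: Iek_def)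
  also have "\<dots> \<le> integral {0..t} (\<lambda>s. (e t)\<^sup>2 / 2 * k s + 1/2 * (k s * (e s)\<^sup>2))"
  proof (rule integral_le)
    fix s
    have "e t * e s \<le> ((e t)\<^sup>2 + (e s)\<^sup>2) / 2" using zero_le_power2[of "e t - e s"] by (simp add: power2_diff)
    then have "k s * (e t * e s) \<le> k s * (((e t)\<^sup>2 + (e s)\<^sup>2) / 2)" using k_ge_1[of s] by (intro mult_left_mono) auto
    then show "e t * (k s * e s) \<le> (e t)\<^sup>2 / 2 * k s + 1/2 * (k s * (e s)\<^sup>2)" by (simp add: algebra_simps)
  qed (use integrable_sub[OF t] in \<open>auto intro!: integrable_on_mult_right integrable_add\<close>)
  also have "\<dots> = (e t)\<^sup>2 / 2 * Ik t + 1/2 * W t"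
    unfolding Ik_def W_def using integrable_sub[OF t]
    by (intro integral_unique has_integral_add has_integral_mult_right integrable_integral) auto
  also have "\<dots> \<le> (e t)\<^sup>2 / 2 * C1 + 1/2 * W t" using Ik_le[OF t] by (intro add_right_mono mult_left_mono) auto
  finally show ?thesis by (simp add: algebra_simps)
qed

text \<open>\<open>P0\<close> gathers the errors from data and cut-offs, \<open>P1\<close>
  multiplies the present squared distance, and \<open>P2\<close> multiplies its weighted history
  \<open>W\<close>.\<close>

definition P0 :: real where "P0 = 16 * R^3 * M * e 0 + 16 * A4 * R^5 * e 0 + 16 * A4 * \<delta> * R^6 * C1"
definition P1 :: real where "P1 = 8 * A4 * R^4 + 16 * A4 * R^4 * C1"
definition P2 :: real where "P2 = 16 * A4 * R^4"

lemma \<delta>_nonneg: "0 \<le> \<delta>" by (simp add: \<delta>_def)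

text \<open>By conservation of energy the speed difference splits into two terms fixed by the data
  at time zero and the change estimated in \<open>amplitude_diff\<close>. The data terms have no
  decay in \<open>n\<close>, so the bound on the frequency enters: this is the source of the factor
  \<open>M\<close> in \<open>err\<close>.\<close>

lemma rot_le_aux:
  assumes s: "s \<in> {0..T}"
  shows "\<bar>rot s\<bar> \<le> 2 * R * e s * (4 * M * R * e 0 + 4 * (A4 * R^3 * (e s + e 0) + 4 * A4 * R^3 * Iek s + A4 * \<delta> * R^4 * Ik s))"
proof -
  let ?G = "4 * M * R * e 0 + 4 * (A4 * R^3 * (e s + e 0) + 4 * A4 * R^3 * Iek s + A4 * \<delta> * R^4 * Ik s)"
  have T0: "0 \<in> {0..T}" using g1.T by auto
  have tm: "\<bar>2 * \<mu> * real_of_int n * ((n2 B (\<zeta> s) - (cmod (\<zeta> s n))\<^sup>2) - (n2 B (\<xi> s) - (cmod (\<xi> s n))\<^sup>2)) * Im (\<zeta> s n * cnj (\<xi> s n))\<bar>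
    \<le> 2 * ?G * (cmod (y s n) * cmod (\<xi> s n))" if n: "n \<in> modes M" for n
  proof -
    let ?v = "(n2 B (\<zeta> s) - (cmod (\<zeta> s n))\<^sup>2) - (n2 B (\<xi> s) - (cmod (\<xi> s n))\<^sup>2)"
    let ?D = "((cmod (\<zeta> s n))\<^sup>2 - (cmod (\<zeta> 0 n))\<^sup>2) - ((cmod (\<xi> s n))\<^sup>2 - (cmod (\<xi> 0 n))\<^sup>2)"
    have "?v = (n2 B (\<zeta> 0) - n2 B (\<xi> 0)) - ((cmod (\<zeta> 0 n))\<^sup>2 - (cmod (\<xi> 0 n))\<^sup>2) - ?D"
      unfolding g1.energy[OF s] g2.energy[OF s] by simp
    then have "\<bar>?v\<bar> \<le> \<bar>n2 B (\<zeta> 0) - n2 B (\<xi> 0)\<bar> + \<bar>(cmod (\<zeta> 0 n))\<^sup>2 - (cmod (\<xi> 0 n))\<^sup>2\<bar> + \<bar>?D\<bar>" by linarith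
    also have "\<dots> \<le> e 0 * (R + R) + e 0 * (R + R) + \<bar>?D\<bar>"
    proof (intro add_mono order_refl)
      show "\<bar>n2 B (\<zeta> 0) - n2 B (\<xi> 0)\<bar> \<le> e 0 * (R + R)"
        using R1 R2 by (intro order_trans[OF n2_diff_le]) (simp add: e_def y_eq mult_left_mono add_mono)
      have nB: "n \<in> modes B" using modes_M n by blast
      have "\<bar>(cmod (\<zeta> 0 n))\<^sup>2 - (cmod (\<xi> 0 n))\<^sup>2\<bar> \<le> cmod (y 0 n) * (cmod (\<zeta> 0 n) + cmod (\<xi> 0 n))"
        unfolding y_def by (rule sq_diff_le)
      also have "\<dots> \<le> e 0 * (R + R)"
        unfolding e_def using cmod_le_n2[OF nB] R1 R2
        by (intro mult_mono add_mono) (auto intro: order_trans)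
      finally show "\<bar>(cmod (\<zeta> 0 n))\<^sup>2 - (cmod (\<xi> 0 n))\<^sup>2\<bar> \<le> e 0 * (R + R)" .
    qed
    finally have "\<bar>real_of_int n\<bar> * \<bar>?v\<bar> \<le> \<bar>real_of_int n\<bar> * (4 * R * e 0 + \<bar>?D\<bar>)"
      by (intro mult_left_mono) (auto simp: algebra_simps)
    also have "\<dots> = \<bar>real_of_int n\<bar> * (4 * R * e 0) + \<bar>real_of_int n\<bar> * \<bar>?D\<bar>" by (rule distrib_left)
    also have "\<dots> \<le> real M * (4 * R * e 0) + 4 * (A4 * R^3 * (e s + e 0) + 4 * A4 * R^3 * Iek s + A4 * \<delta> * R^4 * Ik s)"
    proof (intro add_mono amplitude_diff n s mult_right_mono)
      have "\<bar>n\<bar> \<le> int M" using n by (auto simp: modes_def)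
      then show "\<bar>real_of_int n\<bar> \<le> real M" by linarith
    qed (use R_nonneg in auto)
    finally have v: "\<bar>real_of_int n\<bar> * \<bar>?v\<bar> \<le> ?G" by (simp add: mult_ac)
    \<comment> \<open>Subtracting the real number \<open>(cmod (\<xi> s n))\<^sup>2\<close> does not
      change the imaginary part and produces the factor \<open>y s n\<close>.\<close>
    have "\<zeta> s n * cnj (\<xi> s n) = y s n * cnj (\<xi> s n) + of_real ((cmod (\<xi> s n))\<^sup>2)"
      unfolding complex_norm_square y_def by (simp add: algebra_simps)
    then have "Im (\<zeta> s n * cnj (\<xi> s n)) = Im (y s n * cnj (\<xi> s n))" by simp
    then have i: "\<bar>Im (\<zeta> s n * cnj (\<xi> s n))\<bar> \<le> cmod (y s n) * cmod (\<xi> s n)"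
      using abs_Im_le_cmod[of "y s n * cnj (\<xi> s n)"] by (simp add: norm_mult)
    have "\<bar>2 * \<mu> * real_of_int n * ?v * Im (\<zeta> s n * cnj (\<xi> s n))\<bar> = 2 * (\<bar>real_of_int n\<bar> * \<bar>?v\<bar>) * \<bar>Im (\<zeta> s n * cnj (\<xi> s n))\<bar>"
      using mu by (simp only: abs_mult)
    also have "\<dots> \<le> 2 * ?G * (cmod (y s n) * cmod (\<xi> s n))"
    proof (rule mult_mono[OF mult_left_mono[OF v] i])
      have "0 \<le> ?G" using v by (rule order_trans[rotated]) simp
      then show "0 \<le> 2 * ?G" by (rule mult_nonneg_nonneg[rotated]) simp
    qed simp_all
    finally show ?thesis .
  qed
  have "0 \<in> modes M" by simp
  have G0: "0 \<le> ?G"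
    using order_trans[OF _ amplitude_diff[OF \<open>0 \<in> modes M\<close> s]] R_nonneg by (intro add_nonneg_nonneg) auto
  have "\<bar>rot s\<bar> \<le> (\<Sum>n\<in>modes M. 2 * ?G * (cmod (y s n) * cmod (\<xi> s n)))"
    unfolding rot_def by (rule order_trans[OF sum_abs sum_mono[OF tm]])
  also have "\<dots> = 2 * ?G * (\<Sum>n\<in>modes M. cmod (y s n) * cmod (\<xi> s n))" by (rule sum_distrib_left[symmetric])
  also have "\<dots> \<le> 2 * ?G * (e s * R)"
  proof (rule mult_left_mono)
    have "(\<Sum>n\<in>modes M. cmod (y s n) * cmod (\<xi> s n)) \<le> (\<Sum>n\<in>modes B. cmod (y s n) * cmod (\<xi> s n))"
      using modes_M by (intro sum_mono2) auto
    also have "\<dots> \<le> e s * sqrt (n2 B (\<xi> s))" unfolding e_def by (rule sum_mult_le_n2)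
    also have "\<dots> \<le> e s * R" using R_xi[OF s] by (intro mult_left_mono) auto
    finally show "(\<Sum>n\<in>modes M. cmod (y s n) * cmod (\<xi> s n)) \<le> e s * R" .
  qed (use G0 in simp)
  also have "\<dots> = 2 * R * e s * ?G" by (simp only: mult_ac)
  finally show ?thesis .
qed

lemma rot_le:
  assumes s: "s \<in> {0..T}"
  shows "\<bar>rot s\<bar> \<le> P0 + P1 * (k s * (e s)\<^sup>2) + P2 * W s"
proof -
  note nn = R_nonneg A4_nonneg \<delta>_nonneg C1_nonneg e_nonneg[of s] e_nonneg[of 0]
  have es: "e s \<le> 2 * R" by (rule e_le[OF s])
  have t1: "R\<^sup>2 * M * (e s * e 0) \<le> R\<^sup>2 * M * (2 * R * e 0)" using es nn by (intro mult_left_mono mult_right_mono) auto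
  have t2: "A4 * R^4 * (e s * e 0) \<le> A4 * R^4 * (2 * R * e 0)" using es nn by (intro mult_left_mono mult_right_mono) auto
  have t3: "A4 * R^4 * (e s * Iek s) \<le> A4 * R^4 * ((C1 * (e s)\<^sup>2 + W s) / 2)" using e_Iek_le[OF s] nn by (intro mult_left_mono) auto
  have t4: "A4 * \<delta> * R^5 * (e s * Ik s) \<le> A4 * \<delta> * R^5 * (2 * R * C1)"
  proof (rule mult_left_mono)
    show "e s * Ik s \<le> 2 * R * C1"
      by (rule mult_mono[OF es Ik_le[OF s]]) (simp_all add: R_nonneg Ik_nonneg[OF s])
  qed (simp add: R_nonneg A4_nonneg \<delta>_nonneg)
  have t5: "P1 * (e s)\<^sup>2 \<le> P1 * (k s * (e s)\<^sup>2)"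
    using mult_right_mono[OF k_ge_1[of s], of "(e s)\<^sup>2"] nn by (intro mult_left_mono) (auto simp: P1_def)
  have "\<bar>rot s\<bar> \<le> 8 * (R\<^sup>2 * M * (e s * e 0)) + 8 * A4 * R^4 * (e s)\<^sup>2 + 8 * (A4 * R^4 * (e s * e 0)) +
     32 * (A4 * R^4 * (e s * Iek s)) + 8 * (A4 * \<delta> * R^5 * (e s * Ik s))"
    using rot_le_aux[OF s] by (simp add: algebra_simps power_numeral_reduce)
  also have "\<dots> \<le> 8 * (R\<^sup>2 * M * (2 * R * e 0)) + 8 * A4 * R^4 * (e s)\<^sup>2 + 8 * (A4 * R^4 * (2 * R * e 0)) +
     32 * (A4 * R^4 * ((C1 * (e s)\<^sup>2 + W s) / 2)) + 8 * (A4 * \<delta> * R^5 * (2 * R * C1))"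
    using t1 t2 t3 t4 by linarith
  also have "\<dots> = P0 + P1 * (e s)\<^sup>2 + P2 * W s"
    unfolding P0_def P1_def P2_def by (simp add: algebra_simps power_numeral_reduce)
  finally show ?thesis using t5 by linarith
qed

lemma P_nonneg: "0 \<le> P0" "0 \<le> P1" "0 \<le> P2"
  unfolding P0_def P1_def P2_def using R_nonneg A4_nonneg \<delta>_nonneg C1_nonneg by auto

lemma integral_rot_le:
  assumes t: "t \<in> {0..T}"
  shows "integral {0..t} rot \<le> T * P0 + (P1 + T * P2) * W t"
proof -
  have sub: "{0..t} \<subseteq> {0..T}" using t by auto
  have "integral {0..t} rot \<le> integral {0..t} (\<lambda>s. P0 + P1 * (k s * (e s)\<^sup>2) + P2 * W t)"
  proof (rule integral_le)
    show "rot integrable_on {0..t}" by (intro integrable_continuous_real continuous_on_subset[OF cont_rot sub])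
    show "(\<lambda>s. P0 + P1 * (k s * (e s)\<^sup>2) + P2 * W t) integrable_on {0..t}"
      using integrable_sub(3)[OF t] by (intro integrable_add integrable_on_mult_right) auto
    fix s assume s: "s \<in> {0..t}"
    then have "P2 * W s \<le> P2 * W t" using t P_nonneg W_mono by (intro mult_left_mono) auto
    then show "rot s \<le> P0 + P1 * (k s * (e s)\<^sup>2) + P2 * W t" using rot_le[of s] s t by auto
  qed
  also have "\<dots> = t * P0 + P1 * W t + t * (P2 * W t)"
  proof -
    have c: "((\<lambda>s. c) has_integral (t * c)) {0..t}" for c :: real
      using has_integral_const_real[of c 0 t] t by (simp add: mult_ac)
    have "((\<lambda>s. k s * (e s)\<^sup>2) has_integral W t) {0..t}" unfolding W_def by (intro integrable_integral integrable_sub t)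
    then have "((\<lambda>s. P0 + P1 * (k s * (e s)\<^sup>2) + P2 * W t) has_integral (t * P0 + P1 * W t + t * (P2 * W t))) {0..t}"
      by (intro has_integral_add c has_integral_mult_right)
    then show ?thesis by (rule integral_unique)
  qed
  also have "\<dots> \<le> T * P0 + P1 * W t + T * (P2 * W t)"
    using t P_nonneg W_nonneg[OF t] by (intro add_mono mult_right_mono) auto
  finally show ?thesis by (simp add: algebra_simps)
qed

text \<open>The threshold \<open>K\<close> divides the quadruples. Those with large
  \<open>sq4\<close> go through the normal form and get the small factor
  \<open>real K powr - (1/8)\<close> in front of the endpoint terms. The others are finitely many
  and are integrated directly, without integration by parts and hence without endpoint
  terms.\<close>

lemma form_FM_le:
  fixes K :: nat
  assumes K: "1 \<le> K" and t: "t \<in> {0..T}"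
    and s: "slot f1 x1 y1" "slot f2 x2 y2" "slot f3 x3 y3"
    and f: "(f1, f2, f3) \<in> {(True, False, False), (False, True, False), (False, False, True)}"
  shows "cmod (integral {0..t} (qform FM \<kappa>E PhQ x1 x2 x3 y)) \<le>
    2 * ctri * real K powr - (1/8) * R\<^sup>2 * ((e t)\<^sup>2 + (e 0)\<^sup>2) + 4 * (2 * ctri * real K powr - (1/8)) * R\<^sup>2 * W t +
    8 * ctri * \<delta> * R^4 * C1 + real (card (QD K)) * K * R\<^sup>2 * W t"
proof -
  let ?h = "{p \<in> FM. (\<lambda>(a, b, c, d). (real K)\<^sup>2 \<le> sq4 a b c d) p}" and ?l = "{p \<in> FM. (\<lambda>(a, b, c, d). sq4 a b c d < (real K)\<^sup>2) p}"
  have sub: "{0..t} \<subseteq> {0..T}" using t by auto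
  have finFM: "finite FM" by (simp add: FM_def)
  have hN: "?h \<subseteq> NR B" by (auto simp: FM_def)
  have un: "FM = ?l \<union> ?h" "?l \<inter> ?h = {}" by force+
  have cx: "continuous_on {0..T} (\<lambda>s. x s n)" if "slot f x x'" for f x x' n
    unfolding continuous_on_eq_continuous_within using that unfolding slot_def
    by (blast intro: has_vector_derivative_continuous)
  have cf: "continuous_on {0..t} (qform F \<kappa>E PhQ x1 x2 x3 y)" for F
    by (intro continuous_qform continuous_on_subset[OF _ sub] cx[OF s(1)] cx[OF s(2)] cx[OF s(3)] cont_y)
  note int = integrable_continuous_real[OF cf]
  have kE: "cmod (\<kappa>E (a, b, c, d)) \<le> sqrt (sq4 a b c d)" for a b c d
  proof -
    have "\<bar>real_of_int d\<bar> \<le> sqrt (sq4 a b c d)" by (rule real_le_rsqrt) (simp add: sq4_def)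
    then show ?thesis using mu by (simp add: \<kappa>E_def norm_mult norm_divide)
  qed
  have "adm ?h (\<lambda>p. cmod (\<kappa>E p) / \<bar>PhQ p\<bar>) (2 * ctri * real K powr - (1/8)) (2 * ctri * L powr - (1/8)) L"
  proof (rule adm_high)
    fix a b c d assume p: "(a, b, c, d) \<in> ?h"
    then show "(real K)\<^sup>2 \<le> sq4 a b c d" by simp
    have "nonres (a, b, c, d)" using p hN by (auto simp: NR_def)
    then show "cmod (\<kappa>E (a, b, c, d)) / \<bar>PhQ (a, b, c, d)\<bar> \<le> sqrt (sq4 a b c d) / (pp a b c * sq4 a b c d)"
      by (rule weight_le) (simp_all add: kE)
  qed (use K L finFM hN in \<open>auto simp: NR_def\<close>)
  moreover have "2 * ctri * L powr - (1/8) \<le> 2 * ctri * \<delta>"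
  proof -
    have "L powr - (1/8) = (1 / L) powr (1/8)" using L by (simp add: powr_minus_divide powr_divide)
    also have "\<dots> \<le> \<delta>" unfolding \<delta>_def using L M by (intro powr_mono2 divide_right_mono) auto
    finally show ?thesis using ctri_nonneg by (intro mult_left_mono) auto
  qed
  ultimately have adm: "adm ?h (\<lambda>p. cmod (\<kappa>E p) / \<bar>PhQ p\<bar>) (2 * ctri * real K powr - (1/8)) (2 * ctri * \<delta>) L" by (rule adm_mono)
  have high: "cmod (integral {0..t} (qform ?h \<kappa>E PhQ x1 x2 x3 y)) \<le>
     2 * ctri * real K powr - (1/8) * R\<^sup>2 * ((e t)\<^sup>2 + (e 0)\<^sup>2) + 4 * (2 * ctri * real K powr - (1/8)) * R\<^sup>2 * W t +
     2 * (2 * ctri * \<delta>) * R^3 * Iek t"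
    by (rule form_bound_2[OF hN adm _ _ t s slot_y f]) (simp_all add: ctri_nonneg \<delta>_nonneg)
  have "2 * (2 * ctri * \<delta>) * R^3 * Iek t \<le> 2 * (2 * ctri * \<delta>) * R^3 * (2 * R * C1)"
    using Iek_le[OF t] ctri_nonneg \<delta>_nonneg R_nonneg by (intro mult_left_mono) auto
  also have "\<dots> = 8 * ctri * \<delta> * R^4 * C1" by (simp add: power_numeral_reduce)
  finally have high2: "2 * (2 * ctri * \<delta>) * R^3 * Iek t \<le> 8 * ctri * \<delta> * R^4 * C1" .
  \<comment> \<open>The low quadruples lie in a set depending on \<open>K\<close> alone, so their
    number is bounded independently of \<open>M\<close>, the cut-offs and the box.\<close>
  have lowQ: "?l \<subseteq> QD K"
  proof
    fix p assume p: "p \<in> ?l"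
    obtain a b c d where pe: "p = (a, b, c, d)" by (cases p)
    have "sq4 a b c d < (real K)\<^sup>2" and q: "a + b + c + d = 0" using p by (auto simp: pe FM_def NR_def QD_def)
    then have "(real_of_int a)\<^sup>2 < (real K)\<^sup>2" "(real_of_int b)\<^sup>2 < (real K)\<^sup>2" "(real_of_int c)\<^sup>2 < (real K)\<^sup>2" "(real_of_int d)\<^sup>2 < (real K)\<^sup>2"
      unfolding sq4_def of_int_add of_int_power
      by (smt (verit) zero_le_power2)+
    moreover have "\<bar>x\<bar> < int K" if "(real_of_int x)\<^sup>2 < (real K)\<^sup>2" for x
    proof -
      have "\<bar>real_of_int x\<bar> < real K" by (rule power2_less_imp_less) (use that in simp_all)
      then show ?thesis by linarith
    qed
    ultimately have "\<bar>a\<bar> < int K" "\<bar>b\<bar> < int K" "\<bar>c\<bar> < int K" "\<bar>d\<bar> < int K" by blast+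
    then show "p \<in> QD K" using q by (auto simp: pe QD_def modes_def)
  qed
  have low: "cmod (qform ?l \<kappa>E PhQ x1 x2 x3 y r) \<le> real (card (QD K)) * K * R\<^sup>2 * (e r)\<^sup>2" if r: "r \<in> {0..T}" for r
  proof -
    have b: "cmod (x1 r n) \<le> bd f1 r" "cmod (x2 r n) \<le> bd f2 r" "cmod (x3 r n) \<le> bd f3 r" "cmod (y r n) \<le> bd True r" for n
      using s slot_y r l2b_le by (auto simp: slot_def)
    have bp: "0 \<le> bd f r" for f using R_nonneg by (simp add: bd_def)
    have "cmod (qform ?l \<kappa>E PhQ x1 x2 x3 y r) \<le> (\<Sum>p\<in>?l. real K * (R\<^sup>2 * (e r)\<^sup>2))"
      unfolding qform_def
    proof (rule order_trans[OF norm_sum sum_mono])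
      fix p assume p: "p \<in> ?l"
      obtain a b c d where pe: "p = (a, b, c, d)" by (cases p)
      have "sq4 a b c d < (real K)\<^sup>2" using p by (auto simp: pe)
      then have "cmod (\<kappa>E (a, b, c, d)) \<le> real K"
        using order_trans[OF kE real_sqrt_le_mono[of "sq4 a b c d" "(real K)\<^sup>2"]] by auto
      moreover have "cmod (x1 r a * x2 r b * x3 r c * y r d) \<le> bd f1 r * bd f2 r * bd f3 r * bd True r"
        unfolding norm_mult using \<open>\<And>n. cmod (x1 r n) \<le> bd f1 r\<close> \<open>\<And>n. cmod (x2 r n) \<le> bd f2 r\<close>
          \<open>\<And>n. cmod (x3 r n) \<le> bd f3 r\<close> \<open>\<And>n. cmod (y r n) \<le> bd True r\<close> bp by (intro mult_mono mult_nonneg_nonneg) auto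
      moreover have "bd f1 r * bd f2 r * bd f3 r * bd True r = R\<^sup>2 * (e r)\<^sup>2"
        using f by (auto simp: bd_def power2_eq_square)
      ultimately have "cmod (\<kappa>E (a, b, c, d)) * cmod (x1 r a * x2 r b * x3 r c * y r d) \<le> real K * (R\<^sup>2 * (e r)\<^sup>2)"
        by (intro mult_mono) auto
      then show "cmod (case p of (a, b, c, d) \<Rightarrow> \<kappa>E (a, b, c, d) * (cis (r * PhQ (a, b, c, d)) * (x1 r a * x2 r b * x3 r c * y r d)))
        \<le> real K * (R\<^sup>2 * (e r)\<^sup>2)"
        unfolding pe prod.case norm_mult[of "\<kappa>E _"] norm_mult[of "cis _"] norm_cis mult_1_left .
    qed
    also have "\<dots> = real (card ?l) * (real K * (R\<^sup>2 * (e r)\<^sup>2))" by simp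
    also have "\<dots> \<le> real (card (QD K)) * (real K * (R\<^sup>2 * (e r)\<^sup>2))"
      using card_mono[OF finite_QD lowQ] by (intro mult_right_mono) auto
    finally show ?thesis by (simp add: mult_ac)
  qed
  have "cmod (integral {0..t} (qform ?l \<kappa>E PhQ x1 x2 x3 y)) \<le> integral {0..t} (\<lambda>r. real (card (QD K)) * K * R\<^sup>2 * (k r * (e r)\<^sup>2))"
  proof (rule integral_norm_bound_integral)
    show "qform ?l \<kappa>E PhQ x1 x2 x3 y integrable_on {0..t}" by (rule int)
    show "(\<lambda>r. real (card (QD K)) * K * R\<^sup>2 * (k r * (e r)\<^sup>2)) integrable_on {0..t}"
      using integrable_sub(3)[OF t] by (rule integrable_on_mult_right)
    fix r assume r: "r \<in> {0..t}"
    have "(e r)\<^sup>2 \<le> k r * (e r)\<^sup>2" using mult_right_mono[OF k_ge_1[of r], of "(e r)\<^sup>2"] by simp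
    then have "real (card (QD K)) * K * R\<^sup>2 * (e r)\<^sup>2 \<le> real (card (QD K)) * K * R\<^sup>2 * (k r * (e r)\<^sup>2)"
      by (rule mult_left_mono) auto
    then show "cmod (qform ?l \<kappa>E PhQ x1 x2 x3 y r) \<le> real (card (QD K)) * K * R\<^sup>2 * (k r * (e r)\<^sup>2)"
      using low[of r] r t by auto
  qed
  also have "\<dots> = real (card (QD K)) * K * R\<^sup>2 * W t" by (simp add: W_def)
  finally have low': "cmod (integral {0..t} (qform ?l \<kappa>E PhQ x1 x2 x3 y)) \<le> real (card (QD K)) * K * R\<^sup>2 * W t" .
  have "qform FM \<kappa>E PhQ x1 x2 x3 y = (\<lambda>r. qform ?l \<kappa>E PhQ x1 x2 x3 y r + qform ?h \<kappa>E PhQ x1 x2 x3 y r)"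
    by (subst un(1), rule ext, rule qform_union) (use finFM un(2) in auto)
  then have "integral {0..t} (qform FM \<kappa>E PhQ x1 x2 x3 y) = integral {0..t} (qform ?l \<kappa>E PhQ x1 x2 x3 y) + integral {0..t} (qform ?h \<kappa>E PhQ x1 x2 x3 y)"
    by (simp only: integral_add[OF int int])
  then have "cmod (integral {0..t} (qform FM \<kappa>E PhQ x1 x2 x3 y)) \<le> cmod (integral {0..t} (qform ?l \<kappa>E PhQ x1 x2 x3 y)) + cmod (integral {0..t} (qform ?h \<kappa>E PhQ x1 x2 x3 y))"
    by (simp only: norm_triangle_ineq)
  then show ?thesis using low' high high2 by linarith
qed

definition tau :: "(real \<Rightarrow> int \<Rightarrow> complex) \<Rightarrow> real \<Rightarrow> real" where
  "tau z s = (\<Sum>n\<in>modes B - modes M. (cmod (z s n))\<^sup>2)"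

lemma tau_nonneg: "0 \<le> tau z s" by (simp add: tau_def sum_nonneg)

definition Ct :: real where "Ct = 2 * ctri * (2 * R^4 + 4 * R^4 * (T + CQ R T))"

text \<open>Above \<open>M\<close> the difference is estimated by the two solutions separately, and
  \<open>tail_le\<close> carries both tails back to time zero.\<close>

lemma e_sq_le:
  assumes t: "t \<in> {0..T}"
  shows "(e t)\<^sup>2 \<le> Lo t + 2 * tau \<zeta> 0 + 2 * tau \<xi> 0 + 4 * Ct * real M powr - (1/8)"
proof -
  have "(e t)\<^sup>2 = n2 B (y t)" by (simp add: e_def)
  also have "\<dots> = tau y t + Lo t"
    unfolding Lo_def tau_def n2_def using modes_M by (intro sum.subset_diff) auto
  also have "tau y t \<le> 2 * tau \<zeta> t + 2 * tau \<xi> t"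
    unfolding tau_def sum_distrib_left sum.distrib[symmetric]
  proof (rule sum_mono)
    fix n
    have "(cmod (y t n))\<^sup>2 \<le> (cmod (\<zeta> t n) + cmod (\<xi> t n))\<^sup>2"
      unfolding y_def by (intro power_mono norm_triangle_ineq4) simp
    also have "\<dots> \<le> 2 * (cmod (\<zeta> t n))\<^sup>2 + 2 * (cmod (\<xi> t n))\<^sup>2"
      using zero_le_power2[of "cmod (\<zeta> t n) - cmod (\<xi> t n)"] by (simp add: power2_diff power2_sum)
    finally show "(cmod (y t n))\<^sup>2 \<le> 2 * (cmod (\<zeta> t n))\<^sup>2 + 2 * (cmod (\<xi> t n))\<^sup>2" .
  qed
  finally have "(e t)\<^sup>2 \<le> Lo t + 2 * tau \<zeta> t + 2 * tau \<xi> t" by simp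
  then show ?thesis
    using g1.tail_le[OF R1 t M(1)] g2.tail_le[OF R2 t M(1)] unfolding tau_def Ct_def by (simp add: algebra_simps)
qed

definition Ca :: real where
  "Ca = 2 * (3 * R + 16 * T * R^3 + 16 * T * A4 * R^5 + 16 * T * A4 * R^6 * C1 + 24 * ctri * R^4 * C1 + 2 + 4 * Ct)"
definition Ck :: "nat \<Rightarrow> real" where "Ck K = 2 * (P1 + T * P2 + 3 * (real (card (QD K)) * K * R\<^sup>2) + 2)"
text \<open>The tails and the last term become small for large \<open>M\<close>. With
  \<open>M\<close> fixed, \<open>M * e 0\<close> becomes small for close data and
  \<open>\<delta>\<close> for large cut-offs.\<close>

definition err :: real where "err = M * e 0 + \<delta> + tau \<zeta> 0 + tau \<xi> 0 + real M powr - (1/8)"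

text \<open>The endpoint terms of the normal form contain the squared distance at time
  \<open>t\<close> itself. The condition on \<open>K\<close> keeps their total coefficient at most
  \<open>1/2\<close>, so they are absorbed into the left-hand side; this doubles the remaining
  constants in \<open>Ca\<close> and \<open>Ck\<close>.\<close>

lemma energy_inequality:
  fixes K :: nat
  assumes K: "1 \<le> K" "6 * ctri * real K powr - (1/8) * R\<^sup>2 \<le> 1/2" and t: "t \<in> {0..T}"
  shows "(e t)\<^sup>2 \<le> Ca * err + Ck K * W t"
proof -
  note nn = R_nonneg A4_nonneg \<delta>_nonneg C1_nonneg e_nonneg[of 0] ctri_nonneg g1.T
  let ?A = "2 * ctri * real K powr - (1/8) * R\<^sup>2" and ?c = "real (card (QD K)) * K * R\<^sup>2"
  have A: "3 * ?A \<le> 1/2" using K(2) by simp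
  have W0: "0 \<le> W t" by (rule W_nonneg[OF t])
  have CQ0: "0 \<le> CQ R T" unfolding CQ_def using nn by auto
  have Ct0: "0 \<le> Ct" unfolding Ct_def using nn CQ0 by auto
  let ?b = "?A * ((e t)\<^sup>2 + (e 0)\<^sup>2) + 4 * ?A * W t + 8 * ctri * \<delta> * R^4 * C1 + ?c * W t"
  have f: "cmod (integral {0..t} (qform FM \<kappa>E PhQ y \<zeta> \<zeta> y)) \<le> ?b" "cmod (integral {0..t} (qform FM \<kappa>E PhQ \<xi> y \<zeta> y)) \<le> ?b"
    "cmod (integral {0..t} (qform FM \<kappa>E PhQ \<xi> \<xi> y y)) \<le> ?b"
    using form_FM_le[OF K(1) t slot_y slot_zeta slot_zeta] form_FM_le[OF K(1) t slot_xi slot_y slot_zeta]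
      form_FM_le[OF K(1) t slot_xi slot_xi slot_y] by (simp_all add: mult.assoc)
  have "Re (integral {0..t} (qform FM \<kappa>E PhQ y \<zeta> \<zeta> y) + integral {0..t} (qform FM \<kappa>E PhQ \<xi> y \<zeta> y) + integral {0..t} (qform FM \<kappa>E PhQ \<xi> \<xi> y y)) \<le> 3 * ?b"
  proof -
    have "p + q + r \<le> 3 * b" if "p \<le> b" "q \<le> b" "r \<le> b" for p q r b :: real using that by linarith
    from this[OF order_trans[OF complex_Re_le_cmod f(1)] order_trans[OF complex_Re_le_cmod f(2)] order_trans[OF complex_Re_le_cmod f(3)]]
    show ?thesis unfolding plus_complex.simps .
  qed
  then have 1: "Lo t \<le> Lo 0 + (T * P0 + (P1 + T * P2) * W t) + 3 * ?b"
    using Lo_change[OF t] integral_rot_le[OF t] by linarith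
  have "(e 0)\<^sup>2 = n2 B (y 0)" by (simp add: e_def)
  then have Lo0: "Lo 0 \<le> (e 0)\<^sup>2" unfolding Lo_def n2_def using modes_M by (auto intro!: sum_mono2)
  have e0: "(e 0)\<^sup>2 \<le> 2 * R * e 0" using e_le[of 0] g1.T mult_right_mono[of "e 0" "2 * R" "e 0"] by (simp add: power2_eq_square)
  have 2: "3 * (?A * ((e t)\<^sup>2 + (e 0)\<^sup>2)) \<le> 1/2 * ((e t)\<^sup>2 + (e 0)\<^sup>2)"
    using mult_right_mono[OF A, of "(e t)\<^sup>2 + (e 0)\<^sup>2"] by (simp add: mult.assoc)
  have 3: "3 * (4 * ?A * W t) \<le> 2 * W t" using mult_right_mono[OF A W0] by (simp add: mult_ac)
  have 4: "(e t)\<^sup>2 \<le> (e 0)\<^sup>2 + (T * P0 + (P1 + T * P2) * W t) + (1/2 * ((e t)\<^sup>2 + (e 0)\<^sup>2) + 2 * W t + 24 * ctri * \<delta> * R^4 * C1 + 3 * (?c * W t))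
     + 2 * tau \<zeta> 0 + 2 * tau \<xi> 0 + 4 * Ct * real M powr - (1/8)"
    using e_sq_le[OF t] 1 Lo0 2 3 by (simp add: algebra_simps)
  then have "(e t)\<^sup>2 \<le> 2 * (3 * R * e 0 + T * P0 + 24 * ctri * \<delta> * R^4 * C1 + 2 * tau \<zeta> 0 + 2 * tau \<xi> 0 + 4 * Ct * real M powr - (1/8))
     + Ck K * W t"
    using e0 unfolding Ck_def by (simp add: algebra_simps)
  also have "2 * (3 * R * e 0 + T * P0 + 24 * ctri * \<delta> * R^4 * C1 + 2 * tau \<zeta> 0 + 2 * tau \<xi> 0 + 4 * Ct * real M powr - (1/8)) \<le> Ca * err"
  proof -
    define m where "m = M * e 0"
    have em: "e 0 \<le> m" unfolding m_def using M(1) mult_right_mono[of 1 "real M" "e 0"] by simp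
    have pos: "0 \<le> m" "0 \<le> tau \<zeta> 0" "0 \<le> tau \<xi> 0" "0 \<le> real M powr - (1/8)" "0 \<le> \<delta>"
      using order_trans[OF e_nonneg em] nn tau_nonneg by auto
    have "T * P0 = 16 * T * R^3 * m + 16 * T * A4 * R^5 * e 0 + 16 * T * A4 * R^6 * C1 * \<delta>"
      unfolding P0_def m_def by (simp add: algebra_simps)
    moreover have "16 * T * A4 * R^5 * e 0 \<le> 16 * T * A4 * R^5 * m" "3 * R * e 0 \<le> 3 * R * m" using em nn by (auto intro!: mult_left_mono)
    moreover have "c * x \<le> c * (m + \<delta> + tau \<zeta> 0 + tau \<xi> 0 + real M powr - (1/8))"
      if "0 \<le> c" "x \<in> {m, \<delta>, tau \<zeta> 0 + tau \<xi> 0, real M powr - (1/8)}" for c x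
      using that pos by (intro mult_left_mono) auto
    note b = this
    have "3 * R * m \<le> 3 * R * err" "16 * T * R^3 * m \<le> 16 * T * R^3 * err" "16 * T * A4 * R^5 * m \<le> 16 * T * A4 * R^5 * err"
      "16 * T * A4 * R^6 * C1 * \<delta> \<le> 16 * T * A4 * R^6 * C1 * err" "24 * ctri * R^4 * C1 * \<delta> \<le> 24 * ctri * R^4 * C1 * err"
      "2 * (tau \<zeta> 0 + tau \<xi> 0) \<le> 2 * err" "4 * Ct * real M powr - (1/8) \<le> 4 * Ct * err"
      unfolding err_def m_def[symmetric] using nn Ct0 by (intro b; auto)+
    ultimately show ?thesis unfolding Ca_def by (simp add: algebra_simps)
  qed
  finally show ?thesis by simp
qed

lemma stability_aux:
  fixes K :: nat
  assumes K: "1 \<le> K" "6 * ctri * real K powr - (1/8) * R\<^sup>2 \<le> 1/2" and t: "t \<in> {0..T}"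
  shows "(e t)\<^sup>2 \<le> Ca * err * exp (Ck K * C1)"
proof -
  note nn = R_nonneg A4_nonneg \<delta>_nonneg C1_nonneg e_nonneg[of 0] ctri_nonneg g1.T
  have CK: "0 \<le> Ck K" unfolding Ck_def using P_nonneg nn by auto
  have "(e t)\<^sup>2 \<le> Ca * err * exp (integral {0..t} (\<lambda>s. Ck K * k s))"
  proof (rule gronwall[of T "\<lambda>s. (e s)\<^sup>2" "\<lambda>s. Ck K * k s"])
    show "continuous_on {0..T} (\<lambda>s. (e s)\<^sup>2)" "continuous_on {0..T} (\<lambda>s. Ck K * k s)"
      by (intro continuous_intros cont_e cont_k)+
    show "0 \<le> Ck K * k s" for s using CK k_ge_1[of s] by auto
    fix s assume s: "s \<in> {0..T}"
    show "(e s)\<^sup>2 \<le> Ca * err + integral {0..s} (\<lambda>s. Ck K * k s * (e s)\<^sup>2)"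
      using energy_inequality[OF K s] by (simp add: W_def mult.assoc)
  qed (rule t)
  also have "\<dots> \<le> Ca * err * exp (Ck K * C1)"
  proof (rule mult_left_mono)
    have "Ck K * Ik t \<le> Ck K * C1" using Ik_le[OF t] CK by (rule mult_left_mono)
    then show "exp (integral {0..t} (\<lambda>s. Ck K * k s)) \<le> exp (Ck K * C1)" by (simp add: Ik_def)
    have "0 \<le> CQ R T" unfolding CQ_def using nn by auto
    then show "0 \<le> Ca * err" unfolding Ca_def err_def Ct_def using nn tau_nonneg by (intro mult_nonneg_nonneg add_nonneg_nonneg) auto
  qed
  finally show ?thesis .
qed

end

section \<open>Existence of truncated solutions\<close>

text \<open>With it a family of curves indexed by the integers becomes one bounded continuous
  function on \<open>real \<times> int discrete\<close>, hence a point of the complete type of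
  bounded continuous functions, where the Banach fixed point theorem is available.\<close>

lemma continuous_on_times_discrete:
  fixes f :: "real \<times> 'b discrete \<Rightarrow> 'a::topological_space"
  assumes "\<And>n. continuous_on UNIV (\<lambda>t. f (t, n))"
  shows "continuous_on UNIV f"
  unfolding continuous_on_open_vimage[OF open_UNIV]
proof (intro allI impI)
  fix S :: "'a set" assume S: "open S"
  have "f -` S \<inter> UNIV = (\<Union>n. ((\<lambda>t. f (t, n)) -` S) \<times> {n})" by auto
  moreover have "open (((\<lambda>t. f (t, n)) -` S) \<times> {n})" for n
    using assms[of n] S by (intro open_Times Discrete_Topology.open_discrete) (auto simp: continuous_on_open_vimage[OF open_UNIV])
  ultimately show "open (f -` S \<inter> UNIV)" by auto
qed

lemma exp_has_integral:
  fixes l t c :: real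
  assumes "0 < l" "0 \<le> t"
  shows "((\<lambda>s. c * exp (l * s)) has_integral (c / l * (exp (l * t) - 1))) {0..t}"
proof -
  have "((\<lambda>s. c * exp (l * s)) has_integral (c / l * exp (l * t) - c / l * exp (l * 0))) {0..t}"
  proof (rule fundamental_theorem_of_calculus[OF assms(2)])
    fix s
    have "((\<lambda>s. c / l * exp (l * s)) has_real_derivative c * exp (l * s)) (at s within {0..t})"
      using assms(1) by (auto intro!: derivative_eq_intros)
    then show "((\<lambda>s. c / l * exp (l * s)) has_vector_derivative c * exp (l * s)) (at s within {0..t})"
      by (simp add: has_real_derivative_iff_has_vector_derivative)
  qed
  then show ?thesis by (simp add: algebra_simps)
qed

text \<open>Picard iteration in the norm \<open>sup exp (- l s) \<bar>x s n\<bar>\<close>, in which the integral operator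
  contracts on the whole interval at once.\<close>

lemma picard_system:
  fixes G :: "int \<Rightarrow> real \<Rightarrow> (int \<Rightarrow> complex) \<Rightarrow> complex" and c :: "int \<Rightarrow> complex"
  assumes A: "finite A" and T: "0 \<le> T" and \<Lambda>: "0 < \<Lambda>"
    and lip: "\<And>n s z w D. 0 \<le> D \<Longrightarrow> (\<And>m. m \<in> A \<Longrightarrow> cmod (z m - w m) \<le> D) \<Longrightarrow> cmod (G n s z - G n s w) \<le> \<Lambda> * D"
    and zero: "\<And>n s. G n s (\<lambda>_. 0) = 0"
    and cont: "\<And>z n. (\<And>m. continuous_on {0..T} (\<lambda>s. z s m)) \<Longrightarrow> continuous_on {0..T} (\<lambda>s. G n s (z s))"
  obtains \<zeta> where "\<And>n. continuous_on {0..T} (\<lambda>s. \<zeta> s n)"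
    "\<And>t n. \<zeta> t n = (if n \<in> A then c n + integral {0..max 0 (min T t)} (\<lambda>s. G n s (\<zeta> s)) else 0)"
proof -
  \<comment> \<open>Integrating the exponential weight gains \<open>1 / l\<close>, so the Lipschitz
    constant \<open>\<Lambda>\<close> becomes the contraction factor \<open>1/2\<close>.\<close>
  define l where "l = 2 * \<Lambda>"
  have l: "0 < l" using \<Lambda> by (simp add: l_def)
  \<comment> \<open>Clamping time to \<open>{0..T}\<close> extends the curves constantly, since the
    function space lives on the whole line.\<close>
  define cl where "cl t = max 0 (min T t)" for t :: real
  have cl: "cl t \<in> {0..T}" for t using T by (auto simp: cl_def)
  have cl_id: "t \<in> {0..T} \<Longrightarrow> cl t = t" for t by (auto simp: cl_def)
  have ccl: "continuous_on UNIV cl" unfolding cl_def by (intro continuous_intros)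
  \<comment> \<open>The fixed point is sought for the curve divided by \<open>exp (l * s)\<close>;
    \<open>z\<close> undoes this division.\<close>
  define z where "z x s m = exp (l * s) *\<^sub>R apply_bcontfun x (s, discrete m)" for x :: "(real \<times> int discrete) \<Rightarrow>\<^sub>C complex" and s :: real and m :: int
  have cx: "continuous_on {0..T} (\<lambda>s. apply_bcontfun x (s, discrete m))" for x :: "(real \<times> int discrete) \<Rightarrow>\<^sub>C complex" and m
    by (rule continuous_on_compose2[of UNIV "apply_bcontfun x"]) (auto intro!: continuous_intros)
  have cz: "continuous_on {0..T} (\<lambda>s. z x s m)" for x m
    unfolding z_def by (intro continuous_intros cx)
  have iG: "(\<lambda>s. G n s (z x s)) integrable_on {0..t}" "(\<lambda>s. G n s (z x s) - G n s (z x' s)) integrable_on {0..t}"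
    if "t \<in> {0..T}" for n x x' t
    using that by (intro integrable_diff integrable_continuous_real continuous_on_subset[OF cont[OF cz]]; auto)+
  define \<Psi> where "\<Psi> x = (\<lambda>(t, k). if of_discrete k \<in> A then exp (- (l * cl t)) *\<^sub>R
     (c (of_discrete k) + integral {0..cl t} (\<lambda>s. G (of_discrete k) s (z x s))) else 0)"
    for x :: "(real \<times> int discrete) \<Rightarrow>\<^sub>C complex"
  have Gd: "cmod (G n s (z x s) - G n s (z x' s)) \<le> \<Lambda> * (exp (l * s) * dist x x')" for n s x x'
  proof (rule lip)
    fix m
    have "z x s m - z x' s m = exp (l * s) *\<^sub>R (apply_bcontfun x (s, discrete m) - apply_bcontfun x' (s, discrete m))"
      by (simp add: z_def scaleR_diff_right)
    then show "cmod (z x s m - z x' s m) \<le> exp (l * s) * dist x x'"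
      using dist_bounded[of x "(s, discrete m)" x'] by (simp add: dist_norm)
  qed simp
  have Id: "exp (- (l * t)) * cmod (integral {0..t} (\<lambda>s. G n s (z x s)) - integral {0..t} (\<lambda>s. G n s (z x' s))) \<le> 1/2 * dist x x'"
    if t: "t \<in> {0..T}" for n x x' t
  proof -
    have t0: "0 \<le> t" using t by simp
    have "cmod (integral {0..t} (\<lambda>s. G n s (z x s)) - integral {0..t} (\<lambda>s. G n s (z x' s))) =
      cmod (integral {0..t} (\<lambda>s. G n s (z x s) - G n s (z x' s)))"
      by (simp add: integral_diff[OF iG(1)[OF t] iG(1)[OF t]])
    also have "\<dots> \<le> integral {0..t} (\<lambda>s. \<Lambda> * dist x x' * exp (l * s))"
    proof (rule integral_norm_bound_integral[OF iG(2)[OF t]])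
      show "(\<lambda>s. \<Lambda> * dist x x' * exp (l * s)) integrable_on {0..t}"
        using exp_has_integral[OF l t0] by (rule has_integral_integrable)
      show "cmod (G n s (z x s) - G n s (z x' s)) \<le> \<Lambda> * dist x x' * exp (l * s)" for s
        using Gd[of n s x x'] by (simp only: mult_ac)
    qed
    also have "\<dots> = \<Lambda> * dist x x' / l * (exp (l * t) - 1)" using exp_has_integral[OF l t0] by (rule integral_unique)
    also have "\<dots> = 1/2 * dist x x' * (exp (l * t) - 1)" using \<Lambda> by (simp add: l_def)
    also have "\<dots> \<le> 1/2 * dist x x' * exp (l * t)" by (intro mult_left_mono) auto
    finally show ?thesis by (simp add: exp_minus field_simps)
  qed
  have \<Psi>b: "\<Psi> x \<in> bcontfun" for x
  proof (rule bcontfun_normI)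
    show "continuous_on UNIV (\<Psi> x)"
    proof (rule continuous_on_times_discrete)
      fix k :: "int discrete"
      define n where "n = of_discrete k"
      have "continuous_on {0..T} (\<lambda>t. integral {0..t} (\<lambda>s. G n s (z x s)))"
        using T by (intro indefinite_integral_continuous_1 iG) auto
      then have "continuous_on UNIV (\<lambda>t. integral {0..cl t} (\<lambda>s. G n s (z x s)))"
        by (rule continuous_on_compose2[OF _ ccl]) (use cl in auto)
      then show "continuous_on UNIV (\<lambda>t. \<Psi> x (t, k))"
        unfolding \<Psi>_def prod.case n_def[symmetric] by (cases "n \<in> A") (auto intro!: continuous_intros ccl)
    qed
    fix p :: "real \<times> int discrete"
    obtain t n where p: "p = (t, discrete n)" by (cases p, case_tac b) auto
    have "z 0 s = (\<lambda>_. 0)" for s by (simp add: z_def fun_eq_iff)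
    then have G0: "integral {0..cl t} (\<lambda>s. G n s (z 0 s)) = 0" by (simp add: zero)
    have "cmod (\<Psi> x p) \<le> (\<Sum>n\<in>A. cmod (c n)) + 1/2 * dist x 0"
    proof (cases "n \<in> A")
      case True
      have "cmod (\<Psi> x p) \<le> exp (- (l * cl t)) * (cmod (c n) + cmod (integral {0..cl t} (\<lambda>s. G n s (z x s))))"
        unfolding \<Psi>_def p prod.case discrete_inverse[OF UNIV_I] using True by (simp add: norm_triangle_ineq)
      also have "\<dots> \<le> 1 * cmod (c n) + 1/2 * dist x 0"
        unfolding distrib_left using Id[OF cl, of t n x 0] l cl[of t] unfolding G0
        by (intro add_mono mult_right_mono) auto
      also have "1 * cmod (c n) \<le> (\<Sum>n\<in>A. cmod (c n))" using True A by (auto intro: member_le_sum)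
      finally show ?thesis by simp
    qed (auto simp: \<Psi>_def p discrete_inverse sum_nonneg)
    then show "norm (\<Psi> x p) \<le> (\<Sum>n\<in>A. cmod (c n)) + 1/2 * dist x 0" .
  qed
  have "\<exists>!x. Bcontfun (\<Psi> x) = x"
  proof (rule banach_fix_type[where c = "1/2"])
    show "\<forall>x y. dist (Bcontfun (\<Psi> x)) (Bcontfun (\<Psi> y)) \<le> 1/2 * dist x y"
    proof (intro allI dist_bound)
      fix x x' :: "(real \<times> int discrete) \<Rightarrow>\<^sub>C complex" and p :: "real \<times> int discrete"
      obtain t n where p: "p = (t, discrete n)" by (cases p, case_tac b) auto
      have "dist (\<Psi> x p) (\<Psi> x' p) \<le> 1/2 * dist x x'"
      proof (cases "n \<in> A")
        case True
        then have "dist (\<Psi> x p) (\<Psi> x' p) = exp (- (l * cl t)) * cmod (integral {0..cl t} (\<lambda>s. G n s (z x s)) - integral {0..cl t} (\<lambda>s. G n s (z x' s)))"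
          by (simp add: \<Psi>_def p discrete_inverse dist_norm flip: scaleR_diff_right)
        then show ?thesis using Id[OF cl] by simp
      qed (simp add: \<Psi>_def p discrete_inverse)
      then show "dist (apply_bcontfun (Bcontfun (\<Psi> x)) p) (apply_bcontfun (Bcontfun (\<Psi> x')) p) \<le> 1/2 * dist x x'"
        by (simp add: Bcontfun_inverse[OF \<Psi>b])
    qed
  qed auto
  then obtain x where "Bcontfun (\<Psi> x) = x" by blast
  then have x: "apply_bcontfun x = \<Psi> x" using Bcontfun_inverse[OF \<Psi>b] by metis
  define \<zeta> where "\<zeta> t n = z x (cl t) n" for t n
  have zz: "\<zeta> s = z x s" if "s \<in> {0..T}" for s unfolding \<zeta>_def cl_id[OF that] ..
  show thesis
  proof (rule that[of \<zeta>])
    fix n show "continuous_on {0..T} (\<lambda>s. \<zeta> s n)" by (rule continuous_on_eq[OF cz[of x n]]) (simp add: zz)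
  next
    fix t n
    have cc: "cl (cl t) = cl t" using cl_id cl by blast
    have "integral {0..cl t} (\<lambda>s. G n s (\<zeta> s)) = integral {0..cl t} (\<lambda>s. G n s (z x s))"
      using cl[of t] by (intro integral_cong) (simp add: zz)
    then show "\<zeta> t n = (if n \<in> A then c n + integral {0..max 0 (min T t)} (\<lambda>s. G n s (\<zeta> s)) else 0)"
      unfolding cl_def[symmetric] \<zeta>_def[of t] z_def[of x "cl t"] x
      by (simp add: \<Psi>_def discrete_inverse cc flip: exp_add)
  qed
qed

section \<open>Cut-off vector field and global existence for a fixed truncation\<close>

context kaw
begin

text \<open>Projecting to real data and rescaling to a ball of radius \<open>R\<close> makes the vector field globally Lipschitz;
  conservation of energy shows afterwards that \<open>cut\<close> acts as the identity along the solution.\<close>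

definition hm :: "(int \<Rightarrow> complex) \<Rightarrow> int \<Rightarrow> complex" where "hm z m = (z m + cnj (z (- m))) / 2"

definition cut :: "nat \<Rightarrow> real \<Rightarrow> (int \<Rightarrow> complex) \<Rightarrow> int \<Rightarrow> complex" where
  "cut N R z m = (if m \<in> modes N then of_real (R / max R (sqrt (n2 N (hm z)))) * hm z m else 0)"

lemma herm_cut: "herm (cut N R z)"
  by (auto simp: herm_def cut_def hm_def)

lemma supp_cut: "supp (cut N R z) N" by (simp add: supp_def cut_def)

lemma sqrt_n2_le_card:
  assumes "\<And>m. m \<in> modes N \<Longrightarrow> cmod (z m) \<le> D" "0 \<le> D"
  shows "sqrt (n2 N z) \<le> real (card (modes N)) * D"
proof -
  have "sqrt (n2 N z) \<le> (\<Sum>m\<in>modes N. cmod (z m))"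
    using L2_set_le_sum[of "modes N" "\<lambda>m. cmod (z m)"] by (simp add: L2_set_def n2_def)
  also have "\<dots> \<le> real (card (modes N)) * D" by (rule sum_bounded_above) (rule assms)
  finally show ?thesis .
qed

lemma sqrt_n2_diff_le: "\<bar>sqrt (n2 N z) - sqrt (n2 N w)\<bar> \<le> sqrt (n2 N (\<lambda>m. z m - w m))"
proof -
  have m: "n2 N (\<lambda>m. - z m) = n2 N z" for z by (simp add: n2_def)
  have "sqrt (n2 N z) \<le> sqrt (n2 N (\<lambda>m. z m - w m)) + sqrt (n2 N w)" for z w
    using n2_triangle[of N "\<lambda>m. z m - w m" "\<lambda>m. - w m"] m[of w] by simp
  from this[of z w] this[of w z] show ?thesis using m[of "\<lambda>m. z m - w m"] by simp
qed

lemma cut_le: assumes "0 < R" shows "cmod (cut N R z m) \<le> R"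
proof (cases "m \<in> modes N")
  case True
  let ?a = "max R (sqrt (n2 N (hm z)))"
  have "cmod (hm z m) \<le> ?a" using cmod_le_n2[OF True, of "hm z"] by simp
  then have "R * cmod (hm z m) \<le> R * ?a" using assms by (intro mult_left_mono) auto
  moreover have "0 < ?a" using assms by simp
  ultimately show ?thesis using True assms by (simp add: cut_def norm_mult norm_divide pos_divide_le_eq del: max_less_iff_conj)
qed (use assms in \<open>simp add: cut_def\<close>)

lemma cut_lip:
  assumes R: "0 < R" and D: "0 \<le> D" "\<And>m. m \<in> modes N \<Longrightarrow> cmod (z m - w m) \<le> D"
  shows "cmod (cut N R z m - cut N R w m) \<le> (1 + real (card (modes N))) * D"
proof (cases "m \<in> modes N")
  case True
  let ?c = "real (card (modes N))" and ?p = "hm z" and ?q = "hm w"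
  let ?a = "max R (sqrt (n2 N ?p))" and ?b = "max R (sqrt (n2 N ?q))"
  have ab: "0 < ?a" "0 < ?b" "R \<le> ?a" "R \<le> ?b" using R by auto
  have pq: "cmod (?p j - ?q j) \<le> D" if "j \<in> modes N" for j
  proof -
    have e: "?p j - ?q j = ((z j - w j) + cnj (z (- j) - w (- j))) / 2" by (simp add: hm_def field_simps)
    have "cmod (?p j - ?q j) \<le> (cmod (z j - w j) + cmod (cnj (z (- j) - w (- j)))) / 2"
      unfolding e norm_divide by (simp add: norm_triangle_ineq del: complex_cnj_diff complex_mod_cnj)
    also have "\<dots> \<le> D" using D(2)[of j] D(2)[of "- j"] that by (simp only: complex_mod_cnj) simp
    finally show ?thesis .
  qed
  have d: "\<bar>?a - ?b\<bar> \<le> ?c * D"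
    using sqrt_n2_diff_le[of N ?p ?q] sqrt_n2_le_card[of N "\<lambda>m. ?p m - ?q m" D] pq D(1) by auto
  have q: "cmod (?q m) \<le> ?b" using cmod_le_n2[OF True, of ?q] by simp
  \<comment> \<open>The two scalar factors differ by \<open>R / a * (b - a) / b\<close> with
    \<open>a\<close>, \<open>b\<close> the two maxima; the size of the second vector is at most
    \<open>b\<close>, which cancels the denominator.\<close>
  have cc: "cut N R z m - cut N R w m = of_real (R / ?a) * (?p m - ?q m) + of_real (R / ?a * ((?b - ?a) / ?b)) * ?q m"
    using True ab by (simp add: cut_def field_simps)
  have "\<bar>R / ?a\<bar> = R / ?a" "\<bar>R / ?a * ((?b - ?a) / ?b)\<bar> = R / ?a * (\<bar>?b - ?a\<bar> / ?b)"
    using ab R by (simp_all add: abs_mult abs_divide)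
  then have "cmod (cut N R z m - cut N R w m) \<le> R / ?a * cmod (?p m - ?q m) + R / ?a * (\<bar>?b - ?a\<bar> / ?b) * cmod (?q m)"
    unfolding cc by (intro order_trans[OF norm_triangle_ineq]) (simp only: norm_mult norm_of_real)
  also have "\<dots> \<le> 1 * D + 1 * (\<bar>?b - ?a\<bar> / ?b) * ?b"
    using ab R pq[OF True] q by (intro add_mono mult_mono divide_nonneg_pos mult_nonneg_nonneg) auto
  also have "\<dots> \<le> D + ?c * D" using d ab by (simp add: abs_minus_commute)
  finally show ?thesis by (simp add: algebra_simps)
qed (use D in \<open>simp add: cut_def\<close>)

text \<open>Only existence for a fixed truncation rests on this estimate, so the constant may grow
  with \<open>N\<close>.\<close>

lemma rhs_lip:
  assumes "\<And>m. cmod (p m) \<le> R" "\<And>m. cmod (q m) \<le> R" "\<And>m. cmod (p m - q m) \<le> D"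
  shows "cmod (rhs N N s p n - rhs N N s q n) \<le> real N * (real (card (modes N)))\<^sup>2 * R\<^sup>2 * D"
proof (cases "n \<in> modes N")
  case True
  let ?c = "real (card (modes N))" and ?p = "U s p" and ?q = "U s q"
  have R0: "0 \<le> R" "0 \<le> D" using assms(1,3)[of 0] norm_ge_zero order_trans by blast+
  have b: "cmod (?p m) \<le> R" "cmod (?q m) \<le> R" "cmod (?p m - ?q m) \<le> D" for m
    using assms[of m] by (simp_all add: U_def norm_mult flip: right_diff_distrib)
  have three: "cmod (?p a * ?p b * ?p c - ?q a * ?q b * ?q c) \<le> 3 * R\<^sup>2 * D" for a b c
  proof -
    have "?p a * ?p b * ?p c - ?q a * ?q b * ?q c = (?p a - ?q a) * ?p b * ?p c + ?q a * (?p b - ?q b) * ?p c + ?q a * ?q b * (?p c - ?q c)"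
      by (simp add: algebra_simps)
    also have "cmod \<dots> \<le> D * R * R + R * D * R + R * R * D"
      by (intro norm_triangle_le add_mono) (auto simp: norm_mult intro!: mult_mono b R0 mult_nonneg_nonneg)
    finally show ?thesis by (simp add: power2_eq_square algebra_simps)
  qed
  have "cmod (cub N ?p n - cub N ?q n) \<le> (\<Sum>a\<in>modes N. \<Sum>b\<in>modes N. 3 * R\<^sup>2 * D)"
    unfolding tri_def sum_subtractf[symmetric] by (intro order_trans[OF norm_sum] sum_mono three)
  also have "\<dots> = 3 * ?c\<^sup>2 * R\<^sup>2 * D" by (simp add: power2_eq_square)
  finally have c: "cmod (cub N ?p n - cub N ?q n) \<le> 3 * ?c\<^sup>2 * R\<^sup>2 * D" .
  have e: "rhs N N s p n - rhs N N s q n = \<i> * of_real (\<mu> * of_int n / 3) * cis (- (s * phase \<beta> \<gamma> n)) * (cub N ?p n - cub N ?q n)"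
    using True by (simp add: rhs_def right_diff_distrib)
  have "cmod (rhs N N s p n - rhs N N s q n) = \<bar>real_of_int n\<bar> / 3 * cmod (cub N ?p n - cub N ?q n)"
    unfolding e norm_mult norm_ii norm_cis norm_of_real by (simp add: abs_mult mu)
  also have "\<dots> \<le> real N / 3 * (3 * ?c\<^sup>2 * R\<^sup>2 * D)"
  proof (intro mult_mono c divide_right_mono)
    have "\<bar>n\<bar> \<le> int N" using True by (auto simp: modes_def)
    then show "\<bar>real_of_int n\<bar> \<le> real N" by linarith
  qed auto
  finally show ?thesis by (simp add: mult_ac)
next
  case False
  have "0 \<le> D" using assms(3)[of 0] norm_ge_zero order_trans by blast
  then show ?thesis using False by (simp add: rhs_def)
qed

lemma herm_rhs: "herm z \<Longrightarrow> herm (rhs N B s z)"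
proof -
  assume z: "herm z"
  have "tri B u u u (- n) = cnj (tri B u u u n)" if "herm u" for u n
  proof -
    have "tri B u u u (- n) = (\<Sum>a\<in>modes B. u (- a) * conv B u u (- (n - a)))"
      unfolding tri_conv by (rule sum.reindex_bij_witness[of _ uminus uminus]) auto
    then show ?thesis by (simp add: tri_conv herm_conv[OF that that] hermD[OF that] del: minus_diff_eq)
  qed
  from this[OF herm_U[OF z]] show ?thesis by (simp add: herm_def rhs_def phase_minus cis_cnj)
qed

text \<open>The equation with \<open>cut\<close> inserted is globally Lipschitz and has a solution
  on all of \<open>{0..T}\<close>. Its energy is conserved, so it stays in the ball where
  \<open>cut\<close> is the identity and solves the original equation. The \<open>+ 1\<close> in
  \<open>R\<close> keeps the radius positive for zero data.\<close>

lemma galerkin_exists: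
  assumes c: "herm c" and T: "0 \<le> T"
  shows "\<exists>\<zeta>. galerkin \<beta> \<gamma> \<mu> N N T \<zeta> \<and> \<zeta> 0 = (\<lambda>n. if n \<in> modes N then c n else 0)"
proof -
  define R where "R = sqrt (n2 N c) + 1"
  have R: "0 < R" unfolding R_def by (simp add: add_nonneg_pos)
  define C where "C = (1 + real (card (modes N)))"
  define G where "G n s z = rhs N N s (cut N R z) n" for n s z
  define \<Lambda> where "\<Lambda> = real N * (real (card (modes N)))\<^sup>2 * R\<^sup>2 * C + 1"
  have G_cont: "continuous_on {0..T} (\<lambda>s. G n s (z s))" if "\<And>m. continuous_on {0..T} (\<lambda>s. z s m)" for z n
  proof -
    have ch: "continuous_on {0..T} (\<lambda>s. hm (z s) m)" for m
      unfolding hm_def by (intro continuous_intros that) auto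
    have "continuous_on {0..T} (\<lambda>s. max R (sqrt (n2 N (hm (z s)))))"
      unfolding n2_def by (intro continuous_intros ch)
    then have cc: "continuous_on {0..T} (\<lambda>s. cut N R (z s) m)" for m
      unfolding cut_def using R by (cases "m \<in> modes N") (auto intro!: continuous_intros ch simp: less_max_iff_disj order_less_imp_not_eq2)
    show ?thesis unfolding G_def rhs_def tri_def U_def
      by (cases "n \<in> modes N") (auto intro!: continuous_intros cc)
  qed
  have lip: "cmod (G n s z - G n s w) \<le> \<Lambda> * D" if "0 \<le> D" "\<And>m. m \<in> modes N \<Longrightarrow> cmod (z m - w m) \<le> D" for n s z w D
  proof -
    have "cmod (G n s z - G n s w) \<le> real N * (real (card (modes N)))\<^sup>2 * R\<^sup>2 * (C * D)"
      unfolding G_def C_def by (intro rhs_lip cut_le cut_lip R that)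
    also have "\<dots> \<le> \<Lambda> * D" using that(1) by (simp add: \<Lambda>_def algebra_simps)
    finally show ?thesis .
  qed
  have zero: "G n s (\<lambda>_. 0) = 0" for n s
    by (simp add: G_def rhs_def tri_def U_def cut_def hm_def)
  have "0 < \<Lambda>" unfolding \<Lambda>_def C_def by (intro add_nonneg_pos) auto
  obtain \<zeta> where cz: "\<And>n. continuous_on {0..T} (\<lambda>s. \<zeta> s n)"
    and z: "\<And>t n. \<zeta> t n = (if n \<in> modes N then c n + integral {0..max 0 (min T t)} (\<lambda>s. G n s (\<zeta> s)) else 0)"
    using picard_system[of "modes N" T \<Lambda> G c, OF finite_modes T \<open>0 < \<Lambda>\<close> lip zero G_cont] by blast
  have supp: "supp (\<zeta> s) N" for s unfolding supp_def by (subst z) simp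
  have herm: "herm (\<zeta> s)" for s
    unfolding herm_def
  proof
    fix n
    have "G (- n) s w = cnj (G n s w)" for s w
      unfolding G_def using herm_rhs[OF herm_cut] by (simp add: herm_def)
    then show "\<zeta> s (- n) = cnj (\<zeta> s n)" by (simp add: z[of s] hermD[OF c] integral_cnj)
  qed
  have deriv: "((\<lambda>s. \<zeta> s n) has_vector_derivative G n s (\<zeta> s)) (at s within {0..T})" if s: "s \<in> {0..T}" for s n
  proof (cases "n \<in> modes N")
    case True
    have "((\<lambda>t. integral {0..t} (\<lambda>s. G n s (\<zeta> s))) has_vector_derivative G n s (\<zeta> s)) (at s within {0..T})"
      by (rule integral_has_vector_derivative[OF G_cont[OF cz] s])
    from has_vector_derivative_add[OF has_vector_derivative_const[of "c n"] this]
    have "((\<lambda>t. c n + integral {0..t} (\<lambda>s. G n s (\<zeta> s))) has_vector_derivative G n s (\<zeta> s)) (at s within {0..T})" by simp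
    then show ?thesis
      by (rule has_vector_derivative_transform[OF s, rotated]) (use True in \<open>simp add: z[of _ n]\<close>)
  next
    case False
    have "(\<lambda>s. \<zeta> s n) = (\<lambda>s. 0)" by (rule ext) (subst z, simp add: False)
    moreover have "G n s (\<zeta> s) = 0" by (simp add: G_def rhs_def False)
    ultimately show ?thesis by simp
  qed
  have z0: "\<zeta> 0 = (\<lambda>n. if n \<in> modes N then c n else 0)"
    using T by (intro ext) (subst z, simp)
  have hmz: "hm (\<zeta> s) = \<zeta> s" for s using hermD[OF herm[of s]] by (simp add: hm_def fun_eq_iff)
  have en: "n2 N (\<zeta> s) = n2 N (\<zeta> 0)" if s: "s \<in> {0..T}" for s
  proof -
    have "((\<lambda>s. n2 N (\<zeta> s)) has_real_derivative 0) (at x within {0..T})" if x: "x \<in> {0..T}" for x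
    proof -
      define a where "a = R / max R (sqrt (n2 N (\<zeta> x)))"
      have a: "0 < a" using R by (simp add: a_def less_max_iff_disj)
      \<comment> \<open>On a Hermitian vector supported in the box \<open>cut\<close> only rescales
        by the positive number \<open>a\<close>. The field is orthogonal to the cut vector, hence to
        \<open>\<zeta> x\<close> itself, so energy is conserved before \<open>cut\<close> is known
        to be the identity.\<close>
      have cutz: "cut N R (\<zeta> x) = (\<lambda>m. of_real a * \<zeta> x m)"
        using suppD[OF supp[of x]] by (auto simp: cut_def hmz a_def)
      have "((\<lambda>s. n2 N (\<zeta> s)) has_real_derivative (\<Sum>n\<in>modes N. 2 * Re (cnj (\<zeta> x n) * G n x (\<zeta> x)))) (at x within {0..T})"
        unfolding n2_def by (intro DERIV_sum deriv_cmod_sq deriv x)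
      moreover have "(\<Sum>n\<in>modes N. 2 * Re (cnj (\<zeta> x n) * G n x (\<zeta> x))) = 0"
      proof -
        have "0 = (\<Sum>n\<in>modes N. 2 * Re (cnj (cut N R (\<zeta> x) n) * G n x (\<zeta> x)))"
          unfolding G_def using rhs_energy_zero[OF herm_cut supp_cut order_refl] by simp
        also have "\<dots> = a * (\<Sum>n\<in>modes N. 2 * Re (cnj (\<zeta> x n) * G n x (\<zeta> x)))"
          unfolding cutz sum_distrib_left by (intro sum.cong) (simp_all add: algebra_simps)
        finally show ?thesis using a by simp
      qed
      ultimately show ?thesis by simp
    qed
    then obtain d where "\<forall>x\<in>{0..T}. n2 N (\<zeta> x) = d"
      using has_field_derivative_zero_constant[of "{0..T}" "\<lambda>s. n2 N (\<zeta> s)"] by auto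
    then show ?thesis using s T by auto
  qed
  have "n2 N (\<zeta> 0) = n2 N c" unfolding z0 n2_def by simp
  then have "sqrt (n2 N (\<zeta> s)) \<le> R" if "s \<in> {0..T}" for s using en[OF that] by (simp add: R_def)
  then have cutz: "cut N R (\<zeta> s) = \<zeta> s" if "s \<in> {0..T}" for s
    using suppD[OF supp[of s]] that R by (auto simp: cut_def hmz max_absorb1 fun_eq_iff)
  have "galerkin \<beta> \<gamma> \<mu> N N T \<zeta>"
    using supp herm T deriv by unfold_locales (auto simp: G_def cutz)
  then show ?thesis using z0 by blast
qed

end

section \<open>Convergence of truncated solutions\<close>

definition ell2 :: "(int \<Rightarrow> complex) \<Rightarrow> bool" where
  "ell2 c \<longleftrightarrow> herm c \<and> (\<exists>S. \<forall>N. n2 N c \<le> S)"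

definition trunc :: "nat \<Rightarrow> (int \<Rightarrow> complex) \<Rightarrow> int \<Rightarrow> complex" where
  "trunc N c = (\<lambda>n. if n \<in> modes N then c n else 0)"

lemma n2_mono: "M \<le> N \<Longrightarrow> n2 M c \<le> n2 N c"
  unfolding n2_def by (intro sum_mono2 modes_mono) auto

lemma n2_tail: "M \<le> N \<Longrightarrow> (\<Sum>n\<in>modes N - modes M. (cmod (c n))\<^sup>2) = n2 N c - n2 M c"
  unfolding n2_def using sum.subset_diff[OF modes_mono, of M N "\<lambda>n. (cmod (c n))\<^sup>2"] by simp

lemma ell2_tail:
  assumes "ell2 c" "0 < \<epsilon>"
  obtains M where "\<And>N. M \<le> N \<Longrightarrow> n2 N c - n2 M c < \<epsilon>"
proof -
  obtain S where S: "\<And>N. n2 N c \<le> S" using assms(1) by (auto simp: ell2_def)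
  have "convergent (\<lambda>N. n2 N c)"
    using S n2_mono by (intro Bseq_mono_convergent BseqI'[of _ "S"]) auto
  then have "Cauchy (\<lambda>N. n2 N c)" by (rule convergent_Cauchy)
  then obtain M where M: "\<And>m n. M \<le> m \<Longrightarrow> M \<le> n \<Longrightarrow> dist (n2 m c) (n2 n c) < \<epsilon>"
    using assms(2) unfolding Cauchy_def by blast
  show thesis
  proof (rule that[of M])
    fix N assume "M \<le> N"
    then show "n2 N c - n2 M c < \<epsilon>" using M[of N M] by (auto simp: dist_real_def)
  qed
qed

lemma tendsto_root8: "((\<lambda>N. real N powr - (1/8)) \<longlongrightarrow> 0) sequentially"
  by (rule tendsto_neg_powr[OF _ filterlim_real_sequentially]) simp

lemma eventually_root8: "0 < \<epsilon> \<Longrightarrow> \<exists>M\<ge>1. \<forall>N\<ge>M. real N powr - (1/8) < \<epsilon>"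
proof -
  assume "0 < \<epsilon>"
  then have "eventually (\<lambda>N. real N powr - (1/8) < \<epsilon>) sequentially" by (rule order_tendstoD(2)[OF tendsto_root8])
  then obtain M where "\<forall>N\<ge>M. real N powr - (1/8) < \<epsilon>" unfolding eventually_sequentially by blast
  then show ?thesis by (intro exI[of _ "max 1 M"]) auto
qed

section \<open>Stability of truncated solutions, uniform in the truncation\<close>

context kaw
begin

text \<open>The point is the order of quantifiers: \<open>C\<close> is found before
  \<open>M\<close>, the cut-offs, the box and the solutions. This is possible because
  \<open>Ca\<close>, \<open>Ck\<close> and \<open>C1\<close> depend only on \<open>T\<close>,
  \<open>R\<close> and \<open>K\<close>, and \<open>K\<close> is selected from
  \<open>R\<close>.\<close>

lemma stability:
  assumes R: "0 \<le> R"
  obtains C where "0 < C"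
    "\<And>N1 N2 B \<zeta> \<xi> M t. galerkin_pair \<beta> \<gamma> \<mu> N1 N2 B T \<zeta> \<xi> R M \<Longrightarrow> t \<in> {0..T} \<Longrightarrow>
      n2 B (\<lambda>n. \<zeta> t n - \<xi> t n) \<le> C * (real M * sqrt (n2 B (\<lambda>n. \<zeta> 0 n - \<xi> 0 n)) + (real M / real (min N1 N2)) powr (1/8) +
        (n2 B (\<zeta> 0) - n2 M (\<zeta> 0)) + (n2 B (\<xi> 0) - n2 M (\<xi> 0)) + real M powr - (1/8))"
proof -
  \<comment> \<open>The target for \<open>K\<close> is the absorption condition
    \<open>12 * ctri * R\<^sup>2 * real K powr - (1/8) \<le> 1\<close>; the \<open>+ 1\<close>
    avoids division by zero.\<close>
  have "0 < 1 / (12 * ctri * R\<^sup>2 + 1)" using ctri_nonneg by (simp add: add_nonneg_pos)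
  then obtain K :: nat where K: "1 \<le> K" "real K powr - (1/8) < 1 / (12 * ctri * R\<^sup>2 + 1)"
    using eventually_root8 by blast
  have K2: "6 * ctri * real K powr - (1/8) * R\<^sup>2 \<le> 1/2"
  proof -
    have "(12 * ctri * R\<^sup>2) * real K powr - (1/8) \<le> (12 * ctri * R\<^sup>2) * (1 / (12 * ctri * R\<^sup>2 + 1))"
      using K(2) ctri_nonneg by (intro mult_left_mono) auto
    also have "\<dots> \<le> 1" using ctri_nonneg by (simp add: divide_le_eq add_nonneg_pos)
    finally show ?thesis by (simp add: mult_ac)
  qed
  \<comment> \<open>The maximum with \<open>1\<close> secures positivity, which is needed when
    \<open>\<epsilon>\<close> is divided by \<open>C\<close>.\<close>
  define C where "C = max 1 (galerkin_pair.Ca T R * exp (galerkin_pair.Ck T R K * galerkin_pair.C1 T R))"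
  show thesis
  proof (rule that[of C])
    show "0 < C" by (simp add: C_def)
    fix N1 N2 B \<zeta> \<xi> M t assume p: "galerkin_pair \<beta> \<gamma> \<mu> N1 N2 B T \<zeta> \<xi> R M" and t: "t \<in> {0..T}"
    interpret galerkin_pair \<beta> \<gamma> \<mu> N1 N2 B T \<zeta> \<xi> R M by (rule p)
    have MB: "M \<le> B" using M g1.NB by simp
    have err: "err = real M * sqrt (n2 B (\<lambda>n. \<zeta> 0 n - \<xi> 0 n)) + (real M / real (min N1 N2)) powr (1/8) +
        (n2 B (\<zeta> 0) - n2 M (\<zeta> 0)) + (n2 B (\<xi> 0) - n2 M (\<xi> 0)) + real M powr - (1/8)"
      unfolding err_def e_def \<delta>_def L_def tau_def n2_tail[OF MB] y_eq ..
    have err0: "0 \<le> err" unfolding err_def using tau_nonneg \<delta>_nonneg by (intro add_nonneg_nonneg) auto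
    have "n2 B (\<lambda>n. \<zeta> t n - \<xi> t n) = (e t)\<^sup>2" by (simp add: e_def y_eq)
    also have "\<dots> \<le> Ca * exp (Ck K * C1) * err" using stability_aux[OF K(1) K2 t] by (simp add: mult_ac)
    also have "\<dots> \<le> C * err" unfolding C_def using err0 by (intro mult_right_mono) auto
    finally show "n2 B (\<lambda>n. \<zeta> t n - \<xi> t n) \<le> C * (real M * sqrt (n2 B (\<lambda>n. \<zeta> 0 n - \<xi> 0 n)) + (real M / real (min N1 N2)) powr (1/8) +
        (n2 B (\<zeta> 0) - n2 M (\<zeta> 0)) + (n2 B (\<xi> 0) - n2 M (\<xi> 0)) + real M powr - (1/8))" unfolding err .
  qed
qed

definition gal :: "real \<Rightarrow> nat \<Rightarrow> (int \<Rightarrow> complex) \<Rightarrow> real \<Rightarrow> int \<Rightarrow> complex" where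
  "gal T N c = (SOME \<zeta>. galerkin \<beta> \<gamma> \<mu> N N T \<zeta> \<and> \<zeta> 0 = trunc N c)"

lemma gal:
  assumes "herm c" "0 \<le> T"
  shows "galerkin \<beta> \<gamma> \<mu> N N T (gal T N c)" "gal T N c 0 = trunc N c"
  using someI_ex[OF galerkin_exists[OF assms, of N], folded trunc_def] unfolding gal_def by auto

lemma galerkin_mono:
  assumes "galerkin \<beta> \<gamma> \<mu> N N T \<zeta>" "N \<le> B"
  shows "galerkin \<beta> \<gamma> \<mu> N B T \<zeta>"
proof -
  interpret galerkin \<beta> \<gamma> \<mu> N N T \<zeta> by (rule assms)
  have "rhs N B s (\<zeta> s) = rhs N N s (\<zeta> s)" for s
    unfolding rhs_def tri_mono_modes[OF supp_U[OF supp_N] supp_U[OF supp_N] assms(2)] ..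
  then show ?thesis using T supp_N herm deriv assms(2) by unfold_locales auto
qed

lemma n2_trunc: "N \<le> B \<Longrightarrow> n2 B (trunc N c) = n2 N c"
proof -
  assume "N \<le> B"
  then have "n2 B (trunc N c) = n2 N (trunc N c)" by (intro n2_mono_modes) (auto simp: supp_def trunc_def)
  then show ?thesis by (simp add: n2_def trunc_def)
qed

lemma n2_trunc_lower: "M \<le> N \<Longrightarrow> n2 M (trunc N c) = n2 M c"
  unfolding n2_def trunc_def using modes_mono[of M N] by (intro sum.cong) auto

lemma sqrt_n2_add: "sqrt (n2 B (\<lambda>n. z n + w n)) \<le> sqrt (n2 B z) + sqrt (n2 B w)"
  using n2_triangle[of B z "\<lambda>n. - w n"] by (simp add: n2_def)

text \<open>The Galerkin solutions form a Cauchy family as the cut-off tends to infinity and the data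
  converge; both limits are taken together, so this yields existence and continuity at once.\<close>

lemma gal_stable:
  assumes c: "ell2 c" and T: "0 \<le> T" and eps: "0 < \<epsilon>"
  obtains \<delta> N0 where "0 < \<delta>"
    "\<And>c' N1 N2 B t. herm c' \<Longrightarrow> (\<And>N. n2 N (\<lambda>n. c n - c' n) \<le> \<delta>\<^sup>2) \<Longrightarrow> N0 \<le> N1 \<Longrightarrow> N0 \<le> N2 \<Longrightarrow>
      N1 \<le> B \<Longrightarrow> N2 \<le> B \<Longrightarrow> t \<in> {0..T} \<Longrightarrow> n2 B (\<lambda>n. gal T N1 c t n - gal T N2 c' t n) < \<epsilon>"
proof -
  obtain S where S: "\<And>N. n2 N c \<le> S" and hc: "herm c" using c by (auto simp: ell2_def)
  have S0: "0 \<le> S" using S[of 0] n2_nonneg order_trans by blast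
  \<comment> \<open>The extra \<open>1\<close> leaves room for the perturbed datum, which is at l2
    distance at most \<open>\<delta> \<le> 1\<close>.\<close>
  define R where "R = sqrt S + 1"
  have R: "0 \<le> R" using S0 by (simp add: R_def)
  obtain C where C: "0 < C" and st: "\<And>N1 N2 B \<zeta> \<xi> M t. galerkin_pair \<beta> \<gamma> \<mu> N1 N2 B T \<zeta> \<xi> R M \<Longrightarrow> t \<in> {0..T} \<Longrightarrow>
      n2 B (\<lambda>n. \<zeta> t n - \<xi> t n) \<le> C * (real M * sqrt (n2 B (\<lambda>n. \<zeta> 0 n - \<xi> 0 n)) + (real M / real (min N1 N2)) powr (1/8) +
        (n2 B (\<zeta> 0) - n2 M (\<zeta> 0)) + (n2 B (\<xi> 0) - n2 M (\<xi> 0)) + real M powr - (1/8))"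
    using stability[OF R, of T] by blast
  \<comment> \<open>The error terms are bounded by \<open>3/2 * h\<close> for the first and
    \<open>h\<close> for each of the other four, together at most \<open>6 * h\<close>, which stays
    below \<open>10 * h\<close>.\<close>
  define h where "h = \<epsilon> / (10 * C)"
  have h: "0 < h" using eps C by (simp add: h_def)
  obtain M1 where M1: "1 \<le> M1" "\<And>N. M1 \<le> N \<Longrightarrow> real N powr - (1/8) < h" using eventually_root8[OF h] by blast
  obtain M2 where M2: "\<And>N. M2 \<le> N \<Longrightarrow> n2 N c - n2 M2 c < h / 4" using ell2_tail[OF c, of "h / 4"] h by auto
  define M where "M = max M1 M2"
  have M: "1 \<le> M" and Mh: "real M powr - (1/8) < h" using M1 by (auto simp: M_def)
  have tail: "n2 N c - n2 M c < h / 4" if "M \<le> N" for N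
    using M2[of N] n2_mono[of M2 M c] that by (simp add: M_def)
  \<comment> \<open>Chosen after \<open>M\<close>: the second entry pays for the factor
    \<open>M\<close> in front of the initial distance, the third keeps the tail of the perturbed
    datum below \<open>h\<close>.\<close>
  define \<delta> where "\<delta> = min 1 (min (h / (2 * real M)) (sqrt (h / 4)))"
  have \<delta>: "0 < \<delta>" "\<delta> \<le> 1" "real M * \<delta> \<le> h / 2" "\<delta>\<^sup>2 \<le> h / 4"
  proof -
    show d: "0 < \<delta>" using h M by (simp add: \<delta>_def)
    have "\<delta> \<le> h / (2 * real M)" "\<delta> \<le> sqrt (h / 4)" by (simp_all add: \<delta>_def)
    then show "real M * \<delta> \<le> h / 2" "\<delta>\<^sup>2 \<le> h / 4"
      using M d h power_mono[of \<delta> "sqrt (h / 4)" 2] by (simp_all add: field_simps)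
  qed (simp add: \<delta>_def)
  \<comment> \<open>Also after \<open>M\<close>: \<open>N1'\<close> makes the truncation error of
    the datum small even when multiplied by \<open>M\<close>, and \<open>N2'\<close> makes the ratio
    of \<open>M\<close> to the cut-offs small.\<close>
  have "0 < (h / (2 * real M))\<^sup>2" using h M by simp
  then obtain N1' where N1': "\<And>N. N1' \<le> N \<Longrightarrow> n2 N c - n2 N1' c < (h / (2 * real M))\<^sup>2" using ell2_tail[OF c] by metis
  have "0 < h * real M powr - (1/8)" using h M by simp
  then obtain N2' where N2': "\<And>N. N2' \<le> N \<Longrightarrow> real N powr - (1/8) < h * real M powr - (1/8)" using eventually_root8 by blast
  define N0 where "N0 = max M (max N1' N2')"
  show thesis
  proof (rule that[OF \<delta>(1), of N0])
    fix c' N1 N2 B t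
    assume hc': "herm c'" and d: "\<And>N. n2 N (\<lambda>n. c n - c' n) \<le> \<delta>\<^sup>2" and N: "N0 \<le> N1" "N0 \<le> N2" "N1 \<le> B" "N2 \<le> B" and t: "t \<in> {0..T}"
    let ?z = "gal T N1 c" and ?x = "gal T N2 c'"
    let ?L = "min N1 N2"
    have sd: "sqrt (n2 N (\<lambda>n. c n - c' n)) \<le> \<delta>" for N using d[of N] \<delta>(1) by (simp add: real_le_lsqrt)
    have MN: "M \<le> ?L" "M \<le> N1" "M \<le> N2" "N1' \<le> ?L" "N2' \<le> ?L" "M \<le> B" using N by (auto simp: N0_def)
    have z0: "?z 0 = trunc N1 c" "?x 0 = trunc N2 c'" using gal hc hc' T by auto
    have nz: "n2 B (?z 0) = n2 N1 c" "n2 B (?x 0) = n2 N2 c'" "n2 M (?z 0) = n2 M c" "n2 M (?x 0) = n2 M c'"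
      unfolding z0 using N MN by (auto simp: n2_trunc n2_trunc_lower)
    interpret galerkin_pair \<beta> \<gamma> \<mu> N1 N2 B T ?z ?x R M
    proof -
      interpret g1: galerkin \<beta> \<gamma> \<mu> N1 B T ?z by (rule galerkin_mono[OF gal(1)[OF hc T] N(3)])
      interpret g2: galerkin \<beta> \<gamma> \<mu> N2 B T ?x by (rule galerkin_mono[OF gal(1)[OF hc' T] N(4)])
      show "galerkin_pair \<beta> \<gamma> \<mu> N1 N2 B T ?z ?x R M"
      proof unfold_locales
        show "sqrt (n2 B (?z 0)) \<le> R" unfolding nz R_def using S[of N1] by (simp add: add_increasing2)
        have "sqrt (n2 N2 c') \<le> sqrt (n2 N2 c) + sqrt (n2 N2 (\<lambda>n. c n - c' n))"
          using n2_triangle[of N2 c "\<lambda>n. c n - c' n"] by simp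
        also have "\<dots> \<le> sqrt S + 1"
          by (intro add_mono real_sqrt_le_mono S order_trans[OF sd \<delta>(2)])
        finally show "sqrt (n2 B (?x 0)) \<le> R" unfolding nz R_def .
      qed (use M MN in auto)
    qed
    have a1: "real M * sqrt (n2 B (\<lambda>n. ?z 0 n - ?x 0 n)) \<le> h + h / 2"
    proof -
      \<comment> \<open>Two sources of initial difference: truncating \<open>c\<close> at two
        levels, and the perturbation of the datum truncated at one level.\<close>
      have "(\<lambda>n. ?z 0 n - ?x 0 n) = (\<lambda>n. (trunc N1 c n - trunc N2 c n) + trunc N2 (\<lambda>n. c n - c' n) n)"
        unfolding z0 by (auto simp: trunc_def)
      then have "sqrt (n2 B (\<lambda>n. ?z 0 n - ?x 0 n)) \<le> sqrt (n2 B (\<lambda>n. trunc N1 c n - trunc N2 c n)) + sqrt (n2 B (trunc N2 (\<lambda>n. c n - c' n)))"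
        by (simp only: sqrt_n2_add)
      also have "sqrt (n2 B (trunc N2 (\<lambda>n. c n - c' n))) \<le> \<delta>" using n2_trunc[OF N(4)] sd by simp
      also have "sqrt (n2 B (\<lambda>n. trunc N1 c n - trunc N2 c n)) \<le> h / (2 * real M)"
      proof -
        have "n2 B (\<lambda>n. trunc N1 c n - trunc N2 c n) \<le> (\<Sum>n\<in>modes B - modes N1'. (cmod (c n))\<^sup>2)"
        proof -
          have "n2 B (\<lambda>n. trunc N1 c n - trunc N2 c n) = (\<Sum>n\<in>modes B - modes N1'. (cmod (trunc N1 c n - trunc N2 c n))\<^sup>2)"
            unfolding n2_def using MN modes_mono[of N1' N1] modes_mono[of N1' N2]
            by (intro sum.mono_neutral_right) (auto simp: trunc_def)
          also have "\<dots> \<le> (\<Sum>n\<in>modes B - modes N1'. (cmod (c n))\<^sup>2)"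
            by (intro sum_mono) (auto simp: trunc_def)
          finally show ?thesis .
        qed
        also have "\<dots> = n2 B c - n2 N1' c" using MN N by (intro n2_tail) auto
        also have "\<dots> \<le> (h / (2 * real M))\<^sup>2" using N1'[of B] MN N by auto
        finally show ?thesis using h by (simp add: real_le_lsqrt)
      qed
      finally have "real M * sqrt (n2 B (\<lambda>n. ?z 0 n - ?x 0 n)) \<le> real M * (h / (2 * real M) + \<delta>)"
        by (intro mult_left_mono) auto
      also have "\<dots> \<le> h + h / 2" using \<delta>(3) M h by (simp add: distrib_left)
      finally show ?thesis .
    qed
    have a2: "(real M / real ?L) powr (1/8) \<le> h"
    proof -
      have L: "1 \<le> ?L" using MN M by simp
      have "(real M / real ?L) powr (1/8) = real M powr (1/8) * real ?L powr - (1/8)"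
        using M L by (simp add: powr_divide powr_minus_divide)
      also have "\<dots> \<le> real M powr (1/8) * (h * real M powr - (1/8))" using N2'[of ?L] MN by (intro mult_left_mono) auto
      also have "\<dots> = h" using M by (simp add: powr_minus_divide)
      finally show ?thesis .
    qed
    have a3: "n2 B (?z 0) - n2 M (?z 0) \<le> h" unfolding nz using tail[OF MN(2)] h by simp
    have a4: "n2 B (?x 0) - n2 M (?x 0) \<le> h"
    proof -
      have "n2 N2 c' - n2 M c' = (\<Sum>n\<in>modes N2 - modes M. (cmod (c' n))\<^sup>2)" using MN by (simp add: n2_tail)
      also have "\<dots> \<le> (\<Sum>n\<in>modes N2 - modes M. 2 * (cmod (c n))\<^sup>2 + 2 * (cmod (c n - c' n))\<^sup>2)"
      proof (rule sum_mono)
        fix n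
        have "cmod (c' n) \<le> cmod (c n) + cmod (c n - c' n)" using norm_triangle_ineq4[of "c n" "c n - c' n"] by simp
        then have "(cmod (c' n))\<^sup>2 \<le> (cmod (c n) + cmod (c n - c' n))\<^sup>2" by (intro power_mono) auto
        also have "\<dots> \<le> 2 * (cmod (c n))\<^sup>2 + 2 * (cmod (c n - c' n))\<^sup>2"
          using zero_le_power2[of "cmod (c n) - cmod (c n - c' n)"] by (simp add: power2_diff power2_sum)
        finally show "(cmod (c' n))\<^sup>2 \<le> 2 * (cmod (c n))\<^sup>2 + 2 * (cmod (c n - c' n))\<^sup>2" .
      qed
      also have "\<dots> = 2 * (n2 N2 c - n2 M c) + 2 * (\<Sum>n\<in>modes N2 - modes M. (cmod (c n - c' n))\<^sup>2)"
        unfolding n2_tail[OF MN(3), symmetric] by (simp add: sum.distrib sum_distrib_left)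
      also have "(\<Sum>n\<in>modes N2 - modes M. (cmod (c n - c' n))\<^sup>2) \<le> n2 N2 (\<lambda>n. c n - c' n)"
        unfolding n2_def by (intro sum_mono2) auto
      also have "\<dots> \<le> h / 4" using d[of N2] \<delta>(4) by simp
      finally show ?thesis unfolding nz using tail[OF MN(3)] by simp
    qed
    have "n2 B (\<lambda>n. ?z t n - ?x t n) \<le> C * (real M * sqrt (n2 B (\<lambda>n. ?z 0 n - ?x 0 n)) + (real M / real ?L) powr (1/8) +
        (n2 B (?z 0) - n2 M (?z 0)) + (n2 B (?x 0) - n2 M (?x 0)) + real M powr - (1/8))"
      by (rule st[OF galerkin_pair_axioms t])
    also have "\<dots> \<le> C * (6 * h)"
      using a1 a2 a3 a4 Mh C h by (intro mult_left_mono) auto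
    also have "\<dots> < \<epsilon>" using C eps by (simp add: h_def)
    finally show "n2 B (\<lambda>n. ?z t n - ?x t n) < \<epsilon>" .
  qed
qed

end

section \<open>Functions on the torus\<close>

text \<open>The increments are summable in the L1 norm, so the telescoping series converges
  absolutely almost everywhere and may be integrated term by term. No dominating function has to be
  exhibited. The second claim accepts any measurable almost everywhere limit.\<close>

lemma L1_telescope:
  fixes f :: "nat \<Rightarrow> 'a \<Rightarrow> 'b::{banach, second_countable_topology}"
  assumes int [measurable]: "\<And>k. integrable M (f k)"
    and sum: "summable (\<lambda>k. \<integral>x. norm (f (Suc k) x - f k x) \<partial>M)"
  shows "AE x in M. convergent (\<lambda>k. f k x)"
    and "g \<in> borel_measurable M \<Longrightarrow> AE x in M. (\<lambda>k. f k x) \<longlonglongrightarrow> g x \<Longrightarrow>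
      integrable M g \<and> (\<lambda>k. integral\<^sup>L M (f k)) \<longlonglongrightarrow> integral\<^sup>L M g"
proof -
  let ?d = "\<lambda>k x. f (Suc k) x - f k x"
  have d: "integrable M (?d k)" for k by (intro Bochner_Integration.integrable_diff int)
  have "(\<integral>\<^sup>+x. (\<Sum>k. ennreal (norm (?d k x))) \<partial>M) = (\<Sum>k. \<integral>\<^sup>+x. ennreal (norm (?d k x)) \<partial>M)"
    by (intro nn_integral_suminf) measurable
  also have "\<dots> = (\<Sum>k. ennreal (\<integral>x. norm (?d k x) \<partial>M))"
    by (intro arg_cong[where f = suminf] ext nn_integral_eq_integral integrable_norm d) auto
  also have "\<dots> \<noteq> top" by (intro ennreal_suminf_neq_top sum) (auto intro: integral_nonneg_AE)
  finally have "(\<integral>\<^sup>+x. (\<Sum>k. ennreal (norm (?d k x))) \<partial>M) \<noteq> \<infinity>" by simp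
  then have "AE x in M. (\<Sum>k. ennreal (norm (?d k x))) \<noteq> \<infinity>"
    by (intro nn_integral_PInf_AE) measurable
  then have s: "AE x in M. summable (\<lambda>k. norm (?d k x))"
    by eventually_elim (auto intro!: summable_suminf_not_top)
  have tel: "f k x = f 0 x + (\<Sum>i<k. ?d i x)" for k x
    using sum_lessThan_telescope[of "\<lambda>k. f k x" k] by simp
  have lim: "AE x in M. (\<lambda>k. f k x) \<longlonglongrightarrow> f 0 x + (\<Sum>i. ?d i x)"
    using s
  proof eventually_elim
    fix x assume "summable (\<lambda>k. norm (?d k x))"
    then have "(\<lambda>k. \<Sum>i<k. ?d i x) \<longlonglongrightarrow> (\<Sum>i. ?d i x)" by (rule summable_LIMSEQ[OF summable_norm_cancel])
    from tendsto_add[OF tendsto_const this, of "f 0 x"]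
    show "(\<lambda>k. f k x) \<longlonglongrightarrow> f 0 x + (\<Sum>i. ?d i x)" by (simp only: tel[symmetric])
  qed
  then show "AE x in M. convergent (\<lambda>k. f k x)" by eventually_elim (auto simp: convergent_def)
  have iS: "integrable M (\<lambda>x. \<Sum>i. ?d i x)" "(\<lambda>i. integral\<^sup>L M (?d i)) sums (\<integral>x. (\<Sum>i. ?d i x) \<partial>M)"
    by (rule integrable_suminf[OF d s sum], rule sums_integral[OF d s sum])
  have i2: "integrable M (\<lambda>x. f 0 x + (\<Sum>i. ?d i x))" by (intro Bochner_Integration.integrable_add int iS)
  { assume g [measurable]: "g \<in> borel_measurable M" and gl: "AE x in M. (\<lambda>k. f k x) \<longlonglongrightarrow> g x"
    have eq: "AE x in M. g x = f 0 x + (\<Sum>i. ?d i x)"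
      using lim gl by eventually_elim (rule LIMSEQ_unique)
    have "integrable M g" using i2 integrable_cong_AE[OF g borel_measurable_integrable[OF i2] eq] by simp
    moreover have "integral\<^sup>L M g = integral\<^sup>L M (f 0) + (\<integral>x. (\<Sum>i. ?d i x) \<partial>M)"
      using integral_cong_AE[OF g borel_measurable_integrable[OF i2] eq] iS(1) int by simp
    moreover have "integral\<^sup>L M (f k) = integral\<^sup>L M (f 0) + (\<Sum>i<k. integral\<^sup>L M (?d i))" for k
      using int sum_lessThan_telescope[of "\<lambda>k. integral\<^sup>L M (f k)" k] by simp
    note ik = this
    have "(\<lambda>k. integral\<^sup>L M (f 0) + (\<Sum>i<k. integral\<^sup>L M (?d i))) \<longlonglongrightarrow> integral\<^sup>L M (f 0) + (\<integral>x. (\<Sum>i. ?d i x) \<partial>M)"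
      using tendsto_add[OF tendsto_const iS(2)[unfolded sums_def]] .
    then have "(\<lambda>k. integral\<^sup>L M (f k)) \<longlonglongrightarrow> integral\<^sup>L M (f 0) + (\<integral>x. (\<Sum>i. ?d i x) \<partial>M)"
      by (simp only: ik[symmetric])
    ultimately show "integrable M g \<and> (\<lambda>k. integral\<^sup>L M (f k)) \<longlonglongrightarrow> integral\<^sup>L M g" by simp }
qed

section \<open>Square-integrable functions on the torus\<close>

abbreviation MT :: "real measure" where "MT \<equiv> lebesgue_on {0..2*pi}"

lemma set_integrable_iff_MT:
  fixes f :: "real \<Rightarrow> 'b::{banach, second_countable_topology}"
  shows "set_integrable lebesgue {0..2*pi} f \<longleftrightarrow> integrable MT f"
  by (simp add: set_integrable_def integrable_restrict_space)

lemma set_integral_eq_MT: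
  fixes f :: "real \<Rightarrow> 'b::{banach, second_countable_topology}"
  shows "set_lebesgue_integral lebesgue {0..2*pi} f = integral\<^sup>L MT f"
  by (simp add: set_lebesgue_integral_def integral_restrict_space)

lemma L2T_iff: "f \<in> L2T \<longleftrightarrow> f \<in> borel_measurable MT \<and> integrable MT (\<lambda>x. (f x)\<^sup>2)"
  unfolding L2T_def set_integrable_iff_MT set_borel_measurable_def
  by (simp add: borel_measurable_restrict_space_iff)

lemma l2norm_sq: "(l2norm f)\<^sup>2 = (\<integral>x. (f x)\<^sup>2 \<partial>MT)"
  unfolding l2norm_def set_integral_eq_MT by (simp add: integral_nonneg_AE)

lemma l2norm_nonneg [simp]: "0 \<le> l2norm f"
  unfolding l2norm_def set_integral_eq_MT by (simp add: integral_nonneg_AE)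

lemma l2dist_nonneg [simp]: "0 \<le> l2dist f g" by (simp add: l2dist_def)

lemma fcoeff_MT: "fcoeff f n = (\<integral>x. complex_of_real (f x) * cis (- (real_of_int n * x)) \<partial>MT)"
  unfolding fcoeff_def set_integral_eq_MT by simp

lemma L2T_measurable: "f \<in> L2T \<Longrightarrow> f \<in> borel_measurable MT" by (simp add: L2T_iff)
lemma L2T_sq: "f \<in> L2T \<Longrightarrow> integrable MT (\<lambda>x. (f x)\<^sup>2)" by (simp add: L2T_iff)

lemma L2T_mult: "f \<in> L2T \<Longrightarrow> g \<in> L2T \<Longrightarrow> integrable MT (\<lambda>x. f x * g x)"
proof -
  assume fg: "f \<in> L2T" "g \<in> L2T"
  have [measurable]: "f \<in> borel_measurable MT" "g \<in> borel_measurable MT" using fg by (auto dest: L2T_measurable)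
  show ?thesis
  proof (rule Bochner_Integration.integrable_bound)
    show "integrable MT (\<lambda>x. (f x)\<^sup>2 + (g x)\<^sup>2)" by (intro Bochner_Integration.integrable_add L2T_sq fg)
    have "\<bar>a * b\<bar> \<le> a\<^sup>2 + b\<^sup>2" for a b :: real
    proof -
      have "0 \<le> \<bar>a\<bar> * \<bar>b\<bar>" by simp
      moreover have "0 \<le> a\<^sup>2 + b\<^sup>2 - 2 * (\<bar>a\<bar> * \<bar>b\<bar>)"
        using zero_le_power2[of "\<bar>a\<bar> - \<bar>b\<bar>"] by (simp add: power2_diff mult.assoc)
      ultimately show ?thesis unfolding abs_mult by linarith
    qed
    then show "AE x in MT. norm (f x * g x) \<le> norm ((f x)\<^sup>2 + (g x)\<^sup>2)" by (intro AE_I2) simp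
  qed measurable
qed

lemma L2T_cont: "continuous_on {0..2*pi} f \<Longrightarrow> f \<in> L2T"
  unfolding L2T_iff
  by (intro conjI continuous_imp_measurable_on_sets_lebesgue continuous_imp_integrable_real continuous_intros) auto

lemma L2T_const: "(\<lambda>_. c) \<in> L2T" by (intro L2T_cont continuous_intros)

lemma L2T_scale: "f \<in> L2T \<Longrightarrow> (\<lambda>x. c * f x) \<in> L2T"
  unfolding L2T_iff by (auto simp: power_mult_distrib)

lemma L2T_add: "f \<in> L2T \<Longrightarrow> g \<in> L2T \<Longrightarrow> (\<lambda>x. f x + g x) \<in> L2T"
  using L2T_mult[of f g] unfolding L2T_iff
  by (auto simp: power2_sum mult.assoc)

lemma L2T_diff: "f \<in> L2T \<Longrightarrow> g \<in> L2T \<Longrightarrow> (\<lambda>x. f x - g x) \<in> L2T"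
  using L2T_add[OF _ L2T_scale[of g "-1"], of f] by simp

lemma L2T_integrable: "f \<in> L2T \<Longrightarrow> integrable MT f"
  using L2T_mult[OF _ L2T_const[of 1]] by simp

lemma L2T_abs: "f \<in> L2T \<Longrightarrow> (\<lambda>x. \<bar>f x\<bar>) \<in> L2T"
  unfolding L2T_iff by auto

lemma L2_Cauchy_Schwarz:
  assumes f: "f \<in> L2T" and g: "g \<in> L2T"
  shows "(\<integral>x. f x * g x \<partial>MT) \<le> l2norm f * l2norm g"
proof -
  let ?I = "\<integral>x. f x * g x \<partial>MT" and ?a = "l2norm f" and ?b = "l2norm g"
  have q: "0 \<le> s\<^sup>2 * ?a\<^sup>2 + t\<^sup>2 * ?b\<^sup>2 - 2 * s * t * ?I" for s t
  proof -
    have "0 \<le> (\<integral>x. (s * f x - t * g x)\<^sup>2 \<partial>MT)" by (rule integral_nonneg_AE) auto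
    also have "(\<lambda>x. (s * f x - t * g x)\<^sup>2) = (\<lambda>x. s\<^sup>2 * (f x)\<^sup>2 + t\<^sup>2 * (g x)\<^sup>2 - 2 * s * t * (f x * g x))"
      by (auto simp: power2_eq_square algebra_simps)
    also have "(\<integral>x. s\<^sup>2 * (f x)\<^sup>2 + t\<^sup>2 * (g x)\<^sup>2 - 2 * s * t * (f x * g x) \<partial>MT) = s\<^sup>2 * ?a\<^sup>2 + t\<^sup>2 * ?b\<^sup>2 - 2 * s * t * ?I"
      unfolding l2norm_sq using L2T_sq[OF f] L2T_sq[OF g] L2T_mult[OF f g] by simp
    finally show ?thesis .
  qed
  show ?thesis
  proof (cases "?a * ?b = 0")
    case True
    show ?thesis
    proof (rule ccontr)
      assume "\<not> ?thesis"
      then have I: "0 < ?I" using True by simp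
      show False
      proof (cases "?a = 0")
        case True
        \<comment> \<open>If the first norm vanishes the quadratic form in \<open>s\<close> and
          \<open>t\<close> is affine in \<open>s\<close>; this witness makes its value
          \<open>-1\<close>. The other case is symmetric.\<close>
        then show False using q[of "(?b\<^sup>2 + 1) / (2 * ?I)" 1] I by simp
      next
        case False
        then have "?b = 0" using \<open>?a * ?b = 0\<close> by simp
        then show False using q[of 1 "(?a\<^sup>2 + 1) / (2 * ?I)"] I by simp
      qed
    qed
  next
    case False
    then have ab: "0 < ?a * ?b" using l2norm_nonneg[of f] l2norm_nonneg[of g] by (metis mult_nonneg_nonneg order_le_less)
    have "0 \<le> 2 * (?a * ?b) * (?a * ?b - ?I)" using q[of ?b ?a] by (simp add: power2_eq_square algebra_simps)
    then show ?thesis using ab by (simp add: zero_le_mult_iff)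
  qed
qed

lemma l2norm_triangle:
  assumes f: "f \<in> L2T" and g: "g \<in> L2T"
  shows "l2norm (\<lambda>x. f x + g x) \<le> l2norm f + l2norm g"
proof (rule power2_le_imp_le)
  have "(l2norm (\<lambda>x. f x + g x))\<^sup>2 = (\<integral>x. (f x)\<^sup>2 + (g x)\<^sup>2 + 2 * (f x * g x) \<partial>MT)"
    unfolding l2norm_sq by (simp add: power2_sum mult.assoc)
  also have "\<dots> = (l2norm f)\<^sup>2 + (l2norm g)\<^sup>2 + 2 * (\<integral>x. f x * g x \<partial>MT)"
    unfolding l2norm_sq using L2T_sq[OF f] L2T_sq[OF g] L2T_mult[OF f g] by simp
  also have "\<dots> \<le> (l2norm f + l2norm g)\<^sup>2"
    using L2_Cauchy_Schwarz[OF f g] by (simp add: power2_sum)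
  finally show "(l2norm (\<lambda>x. f x + g x))\<^sup>2 \<le> (l2norm f + l2norm g)\<^sup>2" .
qed simp

lemma l2dist_triangle:
  assumes "f \<in> L2T" "g \<in> L2T" "h \<in> L2T"
  shows "l2dist f h \<le> l2dist f g + l2dist g h"
  using l2norm_triangle[OF L2T_diff[OF assms(1,2)] L2T_diff[OF assms(2,3)]] by (simp add: l2dist_def)

lemma l2dist_commute: "l2dist f g = l2dist g f"
  unfolding l2dist_def l2norm_def by (simp add: power2_commute)

lemma L1_le_l2norm:
  assumes "f \<in> L2T"
  shows "(\<integral>x. \<bar>f x\<bar> \<partial>MT) \<le> sqrt (2 * pi) * l2norm f"
proof -
  have "l2norm (\<lambda>x. \<bar>f x\<bar>) = l2norm f" by (simp add: l2norm_def)
  moreover have "l2norm (\<lambda>_. 1) = sqrt (2 * pi)" unfolding l2norm_def set_integral_eq_MT by (simp add: measure_restrict_space)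
  ultimately show ?thesis using L2_Cauchy_Schwarz[OF L2T_const[of 1] L2T_abs[OF assms]] by simp
qed

lemma fcoeff_diff_le:
  assumes f: "f \<in> L2T" and g: "g \<in> L2T"
  shows "cmod (fcoeff f n - fcoeff g n) \<le> sqrt (2 * pi) * l2dist f g"
proof -
  have [measurable]: "(\<lambda>x. cis (- (real_of_int n * x))) \<in> borel_measurable MT"
    by (intro continuous_imp_measurable_on_sets_lebesgue continuous_intros) auto
  have i: "integrable MT (\<lambda>x. complex_of_real (h x) * cis (- (real_of_int n * x)))" if "h \<in> L2T" for h
  proof -
    have [measurable]: "h \<in> borel_measurable MT" using that by (rule L2T_measurable)
    show ?thesis by (rule Bochner_Integration.integrable_bound[OF L2T_integrable[OF that]]) (auto simp: norm_mult)
  qed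
  have "fcoeff f n - fcoeff g n = (\<integral>x. complex_of_real (f x - g x) * cis (- (real_of_int n * x)) \<partial>MT)"
    unfolding fcoeff_MT using i[OF f] i[OF g] by (simp add: left_diff_distrib)
  also have "cmod \<dots> \<le> (\<integral>x. cmod (complex_of_real (f x - g x) * cis (- (real_of_int n * x))) \<partial>MT)"
    by (rule integral_norm_bound)
  also have "\<dots> = (\<integral>x. \<bar>f x - g x\<bar> \<partial>MT)" by (simp only: norm_mult norm_cis norm_of_real mult_1_right)
  also have "\<dots> \<le> sqrt (2 * pi) * l2dist f g" unfolding l2dist_def by (rule L1_le_l2norm[OF L2T_diff[OF f g]])
  finally show ?thesis .
qed

lemma fast_Cauchy_l2:
  assumes f: "\<And>k. f k \<in> L2T" and d: "\<And>k. l2dist (f (Suc k)) (f k) \<le> (1/2)^k"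
  shows "l2dist (f (k + m)) (f k) \<le> 2 * (1/2)^k"
proof -
  have "l2dist (f (k + m)) (f k) \<le> (2 - 2 * (1/2)^m) * (1/2)^k"
  proof (induction m)
    case 0 then show ?case by (simp add: l2dist_def l2norm_def)
  next
    case (Suc m)
    have "l2dist (f (k + Suc m)) (f k) \<le> (1/2)^(k + m) + (2 - 2 * (1/2)^m) * (1/2)^k"
      using l2dist_triangle[OF f[of "k + Suc m"] f[of "k + m"] f[of k]] d[of "k + m"] Suc by simp
    then show ?case by (simp add: power_add algebra_simps)
  qed
  also have "\<dots> \<le> 2 * (1/2)^k" by (intro mult_right_mono) auto
  finally show ?thesis .
qed

text \<open>The completeness argument of Riesz and Fischer. The limit is the pointwise
  \<open>lim\<close>, a concrete measurable function whose values matter only where the sequence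
  converges; Fatou's lemma carries the distance estimate to it.\<close>

lemma fast_Cauchy_limit:
  assumes f: "\<And>k. f k \<in> L2T" and d: "\<And>k. l2dist (f (Suc k)) (f k) \<le> (1/2)^k"
  defines "F \<equiv> \<lambda>x. lim (\<lambda>k. f k x)"
  shows "AE x in MT. (\<lambda>k. f k x) \<longlonglongrightarrow> F x" and "F \<in> L2T" and "l2dist F (f k) \<le> 2 * (1/2)^k"
proof -
  have [measurable]: "f k \<in> borel_measurable MT" for k using f by (rule L2T_measurable)
  have mF [measurable]: "F \<in> borel_measurable MT" unfolding F_def by measurable
  have "summable (\<lambda>k. \<integral>x. norm (f (Suc k) x - f k x) \<partial>MT)"
  proof (rule summable_comparison_test'[of "\<lambda>k. sqrt (2 * pi) * (1/2)^k" 0])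
    show "summable (\<lambda>k. sqrt (2 * pi) * (1/2)^k)" by (intro summable_mult summable_geometric) simp
    fix k
    have "(\<integral>x. norm (f (Suc k) x - f k x) \<partial>MT) \<le> sqrt (2 * pi) * l2dist (f (Suc k)) (f k)"
      using L1_le_l2norm[OF L2T_diff[OF f f, of "Suc k" k]] by (simp add: l2dist_def)
    also have "\<dots> \<le> sqrt (2 * pi) * (1/2)^k" using d by (intro mult_left_mono) auto
    finally show "norm (\<integral>x. norm (f (Suc k) x - f k x) \<partial>MT) \<le> sqrt (2 * pi) * (1/2)^k"
      by (simp add: integral_nonneg_AE)
  qed
  from L1_telescope(1)[OF L2T_integrable[OF f] this]
  show conv: "AE x in MT. (\<lambda>k. f k x) \<longlonglongrightarrow> F x"
    unfolding F_def by eventually_elim (simp add: convergent_LIMSEQ_iff)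
  have key: "(\<integral>\<^sup>+x. ennreal ((F x - f k x)\<^sup>2) \<partial>MT) \<le> ennreal ((2 * (1/2)^k)\<^sup>2)" for k
  proof -
    have "(\<integral>\<^sup>+x. ennreal ((F x - f k x)\<^sup>2) \<partial>MT) = (\<integral>\<^sup>+x. liminf (\<lambda>m. ennreal ((f (k + m) x - f k x)\<^sup>2)) \<partial>MT)"
    proof (rule nn_integral_cong_AE)
      show "AE x in MT. ennreal ((F x - f k x)\<^sup>2) = liminf (\<lambda>m. ennreal ((f (k + m) x - f k x)\<^sup>2))"
        using conv
      proof eventually_elim
        fix x assume "(\<lambda>k. f k x) \<longlonglongrightarrow> F x"
        then have "(\<lambda>m. f (k + m) x) \<longlonglongrightarrow> F x" by (subst add.commute) (rule LIMSEQ_ignore_initial_segment)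
        then have "(\<lambda>m. ennreal ((f (k + m) x - f k x)\<^sup>2)) \<longlonglongrightarrow> ennreal ((F x - f k x)\<^sup>2)"
          by (intro tendsto_ennrealI tendsto_intros)
        then show "ennreal ((F x - f k x)\<^sup>2) = liminf (\<lambda>m. ennreal ((f (k + m) x - f k x)\<^sup>2))"
          by (rule lim_imp_Liminf[OF sequentially_bot, symmetric])
      qed
    qed
    also have "\<dots> \<le> liminf (\<lambda>m. \<integral>\<^sup>+x. ennreal ((f (k + m) x - f k x)\<^sup>2) \<partial>MT)"
      by (rule nn_integral_liminf) measurable
    also have "\<dots> \<le> liminf (\<lambda>m. ennreal ((2 * (1/2)^k)\<^sup>2))"
    proof (intro Liminf_mono always_eventually allI)
      fix m
      have "(\<integral>\<^sup>+x. ennreal ((f (k + m) x - f k x)\<^sup>2) \<partial>MT) = ennreal ((l2dist (f (k + m)) (f k))\<^sup>2)"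
        unfolding l2dist_def l2norm_sq by (rule nn_integral_eq_integral[OF L2T_sq[OF L2T_diff[OF f f]]]) auto
      also have "\<dots> \<le> ennreal ((2 * (1/2)^k)\<^sup>2)"
        using fast_Cauchy_l2[OF f d] by (intro ennreal_leI power_mono) auto
      finally show "(\<integral>\<^sup>+x. ennreal ((f (k + m) x - f k x)\<^sup>2) \<partial>MT) \<le> ennreal ((2 * (1/2)^k)\<^sup>2)" .
    qed
    also have "\<dots> = ennreal ((2 * (1/2)^k)\<^sup>2)" by (rule Liminf_const[OF sequentially_bot])
    finally show ?thesis .
  qed
  have in_L2: "(\<lambda>x. F x - f k x) \<in> L2T" for k
    unfolding L2T_iff
  proof (intro conjI integrableI_bounded)
    show "(\<integral>\<^sup>+x. ennreal (norm ((F x - f k x)\<^sup>2)) \<partial>MT) < \<infinity>"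
      using order_le_less_trans[OF key[of k] ennreal_less_top] by simp
  qed measurable
  show "F \<in> L2T" using L2T_add[OF in_L2[of 0] f[of 0]] by simp
  have "ennreal ((l2dist F (f k))\<^sup>2) \<le> ennreal ((2 * (1/2)^k)\<^sup>2)"
  proof -
    have e: "(\<integral>\<^sup>+x. ennreal ((F x - f k x)\<^sup>2) \<partial>MT) = ennreal (\<integral>x. (F x - f k x)\<^sup>2 \<partial>MT)"
      by (rule nn_integral_eq_integral[OF L2T_sq[OF in_L2]]) auto
    show ?thesis using key[of k] unfolding e l2dist_def l2norm_sq .
  qed
  then have "(l2dist F (f k))\<^sup>2 \<le> (2 * (1/2)^k)\<^sup>2" by (simp add: ennreal_le_iff)
  then show "l2dist F (f k) \<le> 2 * (1/2)^k" by (rule power2_le_imp_le) simp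
qed

section \<open>Trigonometric polynomials\<close>

definition tp :: "nat \<Rightarrow> (int \<Rightarrow> complex) \<Rightarrow> real \<Rightarrow> real" where
  "tp N u x = Re (\<Sum>n\<in>modes N. u n * cis (real_of_int n * x))"

lemma cnj_tp_sum:
  assumes "herm u"
  shows "cnj (\<Sum>n\<in>modes N. u n * cis (real_of_int n * x)) = (\<Sum>n\<in>modes N. u n * cis (real_of_int n * x))"
proof -
  have "cnj (\<Sum>n\<in>modes N. u n * cis (real_of_int n * x)) = (\<Sum>n\<in>modes N. u (- n) * cis (real_of_int (- n) * x))"
    by (simp add: hermD[OF assms] cis_cnj)
  also have "\<dots> = (\<Sum>n\<in>modes N. u n * cis (real_of_int n * x))"
    by (rule sum.reindex_bij_witness[of _ uminus uminus]) auto
  finally show ?thesis .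
qed

text \<open>The real part in \<open>tp\<close> only fixes the type: for Hermitian coefficients the
  sum equals its own conjugate.\<close>

lemma tp_complex:
  assumes "herm u"
  shows "complex_of_real (tp N u x) = (\<Sum>n\<in>modes N. u n * cis (real_of_int n * x))"
proof -
  have "complex_of_real (Re z) = z" if "cnj z = z" for z using that by (simp add: complex_eq_iff)
  then show ?thesis unfolding tp_def using cnj_tp_sum[OF assms] by blast
qed

lemma cont_tp: "continuous_on S (tp N u)"
  unfolding tp_def by (intro continuous_intros)

lemma tp_L2T: "tp N u \<in> L2T" by (intro L2T_cont cont_tp)

lemma tp_diff: "tp N u x - tp N w x = tp N (\<lambda>n. u n - w n) x"
  by (simp add: tp_def sum_subtractf left_diff_distrib)

lemma tp_mono:
  assumes "supp u N" "N \<le> B"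
  shows "tp B u = tp N u"
  unfolding tp_def using assms modes_mono[OF assms(2)]
  by (intro ext arg_cong[where f = Re] sum.mono_neutral_right) (auto simp: supp_def)

lemma tp_mult:
  assumes "supp w B" "herm u" "herm w"
  shows "tp A u x * tp B w x = tp (A + B) (conv A u w) x"
proof -
  let ?E = "\<lambda>n. cis (real_of_int n * x)"
  have hc: "herm (conv A u w)" using herm_conv[OF assms(2,3)] by (simp add: herm_def)
  have "complex_of_real (tp (A + B) (conv A u w) x) = (\<Sum>m\<in>modes (A + B). \<Sum>a\<in>modes A. u a * (w (m - a) * ?E m))"
    unfolding tp_complex[OF hc] conv_def by (simp add: sum_distrib_right mult.assoc)
  also have "\<dots> = (\<Sum>a\<in>modes A. u a * (\<Sum>m\<in>modes (A + B). w (m - a) * ?E m))"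
    by (subst sum.swap) (simp add: sum_distrib_left)
  also have "\<dots> = (\<Sum>a\<in>modes A. u a * (\<Sum>b\<in>modes B. w b * ?E (a + b)))"
    by (intro sum.cong refl) (simp add: sum_shift[OF assms(1)])
  also have "\<dots> = (\<Sum>a\<in>modes A. u a * ?E a) * (\<Sum>b\<in>modes B. w b * ?E b)"
  proof -
    have "?E (a + b) = ?E a * ?E b" for a b by (simp add: cis_mult distrib_right)
    then show ?thesis unfolding sum_distrib_right
      by (intro sum.cong refl) (simp only: sum_distrib_left mult_ac)
  qed
  also have "\<dots> = complex_of_real (tp A u x * tp B w x)" by (simp add: tp_complex assms)
  finally show ?thesis using of_real_eq_iff by metis
qed

lemma integral_cis_MT: "(\<integral>x. cis (real_of_int n * x) \<partial>MT) = (if n = 0 then of_real (2 * pi) else 0)"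
proof (cases "n = 0")
  case True
  then show ?thesis by (simp add: measure_restrict_space scaleR_conv_of_real)
next
  case False
  have c: "continuous_on {0..2*pi} (\<lambda>x. cis (real_of_int n * x))" by (intro continuous_intros)
  have "((\<lambda>x. cis (real_of_int n * x)) has_integral (cis (real_of_int n * (2 * pi)) / (\<i> * of_int n) - cis (real_of_int n * 0) / (\<i> * of_int n))) {0..2*pi}"
  proof (rule fundamental_theorem_of_calculus)
    fix s assume "s \<in> {0..2*pi}"
    have "((\<lambda>s. cis (real_of_int n * s)) has_vector_derivative (real_of_int n *\<^sub>R (\<i> * cis (real_of_int n * s)))) (at s within {0..2*pi})"
      unfolding has_vector_derivative_def
      by (rule has_derivative_eq_rhs, (rule derivative_eq_intros refl)+) (auto simp: mult_ac scaleR_conv_of_real)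
    from has_vector_derivative_mult_left[OF this, of "1 / (\<i> * of_int n)"]
    show "((\<lambda>s. cis (real_of_int n * s) / (\<i> * of_int n)) has_vector_derivative cis (real_of_int n * s)) (at s within {0..2*pi})"
      using False by (simp add: scaleR_conv_of_real)
  qed simp
  moreover have "cis (real_of_int n * (2 * pi)) = 1" by (metis Ints_of_int cis_multiple_2pi mult.commute)
  ultimately have "integral {0..2*pi} (\<lambda>x. cis (real_of_int n * x)) = 0" by (simp add: integral_unique)
  then show ?thesis using False lebesgue_integral_eq_integral[OF continuous_imp_integrable_real[OF c]] by simp
qed

lemma fcoeff_tp:
  assumes "supp u N" "herm u"
  shows "fcoeff (tp N u) n = complex_of_real (2 * pi) * u n"
proof -
  have "fcoeff (tp N u) n = (\<integral>x. (\<Sum>m\<in>modes N. u m * cis (real_of_int (m - n) * x)) \<partial>MT)"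
    unfolding fcoeff_MT tp_complex[OF assms(2)] sum_distrib_right
    by (simp add: cis_mult mult.assoc left_diff_distrib)
  also have "\<dots> = (\<Sum>m\<in>modes N. u m * (\<integral>x. cis (real_of_int (m - n) * x) \<partial>MT))"
    by (subst Bochner_Integration.integral_sum)
      (auto intro!: Bochner_Integration.integrable_mult_right continuous_imp_integrable_real continuous_intros)
  also have "\<dots> = (\<Sum>m\<in>modes N. if m = n then complex_of_real (2 * pi) * u n else 0)"
    unfolding integral_cis_MT by (intro sum.cong) auto
  also have "\<dots> = complex_of_real (2 * pi) * u n" using suppD[OF assms(1)] by simp
  finally show ?thesis .
qed

lemma fcoeff_0: "fcoeff f 0 = of_real (integral\<^sup>L MT f)" unfolding fcoeff_MT by simp

text \<open>The square of the polynomial is the polynomial of the convolution, and its integral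
  picks out the coefficient at zero, which is the energy. This gives Parseval without infinite
  series.\<close>

lemma l2norm_tp:
  assumes "supp u N" "herm u"
  shows "(l2norm (tp N u))\<^sup>2 = 2 * pi * n2 N u"
proof -
  have hc: "herm (conv N u u)" using herm_conv[OF assms(2,2)] by (simp add: herm_def)
  have "complex_of_real ((l2norm (tp N u))\<^sup>2) = fcoeff (tp (N + N) (conv N u u)) 0"
    unfolding fcoeff_0 l2norm_sq by (simp add: power2_eq_square tp_mult[OF assms(1,2,2)])
  also have "\<dots> = complex_of_real (2 * pi) * conv N u u 0" by (rule fcoeff_tp[OF supp_conv[OF assms(1,1)] hc])
  also have "conv N u u 0 = complex_of_real (n2 N u)"
    by (simp add: conv_def n2_def hermD[OF assms(2)] complex_norm_square[symmetric] del: of_real_power)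
  finally show ?thesis unfolding of_real_mult[symmetric] of_real_eq_iff .
qed

lemma l2dist_tp:
  assumes "supp u N" "herm u" "supp w N" "herm w"
  shows "l2dist (tp N u) (tp N w) = sqrt (2 * pi * n2 N (\<lambda>n. u n - w n))"
  using l2norm_tp[OF supp_diff[OF assms(1,3)] herm_diff[OF assms(2,4)]]
  unfolding l2dist_def tp_diff by (metis l2norm_nonneg real_sqrt_unique)

lemma integral_tp_pow4:
  assumes "supp u N" "herm u"
  shows "(\<integral>x. (tp N u x)^4 \<partial>MT) = 2 * pi * Q N u"
proof -
  have hc: "herm (conv N u u)" using herm_conv[OF assms(2,2)] by (simp add: herm_def)
  have "(\<lambda>x. (tp N u x)^4) = (\<lambda>x. (tp (N + N) (conv N u u) x)\<^sup>2)"
    unfolding tp_mult[OF assms(1,2,2), symmetric] by (simp add: power4_eq_xxxx power2_eq_square mult.assoc)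
  then have "(\<integral>x. (tp N u x)^4 \<partial>MT) = (l2norm (tp (N + N) (conv N u u)))\<^sup>2" unfolding l2norm_sq by simp
  also have "\<dots> = 2 * pi * Q N u"
    unfolding l2norm_tp[OF supp_conv[OF assms(1,1)] hc] by (simp only: Q_def n2_def mult_2[of N])
  finally show ?thesis .
qed

lemma fcoeff_tp_cube:
  assumes "supp u N" "herm u"
  shows "fcoeff (\<lambda>x. (tp N u x)^3) n = complex_of_real (2 * pi) * cub N u n"
proof -
  have hc: "herm (conv N u u)" using herm_conv[OF assms(2,2)] by (simp add: herm_def)
  then have hcc: "herm (conv N u (conv N u u))" using herm_conv[OF assms(2) hc] by (simp add: herm_def)
  have "(\<lambda>x. (tp N u x)^3) = (\<lambda>x. tp N u x * tp (N + N) (conv N u u) x)"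
    unfolding tp_mult[OF assms(1,2,2), symmetric] by (simp add: power3_eq_cube mult.assoc)
  also have "\<dots> = tp (N + (N + N)) (conv N u (conv N u u))"
    unfolding tp_mult[OF supp_conv[OF assms(1,1)] assms(2) hc] ..
  finally have "fcoeff (\<lambda>x. (tp N u x)^3) n = complex_of_real (2 * pi) * conv N u (conv N u u) n"
    by (simp add: fcoeff_tp[OF supp_conv[OF assms(1) supp_conv[OF assms(1,1)]] hcc])
  then show ?thesis by (simp add: conv_def[of N u "conv N u u"] tri_conv)
qed

section \<open>Normalised Fourier coefficients and Bessel's inequality\<close>

definition co :: "(real \<Rightarrow> real) \<Rightarrow> int \<Rightarrow> complex" where "co f n = fcoeff f n / of_real (2 * pi)"

lemma herm_co: "herm (co f)"
proof -
  have "fcoeff f (- n) = cnj (fcoeff f n)" for n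
    unfolding fcoeff_MT Bochner_Integration.integral_cnj[symmetric] by (simp add: cis_cnj)
  then show ?thesis by (simp add: herm_def co_def)
qed

lemma co_diff:
  assumes f: "f \<in> L2T" and g: "g \<in> L2T"
  shows "co (\<lambda>x. f x - g x) n = co f n - co g n"
proof -
  have [measurable]: "(\<lambda>x. cis (- (real_of_int n * x))) \<in> borel_measurable MT"
    by (intro continuous_imp_measurable_on_sets_lebesgue continuous_intros) auto
  have i: "integrable MT (\<lambda>x. complex_of_real (h x) * cis (- (real_of_int n * x)))" if "h \<in> L2T" for h
  proof -
    have [measurable]: "h \<in> borel_measurable MT" using that by (rule L2T_measurable)
    show ?thesis by (rule Bochner_Integration.integrable_bound[OF L2T_integrable[OF that]]) (auto simp: norm_mult)
  qed
  show ?thesis unfolding co_def fcoeff_MT using i[OF f] i[OF g] by (simp add: left_diff_distrib diff_divide_distrib)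
qed

text \<open>The function is paired with its own partial Fourier sum. The pairing and the squared
  norm of the partial sum are the same number, so Cauchy-Schwarz and division give the
  claim.\<close>

lemma Bessel:
  assumes f: "f \<in> L2T"
  shows "2 * pi * n2 N (co f) \<le> (l2norm f)\<^sup>2"
proof -
  let ?c = "trunc N (co f)"
  have hc: "herm ?c" using herm_co[of f] by (auto simp: herm_def trunc_def)
  have sc: "supp ?c N" by (simp add: supp_def trunc_def)
  have n2c: "n2 N ?c = n2 N (co f)" by (simp add: n2_def trunc_def)
  have [measurable]: "f \<in> borel_measurable MT" using f by (rule L2T_measurable)
  have [measurable]: "(\<lambda>x. cis (real_of_int n * x)) \<in> borel_measurable MT" for n
    by (intro continuous_imp_measurable_on_sets_lebesgue continuous_intros) auto
  have i: "integrable MT (\<lambda>x. complex_of_real (f x) * cis (real_of_int n * x))" for n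
    by (rule Bochner_Integration.integrable_bound[OF L2T_integrable[OF f]]) (auto simp: norm_mult)
  have "complex_of_real (\<integral>x. f x * tp N ?c x \<partial>MT) = (\<integral>x. complex_of_real (f x * tp N ?c x) \<partial>MT)"
    by (rule integral_complex_of_real[symmetric])
  also have "\<dots> = (\<integral>x. (\<Sum>n\<in>modes N. ?c n * (complex_of_real (f x) * cis (real_of_int n * x))) \<partial>MT)"
    unfolding of_real_mult tp_complex[OF hc] sum_distrib_left by (simp only: mult_ac)
  also have "\<dots> = (\<Sum>n\<in>modes N. ?c n * (\<integral>x. complex_of_real (f x) * cis (real_of_int n * x) \<partial>MT))"
    by (subst Bochner_Integration.integral_sum) (auto intro!: Bochner_Integration.integrable_mult_right i)
  also have "\<dots> = (\<Sum>n\<in>modes N. ?c n * (of_real (2 * pi) * co f (- n)))"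
    unfolding co_def fcoeff_MT by simp
  also have "\<dots> = (\<Sum>n\<in>modes N. complex_of_real (2 * pi * (cmod (co f n))\<^sup>2))"
    by (intro sum.cong refl) (simp add: trunc_def hermD[OF herm_co] complex_norm_square[symmetric] mult_ac del: of_real_power)
  also have "\<dots> = complex_of_real (2 * pi * n2 N (co f))" by (simp add: n2_def sum_distrib_left)
  finally have I: "(\<integral>x. f x * tp N ?c x \<partial>MT) = 2 * pi * n2 N (co f)" using of_real_eq_iff by blast
  have "2 * pi * n2 N (co f) \<le> l2norm f * l2norm (tp N ?c)"
    using L2_Cauchy_Schwarz[OF f tp_L2T[of N ?c]] unfolding I .
  also have "l2norm (tp N ?c) = sqrt (2 * pi * n2 N (co f))"
    using l2norm_tp[OF sc hc] unfolding n2c by (metis l2norm_nonneg real_sqrt_unique)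
  finally have le: "2 * pi * n2 N (co f) \<le> l2norm f * sqrt (2 * pi * n2 N (co f))" .
  show ?thesis
  proof (cases "n2 N (co f) = 0")
    case False
    let ?s = "sqrt (2 * pi * n2 N (co f))"
    have "0 < 2 * pi * n2 N (co f)" using False n2_nonneg[of N "co f"] by (simp add: order_less_le)
    then have s: "0 < ?s" "?s * ?s = 2 * pi * n2 N (co f)" by simp_all
    then have "?s \<le> l2norm f" using le by (metis mult_le_cancel_right_pos)
    then have "?s * ?s \<le> l2norm f * l2norm f" using s by (intro mult_mono) auto
    then show ?thesis unfolding s(2) by (simp add: power2_eq_square)
  qed simp
qed

lemma ell2_co: "f \<in> L2T \<Longrightarrow> ell2 (co f)"
proof -
  assume "f \<in> L2T"
  then have "n2 N (co f) \<le> (l2norm f)\<^sup>2 / (2 * pi)" for N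
    using Bessel[of f N] by (simp add: field_simps)
  then show ?thesis unfolding ell2_def using herm_co by blast
qed

section \<open>Passing to the limit\<close>

text \<open>\<open>h\<close> is known only as a pointwise limit off a null set. Integrability is
  shown for the measurable function \<open>lim\<close> and transferred to \<open>h\<close> by
  changing values on that null set.\<close>

lemma L1_limit_interval:
  fixes f :: "nat \<Rightarrow> real \<Rightarrow> complex"
  assumes c: "\<And>k. continuous_on {0..t} (f k)"
    and s: "summable (\<lambda>k. integral {0..t} (\<lambda>s. cmod (f (Suc k) s - f k s)))"
    and N: "negligible N" "\<And>s. s \<in> {0..t} - N \<Longrightarrow> (\<lambda>k. f k s) \<longlonglongrightarrow> h s"
  shows "set_integrable lebesgue {0..t} h"
    and "(\<lambda>k. integral {0..t} (f k)) \<longlonglongrightarrow> set_lebesgue_integral lebesgue {0..t} h"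
proof -
  let ?M = "lebesgue_on {0..t}"
  define g where "g s = lim (\<lambda>k. f k s)" for s
  have i: "integrable ?M (f k)" for k by (rule continuous_imp_integrable_real[OF c])
  have [measurable]: "f k \<in> borel_measurable ?M" for k using i by (rule borel_measurable_integrable)
  have mg: "g \<in> borel_measurable ?M" unfolding g_def by measurable
  have "(\<integral>s. norm (f (Suc k) s - f k s) \<partial>?M) = integral {0..t} (\<lambda>s. cmod (f (Suc k) s - f k s))" for k
    by (intro lebesgue_integral_eq_integral continuous_imp_integrable_real continuous_intros c) auto
  then have s': "summable (\<lambda>k. \<integral>s. norm (f (Suc k) s - f k s) \<partial>?M)" using s by simp
  have "AE s in ?M. (\<lambda>k. f k s) \<longlonglongrightarrow> g s"
    using L1_telescope(1)[OF i s'] unfolding g_def by eventually_elim (simp add: convergent_LIMSEQ_iff)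
  from L1_telescope(2)[OF i s' mg this]
  have ig: "integrable ?M g" and lim: "(\<lambda>k. integral\<^sup>L ?M (f k)) \<longlonglongrightarrow> integral\<^sup>L ?M g" by auto
  have ai: "g absolutely_integrable_on {0..t}"
    using ig by (simp add: set_integrable_def integrable_restrict_space)
  have gh: "h s = g s" if "s \<in> {0..t} - N" for s using N(2)[OF that] by (simp add: g_def limI)
  show h: "h absolutely_integrable_on {0..t}" by (rule absolutely_integrable_spike[OF ai N(1) gh])
  have "integral\<^sup>L ?M g = integral {0..t} g" by (rule lebesgue_integral_eq_integral[OF ig]) auto
  also have "\<dots> = integral {0..t} h" by (rule integral_spike[OF N(1)]) (use gh in auto)
  also have "\<dots> = set_lebesgue_integral lebesgue {0..t} h" by (rule set_lebesgue_integral_eq_integral(2)[OF h, symmetric])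
  finally have "integral\<^sup>L ?M g = set_lebesgue_integral lebesgue {0..t} h" .
  moreover have "integral\<^sup>L ?M (f k) = integral {0..t} (f k)" for k by (rule lebesgue_integral_eq_integral[OF i]) auto
  ultimately show "(\<lambda>k. integral {0..t} (f k)) \<longlonglongrightarrow> set_lebesgue_integral lebesgue {0..t} h" using lim by simp
qed

text \<open>The factor \<open>a - b\<close> is split off and Young's inequality is applied with
  weight \<open>l\<close>. The free \<open>l\<close> trades a small L2 distance against possibly
  large L4 norms.\<close>

lemma cube_diff_le:
  fixes a b l :: real
  assumes "0 < l"
  shows "\<bar>a^3 - b^3\<bar> \<le> l * (a - b)\<^sup>2 + 2 / l * (a^4 + b^4)"
proof -
  let ?p = "a\<^sup>2 + a * b + b\<^sup>2"
  have 1: "a^3 - b^3 = (a - b) * ?p" by (simp add: power2_eq_square power3_eq_cube algebra_simps)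
  have 2: "?p\<^sup>2 \<le> 5 * (a^4 + b^4)"
  proof -
    have "\<bar>?p\<bar> \<le> 3/2 * (a\<^sup>2 + b\<^sup>2)"
      using zero_le_power2[of "a - b"] zero_le_power2[of "a + b"] zero_le_power2[of a] zero_le_power2[of b]
      unfolding power2_diff power2_sum by (simp add: abs_le_iff)
    then have "?p\<^sup>2 \<le> (3/2 * (a\<^sup>2 + b\<^sup>2))\<^sup>2" by (rule abs_le_square_iff[THEN iffD1, OF order_trans]) simp
    also have "\<dots> \<le> 5 * (a^4 + b^4)"
      using zero_le_power2[of "a\<^sup>2 - b\<^sup>2"] zero_le_power2[of "a\<^sup>2"] zero_le_power2[of "b\<^sup>2"]
      by (simp add: power2_eq_square power4_eq_xxxx algebra_simps)
    finally show ?thesis .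
  qed
  have "\<bar>a - b\<bar> * \<bar>?p\<bar> \<le> l * (a - b)\<^sup>2 + 1 / (4 * l) * ?p\<^sup>2"
  proof -
    have "0 \<le> (2 * l * \<bar>a - b\<bar> - \<bar>?p\<bar>)\<^sup>2 / (4 * l)" using assms by simp
    also have "\<dots> = l * (a - b)\<^sup>2 + 1 / (4 * l) * ?p\<^sup>2 - \<bar>a - b\<bar> * \<bar>?p\<bar>"
      using assms by (simp add: power2_diff power_mult_distrib field_simps) (simp add: power2_eq_square algebra_simps)
    finally show ?thesis by simp
  qed
  also have "1 / (4 * l) * ?p\<^sup>2 \<le> 1 / (4 * l) * (8 * (a^4 + b^4))"
  proof (rule mult_left_mono)
    have "5 * (a^4 + b^4) \<le> 8 * (a^4 + b^4)" by (rule mult_right_mono) simp_all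
    with 2 show "?p\<^sup>2 \<le> 8 * (a^4 + b^4)" by (rule order_trans)
  qed (use assms in simp)
  also have "1 / (4 * l) * (8 * (a^4 + b^4)) = 2 / l * (a^4 + b^4)" using assms by (simp add: field_simps)
  finally show ?thesis unfolding 1 abs_mult by simp
qed

section \<open>Uniform limits of truncated solutions\<close>

context kaw
begin

definition gv :: "real \<Rightarrow> nat \<Rightarrow> (int \<Rightarrow> complex) \<Rightarrow> real \<Rightarrow> real \<Rightarrow> real" where
  "gv T N c t = tp N (U t (gal T N c t))"

text \<open>The whole sequence of truncations has to converge, uniformly in time, so that the limits
  for two data can be compared at a common \<open>N\<close>.\<close>

definition limit_sol :: "real \<Rightarrow> (int \<Rightarrow> complex) \<Rightarrow> (real \<Rightarrow> real \<Rightarrow> real) \<Rightarrow> bool" where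
  "limit_sol T c v \<longleftrightarrow> v \<in> CL2 T \<and> (\<forall>\<epsilon>>0. \<exists>N0. \<forall>N\<ge>N0. \<forall>t\<in>{0..T}. l2dist (v t) (gv T N c t) < \<epsilon>)"

lemma gal_supp_herm:
  assumes "herm c" "0 \<le> T"
  shows "supp (U t (gal T N c t)) N" "herm (U t (gal T N c t))"
proof -
  interpret galerkin \<beta> \<gamma> \<mu> N N T "gal T N c" by (rule gal(1)[OF assms])
  show "supp (U t (gal T N c t)) N" "herm (U t (gal T N c t))" using supp_U supp_N herm_U herm by blast+
qed

lemma gv_L2T: "gv T N c t \<in> L2T" by (simp add: gv_def tp_L2T)

lemma l2dist_gv:
  assumes c: "herm c" "herm c'" and T: "0 \<le> T" and B: "N1 \<le> B" "N2 \<le> B"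
  shows "l2dist (gv T N1 c t) (gv T N2 c' t) = sqrt (2 * pi * n2 B (\<lambda>n. gal T N1 c t n - gal T N2 c' t n))"
proof -
  note a = gal_supp_herm[OF c(1) T, of t N1] and b = gal_supp_herm[OF c(2) T, of t N2]
  show ?thesis
    unfolding gv_def tp_mono[OF a(1) B(1), symmetric] tp_mono[OF b(1) B(2), symmetric]
      l2dist_tp[OF supp_mono[OF a(1) B(1)] a(2) supp_mono[OF b(1) B(2)] b(2)] U_diff n2_U ..
qed

lemma gv_stable:
  assumes c: "ell2 c" and T: "0 \<le> T" and eps: "0 < \<epsilon>"
  obtains \<delta> N0 where "0 < \<delta>"
    "\<And>c' N1 N2 t. herm c' \<Longrightarrow> (\<And>N. n2 N (\<lambda>n. c n - c' n) \<le> \<delta>\<^sup>2) \<Longrightarrow> N0 \<le> N1 \<Longrightarrow> N0 \<le> N2 \<Longrightarrow>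
      t \<in> {0..T} \<Longrightarrow> l2dist (gv T N1 c t) (gv T N2 c' t) < \<epsilon>"
proof -
  have "0 < \<epsilon>\<^sup>2 / (2 * pi)" using eps by simp
  then obtain \<delta> N0 where d: "0 < \<delta>" and st: "\<And>c' N1 N2 B t. herm c' \<Longrightarrow> (\<And>N. n2 N (\<lambda>n. c n - c' n) \<le> \<delta>\<^sup>2) \<Longrightarrow> N0 \<le> N1 \<Longrightarrow> N0 \<le> N2 \<Longrightarrow>
      N1 \<le> B \<Longrightarrow> N2 \<le> B \<Longrightarrow> t \<in> {0..T} \<Longrightarrow> n2 B (\<lambda>n. gal T N1 c t n - gal T N2 c' t n) < \<epsilon>\<^sup>2 / (2 * pi)"
    using gal_stable[OF c T] by blast
  show thesis
  proof (rule that[OF d, of N0])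
    fix c' N1 N2 t assume a: "herm c'" "\<And>N. n2 N (\<lambda>n. c n - c' n) \<le> \<delta>\<^sup>2" "N0 \<le> N1" "N0 \<le> N2" "t \<in> {0..T}"
    have hc: "herm c" using c by (simp add: ell2_def)
    have "2 * pi * n2 (max N1 N2) (\<lambda>n. gal T N1 c t n - gal T N2 c' t n) < \<epsilon>\<^sup>2"
      using st[OF a(1,2,3,4) _ _ a(5), of "max N1 N2"] by (simp add: field_simps)
    then show "l2dist (gv T N1 c t) (gv T N2 c' t) < \<epsilon>"
      unfolding l2dist_gv[OF hc a(1) T max.cobounded1 max.cobounded2] using eps
      by (metis abs_of_pos real_sqrt_abs real_sqrt_less_mono)
  qed
qed

lemma limit_sol_stable:
  assumes c: "ell2 c" and T: "0 \<le> T" and eps: "0 < \<epsilon>"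
  obtains \<delta> where "0 < \<delta>"
    "\<And>c' v w t. ell2 c' \<Longrightarrow> (\<And>N. n2 N (\<lambda>n. c n - c' n) \<le> \<delta>\<^sup>2) \<Longrightarrow> limit_sol T c v \<Longrightarrow> limit_sol T c' w \<Longrightarrow>
      t \<in> {0..T} \<Longrightarrow> l2dist (v t) (w t) < \<epsilon>"
proof -
  have e3: "0 < \<epsilon> / 3" using eps by simp
  obtain \<delta> N0 where d: "0 < \<delta>" and st: "\<And>c' N1 N2 t. herm c' \<Longrightarrow> (\<And>N. n2 N (\<lambda>n. c n - c' n) \<le> \<delta>\<^sup>2) \<Longrightarrow> N0 \<le> N1 \<Longrightarrow> N0 \<le> N2 \<Longrightarrow>
      t \<in> {0..T} \<Longrightarrow> l2dist (gv T N1 c t) (gv T N2 c' t) < \<epsilon> / 3"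
    using gv_stable[OF c T e3] by blast
  show thesis
  proof (rule that[OF d])
    fix c' v w t assume a: "ell2 c'" "\<And>N. n2 N (\<lambda>n. c n - c' n) \<le> \<delta>\<^sup>2" "limit_sol T c v" "limit_sol T c' w" "t \<in> {0..T}"
    obtain N1 where N1: "\<forall>N\<ge>N1. \<forall>t\<in>{0..T}. l2dist (v t) (gv T N c t) < \<epsilon> / 3" using a(3) e3 unfolding limit_sol_def by blast
    obtain N2 where N2: "\<forall>N\<ge>N2. \<forall>t\<in>{0..T}. l2dist (w t) (gv T N c' t) < \<epsilon> / 3" using a(4) e3 unfolding limit_sol_def by blast
    define N where "N = max N0 (max N1 N2)"
    have L: "v t \<in> L2T" "w t \<in> L2T" using a(3,4,5) by (auto simp: limit_sol_def CL2_def)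
    have "l2dist (v t) (w t) \<le> l2dist (v t) (gv T N c t) + (l2dist (gv T N c t) (gv T N c' t) + l2dist (gv T N c' t) (w t))"
      using l2dist_triangle[OF L(1) gv_L2T L(2)] l2dist_triangle[OF gv_L2T gv_L2T L(2)] by (smt (verit))
    also have "\<dots> < \<epsilon> / 3 + (\<epsilon> / 3 + \<epsilon> / 3)"
    proof (intro add_strict_mono)
      show "l2dist (v t) (gv T N c t) < \<epsilon> / 3" using N1 a(5) by (simp add: N_def)
      show "l2dist (gv T N c t) (gv T N c' t) < \<epsilon> / 3" using st[of c' N N t] a(1,2,5) by (simp add: N_def ell2_def)
      show "l2dist (gv T N c' t) (w t) < \<epsilon> / 3"
        unfolding l2dist_commute[of _ "w t"] using N2 a(5) by (simp add: N_def)
    qed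
    finally show "l2dist (v t) (w t) < \<epsilon>" by simp
  qed
qed

text \<open>Stability with equal data, taking the supposed positive distance itself as
  \<open>\<epsilon>\<close>.\<close>

lemma limit_sol_unique:
  assumes c: "ell2 c" and T: "0 \<le> T" and v: "limit_sol T c v" "limit_sol T c w" and t: "t \<in> {0..T}"
  shows "l2dist (v t) (w t) = 0"
proof (rule ccontr)
  assume "l2dist (v t) (w t) \<noteq> 0"
  then have "0 < l2dist (v t) (w t)" using l2dist_nonneg[of "v t" "w t"] by linarith
  from limit_sol_stable[OF c T this] obtain \<delta> where "0 < \<delta>"
    "\<And>c' v' w' t'. ell2 c' \<Longrightarrow> (\<And>N. n2 N (\<lambda>n. c n - c' n) \<le> \<delta>\<^sup>2) \<Longrightarrow> limit_sol T c v' \<Longrightarrow> limit_sol T c' w' \<Longrightarrow>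
      t' \<in> {0..T} \<Longrightarrow> l2dist (v' t') (w' t') < l2dist (v t) (w t)" by blast
  from this(2)[OF c _ v t] show False by (simp add: n2_def)
qed

text \<open>At time zero the linear flow is trivial and the truncations carry the coefficients of
  \<open>c\<close>, which pass to the limit. Hence \<open>c\<close> can be recovered from
  \<open>v\<close>, although membership in the solution space only asserts that some
  \<open>c\<close> exists.\<close>

lemma limit_sol_init:
  assumes c: "ell2 c" and T: "0 \<le> T" and v: "limit_sol T c v"
  shows "co (v 0) = c"
proof
  fix n
  have hc: "herm c" using c by (simp add: ell2_def)
  have T0: "0 \<in> {0..T}" using T by simp
  have L: "v 0 \<in> L2T" using v T0 by (auto simp: limit_sol_def CL2_def)
  have U0: "U 0 z = z" for z by (auto simp: U_def)
  have "cmod (co (v 0) n - c n) \<le> 0"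
  proof (rule field_le_epsilon)
    fix \<epsilon> :: real assume e: "0 < \<epsilon>"
    then obtain N0 where N0: "\<forall>N\<ge>N0. \<forall>t\<in>{0..T}. l2dist (v t) (gv T N c t) < \<epsilon>" using v unfolding limit_sol_def by blast
    define N where "N = max N0 (nat \<bar>n\<bar>)"
    have nN: "n \<in> modes N" by (auto simp: N_def modes_def)
    have "fcoeff (gv T N c 0) n = of_real (2 * pi) * c n"
      unfolding gv_def by (subst fcoeff_tp[OF gal_supp_herm[OF hc T]]) (use nN in \<open>simp add: U0 gal(2)[OF hc T] trunc_def\<close>)
    then have "co (v 0) n - c n = (fcoeff (v 0) n - fcoeff (gv T N c 0) n) / of_real (2 * pi)"
      by (simp add: co_def diff_divide_distrib)
    then have "cmod (co (v 0) n - c n) = cmod (fcoeff (v 0) n - fcoeff (gv T N c 0) n) / (2 * pi)"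
      by (simp add: norm_divide)
    also have "\<dots> \<le> sqrt (2 * pi) * l2dist (v 0) (gv T N c 0) / (2 * pi)"
      by (intro divide_right_mono fcoeff_diff_le L gv_L2T) auto
    also have "\<dots> \<le> (2 * pi) * \<epsilon> / (2 * pi)"
    proof (intro divide_right_mono mult_mono)
      show "sqrt (2 * pi) \<le> 2 * pi" using pi_gt3 by (intro real_le_lsqrt) (auto simp: power2_eq_square)
      show "l2dist (v 0) (gv T N c 0) \<le> \<epsilon>" using N0 T0 by (auto simp: N_def intro: less_imp_le)
    qed auto
    finally show "cmod (co (v 0) n - c n) \<le> 0 + \<epsilon>" by simp
  qed
  then show "co (v 0) n = c n" by simp
qed

lemma gal_duhamel:
  assumes hc: "herm c" and T: "0 \<le> T" and t: "t \<in> {0..T}" and n: "n \<in> modes N"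
  shows "U t (gal T N c t) n = cis (t * phase \<beta> \<gamma> n) * c n + of_real (\<mu> / 3) *
    integral {0..t} (\<lambda>s. cis ((t - s) * phase \<beta> \<gamma> n) * (\<i> * of_int n) * cub N (U s (gal T N c s)) n)"
proof -
  interpret galerkin \<beta> \<gamma> \<mu> N N T "gal T N c" by (rule gal(1)[OF hc T])
  have sub: "{0..t} \<subseteq> {0..T}" using t by auto
  have "((\<lambda>s. r s n) has_integral (gal T N c t n - gal T N c 0 n)) {0..t}"
    using t by (intro fundamental_theorem_of_calculus has_vector_derivative_within_subset[OF deriv sub]) auto
  then have I: "gal T N c t n - c n = integral {0..t} (\<lambda>s. r s n)"
    using n by (simp add: integral_unique gal(2)[OF hc T] trunc_def)
  have "cis (t * phase \<beta> \<gamma> n) * r s n = of_real (\<mu> / 3) * (cis ((t - s) * phase \<beta> \<gamma> n) * (\<i> * of_int n) * cub N (U s (gal T N c s)) n)" for s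
  proof -
    have "cis ((t - s) * phase \<beta> \<gamma> n) = cis (t * phase \<beta> \<gamma> n) * cis (- (s * phase \<beta> \<gamma> n))"
      by (simp add: cis_mult algebra_simps)
    then show ?thesis using n by (simp add: rhs_def)
  qed
  then have "cis (t * phase \<beta> \<gamma> n) * integral {0..t} (\<lambda>s. r s n) = of_real (\<mu> / 3) *
    integral {0..t} (\<lambda>s. cis ((t - s) * phase \<beta> \<gamma> n) * (\<i> * of_int n) * cub N (U s (gal T N c s)) n)"
    by (simp only: integral_mult_right[symmetric])
  moreover have "U t (gal T N c t) n = cis (t * phase \<beta> \<gamma> n) * c n + cis (t * phase \<beta> \<gamma> n) * (gal T N c t n - c n)"
    by (simp add: U_def algebra_simps)
  ultimately show ?thesis unfolding I by simp
qed

end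

lemma fcoeff_L1_limit:
  assumes f: "\<And>k. integrable MT (f k)"
    and s: "summable (\<lambda>k. \<integral>x. \<bar>f (Suc k) x - f k x\<bar> \<partial>MT)"
    and h: "h \<in> borel_measurable MT" "AE x in MT. (\<lambda>k. f k x) \<longlonglongrightarrow> h x"
  shows "integrable MT h" and "(\<lambda>k. fcoeff (f k) n) \<longlonglongrightarrow> fcoeff h n"
proof -
  show "integrable MT h" using L1_telescope(2)[of MT f h] f s h by simp
  let ?E = "\<lambda>x. cis (- (real_of_int n * x))"
  have [measurable]: "?E \<in> borel_measurable MT"
    by (intro continuous_imp_measurable_on_sets_lebesgue continuous_intros) auto
  have [measurable]: "f k \<in> borel_measurable MT" for k using f by (rule borel_measurable_integrable)
  note h(1) [measurable]
  have i: "integrable MT (\<lambda>x. complex_of_real (f k x) * ?E x)" for k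
    by (rule Bochner_Integration.integrable_bound[OF f[of k]]) (auto simp: norm_mult)
  have "cmod (complex_of_real a * ?E x - complex_of_real b * ?E x) = \<bar>a - b\<bar>" for a b x
    unfolding left_diff_distrib[symmetric] of_real_diff[symmetric] norm_mult by (simp only: norm_of_real norm_cis mult_1_right)
  then have s': "summable (\<lambda>k. \<integral>x. cmod (complex_of_real (f (Suc k) x) * ?E x - complex_of_real (f k x) * ?E x) \<partial>MT)"
    using s by simp
  have m: "(\<lambda>x. complex_of_real (h x) * ?E x) \<in> borel_measurable MT" by measurable
  have l: "AE x in MT. (\<lambda>k. complex_of_real (f k x) * ?E x) \<longlonglongrightarrow> complex_of_real (h x) * ?E x"
    using h(2) by eventually_elim (intro tendsto_intros)
  show "(\<lambda>k. fcoeff (f k) n) \<longlonglongrightarrow> fcoeff h n"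
    unfolding fcoeff_MT using L1_telescope(2)[OF i s' m l] by simp
qed

section \<open>The limit along a fast subsequence solves the Duhamel formula\<close>

lemma summable_half: "summable (\<lambda>k. (1/2::real)^k)" by (rule summable_geometric) simp

text \<open>A geometric rate makes consecutive differences summable, hence gives almost everywhere
  convergence in \<open>x\<close> at each time. \<open>Nk_mono\<close> places consecutive terms in a
  common box, and \<open>Nk_ge\<close> puts every mode eventually inside the truncation.\<close>

locale fast_galerkin = kaw +
  fixes c :: "int \<Rightarrow> complex" and T :: real and Nk :: "nat \<Rightarrow> nat"
  assumes c: "ell2 c" and T: "0 \<le> T" and Nk_ge: "\<And>k. k \<le> Nk k" and Nk_mono: "\<And>k. Nk k \<le> Nk (Suc k)"
    and close: "\<And>k N1 N2 t. Nk k \<le> N1 \<Longrightarrow> Nk k \<le> N2 \<Longrightarrow> t \<in> {0..T} \<Longrightarrow> l2dist (gv T N1 c t) (gv T N2 c t) \<le> (1/2)^k"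
begin

definition g :: "nat \<Rightarrow> real \<Rightarrow> int \<Rightarrow> complex" where "g k s = U s (gal T (Nk k) c s)"
definition qk :: "nat \<Rightarrow> real \<Rightarrow> real" where "qk k s = Q (Nk k) (g k s)"
definition vk :: "nat \<Rightarrow> real \<Rightarrow> real \<Rightarrow> real" where "vk k t = tp (Nk k) (g k t)"
definition v :: "real \<Rightarrow> real \<Rightarrow> real" where "v t x = lim (\<lambda>k. vk k t x)"

lemma hc: "herm c" using c by (simp add: ell2_def)

lemma gs: "supp (g k s) (Nk k)" "herm (g k s)"
  unfolding g_def by (rule gal_supp_herm[OF hc T])+

lemma vk_gv: "vk k t = gv T (Nk k) c t" by (simp add: vk_def gv_def g_def)

lemma vk_L2T: "vk k t \<in> L2T" by (simp add: vk_gv gv_L2T)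

lemma vk_step: "t \<in> {0..T} \<Longrightarrow> l2dist (vk (Suc k) t) (vk k t) \<le> (1/2)^k"
  unfolding vk_gv by (intro close Nk_mono order_refl)

lemma
  assumes "t \<in> {0..T}"
  shows vk_AE: "AE x in MT. (\<lambda>k. vk k t x) \<longlonglongrightarrow> v t x" and v_L2T: "v t \<in> L2T"
    and v_close: "l2dist (v t) (vk k t) \<le> 2 * (1/2)^k"
  using fast_Cauchy_limit[of "\<lambda>k. vk k t", OF vk_L2T vk_step[OF assms]] by (simp_all add: v_def[abs_def])

lemma cont_g: "continuous_on {0..T} (\<lambda>s. g k s n)"
proof -
  interpret galerkin \<beta> \<gamma> \<mu> "Nk k" "Nk k" T "gal T (Nk k) c" by (rule gal(1)[OF hc T])
  show ?thesis unfolding g_def by (rule cont_U)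
qed

lemma cont_qk: "continuous_on {0..T} (qk k)"
  unfolding qk_def Q_def conv_def by (intro continuous_intros cont_g)

lemma qk_nonneg [simp]: "0 \<le> qk k s" by (simp add: qk_def)

lemma small_half: "0 < \<epsilon> \<Longrightarrow> \<exists>k. 3 * (1/2::real)^k < \<epsilon>"
  using real_arch_pow_inv[of "\<epsilon> / 3" "1/2"] by (auto simp: field_simps)

lemma v_CL2: "v \<in> CL2 T"
  unfolding CL2_def
proof (intro CollectI conjI ballI allI impI v_L2T)
  fix t \<epsilon> :: real assume t: "t \<in> {0..T}" and e: "0 < \<epsilon>"
  obtain k where k: "3 * (1/2::real)^k < \<epsilon> / 2" using small_half[of "\<epsilon> / 2"] e by auto
  let ?h = "\<lambda>t'. sqrt (2 * pi * n2 (Nk k) (\<lambda>n. g k t' n - g k t n))"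
  have "continuous_on {0..T} ?h" unfolding n2_def by (intro continuous_intros cont_g)
  then have "\<forall>t\<in>{0..T}. \<forall>e>0. \<exists>\<delta>>0. \<forall>t'\<in>{0..T}. dist t' t < \<delta> \<longrightarrow> dist (?h t') (?h t) < e"
    unfolding continuous_on_iff .
  moreover have "0 < (1/2::real)^k" by simp
  ultimately have "\<exists>\<delta>>0. \<forall>t'\<in>{0..T}. dist t' t < \<delta> \<longrightarrow> dist (?h t') (?h t) < (1/2)^k"
    using t by blast
  then obtain \<delta> where d: "0 < \<delta>" "\<And>t'. t' \<in> {0..T} \<Longrightarrow> dist t' t < \<delta> \<Longrightarrow> dist (?h t') (?h t) < (1/2)^k" by blast
  have h: "l2dist (vk k t') (vk k t) = ?h t'" for t' unfolding vk_def by (rule l2dist_tp[OF gs gs])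
  show "\<exists>\<delta>>0. \<forall>t'\<in>{0..T}. \<bar>t' - t\<bar> < \<delta> \<longrightarrow> l2dist (v t') (v t) < \<epsilon>"
  proof (intro exI[of _ \<delta>] conjI ballI impI d(1))
    fix t' assume t': "t' \<in> {0..T}" "\<bar>t' - t\<bar> < \<delta>"
    have "?h t = 0" by (simp add: n2_def)
    then have "l2dist (vk k t') (vk k t) < (1/2)^k"
      unfolding h using d(2)[OF t'(1)] t'(2) by (simp add: dist_real_def)
    then show "l2dist (v t') (v t) < \<epsilon>"
      using l2dist_triangle[OF v_L2T[OF t'(1)] vk_L2T[of k t'] v_L2T[OF t]] l2dist_triangle[OF vk_L2T[of k t'] vk_L2T[of k t] v_L2T[OF t]]
        v_close[OF t'(1), of k] v_close[OF t, of k] k l2dist_commute[of "vk k t" "v t"] \<open>0 < (1/2)^k\<close> by linarith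
  qed
qed

lemma v_limit_sol: "limit_sol T c v"
  unfolding limit_sol_def
proof (intro conjI allI impI v_CL2)
  fix \<epsilon> :: real assume "0 < \<epsilon>"
  then obtain k where k: "3 * (1/2::real)^k < \<epsilon>" using small_half by blast
  show "\<exists>N0. \<forall>N\<ge>N0. \<forall>t\<in>{0..T}. l2dist (v t) (gv T N c t) < \<epsilon>"
  proof (intro exI[of _ "Nk k"] allI impI ballI)
    fix N t assume N: "Nk k \<le> N" and t: "t \<in> {0..T}"
    show "l2dist (v t) (gv T N c t) < \<epsilon>"
      using l2dist_triangle[OF v_L2T[OF t] vk_L2T[of k t] gv_L2T[of T N c t]] v_close[OF t, of k] close[OF order_refl N t] k
      unfolding vk_gv by linarith
  qed
qed

lemma qk_bound:
  obtains C where "0 \<le> C" "\<And>k t. t \<in> {0..T} \<Longrightarrow> integral {0..t} (qk k) \<le> C"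
proof -
  obtain S where S: "\<And>N. n2 N c \<le> S" using c by (auto simp: ell2_def)
  have "0 \<le> CQ (sqrt S) T" unfolding CQ_def using T ctri_nonneg by (intro mult_nonneg_nonneg add_nonneg_nonneg) auto
  moreover have "integral {0..t} (qk k) \<le> CQ (sqrt S) T" if t: "t \<in> {0..T}" for k t
  proof -
    interpret galerkin \<beta> \<gamma> \<mu> "Nk k" "Nk k" T "gal T (Nk k) c" by (rule gal(1)[OF hc T])
    have "sqrt (n2 (Nk k) (gal T (Nk k) c 0)) \<le> sqrt S" using S n2_trunc[of "Nk k" "Nk k" c] by (simp add: gal(2)[OF hc T])
    from apriori[OF this t] show ?thesis by (simp add: qk_def[abs_def] g_def)
  qed
  ultimately show thesis by (rule that)
qed

text \<open>Outside this set the L4 quantities grow slowly enough along the subsequence for the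
  cubes to converge in L1 at the given time.\<close>

definition bad :: "real set" where "bad = {s \<in> {0..T}. \<not> summable (\<lambda>k. (1/2)^k * qk k s)}"

text \<open>The time integrals of \<open>qk\<close> are bounded uniformly in \<open>k\<close>, so
  the series of integrals with weights \<open>(1/2)^k\<close> converges and the series itself is
  finite almost everywhere.\<close>

lemma negligible_bad: "negligible bad"
proof -
  let ?M = "lebesgue_on {0..T}"
  obtain C where C: "0 \<le> C" "\<And>k t. t \<in> {0..T} \<Longrightarrow> integral {0..t} (qk k) \<le> C" using qk_bound by blast
  define f where "f K s = (\<Sum>k<K. (1/2)^k * qk k s)" for K s
  have i: "integrable ?M (f K)" for K
    unfolding f_def by (intro continuous_imp_integrable_real continuous_intros cont_qk)
  have "summable (\<lambda>K. \<integral>s. norm (f (Suc K) s - f K s) \<partial>?M)"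
  proof (rule summable_comparison_test'[of "\<lambda>K. C * (1/2)^K" 0])
    show "summable (\<lambda>K. C * (1/2)^K)" by (intro summable_mult summable_half)
    fix K
    have "(\<integral>s. norm (f (Suc K) s - f K s) \<partial>?M) = (\<integral>s. (1/2)^K * qk K s \<partial>?M)" by (simp add: f_def)
    also have "\<dots> = integral {0..T} (\<lambda>s. (1/2)^K * qk K s)"
      by (intro lebesgue_integral_eq_integral continuous_imp_integrable_real continuous_intros cont_qk) auto
    also have "\<dots> = (1/2)^K * integral {0..T} (qk K)" by (rule integral_mult_right)
    also have "\<dots> \<le> (1/2)^K * C" using C(2)[of T K] T by (intro mult_left_mono) auto
    finally show "norm (\<integral>s. norm (f (Suc K) s - f K s) \<partial>?M) \<le> C * (1/2)^K" by (simp add: mult.commute)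
  qed
  from L1_telescope(1)[OF i this] have "AE s in ?M. summable (\<lambda>k. (1/2)^k * qk k s)"
    unfolding f_def summable_iff_convergent .
  then have "AE s in lebesgue. s \<in> {0..T} \<longrightarrow> summable (\<lambda>k. (1/2)^k * qk k s)"
    by (simp add: AE_restrict_space_iff)
  then obtain N where "negligible N" "{s. \<not> (s \<in> {0..T} \<longrightarrow> summable (\<lambda>k. (1/2)^k * qk k s))} \<subseteq> N"
    unfolding eventually_ae_filter_negligible by blast
  then show ?thesis by (elim negligible_subset) (auto simp: bad_def)
qed

text \<open>Weight \<open>2\<^sup>k\<close> in \<open>cube_diff_le\<close>: the squared \<open>L\<^sup>2\<close> distance of consecutive terms is at most \<open>(1/4)\<^sup>k\<close>, while the
  fourth powers of the \<open>L\<^sup>4\<close> norms, which are not bounded at fixed time, are summable against \<open>(1/2)\<^sup>k\<close>.\<close>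

lemma
  assumes s: "s \<in> {0..T} - bad"
  shows v_cube_integrable: "integrable MT (\<lambda>x. (v s x)^3)"
    and v_cube_limit: "(\<lambda>k. fcoeff (\<lambda>x. (vk k s x)^3) n) \<longlonglongrightarrow> fcoeff (\<lambda>x. (v s x)^3) n"
proof -
  have sT: "s \<in> {0..T}" and sm: "summable (\<lambda>k. (1/2)^k * qk k s)" using s by (auto simp: bad_def)
  have cont: "continuous_on {0..2*pi} (vk k s)" for k unfolding vk_def by (rule cont_tp)
  have i: "integrable MT (\<lambda>x. (vk k s x)^3)" for k by (intro continuous_imp_integrable_real continuous_intros cont)
  have i4: "integrable MT (\<lambda>x. (vk k s x)^4)" for k by (intro continuous_imp_integrable_real continuous_intros cont)
  have "summable (\<lambda>k. \<integral>x. \<bar>(vk (Suc k) s x)^3 - (vk k s x)^3\<bar> \<partial>MT)"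
  proof (rule summable_comparison_test'[of "\<lambda>k. (1/2)^k + 4 * pi * (2 * ((1/2)^Suc k * qk (Suc k) s) + (1/2)^k * qk k s)" 0])
    show "summable (\<lambda>k. (1/2)^k + 4 * pi * (2 * ((1/2)^Suc k * qk (Suc k) s) + (1/2)^k * qk k s))"
      using sm summable_Suc_iff[of "\<lambda>k. (1/2)^k * qk k s"]
      by (intro summable_add summable_mult summable_half) simp_all
    fix k
    let ?a = "vk (Suc k) s" and ?b = "vk k s"
    have p: "0 < (2::real)^k" by simp
    have "(\<integral>x. \<bar>(?a x)^3 - (?b x)^3\<bar> \<partial>MT) \<le> (\<integral>x. 2^k * (?a x - ?b x)\<^sup>2 + 2 / 2^k * ((?a x)^4 + (?b x)^4) \<partial>MT)"
      by (intro integral_mono cube_diff_le[OF p] continuous_imp_integrable_real continuous_intros cont)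
    also have "\<dots> = 2^k * (l2dist ?a ?b)\<^sup>2 + 2 / 2^k * ((\<integral>x. (?a x)^4 \<partial>MT) + (\<integral>x. (?b x)^4 \<partial>MT))"
      unfolding l2dist_def l2norm_sq using i4 L2T_sq[OF L2T_diff[OF vk_L2T vk_L2T]] by simp
    also have "\<dots> = 2^k * (l2dist ?a ?b)\<^sup>2 + 2 / 2^k * (2 * pi * qk (Suc k) s + 2 * pi * qk k s)"
      unfolding vk_def qk_def integral_tp_pow4[OF gs] ..
    also have "\<dots> \<le> 2^k * ((1/2)^k)\<^sup>2 + 2 / 2^k * (2 * pi * qk (Suc k) s + 2 * pi * qk k s)"
      using vk_step[OF sT, of k] by (intro add_right_mono mult_left_mono power_mono) auto
    also have "\<dots> = (1/2)^k + 4 * pi * (2 * ((1/2)^Suc k * qk (Suc k) s) + (1/2)^k * qk k s)"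
      by (simp add: power_divide field_simps power2_eq_square)
    finally show "norm (\<integral>x. \<bar>(?a x)^3 - (?b x)^3\<bar> \<partial>MT) \<le> (1/2)^k + 4 * pi * (2 * ((1/2)^Suc k * qk (Suc k) s) + (1/2)^k * qk k s)"
      by simp
  qed
  moreover have "(\<lambda>x. (v s x)^3) \<in> borel_measurable MT" using L2T_measurable[OF v_L2T[OF sT]] by measurable
  moreover have "AE x in MT. (\<lambda>k. (vk k s x)^3) \<longlonglongrightarrow> (v s x)^3"
    using vk_AE[OF sT] by eventually_elim (intro tendsto_intros)
  ultimately show "integrable MT (\<lambda>x. (v s x)^3)" "(\<lambda>k. fcoeff (\<lambda>x. (vk k s x)^3) n) \<longlonglongrightarrow> fcoeff (\<lambda>x. (v s x)^3) n"
    by (rule fcoeff_L1_limit[where f = "\<lambda>k x. (vk k s x)^3", OF i])+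
qed

definition F :: "int \<Rightarrow> nat \<Rightarrow> real \<Rightarrow> complex" where "F n k s = of_real (2 * pi) * cub (Nk k) (g k s) n"

lemma F_fcoeff: "fcoeff (\<lambda>x. (vk k s x)^3) n = F n k s"
  unfolding vk_def F_def by (rule fcoeff_tp_cube[OF gs])

lemma cont_F: "continuous_on {0..T} (F n k)"
  unfolding F_def tri_def by (intro continuous_intros cont_g)

text \<open>Both terms are viewed in the larger box, where \<open>cub_diff_le\<close> gives the
  geometric L2 distance times square roots of \<open>qk\<close>. These are replaced by
  \<open>1 + qk\<close> because the uniform bound is on the time integral of
  \<open>qk\<close>.\<close>

lemma F_step:
  assumes s: "s \<in> {0..T}"
  shows "cmod (F n (Suc k) s - F n k s) \<le> 4 * pi * (1/2)^k * (2 + qk (Suc k) s + qk k s)"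
proof -
  let ?B = "Nk (Suc k)"
  let ?d = "n2 ?B (\<lambda>n. g (Suc k) s n - g k s n)"
  have sB: "supp (g k s) ?B" by (rule supp_mono[OF gs(1) Nk_mono])
  have "F n k s = of_real (2 * pi) * cub ?B (g k s) n" "qk k s = Q ?B (g k s)"
    unfolding F_def qk_def tri_mono_modes[OF gs(1) gs(1) Nk_mono] Q_mono_modes[OF gs(1) Nk_mono] by (rule refl)+
  note k = this
  have "sqrt ?d \<le> sqrt (2 * pi * ?d)"
    using pi_gt3 mult_right_mono[of 1 "2 * pi" ?d] by (intro real_sqrt_le_mono) simp
  also have "\<dots> = l2dist (vk (Suc k) s) (vk k s)"
    unfolding vk_def tp_mono[OF gs(1)[of k s] Nk_mono[of k], symmetric] by (rule l2dist_tp[OF gs sB gs(2), symmetric])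
  also have "\<dots> \<le> (1/2)^k" by (rule vk_step[OF s])
  finally have d: "sqrt ?d \<le> (1/2)^k" .
  have q: "sqrt x \<le> 1 + x" if "0 \<le> x" for x :: real
    using that by (intro real_le_lsqrt) (auto simp: power2_eq_square algebra_simps)
  have "cmod (F n (Suc k) s - F n k s) = 2 * pi * cmod (cub ?B (g (Suc k) s) n - cub ?B (g k s) n)"
    unfolding k F_def[of n "Suc k"] right_diff_distrib[symmetric] norm_mult by simp
  also have "\<dots> \<le> 2 * pi * (2 * sqrt ?d * (sqrt (qk (Suc k) s) + sqrt (qk k s)))"
    unfolding k qk_def[of "Suc k"] by (intro mult_left_mono cub_diff_le gs sB) auto
  also have "\<dots> \<le> 2 * pi * (2 * (1/2)^k * ((1 + qk (Suc k) s) + (1 + qk k s)))"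
    by (intro mult_left_mono mult_mono add_mono q d) (auto intro!: add_nonneg_nonneg)
  also have "\<dots> = 4 * pi * (1/2)^k * (2 + qk (Suc k) s + qk k s)" by (simp add: algebra_simps)
  finally show ?thesis .
qed

text \<open>The weight \<open>w\<close> stands both for the constant one, which yields integrability
  in time of the cubic coefficients, and for the Duhamel kernel.\<close>

lemma F_summable:
  fixes w :: "real \<Rightarrow> complex"
  assumes t: "t \<in> {0..T}" and w: "continuous_on {0..t} w" "\<And>s. cmod (w s) \<le> W"
  shows "summable (\<lambda>k. integral {0..t} (\<lambda>s. cmod (w s * F n (Suc k) s - w s * F n k s)))"
proof -
  have sub: "{0..t} \<subseteq> {0..T}" using t by auto
  have W: "0 \<le> W" using w(2) norm_ge_zero order_trans by blast
  obtain C where C: "0 \<le> C" "\<And>k t. t \<in> {0..T} \<Longrightarrow> integral {0..t} (qk k) \<le> C" using qk_bound by blast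
  note cF = continuous_on_subset[OF cont_F sub] and cq = continuous_on_subset[OF cont_qk sub]
  show ?thesis
  proof (rule summable_comparison_test'[of "\<lambda>k. (W * (4 * pi) * (2 * t + C + C)) * (1/2)^k" 0])
    show "summable (\<lambda>k. (W * (4 * pi) * (2 * t + C + C)) * (1/2)^k)" by (intro summable_mult summable_half)
    fix k
    let ?K = "W * (4 * pi * (1/2)^k)"
    have "integral {0..t} (\<lambda>s. cmod (w s * F n (Suc k) s - w s * F n k s)) \<le> integral {0..t} (\<lambda>s. ?K * (2 + qk (Suc k) s + qk k s))"
    proof (intro integral_le integrable_continuous_real continuous_intros w(1) cF cq)
      fix s assume s: "s \<in> {0..t}"
      have "cmod (w s * F n (Suc k) s - w s * F n k s) = cmod (w s) * cmod (F n (Suc k) s - F n k s)"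
        unfolding right_diff_distrib[symmetric] norm_mult ..
      also have "\<dots> \<le> W * (4 * pi * (1/2)^k * (2 + qk (Suc k) s + qk k s))"
        by (intro mult_mono F_step w(2) W) (use s sub in auto)
      finally show "cmod (w s * F n (Suc k) s - w s * F n k s) \<le> ?K * (2 + qk (Suc k) s + qk k s)" by (simp add: mult.assoc)
    qed
    also have "\<dots> = ?K * (2 * t + integral {0..t} (qk (Suc k)) + integral {0..t} (qk k))"
    proof -
      have q: "qk j integrable_on {0..t}" for j by (rule integrable_continuous_real[OF cq])
      have "((\<lambda>s. 2 + qk (Suc k) s + qk k s) has_integral (2 * t + integral {0..t} (qk (Suc k)) + integral {0..t} (qk k))) {0..t}"
        using has_integral_const_real[of "2::real" 0 t] t by (intro has_integral_add integrable_integral q) (simp add: mult.commute)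
      then show ?thesis by (simp only: integral_mult_right integral_unique)
    qed
    also have "\<dots> \<le> ?K * (2 * t + C + C)" using C(2)[OF t] W by (intro mult_left_mono add_mono) auto
    also have "\<dots> = (W * (4 * pi) * (2 * t + C + C)) * (1/2)^k" by (simp add: mult_ac)
    finally have "integral {0..t} (\<lambda>s. cmod (w s * F n (Suc k) s - w s * F n k s)) \<le> (W * (4 * pi) * (2 * t + C + C)) * (1/2)^k" .
    moreover have "0 \<le> integral {0..t} (\<lambda>s. cmod (w s * F n (Suc k) s - w s * F n k s))"
      by (intro integral_nonneg integrable_continuous_real continuous_intros w(1) cF) auto
    ultimately show "norm (integral {0..t} (\<lambda>s. cmod (w s * F n (Suc k) s - w s * F n k s))) \<le> (W * (4 * pi) * (2 * t + C + C)) * (1/2)^k"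
      by simp
  qed
qed

lemma F_limit:
  assumes t: "t \<in> {0..T}" and w: "continuous_on {0..t} w" "\<And>s. cmod (w s) \<le> W"
  shows "set_integrable lebesgue {0..t} (\<lambda>s. w s * fcoeff (\<lambda>x. (v s x)^3) n)"
    and "(\<lambda>k. integral {0..t} (\<lambda>s. w s * F n k s)) \<longlonglongrightarrow> set_lebesgue_integral lebesgue {0..t} (\<lambda>s. w s * fcoeff (\<lambda>x. (v s x)^3) n)"
proof -
  have sub: "{0..t} \<subseteq> {0..T}" using t by auto
  have c: "continuous_on {0..t} (\<lambda>s. w s * F n k s)" for k
    by (intro continuous_intros w(1) continuous_on_subset[OF cont_F sub])
  have l: "(\<lambda>k. w s * F n k s) \<longlonglongrightarrow> w s * fcoeff (\<lambda>x. (v s x)^3) n" if "s \<in> {0..t} - bad" for s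
    unfolding F_fcoeff[symmetric] by (intro tendsto_mult_left v_cube_limit) (use that sub in auto)
  show "set_integrable lebesgue {0..t} (\<lambda>s. w s * fcoeff (\<lambda>x. (v s x)^3) n)"
    "(\<lambda>k. integral {0..t} (\<lambda>s. w s * F n k s)) \<longlonglongrightarrow> set_lebesgue_integral lebesgue {0..t} (\<lambda>s. w s * fcoeff (\<lambda>x. (v s x)^3) n)"
    using L1_limit_interval[OF c F_summable[OF t w] negligible_bad l] by auto
qed

lemma v_sol:
  assumes v0: "co v0 = c"
  shows "kawahara_sol \<beta> \<gamma> \<mu> T v0 v"
  unfolding kawahara_sol_def
proof (intro conjI v_CL2 allI ballI)
  show "AE s in lebesgue. s \<in> {0..T} \<longrightarrow> set_integrable lebesgue {0..2*pi} (\<lambda>x. (v s x)^3)"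
    unfolding eventually_ae_filter_negligible
    by (intro exI[of _ bad] conjI negligible_bad) (auto simp: set_integrable_iff_MT intro: v_cube_integrable)
  show "set_integrable lebesgue {0..T} (\<lambda>s. fcoeff (\<lambda>x. (v s x)^3) n)" for n
    using F_limit(1)[of T "\<lambda>_. 1" 1] T by simp
  fix t n assume t: "t \<in> {0..T}"
  let ?w = "\<lambda>s. cis ((t - s) * phase \<beta> \<gamma> n) * (\<i> * of_int n)"
  let ?I = "set_lebesgue_integral lebesgue {0..t} (\<lambda>s. ?w s * fcoeff (\<lambda>x. (v s x)^3) n)"
  have v0n: "fcoeff v0 n = of_real (2 * pi) * c n" unfolding v0[symmetric] co_def by simp
  have w: "continuous_on {0..t} ?w" "\<And>s. cmod (?w s) \<le> \<bar>real_of_int n\<bar>"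
    by (intro continuous_intros) (simp add: norm_mult)
  have 1: "(\<lambda>k. cis (t * phase \<beta> \<gamma> n) * fcoeff v0 n + of_real (\<mu> / 3) * integral {0..t} (\<lambda>s. ?w s * F n k s))
      \<longlonglongrightarrow> cis (t * phase \<beta> \<gamma> n) * fcoeff v0 n + of_real (\<mu> / 3) * ?I"
    by (intro tendsto_intros F_limit(2)[OF t w])
  have "(\<lambda>k. fcoeff (vk k t) n) \<longlonglongrightarrow> fcoeff (v t) n"
  proof (rule LIM_zero_cancel, rule Lim_null_comparison)
    show "\<forall>\<^sub>F k in sequentially. cmod (fcoeff (vk k t) n - fcoeff (v t) n) \<le> sqrt (2 * pi) * (2 * (1/2)^k)"
    proof (intro always_eventually allI)
      fix k
      have "cmod (fcoeff (vk k t) n - fcoeff (v t) n) \<le> sqrt (2 * pi) * l2dist (v t) (vk k t)"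
        unfolding l2dist_commute[of "v t"] by (rule fcoeff_diff_le[OF vk_L2T v_L2T[OF t]])
      also have "\<dots> \<le> sqrt (2 * pi) * (2 * (1/2)^k)" by (intro mult_left_mono v_close t) simp
      finally show "cmod (fcoeff (vk k t) n - fcoeff (v t) n) \<le> sqrt (2 * pi) * (2 * (1/2)^k)" .
    qed
    show "(\<lambda>k. sqrt (2 * pi) * (2 * (1/2)^k)) \<longlonglongrightarrow> 0"
      by (intro tendsto_mult_right_zero LIMSEQ_realpow_zero) auto
  qed
  \<comment> \<open>The truncated Duhamel formula is available once mode \<open>n\<close> lies
    inside the truncation, which happens for \<open>k \<ge> \<bar>n\<bar>\<close> since
    \<open>Nk k \<ge> k\<close>.\<close>
  moreover have "\<forall>\<^sub>F k in sequentially. fcoeff (vk k t) n =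
      cis (t * phase \<beta> \<gamma> n) * fcoeff v0 n + of_real (\<mu> / 3) * integral {0..t} (\<lambda>s. ?w s * F n k s)"
    unfolding eventually_sequentially
  proof (intro exI[of _ "nat \<bar>n\<bar>"] allI impI)
    fix k assume "nat \<bar>n\<bar> \<le> k"
    then have "n \<in> modes (Nk k)" using Nk_ge[of k] by (auto simp: modes_def)
    note D = gal_duhamel[OF hc T t this]
    have i: "integral {0..t} (\<lambda>s. ?w s * F n k s) = of_real (2 * pi) * integral {0..t} (\<lambda>s. ?w s * cub (Nk k) (U s (gal T (Nk k) c s)) n)"
      unfolding F_def g_def integral_mult_right[symmetric] by (simp add: mult_ac)
    have "fcoeff (vk k t) n = of_real (2 * pi) * g k t n" unfolding vk_def by (rule fcoeff_tp[OF gs])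
    also have "\<dots> = cis (t * phase \<beta> \<gamma> n) * fcoeff v0 n + of_real (\<mu> / 3) * integral {0..t} (\<lambda>s. ?w s * F n k s)"
      unfolding g_def D i v0n by (simp add: algebra_simps)
    finally show "fcoeff (vk k t) n = cis (t * phase \<beta> \<gamma> n) * fcoeff v0 n + of_real (\<mu> / 3) * integral {0..t} (\<lambda>s. ?w s * F n k s)" .
  qed
  ultimately have "(\<lambda>k. cis (t * phase \<beta> \<gamma> n) * fcoeff v0 n + of_real (\<mu> / 3) * integral {0..t} (\<lambda>s. ?w s * F n k s)) \<longlonglongrightarrow> fcoeff (v t) n"
    by (rule Lim_transform_eventually)
  with 1 show "fcoeff (v t) n = cis (t * phase \<beta> \<gamma> n) * fcoeff v0 n + complex_of_real (\<mu> / 3) * ?I"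
    using LIMSEQ_unique by blast
qed

end

lemma (in kaw) limit_sol_exists:
  assumes c: "ell2 c" and T: "0 \<le> T"
  obtains v where "limit_sol T c v" "\<And>v0. co v0 = c \<Longrightarrow> kawahara_sol \<beta> \<gamma> \<mu> T v0 v"
proof -
  have "\<exists>N0. \<forall>N1\<ge>N0. \<forall>N2\<ge>N0. \<forall>t\<in>{0..T}. l2dist (gv T N1 c t) (gv T N2 c t) \<le> (1/2)^k" for k :: nat
  proof -
    have "0 < (1/2::real)^k" by simp
    from gv_stable[OF c T this] obtain \<delta> N0 where "0 < \<delta>" and st: "\<And>c' N1 N2 t. herm c' \<Longrightarrow> (\<And>N. n2 N (\<lambda>n. c n - c' n) \<le> \<delta>\<^sup>2) \<Longrightarrow> N0 \<le> N1 \<Longrightarrow> N0 \<le> N2 \<Longrightarrow>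
      t \<in> {0..T} \<Longrightarrow> l2dist (gv T N1 c t) (gv T N2 c' t) < (1/2)^k" by blast
    have hc: "herm c" "\<And>N. n2 N (\<lambda>n. c n - c n) \<le> \<delta>\<^sup>2" using c by (simp_all add: ell2_def n2_def)
    show ?thesis by (intro exI[of _ N0] allI impI ballI st[OF hc, THEN less_imp_le])
  qed
  then obtain M where M: "\<And>k N1 N2 t. M k \<le> N1 \<Longrightarrow> M k \<le> N2 \<Longrightarrow> t \<in> {0..T} \<Longrightarrow> l2dist (gv T N1 c t) (gv T N2 c t) \<le> (1/2)^k"
    by metis
  \<comment> \<open>The partial sums of \<open>M\<close> make the sequence monotone and at least
    \<open>M k\<close>; the summand \<open>k\<close> makes it at least \<open>k\<close>.\<close>
  define Nk where "Nk k = k + (\<Sum>j\<le>k. M j)" for k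
  have MN: "M k \<le> Nk k" for k unfolding Nk_def by (cases k) auto
  interpret fast_galerkin \<beta> \<gamma> \<mu> c T Nk
  proof unfold_locales
    show "l2dist (gv T N1 c t) (gv T N2 c t) \<le> (1/2)^k"
      if "Nk k \<le> N1" "Nk k \<le> N2" "t \<in> {0..T}" for k N1 N2 t
      using M[OF order_trans[OF MN that(1)] order_trans[OF MN that(2)] that(3)] .
  qed (use c T in \<open>auto simp: Nk_def\<close>)
  show thesis by (rule that[OF v_limit_sol v_sol])
qed

theorem theorem1p3:
  fixes \<beta> \<gamma> \<mu> :: real
  assumes "\<beta> \<ge> 0" and "\<mu> = 1 \<or> \<mu> = -1"
  shows "\<forall>T>0. \<exists>X. X \<subseteq> CL2 T \<and>
           (\<forall>v0\<in>L2T. \<exists>v\<in>X. kawahara_sol \<beta> \<gamma> \<mu> T v0 v) \<and>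
           (\<forall>v0\<in>L2T. \<forall>v\<in>X. \<forall>w\<in>X.
              kawahara_sol \<beta> \<gamma> \<mu> T v0 v \<and> kawahara_sol \<beta> \<gamma> \<mu> T v0 w \<longrightarrow>
              (\<forall>t\<in>{0..T}. l2dist (v t) (w t) = 0)) \<and>
           (\<forall>v0\<in>L2T. \<forall>\<epsilon>>0. \<exists>\<delta>>0. \<forall>w0\<in>L2T. l2dist w0 v0 < \<delta> \<longrightarrow>
              (\<forall>v\<in>X. \<forall>w\<in>X.
                 kawahara_sol \<beta> \<gamma> \<mu> T v0 v \<and> kawahara_sol \<beta> \<gamma> \<mu> T w0 w \<longrightarrow>
                 (\<forall>t\<in>{0..T}. l2dist (v t) (w t) < \<epsilon>)))"
proof (intro allI impI)
  fix T :: real assume T: "0 < T"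
  interpret kaw \<beta> \<gamma> \<mu> using assms by unfold_locales auto
  have T0: "0 \<le> T" using T by simp
  \<comment> \<open>One space serves all data at once: the coefficient sequence \<open>c\<close> is
    quantified inside.\<close>
  define X where "X = {v. \<exists>c. ell2 c \<and> limit_sol T c v}"
  \<comment> \<open>At \<open>t = 0\<close> the Duhamel integral runs over a single point and
    vanishes, so \<open>v 0\<close> and \<open>v0\<close> have the same coefficients. By
    \<open>limit_sol_init\<close> these are the \<open>c\<close> behind \<open>v\<close>.\<close>
  have X: "limit_sol T (co v0) v" if v: "v \<in> X" and sol: "kawahara_sol \<beta> \<gamma> \<mu> T v0 v" for v0 v
  proof -
    obtain c where c: "ell2 c" "limit_sol T c v" using v by (auto simp: X_def)
    have point: "set_lebesgue_integral lebesgue {0..0} f = 0" for f :: "real \<Rightarrow> complex"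
      unfolding set_lebesgue_integral_def
    proof (rule integral_eq_zero_AE)
      show "AE x in lebesgue. indicat_real {0..0} x *\<^sub>R f x = 0"
        unfolding eventually_ae_filter_negligible by (intro exI[of _ "{0}"]) (auto split: split_indicator)
    qed
    have "\<forall>t\<in>{0..T}. \<forall>n. fcoeff (v t) n = cis (t * phase \<beta> \<gamma> n) * fcoeff v0 n + complex_of_real (\<mu> / 3) *
        set_lebesgue_integral lebesgue {0..t} (\<lambda>s. cis ((t - s) * phase \<beta> \<gamma> n) * (\<i> * of_int n) * fcoeff (\<lambda>x. (v s x)^3) n)"
      using sol unfolding kawahara_sol_def by blast
    from bspec[OF this, of 0] have "fcoeff (v 0) n = fcoeff v0 n" for n
      using T0 unfolding point by simp
    then have "co (v 0) = co v0" by (auto simp: co_def)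
    with c limit_sol_init[OF c(1) T0 c(2)] show ?thesis by simp
  qed
  have X2: "ell2 (co v0)" if "v0 \<in> L2T" for v0 using that by (rule ell2_co)
  show "\<exists>X. X \<subseteq> CL2 T \<and>
           (\<forall>v0\<in>L2T. \<exists>v\<in>X. kawahara_sol \<beta> \<gamma> \<mu> T v0 v) \<and>
           (\<forall>v0\<in>L2T. \<forall>v\<in>X. \<forall>w\<in>X.
              kawahara_sol \<beta> \<gamma> \<mu> T v0 v \<and> kawahara_sol \<beta> \<gamma> \<mu> T v0 w \<longrightarrow>
              (\<forall>t\<in>{0..T}. l2dist (v t) (w t) = 0)) \<and>
           (\<forall>v0\<in>L2T. \<forall>\<epsilon>>0. \<exists>\<delta>>0. \<forall>w0\<in>L2T. l2dist w0 v0 < \<delta> \<longrightarrow>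
              (\<forall>v\<in>X. \<forall>w\<in>X.
                 kawahara_sol \<beta> \<gamma> \<mu> T v0 v \<and> kawahara_sol \<beta> \<gamma> \<mu> T w0 w \<longrightarrow>
                 (\<forall>t\<in>{0..T}. l2dist (v t) (w t) < \<epsilon>)))"
  proof (rule exI[of _ X], intro conjI ballI allI impI)
    show "X \<subseteq> CL2 T" by (auto simp: X_def limit_sol_def)
    show "\<exists>v\<in>X. kawahara_sol \<beta> \<gamma> \<mu> T v0 v" if v0: "v0 \<in> L2T" for v0
    proof -
      obtain v where "limit_sol T (co v0) v" "\<And>w0. co w0 = co v0 \<Longrightarrow> kawahara_sol \<beta> \<gamma> \<mu> T w0 v"
        using limit_sol_exists[OF X2[OF v0] T0] by blast
      then show ?thesis using X2[OF v0] by (auto simp: X_def)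
    qed
    show "l2dist (v t) (w t) = 0"
      if "v0 \<in> L2T" "v \<in> X" "w \<in> X" "kawahara_sol \<beta> \<gamma> \<mu> T v0 v \<and> kawahara_sol \<beta> \<gamma> \<mu> T v0 w" "t \<in> {0..T}" for v0 v w t
      using that by (intro limit_sol_unique[OF X2 T0 X X]) auto
    fix v0 and \<epsilon> :: real assume v0: "v0 \<in> L2T" and e: "0 < \<epsilon>"
    obtain \<delta> where d: "0 < \<delta>" and st: "\<And>c' v w t. ell2 c' \<Longrightarrow> (\<And>N. n2 N (\<lambda>n. co v0 n - c' n) \<le> \<delta>\<^sup>2) \<Longrightarrow>
        limit_sol T (co v0) v \<Longrightarrow> limit_sol T c' w \<Longrightarrow> t \<in> {0..T} \<Longrightarrow> l2dist (v t) (w t) < \<epsilon>"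
      using limit_sol_stable[OF X2[OF v0] T0 e] by blast
    show "\<exists>\<delta>>0. \<forall>w0\<in>L2T. l2dist w0 v0 < \<delta> \<longrightarrow>
              (\<forall>v\<in>X. \<forall>w\<in>X.
                 kawahara_sol \<beta> \<gamma> \<mu> T v0 v \<and> kawahara_sol \<beta> \<gamma> \<mu> T w0 w \<longrightarrow>
                 (\<forall>t\<in>{0..T}. l2dist (v t) (w t) < \<epsilon>))"
    proof (intro exI[of _ \<delta>] conjI ballI impI d)
      fix w0 v w t
      assume w0: "w0 \<in> L2T" "l2dist w0 v0 < \<delta>" and vw: "v \<in> X" "w \<in> X"
        "kawahara_sol \<beta> \<gamma> \<mu> T v0 v \<and> kawahara_sol \<beta> \<gamma> \<mu> T w0 w" and t: "t \<in> {0..T}"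
      have "n2 N (\<lambda>n. co v0 n - co w0 n) \<le> \<delta>\<^sup>2" for N
      proof -
        have n0: "0 \<le> n2 N (co (\<lambda>x. v0 x - w0 x))" by (rule n2_nonneg)
        have "n2 N (\<lambda>n. co v0 n - co w0 n) = n2 N (co (\<lambda>x. v0 x - w0 x))"
          unfolding co_diff[OF v0 w0(1), symmetric] ..
        also have "\<dots> \<le> 2 * pi * n2 N (co (\<lambda>x. v0 x - w0 x))"
          using mult_right_mono[OF _ n0, of 1 "2 * pi"] pi_gt3 by simp
        also have "\<dots> \<le> (l2dist v0 w0)\<^sup>2"
          unfolding l2dist_def by (rule Bessel[OF L2T_diff[OF v0 w0(1)]])
        also have "\<dots> \<le> \<delta>\<^sup>2" unfolding l2dist_commute[of v0] using w0(2) by (intro power_mono) auto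
        finally show ?thesis .
      qed
      then show "l2dist (v t) (w t) < \<epsilon>" using vw by (intro st[OF X2[OF w0(1)] _ X X t]) auto
    qed
  qed
qed

end
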